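(* Let $(\mathcal{X},d,\mu)$ be a metric measure space of non-homogeneous type with dominating function $\lambda$, and let $b\in\widetilde{\mathrm{RBMO}}(\mu)$. Let $K$ be a $\mu$-locally integrable function on $(\mathcal{X}\times\mathcal{X})\setminus\{(x,x):x\in\mathcal{X}\}$ satisfying (1) (size condition) there exists a positive constant $C$ such that, for all $x,y\in\mathcal{X}$ with $x\neq y$, $|K(x,y)|\le C\,\frac{1}{\lambda(x,d(x,y))}$; (2) (Hörmander-type condition) there exists a positive constant $C$ such that, for all $R\in(0,\infty)$ and $y,y'\in\mathcal{X}$ with $d(y,y')<R$, $$\sum_{l=1}^\infty l\int_{6^lR<d(x,y)\le 6^{l+1}R}\Big[|K(x,y)-K(x,y')|+|K(y,x)-K(y',x)|\Big]\,d\mu(x)\le C.$$ Let $T$ be a Calderón-Zygmund operator with kernel $K$, that is, a linear operator such that, for all $f\in L^\infty_b(\mu)$ and $x\notin\operatorname{supp}(f)$, $Tf(x)=\int_{\mathcal{X}}K(x,y)f(y)\,d\mu(y)$. Assume that $T$ is bounded on $L^2(\mu)$. Then the commutator $T_b$, defined by $T_bf:=bTf-T(bf)$ for suitable functions $f$, is bounded from $\widetilde H^1(\mu)$ into $L^{1,\infty}(\mu)$, that is, there exists a positive constant $C$ such that, for all $t\in(0,\infty)$ and all $f\in\widetilde H^1(\mu)$, $$\mu(\{x\in\mathcal{X}:\ |T_bf(x)|>t\})\le C\,\|b\|_{\widetilde{\mathrm{RBMO}}(\mu)}\,t^{-1}\,\|f\|_{\widetilde H^1(\mu)}.$$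
   Context: **Space.** $B(x,r):=\{y\in\mathcal X: d(x,y)<r\}$. A metric space $(\mathcal X,d)$ is geometrically doubling if there is $N_0\in\mathbb N$ such that every ball $B(x,r)$, $x\in\mathcal X$, $r\in(0,\infty)$, is covered by at most $N_0$ balls $B(x_i,r/2)$. $(\mathcal X,d,\mu)$ is upper doubling if $\mu$ is a Borel measure on $\mathcal X$ and there exist a dominating function $\lambda:\mathcal X\times(0,\infty)\to(0,\infty)$ and a positive constant $C_{(\lambda)}$ such that, for each $x$, $r\mapsto\lambda(x,r)$ is non-decreasing and, for all $x\in\mathcal X$, $r\in(0,\infty)$, $\mu(B(x,r))\le\lambda(x,r)\le C_{(\lambda)}\lambda(x,r/2)$. $(\mathcal X,d,\mu)$ is a metric measure space of non-homogeneous type if $(\mathcal X,d)$ is geometrically doubling and $(\mathcal X,d,\mu)$ is upper doubling. It is always assumed (with no loss, after changing $\lambda$) that $\lambda(x,r)\le C_{(\lambda)}\lambda(y,r)$ for all $x,y\in\mathcal X$ with $d(x,y)\le r$. A ball $B$ always comes with a center $c_B$ and radius $r_B$ (equal balls have equal centers and radii), and $\rho B:=B(c_B,\rho r_B)$. $L^\infty_b(\mu)$ is the set of $f\in L^\infty(\mu)$ with bounded support. **Discrete coefficient.** For $\rho\in(1,\infty)$ and balls $B\subset S$, $\widetilde K^{(\rho)}_{B,S}:=1+\sum_{k=-\lfloor\log_\rho2\rfloor}^{N^{(\rho)}_{B,S}}\frac{\mu(\rho^kB)}{\lambda(c_B,\rho^kr_B)}$, where $N^{(\rho)}_{B,S}$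 is the smallest integer with $\rho^{N^{(\rho)}_{B,S}}r_B\ge r_S$. **Hardy space $\widetilde H^1(\mu)$.** Let $\rho\in(1,\infty)$, $q\in(1,\infty]$, $\gamma\in[1,\infty)$. A function $h\in L^1(\mu)$ is a $(q,\gamma,\rho)_\lambda$-atomic block if (i) $\operatorname{supp}h\subset B$ for some ball $B$; (ii) $\int_{\mathcal X}h\,d\mu=0$; (iii) for $j\in\{1,2\}$ there are functions $a_j$ supported on balls $B_j\subset B$ and numbers $\lambda_j\in\mathbb C$ with $h=\lambda_1a_1+\lambda_2a_2$ and $\|a_j\|_{L^q(\mu)}\le[\mu(\rho B_j)]^{1/q-1}[\widetilde K^{(\rho)}_{B_j,B}]^{-\gamma}$; put $|h|:=|\lambda_1|+|\lambda_2|$. A function $f\in L^1(\mu)$ belongs to the space if $f=\sum_{i=1}^\infty h_i$ in $L^1(\mu)$ with atomic blocks $h_i$ and $\sum_i|h_i|<\infty$; its norm is the infimum of $\sum_i|h_i|$ over all such decompositions. It is known that the space is independent of $\rho,\gamma$ and $q\in(1,\infty]$ up to equivalent norms; it is denoted $\widetilde H^1(\mu)$. **Space $\widetilde{\mathrm{RBMO}}(\mu)$.** Let $\rho\in(1,\infty)$, $\gamma\in[1,\infty)$. A function $f\in L^1_{\mathrm{loc}}(\mu)$ belongs to it if there are a positive constant $\widetilde C$ and, for each ball $B$, a number $f_B$ such that $\frac1{\mu(\rho B)}\int_B|f-f_B|\,d\mu\le\widetilde C$ for all balls $B$ and $|f_B-f_{B_1}|\le\widetilde C[\widetilde K^{(\rho)}_{B,B_1}]^\gamma$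 for all balls $B\subset B_1$. The norm $\|f\|_{\widetilde{\mathrm{RBMO}}(\mu)}$ is the infimum of such $\widetilde C$. It is known that the space is independent of $\rho,\gamma$ (up to equivalent norms). *)

theory Defs
  imports "HOL-Analysis.Analysis" "HOL-Probability.Essential_Supremum"
begin

section \<open>The space\<close>

(* A ball is a pair (center, radius): the underlying set does not determine these data. *)
type_synonym 'a ball_data = "'a \<times> real"

definition is_ball :: "'a ball_data \<Rightarrow> bool" where
  "is_ball B \<longleftrightarrow> 0 < snd B"

definition ball_set :: "'a::metric_space ball_data \<Rightarrow> 'a set" where
  "ball_set B = ball (fst B) (snd B)"

definition dilate :: "real \<Rightarrow> 'a ball_data \<Rightarrow> 'a ball_data" where
  "dilate \<rho> B = (fst B, \<rho> * snd B)"

(* Inclusion of sets, subject to the convention that balls which are equal as sets have equal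
   centers and equal radii.  It implies r_B <= 2 r_S, which is what makes the sum in
   discrete_coeff start below its upper end. *)
definition subball :: "'a::metric_space ball_data \<Rightarrow> 'a ball_data \<Rightarrow> bool" where
  "subball B S \<longleftrightarrow> ball_set B \<subseteq> ball_set S \<and> (ball_set B = ball_set S \<longrightarrow> B = S)"

definition geometrically_doubling :: "'a::metric_space itself \<Rightarrow> bool" where
  "geometrically_doubling _ \<longleftrightarrow>
     (\<exists>N0::nat. \<forall>(x::'a) r. 0 < r \<longrightarrow>
        (\<exists>A. finite A \<and> card A \<le> N0 \<and> ball x r \<subseteq> (\<Union>y\<in>A. ball y (r / 2))))"

locale upper_doubling =
  fixes M :: "'a::metric_space measure" and lam :: "'a \<Rightarrow> real \<Rightarrow> real" and Clam :: real
  assumes sets_M: "sets M = sets borel"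
    and Clam_pos: "0 < Clam"
    and lam_pos: "\<And>x r. 0 < r \<Longrightarrow> 0 < lam x r"
    and lam_mono: "\<And>x r s. 0 < r \<Longrightarrow> r \<le> s \<Longrightarrow> lam x r \<le> lam x s"
    and measure_le_lam: "\<And>x r. 0 < r \<Longrightarrow> emeasure M (ball x r) \<le> ennreal (lam x r)"
    and lam_doubling: "\<And>x r. 0 < r \<Longrightarrow> lam x r \<le> Clam * lam x (r / 2)"

(* lam_compare is the usual normalisation of the dominating function. *)
locale nonhomogeneous_space = upper_doubling M lam Clam
  for M :: "'a::metric_space measure" and lam :: "'a \<Rightarrow> real \<Rightarrow> real" and Clam :: real +
  assumes geom_doubling: "geometrically_doubling TYPE('a)"
    and lam_compare: "\<And>x y r. 0 < r \<Longrightarrow> dist x y \<le> r \<Longrightarrow> lam x r \<le> Clam * lam y r"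


section \<open>Function spaces\<close>

definition Lp :: "'a measure \<Rightarrow> ereal \<Rightarrow> ('a \<Rightarrow> complex) set" where
  "Lp M p = {f \<in> borel_measurable M.
     if p = \<infinity> then \<exists>c. AE x in M. cmod (f x) \<le> c
     else integrable M (\<lambda>x. cmod (f x) powr real_of_ereal p)}"

definition Lp_norm :: "'a measure \<Rightarrow> ereal \<Rightarrow> ('a \<Rightarrow> complex) \<Rightarrow> real" where
  "Lp_norm M p f =
     (if p = \<infinity> then real_of_ereal (esssup M (\<lambda>x. ereal (cmod (f x))))
      else (\<integral>x. cmod (f x) powr real_of_ereal p \<partial>M) powr real_of_ereal (1 / p))"

(* Support of an almost-everywhere class: the complement of the largest open set on which f
   vanishes almost everywhere. *)
definition ess_supp :: "'a::metric_space measure \<Rightarrow> ('a \<Rightarrow> complex) \<Rightarrow> 'a set" where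
  "ess_supp M f = {x. \<forall>r>0. \<not> (AE y in M. y \<in> ball x r \<longrightarrow> f y = 0)}"

definition Linf_b :: "'a::metric_space measure \<Rightarrow> ('a \<Rightarrow> complex) set" where
  "Linf_b M = {f \<in> Lp M \<infinity>. bounded (ess_supp M f)}"

definition locally_integrable_on ::
  "'b::topological_space measure \<Rightarrow> 'b set \<Rightarrow> ('b \<Rightarrow> complex) \<Rightarrow> bool" where
  "locally_integrable_on M S f \<longleftrightarrow>
     (\<forall>p\<in>S. \<exists>U. open U \<and> p \<in> U \<and> set_integrable M (U \<inter> S) f)"

definition coeff_index :: "real \<Rightarrow> 'a ball_data \<Rightarrow> 'a ball_data \<Rightarrow> int" where
  "coeff_index \<rho> B S = (LEAST n::int. snd S \<le> \<rho> powi n * snd B)"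

definition discrete_coeff ::
  "'a::metric_space measure \<Rightarrow> ('a \<Rightarrow> real \<Rightarrow> real) \<Rightarrow> real \<Rightarrow> 'a ball_data \<Rightarrow> 'a ball_data \<Rightarrow> real" where
  "discrete_coeff M lam \<rho> B S =
     1 + (\<Sum>k = - \<lfloor>log \<rho> 2\<rfloor>..coeff_index \<rho> B S.
            measure M (ball_set (dilate (\<rho> powi k) B)) / lam (fst B) (\<rho> powi k * snd B))"


subsection \<open>The Hardy space\<close>

definition is_atom ::
  "'a::metric_space measure \<Rightarrow> ('a \<Rightarrow> real \<Rightarrow> real) \<Rightarrow> ereal \<Rightarrow> real \<Rightarrow> real \<Rightarrow>
    'a ball_data \<Rightarrow> 'a ball_data \<Rightarrow> ('a \<Rightarrow> complex) \<Rightarrow> bool" where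
  "is_atom M lam q \<gamma> \<rho> B B' a \<longleftrightarrow>
     is_ball B' \<and> subball B' B \<and> ess_supp M a \<subseteq> ball_set B' \<and> a \<in> Lp M q \<and>
     Lp_norm M q a \<le> measure M (ball_set (dilate \<rho> B')) powr (real_of_ereal (1 / q) - 1)
                     * discrete_coeff M lam \<rho> B' B powr (- \<gamma>)"

(* The size |h| depends on the chosen representation of the block h, so it is an argument:
   s is the size |c1| + |c2| of some representation h = c1 a1 + c2 a2. *)
definition atomic_block ::
  "'a::metric_space measure \<Rightarrow> ('a \<Rightarrow> real \<Rightarrow> real) \<Rightarrow> ereal \<Rightarrow> real \<Rightarrow> real \<Rightarrow>
    ('a \<Rightarrow> complex) \<Rightarrow> real \<Rightarrow> bool" where
  "atomic_block M lam q \<gamma> \<rho> h s \<longleftrightarrow>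
     integrable M h \<and> (\<integral>x. h x \<partial>M) = 0 \<and>
     (\<exists>B. is_ball B \<and> ess_supp M h \<subseteq> ball_set B \<and>
       (\<exists>B1 B2 a1 a2 c1 c2.
          is_atom M lam q \<gamma> \<rho> B B1 a1 \<and> is_atom M lam q \<gamma> \<rho> B B2 a2 \<and>
          (AE x in M. h x = c1 * a1 x + c2 * a2 x) \<and> s = cmod c1 + cmod c2))"

definition atomic_decomposition ::
  "'a::metric_space measure \<Rightarrow> ('a \<Rightarrow> real \<Rightarrow> real) \<Rightarrow> ereal \<Rightarrow> real \<Rightarrow> real \<Rightarrow>
    ('a \<Rightarrow> complex) \<Rightarrow> (nat \<Rightarrow> 'a \<Rightarrow> complex) \<Rightarrow> (nat \<Rightarrow> real) \<Rightarrow> bool" where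
  "atomic_decomposition M lam q \<gamma> \<rho> f h s \<longleftrightarrow>
     (\<forall>i. atomic_block M lam q \<gamma> \<rho> (h i) (s i)) \<and> summable s \<and>
     (\<lambda>n. \<integral>x. cmod (f x - (\<Sum>i<n. h i x)) \<partial>M) \<longlonglongrightarrow> 0"

definition H1 ::
  "'a::metric_space measure \<Rightarrow> ('a \<Rightarrow> real \<Rightarrow> real) \<Rightarrow> ereal \<Rightarrow> real \<Rightarrow> real \<Rightarrow>
    ('a \<Rightarrow> complex) set" where
  "H1 M lam q \<gamma> \<rho> = {f. integrable M f \<and> (\<exists>h s. atomic_decomposition M lam q \<gamma> \<rho> f h s)}"

definition H1_norm ::
  "'a::metric_space measure \<Rightarrow> ('a \<Rightarrow> real \<Rightarrow> real) \<Rightarrow> ereal \<Rightarrow> real \<Rightarrow> real \<Rightarrow>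
    ('a \<Rightarrow> complex) \<Rightarrow> real" where
  "H1_norm M lam q \<gamma> \<rho> f = Inf {(\<Sum>i. s i) | h s. atomic_decomposition M lam q \<gamma> \<rho> f h s}"


subsection \<open>The space RBMO\<close>

(* The oscillation is an extended nonnegative integral, so the bound forces f to be integrable
   on every ball; in ennreal, 0 / 0 = 0. *)
definition RBMO_bound ::
  "'a::metric_space measure \<Rightarrow> ('a \<Rightarrow> real \<Rightarrow> real) \<Rightarrow> real \<Rightarrow> real \<Rightarrow> ('a \<Rightarrow> complex) \<Rightarrow> real \<Rightarrow> bool" where
  "RBMO_bound M lam \<gamma> \<rho> f C \<longleftrightarrow> 0 < C \<and>
     (\<exists>m :: 'a ball_data \<Rightarrow> complex.
        (\<forall>B. is_ball B \<longrightarrow>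
           (\<integral>\<^sup>+x\<in>ball_set B. ennreal (cmod (f x - m B)) \<partial>M)
             / emeasure M (ball_set (dilate \<rho> B)) \<le> ennreal C) \<and>
        (\<forall>B S. is_ball B \<and> is_ball S \<and> subball B S \<longrightarrow>
           cmod (m B - m S) \<le> C * discrete_coeff M lam \<rho> B S powr \<gamma>))"

definition RBMO ::
  "'a::metric_space measure \<Rightarrow> ('a \<Rightarrow> real \<Rightarrow> real) \<Rightarrow> real \<Rightarrow> real \<Rightarrow> ('a \<Rightarrow> complex) set" where
  "RBMO M lam \<gamma> \<rho> = {f. locally_integrable_on M UNIV f \<and> (\<exists>C. RBMO_bound M lam \<gamma> \<rho> f C)}"

definition RBMO_norm ::
  "'a::metric_space measure \<Rightarrow> ('a \<Rightarrow> real \<Rightarrow> real) \<Rightarrow> real \<Rightarrow> real \<Rightarrow> ('a \<Rightarrow> complex) \<Rightarrow> real" where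
  "RBMO_norm M lam \<gamma> \<rho> f = Inf {C. RBMO_bound M lam \<gamma> \<rho> f C}"


section \<open>Kernels, operators and commutators\<close>

definition size_condition ::
  "('a::metric_space \<Rightarrow> real \<Rightarrow> real) \<Rightarrow> ('a \<Rightarrow> 'a \<Rightarrow> complex) \<Rightarrow> bool" where
  "size_condition lam K \<longleftrightarrow>
     (\<exists>C>0. \<forall>x y. x \<noteq> y \<longrightarrow> cmod (K x y) \<le> C * (1 / lam x (dist x y)))"

definition hormander_condition ::
  "'a::metric_space measure \<Rightarrow> ('a \<Rightarrow> 'a \<Rightarrow> complex) \<Rightarrow> bool" where
  "hormander_condition M K \<longleftrightarrow>
     (\<exists>C>0. \<forall>R>0. \<forall>y y'. dist y y' < R \<longrightarrow>
        (\<Sum>j. let l = Suc j in of_nat l *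
           (\<integral>\<^sup>+x\<in>{x. 6 ^ l * R < dist x y \<and> dist x y \<le> 6 ^ (l + 1) * R}.
              ennreal (cmod (K x y - K x y') + cmod (K y x - K y' x)) \<partial>M)) \<le> ennreal C)"

(* Operators act on representatives; identities between functions hold almost everywhere. *)
definition linear_ae ::
  "'a measure \<Rightarrow> ('a \<Rightarrow> complex) set \<Rightarrow> (('a \<Rightarrow> complex) \<Rightarrow> 'a \<Rightarrow> complex) \<Rightarrow> bool" where
  "linear_ae M V T \<longleftrightarrow>
     (\<forall>f\<in>V. \<forall>g\<in>V. AE x in M. T (\<lambda>y. f y + g y) x = T f x + T g x) \<and>
     (\<forall>c. \<forall>f\<in>V. AE x in M. T (\<lambda>y. c * f y) x = c * T f x)"

definition CZ_operator ::
  "'a::metric_space measure \<Rightarrow> ('a \<Rightarrow> 'a \<Rightarrow> complex) \<Rightarrow> (('a \<Rightarrow> complex) \<Rightarrow> 'a \<Rightarrow> complex) \<Rightarrow> bool" where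
  "CZ_operator M K T \<longleftrightarrow> linear_ae M (Lp M 2) T \<and>
     (\<forall>f\<in>Linf_b M. AE x in M. x \<notin> ess_supp M f \<longrightarrow> T f x = (\<integral>y. K x y * f y \<partial>M))"

definition bounded_on_L2 :: "'a measure \<Rightarrow> (('a \<Rightarrow> complex) \<Rightarrow> 'a \<Rightarrow> complex) \<Rightarrow> bool" where
  "bounded_on_L2 M T \<longleftrightarrow>
     (\<exists>C>0. \<forall>f\<in>Lp M 2. T f \<in> Lp M 2 \<and> Lp_norm M 2 (T f) \<le> C * Lp_norm M 2 f)"

definition commutator ::
  "('a \<Rightarrow> complex) \<Rightarrow> (('a \<Rightarrow> complex) \<Rightarrow> 'a \<Rightarrow> complex) \<Rightarrow> ('a \<Rightarrow> complex) \<Rightarrow> 'a \<Rightarrow> complex" where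
  "commutator b T f = (\<lambda>x. b x * T f x - T (\<lambda>y. b y * f y) x)"

(* T is given on L^2, so the defining formula of the commutator is meaningful exactly when f and
   b f both lie in L^2.  On V the commutator is a linear operator Tb that is given by the formula
   for these f.  For V the Hardy space they are dense, so at most one such Tb (up to null
   sets) is bounded from V into weak L^1. *)
definition commutator_on ::
  "'a measure \<Rightarrow> ('a \<Rightarrow> complex) set \<Rightarrow> ('a \<Rightarrow> complex) \<Rightarrow>
    (('a \<Rightarrow> complex) \<Rightarrow> 'a \<Rightarrow> complex) \<Rightarrow> (('a \<Rightarrow> complex) \<Rightarrow> 'a \<Rightarrow> complex) \<Rightarrow> bool" where
  "commutator_on M V b T Tb \<longleftrightarrow>
     (\<forall>f\<in>V. Tb f \<in> borel_measurable M) \<and> linear_ae M V Tb \<and>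
     (\<forall>f\<in>V. f \<in> Lp M 2 \<and> (\<lambda>x. b x * f x) \<in> Lp M 2 \<longrightarrow>
        (AE x in M. Tb f x = commutator b T f x))"

end

theory Submission imports Defs begin

text \<open>
The identity [b,T]g = (b - a) Tg - T((b - a) g), valid for every constant a, drives the proof. If g is
a mean-zero block living on a ball over which b has mean a, then X = (b - a) Tg and Y = (b - a) g
are integrable, and [b,T]g = X - TY is of weak type because T maps L^1 to weak L^1. A function
with such a representation, the masses of X and Y being at most \<kappa> for all normalised symbols at
once, is called good with constant \<kappa>. Weak L^1 quasi-norms do not add up, but the masses do; so all
summation takes place at the level of good functions and the weak inequality is used once, at the end.

The ingredients are as follows. Almost every point is the centre of arbitrarily small doubling balls
(small_doubling); with a Vitali selection this gives stopping balls as in the Calderon--Zygmund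
decomposition (CZ_covering), from which both the weak (1,1) inequality (weak11) and the
John--Nirenberg inequality (John_Nirenberg) follow. A function in RBMO has means that vary along
concentric balls no faster than the sum of the densities \<mu>(B)/\<lambda> (RBMO_clean), because the exponent
\<gamma> can be removed by passing through intermediate balls in steps of bounded coefficient
(chain_lemma). The means thus grow at most linearly in the number of annuli, and this growth is what
the factor l in the Hoermander condition absorbs (nice_block).

An atom is neither of mean zero nor adapted to the ball of its block. It is cut into small pieces, and
the integral of each piece is transported to one fixed bump along a chain of doubling balls; each link
costs a bounded amount, and there are at most about K(B',B) links, which the factor K(B',B)^(-\<gamma>) in
the size condition pays for (atom_good). The bumps cancel in a block, so blocks, and then whole
decompositions, are L^1 limits of bounded functions that form a Cauchy sequence with respect to good
constants (decomposition_approx). Their commutators converge in measure, and the limit is the value of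
T_b. It does not depend on the approximation: truncating the symbol keeps its RBMO bound, and for a
bounded symbol the commutator is of weak type (1,1) on all of L^1 \<inter> L^2 (commutator_closed). Independence
of the choices gives linearity and agreement with bTf - T(bf); letting the RBMO bound and the
decomposition vary turns the estimate into one by the two norms.
\<close>

section \<open>Topology and measure on a geometrically doubling space\<close>

text \<open>Balls with a centre in the dense set and a radius 1/n form a countable base.\<close>

lemma Lindelof_dense:
 fixes D :: "'b::metric_space set" and U :: "'b => 'b set"
 assumes "countable D" and dense: "!!x e. 0 < e ==> EX d:D. dist d x < e"
  and U: "!!x. x : S ==> open (U x) & x : U x"
 shows "\<exists>C\<subseteq>S. countable C & S \<subseteq> (UN x:C. U x)"
proof -
 define Q where "Q = {(d, n::nat). d : D & (EX x:S. ball d (1 / real (Suc n)) \<subseteq> U x)}"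
 have "Q \<subseteq> D \<times> UNIV" by (auto simp: Q_def)
 moreover have "countable (D \<times> (UNIV::nat set))" using \<open>countable D\<close> by (intro countable_SIGMA) auto
 ultimately have cQ: "countable Q" by (rule countable_subset)
 have "ALL q:Q. EX x:S. ball (fst q) (1 / real (Suc (snd q))) \<subseteq> U x" by (auto simp: Q_def)
 then obtain g where g: "!!q. q : Q ==> g q : S & ball (fst q) (1 / real (Suc (snd q))) \<subseteq> U (g q)"
  by metis
 have "S \<subseteq> (UN x:g ` Q. U x)"
 proof
  fix x assume x: "x : S"
  then obtain e where e: "e > 0" "ball x e \<subseteq> U x" using U openE by metis
  obtain n :: nat where n: "1 / real (Suc n) < e / 2" using e(1) nat_approx_posE[of "e/2"] by auto
  obtain d where d: "d : D" "dist d x < 1 / real (Suc n)" using dense[of "1 / real (Suc n)" x] by auto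
  have "ball d (1 / real (Suc n)) \<subseteq> ball x e"
  proof
   fix y assume "y : ball d (1 / real (Suc n))"
   hence "dist d y < 1 / real (Suc n)" by simp
   hence "dist x y < e" using d n dist_triangle[of x y d] by (simp add: dist_commute)
   thus "y : ball x e" by simp
  qed
  hence "(d, n) : Q" using d x e by (auto simp: Q_def)
  hence "x : U (g (d, n))" using g[of "(d,n)"] d by auto
  thus "x : (UN x:g ` Q. U x)" using \<open>(d, n) : Q\<close> by blast
 qed
 moreover have "g ` Q \<subseteq> S" using g by auto
 ultimately show ?thesis using cQ by blast
qed

context upper_doubling
begin

abbreviation meas :: "('a => 'b::topological_space) => bool" where
 "meas f \<equiv> f : measurable M borel"

abbreviation nn :: "complex => ennreal" where
 "nn z \<equiv> ennreal (cmod z)"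

abbreviation mass :: "('a => complex) => ennreal" where
 "mass f \<equiv> nn_integral M (%x. nn (f x))"

abbreviation sq :: "('a => complex) => ennreal" where
 "sq f \<equiv> nn_integral M (%x. ennreal ((cmod (f x))\<^sup>2))"

abbreviation dis :: "real => ('a => complex) => ennreal" where
 "dis t f \<equiv> emeasure M (Collect (%x. t < cmod (f x)))"

abbreviation tot :: "('a => 'b::{banach,second_countable_topology}) => 'b" where
 "tot f \<equiv> lebesgue_integral M f"

abbreviation ntot :: "('a => ennreal) => ennreal" where
 "ntot f \<equiv> nn_integral M f"

abbreviation int_on :: "'a set => ('a => ennreal) => ennreal" where
 "int_on S f \<equiv> nn_integral M (%x. f x * indicator S x)"

abbreviation mass_on :: "'a set => ('a => complex) => ennreal" where
 "mass_on S f \<equiv> nn_integral M (%x. nn (f x) * indicator S x)"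

lemma space_M [simp]: "space M = UNIV"
 using sets_eq_imp_space_eq[OF sets_M] by simp

lemma open_in_sets: "open S ==> S : sets M"
 by (simp add: sets_M)

lemma ball_in_sets [measurable, simp]: "ball x r : sets M"
 by (simp add: sets_M)

lemma measurable_M_borel: "meas f \<longleftrightarrow> f : borel_measurable borel"
 by (simp add: measurable_cong_sets[OF sets_M refl])

lemma dist_measurable [measurable]: "meas (%x. dist x y)"
 "meas (%x. dist y x)"
 unfolding measurable_M_borel by (auto intro!: borel_measurable_continuous_onI continuous_intros)

definition V :: "'a => real => real" where
 "V x r = measure M (ball x r)"

lemma emeasure_ball_finite: "emeasure M (ball x r) < \<infinity>"
proof (cases "0 < r")
 case True
 thus ?thesis using measure_le_lam[OF True, of x] by (simp add: order_le_less_trans)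
next
 case False thus ?thesis by (simp add: ball_empty)
qed

lemma emeasure_ball: "emeasure M (ball x r) = ennreal (V x r)"
 unfolding V_def using emeasure_ball_finite[of x r] by (intro emeasure_eq_ennreal_measure) auto

lemma V_nonneg [simp]: "0 <= V x r" by (simp add: V_def)

lemma V_subset: "ball x r \<subseteq> ball y s ==> V x r <= V y s"
 using emeasure_mono[of "ball x r" "ball y s" M] by (simp add: emeasure_ball)

lemma V_mono: "r <= s ==> V x r <= V x s"
 by (rule V_subset) (rule subset_ball)

lemma V_near: "dist x y + r <= s ==> V x r <= V y s"
proof (rule V_subset, rule subsetI)
 fix z assume "dist x y + r <= s" "z : ball x r"
 thus "z : ball y s" using dist_triangle[of y z x] by (simp add: dist_commute)
qed

lemma V_le_lam: "0 < r ==> V x r <= lam x r"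
 using measure_le_lam[of r x] lam_pos[of r x] by (simp add: emeasure_ball)

lemma lam_scale2: "0 < r ==> lam x (2 ^ n * r) <= Clam ^ n * lam x r"
proof (induction n)
 case (Suc n)
 have "lam x (2 ^ Suc n * r) <= Clam * lam x (2 ^ n * r)"
  using lam_doubling[of "2 ^ Suc n * r" x] Suc(2) by simp
 also have "... <= Clam * (Clam ^ n * lam x r)"
  using Suc Clam_pos by (intro mult_left_mono) auto
 finally show ?case by (simp add: mult_ac)
qed simp

lemma lam_scale: "0 < r ==> s <= 6 ^ n * r ==> 0 < s ==> lam x s <= Clam ^ (3 * n) * lam x r"
proof -
 assume a: "0 < r" "s <= 6 ^ n * r" "0 < s"
 have "(6::real) ^ n <= 8 ^ n" by (intro power_mono) auto
 hence "s <= 2 ^ (3 * n) * r"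
  using a mult_right_mono[of "6 ^ n" "8 ^ n" r] order_trans[of s "6 ^ n * r" "8 ^ n * r"]
  by (simp add: power_mult)
 hence "lam x s <= lam x (2 ^ (3 * n) * r)" using a by (intro lam_mono) auto
 thus ?thesis using lam_scale2[OF a(1), of x "3 * n"] by linarith
qed

lemma UN_balls: "(UN n::nat. ball x (real n)) = UNIV"
 by (auto simp: reals_Archimedean2)

sublocale sigma_finite_measure M
proof
 fix x :: 'a
 show "EX A. countable A & A \<subseteq> sets M & \<Union> A = space M & (ALL a:A. emeasure M a ~= \<infinity>)"
  using UN_balls[of x] emeasure_ball_finite[of x]
  by (intro exI[of _ "range (%n::nat. ball x (real n))"]) (auto simp: less_top)
qed

text \<open>
The sets that can be squeezed in this way form a sigma-algebra: for a countable union, finitely many of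
the closed sets already exhaust it up to small measure inside the ball.
\<close>

lemma closed_open_approx:
 assumes "A : sets M" "0 < (e::real)"
 shows "EX C U. closed C & open U & C \<subseteq> A & A \<subseteq> U & emeasure M ((U - C) Int ball z R) < ennreal e"
proof -
 let ?m = "%S. emeasure M (S Int ball z R)"
 have fin: "?m S < \<infinity>" if "S : sets M" for S
  using emeasure_mono[of "S Int ball z R" "ball z R" M] emeasure_ball_finite[of z R]
  by (auto simp: order_le_less_trans)
 have "A : sigma_sets UNIV {S. open S}"
  using assms(1) by (simp add: sets_M borel_def)
 hence "ALL e>0::real. EX C U. closed C & open U & C \<subseteq> A & A \<subseteq> U & ?m (U - C) < ennreal e"
 proof induction
  case (Basic U)
  hence U: "open U" by simp
  show ?case
  proof (intro allI impI)
   fix e :: real assume e: "0 < e"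
   show "EX C Ua. closed C & open Ua & C \<subseteq> U & U \<subseteq> Ua & ?m (Ua - C) < ennreal e"
   proof (cases "U = UNIV")
    case True thus ?thesis using e by (intro exI[of _ UNIV]) auto
   next
    case False
    define C where "C n = {x. 1 / Suc n <= infdist x (- U)}" for n :: nat
    have cl: "closed (C n)" for n unfolding C_def
     by (intro closed_Collect_le continuous_intros)
    have sub: "C n \<subseteq> U" for n
    proof
     fix x assume "x : C n"
     hence "0 < infdist x (- U)" unfolding C_def
      by (smt (verit) mem_Collect_eq of_nat_0_less_iff zero_less_Suc zero_less_divide_1_iff)
     thus "x : U" by (metis ComplI infdist_zero less_irrefl)
    qed
    have dec: "decseq (%n. (U - C n) Int ball z R)"
    proof (intro decseq_SucI)
     fix n
     have "1 / real (Suc (Suc n)) <= 1 / real (Suc n)" by (simp add: frac_le)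
     thus "(U - C (Suc n)) Int ball z R \<subseteq> (U - C n) Int ball z R"
      unfolding C_def by fastforce
    qed
    have int: "(\<Inter>n. (U - C n) Int ball z R) = {}"
    proof -
     have "EX n. x : C n" if "x : U" for x
     proof -
      have "closed (- U)" using U by auto
      hence "infdist x (- U) ~= 0" using that False
      by (metis ComplD Compl_UNIV_eq double_complement in_closed_iff_infdist_zero)
      hence "0 < infdist x (- U)" by (simp add: infdist_nonneg less_le)
      then obtain n where "1 / Suc n < infdist x (- U)" using nat_approx_posE by blast
      thus ?thesis by (auto simp: C_def intro!: exI[of _ n])
     qed
     thus ?thesis by blast
    qed
    have "(%n. ?m (U - C n)) \<longlonglongrightarrow> emeasure M (\<Inter>n. (U - C n) Int ball z R)"
     using cl U fin by (intro Lim_emeasure_decseq dec) (auto simp: less_top sets_M)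
    hence "eventually (%n. ?m (U - C n) < ennreal e) sequentially"
     unfolding int using e by (intro order_tendstoD(2)) auto
    then obtain n where "?m (U - C n) < ennreal e" by (auto simp: eventually_sequentially)
    thus ?thesis using cl sub U by blast
   qed
  qed
 next
  case Empty
  show ?case by (intro allI impI exI[of _ "{}"]) auto
 next
  case (Compl A)
  show ?case
  proof (intro allI impI)
   fix e :: real assume "0 < e"
   then obtain C U where *: "closed C" "open U" "C \<subseteq> A" "A \<subseteq> U" "?m (U - C) < ennreal e"
    using Compl by meson
   have "- C - - U = U - C" by auto
   moreover have "closed (- U)" "open (- C)" "- U \<subseteq> UNIV - A" "UNIV - A \<subseteq> - C"
    using * by auto
   ultimately show "EX C U. closed C & open U & C \<subseteq> UNIV - A & UNIV - A \<subseteq> U & ?m (U - C) < ennreal e"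
    using *(5) by (intro exI[of _ "- U"] exI[of _ "- C"]) simp
  qed
 next
  case (Union A)
  show ?case
  proof (intro allI impI)
   fix e :: real assume e: "0 < e"
   have "EX C U. closed C & open U & C \<subseteq> A i & A i \<subseteq> U & ?m (U - C) < ennreal (e / 4 * (1/2) ^ i)" for i
    using Union e by simp
   then obtain C U where *: "!!i. closed (C i)" "!!i. open (U i)" "!!i. C i \<subseteq> A i"
    "!!i. A i \<subseteq> U i" "!!i. ?m (U i - C i) < ennreal (e / 4 * (1/2) ^ i)" by metis
   define D where "D n = ((UN i. U i) - (UN i<n. C i)) Int ball z R" for n :: nat
   have s1: "U i : sets M" "C i : sets M" for i using * by (auto simp: sets_M)
   have Ds: "D n : sets M" for n unfolding D_def using s1 by auto
   have fD: "emeasure M (D n) ~= \<infinity>" for n using Ds[of n] fin[of "D n"]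
    by (simp add: D_def Int_assoc)
   have dec: "decseq D" unfolding D_def by (intro decseq_SucI) auto
   have "(\<Inter>n. D n) \<subseteq> (UN i. (U i - C i) Int ball z R)"
   proof
    fix x assume x: "x : (\<Inter>n. D n)"
    hence "x : D 0" by blast
    then obtain i where "x : U i" "x : ball z R" by (auto simp: D_def)
    moreover have "x : D (Suc i)" using x by blast
    hence "x ~: C i" by (auto simp: D_def)
    ultimately show "x : (UN i. (U i - C i) Int ball z R)" by blast
   qed
   hence "emeasure M (\<Inter>n. D n) <= emeasure M (UN i. (U i - C i) Int ball z R)"
    using s1 by (intro emeasure_mono) auto
   also have "... <= (\<Sum>i. ?m (U i - C i))"
    using s1 by (intro emeasure_subadditive_countably) auto
   also have "... <= (\<Sum>i. ennreal (e / 4 * (1/2) ^ i))"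
    using *(5) by (intro suminf_le) (auto simp: less_imp_le)
   also have "... = ennreal (e / 4 * (1 / (1 - 1/2)))"
    using e by (intro suminf_ennreal_eq sums_mult geometric_sums) auto
   also have "... < ennreal e" using e by (simp add: ennreal_lessI)
   finally have lt: "emeasure M (\<Inter>n. D n) < ennreal e" .
   have "(%n. emeasure M (D n)) \<longlonglongrightarrow> emeasure M (\<Inter>n. D n)"
    using Ds fD by (intro Lim_emeasure_decseq dec) auto
   hence "eventually (%n. emeasure M (D n) < ennreal e) sequentially"
    using lt by (intro order_tendstoD(2)) auto
   then obtain n where n: "emeasure M (D n) < ennreal e" by (auto simp: eventually_sequentially)
   have "closed (UN i<n. C i)" using * by auto
   moreover have "open (UN i. U i)" using * by auto
   ultimately show "EX Ca Ua. closed Ca & open Ua & Ca \<subseteq> \<Union> (range A) & \<Union> (range A) \<subseteq> Ua & ?m (Ua - Ca) < ennreal e"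
    using *(3,4) n unfolding D_def
    by (intro exI[of _ "UN i<n. C i"] exI[of _ "UN i. U i"] conjI UN_least UN_mono) (use *(3,4) in \<open>blast+\<close>)
  qed
 qed
 thus ?thesis using assms(2) by blast
qed

lemma inner_closed:
 assumes A: "A : sets M" "A \<subseteq> ball z R" "0 < emeasure M A"
 shows "EX C. closed C & C \<subseteq> A & 0 < emeasure M C"
proof -
 have fA: "emeasure M A < \<infinity>"
  using emeasure_mono[OF A(2), of M] emeasure_ball_finite[of z R] by (simp add: order_le_less_trans)
 hence eA: "emeasure M A = ennreal (measure M A)" by (intro emeasure_eq_ennreal_measure) auto
 hence "0 < measure M A" using A(3) by (simp add: zero_less_measure_iff)
 then obtain C U where *: "closed C" "open U" "C \<subseteq> A" "A \<subseteq> U"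
  "emeasure M ((U - C) Int ball z R) < emeasure M A"
  using closed_open_approx[OF A(1), of "measure M A" z R] eA by metis
 have C: "C : sets M" using * by (simp add: sets_M)
 have "emeasure M A <= emeasure M C + emeasure M (A - C)"
  using emeasure_subadditive[of C M "A - C"] C A *(3) by (simp add: Un_absorb1)
 moreover have "emeasure M (A - C) <= emeasure M ((U - C) Int ball z R)"
  using * A C by (intro emeasure_mono) (auto simp: sets_M)
 ultimately have "emeasure M C ~= 0" using *(5) by auto
 thus ?thesis using * by (auto simp: zero_less_iff_neq_zero)
qed

text \<open>
The function is lower semicontinuous, since an open ball is exhausted by slightly smaller ones.
\<close>

lemma emeasure_ball_measurable:
 assumes "sets N = sets borel"
 shows "(%x::'b::metric_space. emeasure N (ball x r)) : borel_measurable borel"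
proof (rule borel_measurableI_greater)
 fix a :: ennreal
 have "open {x. a < emeasure N (ball x r)}"
 proof (rule openI)
  fix x assume x: "x : {x. a < emeasure N (ball x r)}"
  define B where "B n = ball x (r - 1 / Suc n)" for n :: nat
  have inc: "incseq B" unfolding B_def
   by (intro incseq_SucI subset_ball) (simp add: frac_le)
  have UB: "(UN n. B n) = ball x r"
  proof (intro equalityI subsetI)
   fix y assume "y : ball x r"
   hence "0 < r - dist x y" by simp
   then obtain n where "1 / Suc n < r - dist x y" using nat_approx_posE by blast
   thus "y : (UN n. B n)" by (auto simp: B_def intro!: exI[of _ n])
  next
   fix y assume "y : (UN n. B n)"
   then obtain n where "dist x y < r - 1 / Suc n" by (auto simp: B_def)
   moreover have "0 < 1 / real (Suc n)" by simp
   ultimately have "dist x y < r" by linarith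
   thus "y : ball x r" by simp
  qed
  have Bs: "B n : sets N" for n unfolding B_def assms by (rule borel_open) (rule open_ball)
  have rB: "range B \<subseteq> sets N" using Bs by (rule image_subsetI)
  have "emeasure N (ball x r) = (SUP n. emeasure N (B n))"
   using SUP_emeasure_incseq[OF rB inc] UB by argo
  then obtain n where n: "a < emeasure N (B n)" using x by (auto simp: less_SUP_iff)
  have "ball x (1 / Suc n) \<subseteq> {x. a < emeasure N (ball x r)}"
  proof
   fix y assume y: "y : ball x (1 / Suc n)"
   have "B n \<subseteq> ball y r"
   proof
    fix w assume "w : B n"
    thus "w : ball y r" using y dist_triangle[of y w x] by (simp add: B_def dist_commute)
   qed
   hence "emeasure N (B n) <= emeasure N (ball y r)" using assms by (intro emeasure_mono) auto
   thus "y : {x. a < emeasure N (ball x r)}" using n by auto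
  qed
  thus "EX e>0. ball x e \<subseteq> {x. a < emeasure N (ball x r)}" by (intro exI[of _ "1 / Suc n"]) auto
 qed
 thus "{x : space borel. a < emeasure N (ball x r)} : sets borel" by simp
qed

end

context nonhomogeneous_space
begin

text \<open>
Halving the radius k times multiplies the number of covering balls by the doubling constant each time.
\<close>

lemma cover_count:
 "EX N::nat. ALL k x r. 0 < r -->
   (EX A. finite A & card A <= N ^ k & ball (x::'a) r \<subseteq> (UN y:A. ball y (r / 2 ^ k)))"
proof -
 obtain N :: nat where N: "!!(x::'a) r. 0 < r ==>
   EX A. finite A & card A <= N & ball x r \<subseteq> (UN y:A. ball y (r / 2))"
  using geom_doubling unfolding geometrically_doubling_def by auto
 define A where "A x r = (SOME A. finite A & card A <= N & ball (x::'a) r \<subseteq> (UN y:A. ball y (r / 2)))" for x r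
 have A: "finite (A x r) & card (A x r) <= N & ball x r \<subseteq> (UN y:A x r. ball y (r / 2))" if "0 < r" for x r
  unfolding A_def by (rule someI_ex[OF N[OF that]])
 have "ALL x r. 0 < r -->
   (EX A. finite A & card A <= N ^ k & ball (x::'a) r \<subseteq> (UN y:A. ball y (r / 2 ^ k)))" for k
 proof (induction k)
  case 0
  show ?case
  proof (intro allI impI)
   fix x :: 'a and r :: real assume "0 < r"
   show "EX A. finite A & card A <= N ^ 0 & ball x r \<subseteq> (UN y:A. ball y (r / 2 ^ 0))"
    by (rule exI[of _ "{x}"]) auto
  qed
 next
  case (Suc k)
  show ?case
  proof (intro allI impI)
   fix x :: 'a and r :: real assume r: "0 < r"
   obtain B where B: "finite B" "card B <= N ^ k" "ball x r \<subseteq> (UN y:B. ball y (r / 2 ^ k))"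
    using Suc r by blast
   let ?C = "UN y:B. A y (r / 2 ^ k)"
   have AA: "finite (A y (r / 2 ^ k))" "card (A y (r / 2 ^ k)) <= N"
     "ball y (r / 2 ^ k) \<subseteq> (UN z:A y (r / 2 ^ k). ball z (r / 2 ^ k / 2))" for y
    using A[of "r / 2 ^ k" y] r by auto
   have "card ?C <= (SUM y:B. card (A y (r / 2 ^ k)))" using B(1) by (rule card_UN_le)
   also have "... <= card B * N" using sum_bounded_above[of B "%y. card (A y (r / 2 ^ k))" N] AA by simp
   also have "... <= N ^ Suc k" using B(2) by (simp add: mult.commute)
   finally have "card ?C <= N ^ Suc k" .
   moreover have "ball x r \<subseteq> (UN y:?C. ball y (r / 2 ^ Suc k))"
   proof
    fix w assume "w : ball x r"
    then obtain y where y: "y : B" "w : ball y (r / 2 ^ k)" using B(3) by blast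
    then obtain z where "z : A y (r / 2 ^ k)" "w : ball z (r / 2 ^ k / 2)" using AA(3)[of y] by blast
    thus "w : (UN y:?C. ball y (r / 2 ^ Suc k))" using y(1)
     by (intro UN_I[of z] UN_I[of y]) (auto simp: mult.commute)
   qed
   moreover have "finite ?C" using B(1) AA by auto
   ultimately show "EX A. finite A & card A <= N ^ Suc k & ball x r \<subseteq> (UN y:A. ball y (r / 2 ^ Suc k))"
    by blast
  qed
 qed
 thus ?thesis by blast
qed

lemma separable:
 "EX D::'a set. countable D & (ALL x e. 0 < e --> (EX d:D. dist d x < e))"
proof -
 obtain N :: nat where N: "!!k x r. 0 < r ==>
   EX A. finite A & card A <= N ^ k & ball (x::'a) r \<subseteq> (UN y:A. ball y (r / 2 ^ k))"
  using cover_count by blast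
 define A where "A k x r = (SOME A. finite A & card A <= N ^ k & ball (x::'a) r \<subseteq> (UN y:A. ball y (r / 2 ^ k)))" for k x r
 have A: "finite (A k x r) & ball x r \<subseteq> (UN y:A k x r. ball y (r / 2 ^ k))" if "0 < r" for k x r
  using someI_ex[OF N[OF that, of k x]] unfolding A_def by blast
 fix o' :: 'a
 define D where "D = (UN n::nat. UN k::nat. A k o' (real (Suc n)))"
 have "countable D" unfolding D_def
  using A by (intro countable_UN) (auto intro: countable_finite)
 moreover have "EX d:D. dist d x < e" if e: "0 < e" for x e
 proof -
  obtain n :: nat where "dist o' x < real n" using reals_Archimedean2 by blast
  hence x: "x : ball o' (real (Suc n))" by simp
  obtain k :: nat where k: "real (Suc n) / e < 2 ^ k"
   using real_arch_pow[of 2 "real (Suc n) / e"] by auto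
  obtain d where d: "d : A k o' (real (Suc n))" "x : ball d (real (Suc n) / 2 ^ k)"
   using A[of "real (Suc n)" k o'] x by auto
  have "real (Suc n) / 2 ^ k < e" using k e by (simp add: field_simps)
  hence "dist d x < e" using d by simp
  moreover have "d : D" using d by (auto simp: D_def)
  ultimately show ?thesis by blast
 qed
 ultimately show ?thesis by blast
qed

lemma Lindelof_space:
 assumes "!!x. x : S ==> open (U x) & x : U x"
 shows "\<exists>C\<subseteq>S. countable C & S \<subseteq> (UN x:C. U (x::'a))"
 using separable assms Lindelof_dense[of _ S U] by metis

text \<open>Lindelof reduces an almost-everywhere statement to countably many neighbourhoods.\<close>

lemma AE_locally:
 assumes "!!x. x : S ==> EX r>0. AE y in M. y : ball x r --> P y"
 shows "AE y in M. y : S --> P y"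
proof -
 obtain r where r: "!!x. x : S ==> 0 < r x & (AE y in M. y : ball x (r x) --> P y)"
  using assms by metis
 obtain C where C: "C \<subseteq> S" "countable C" "S \<subseteq> (UN x:C. ball x (r x))"
  using Lindelof_space[of S "%x. ball x (r x)"] r by auto
 have "AE y in M. ALL x:C. y : ball x (r x) --> P y"
  using C r by (intro AE_ball_countable') auto
 thus ?thesis
 proof eventually_elim
  case (elim y)
  thus ?case using C(3) by blast
 qed
qed

section \<open>Coverings, small doubling balls and stopping balls\<close>

text \<open>
Zorn's lemma is applied to the disjoint families with the property that every ball met by a member is met
by a member at least as large. The property is inherited by unions of chains, and a maximal family meets
every ball, as otherwise a largest missed ball could be added. Two intersecting balls, the selected one
being at least as large, give the factor 3. The family is indexed by the naturals, padded with radius 0,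
for which the ball is empty.
\<close>

lemma vitali_cover:
 fixes l :: "'a => nat"
 assumes R: "0 < R"
 defines "rho \<equiv> %x. R / 6 ^ l x"
 shows "EX (c::nat => 'a) s. (ALL i. s i = 0 \<or> (c i : A & s i = rho (c i))) &
   disjoint_family (%i. ball (c i) (s i)) &
   (ALL x:A. EX i. s i > 0 & ball x (rho x) \<subseteq> ball (c i) (3 * s i))"
proof -
 define B where "B x = ball x (rho x)" for x
 have rho0: "0 < rho x" for x using R by (simp add: rho_def)
 have memB: "x : B x" for x using rho0 by (simp add: B_def)
 define \<G> where "\<G> = {G. G \<subseteq> A & disjoint_family_on B G &
   (ALL x:A. (EX y:G. B x Int B y ~= {}) --> (EX y:G. l y <= l x & B x Int B y ~= {}))}"
 have "EX G:\<G>. ALL X:\<G>. G \<subseteq> X --> X = G"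
 proof (rule subset_Zorn')
  fix C assume C: "subset.chain \<G> C"
  hence CG: "!!G. G : C ==> G : \<G>" unfolding subset.chain_def by blast
  have "disjoint_family_on B (\<Union>C)"
   unfolding disjoint_family_on_def
  proof (intro ballI impI)
   fix x y assume "x : \<Union>C" "y : \<Union>C" "x ~= y"
   then obtain X Y where XY: "X : C" "x : X" "Y : C" "y : Y" by blast
   hence "X \<subseteq> Y \<or> Y \<subseteq> X" using C unfolding subset.chain_def by blast
   then obtain Z where "Z : C" "x : Z" "y : Z" using XY by blast
   thus "B x Int B y = {}" using CG[of Z] \<open>x ~= y\<close>
    unfolding \<G>_def disjoint_family_on_def by blast
  qed
  moreover have "\<Union>C \<subseteq> A" using CG unfolding \<G>_def by blast
  moreover have "EX y:\<Union>C. l y <= l x & B x Int B y ~= {}"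
   if "x : A" "y : \<Union>C" "B x Int B y ~= {}" for x y
   using that CG unfolding \<G>_def by blast
  ultimately show "\<Union>C : \<G>" unfolding \<G>_def by blast
 qed
 then obtain G where G: "G : \<G>" and max: "!!X. X : \<G> ==> G \<subseteq> X ==> X = G" by blast
 have GA: "G \<subseteq> A" and dis: "disjoint_family_on B G" using G unfolding \<G>_def by auto
 have meet: "EX y:G. B x Int B y ~= {}" if x: "x : A" for x
 proof (rule ccontr)
  assume n: "~ (EX y:G. B x Int B y ~= {})"
  define S where "S = {x : A. ALL y:G. B x Int B y = {}}"
  have "x : S" using x n by (auto simp: S_def)
  then obtain z where z: "z : S" and zmin: "!!w. w : S ==> l z <= l w"
   using exists_least_iff[of "%k. EX w:S. l w = k"] by (metis not_le_imp_less)
  have "insert z G : \<G>"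
  proof -
   have "disjoint_family_on B (insert z G)"
    using dis z unfolding S_def disjoint_family_on_def by blast
   moreover have "EX y:insert z G. l y <= l w & B w Int B y ~= {}"
    if "w : A" "y : insert z G" "B w Int B y ~= {}" for w y
   proof (cases "w : S")
    case True
    hence "y = z" using that unfolding S_def by blast
    thus ?thesis using zmin[OF True] that by blast
   next
    case False
    hence "EX y:G. B w Int B y ~= {}" using that unfolding S_def by blast
    thus ?thesis using G that(1) unfolding \<G>_def by blast
   qed
   ultimately show ?thesis using GA z unfolding \<G>_def S_def by blast
  qed
  hence "z : G" using max[of "insert z G"] by blast
  thus False using z memB[of z] unfolding S_def by blast
 qed
 have cov: "EX y:G. B x \<subseteq> ball y (3 * rho y)" if x: "x : A" for x
 proof -
  obtain y where y: "y : G" "l y <= l x" "B x Int B y ~= {}"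
   using meet[OF x] G x unfolding \<G>_def by blast
  have "(6::real) ^ l y <= 6 ^ l x" using y by (intro power_increasing) auto
  hence le: "rho x <= rho y" using R unfolding rho_def by (intro divide_left_mono) auto
  obtain w where w: "dist x w < rho x" "dist y w < rho y" using y(3) by (auto simp: B_def)
  have "B x \<subseteq> ball y (3 * rho y)"
  proof
   fix v assume "v : B x"
   hence "dist x v < rho x" by (simp add: B_def)
   hence "dist y v < 3 * rho y"
    using w le dist_triangle[of y v w] dist_triangle[of w v x] by (simp add: dist_commute)
   thus "v : ball y (3 * rho y)" by simp
  qed
  thus ?thesis using y by blast
 qed
 have "countable G"
 proof -
  obtain D :: "'a set" where D: "countable D" "!!x e. 0 < e ==> EX d:D. dist d x < e"
   using separable by blast
  have "EX d:D. d : B x" for x using D(2)[OF rho0[of x], of x] by (auto simp: B_def dist_commute)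
  then obtain d where d: "!!x. d x : D & d x : B x" by metis
  have "inj_on d G"
  proof (rule inj_onI)
   fix x y assume xy: "x : G" "y : G" "d x = d y"
   hence "B x Int B y ~= {}" using d[of x] d[of y] by auto
   thus "x = y" using disjoint_family_onD[OF dis xy(1,2)] by auto
  qed
  moreover have "countable (d ` G)" using d D(1) by (meson countable_subset image_subsetI)
  ultimately show ?thesis by (metis countable_image_inj_on)
 qed
 then obtain e :: "'a => nat" where e: "inj_on e G" using countableE by blast
 define c where "c = inv_into G e"
 define s where "s i = (if i : e ` G then rho (c i) else 0)" for i
 have ce: "c (e x) = x" if "x : G" for x unfolding c_def using e that by simp
 have cG: "c i : G" if "i : e ` G" for i unfolding c_def using that by (simp add: inv_into_into)
 show ?thesis
 proof (intro exI[of _ c] exI[of _ s] conjI allI ballI)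
  fix i show "s i = 0 \<or> c i : A & s i = rho (c i)" using cG GA by (auto simp: s_def)
 next
  show "disjoint_family (%i. ball (c i) (s i))"
   unfolding disjoint_family_on_def
  proof (intro ballI impI)
   fix i j :: nat assume ij: "i ~= j"
   show "ball (c i) (s i) Int ball (c j) (s j) = {}"
   proof (cases "i : e ` G & j : e ` G")
    case True
    then obtain x y where xy: "x : G" "y : G" "i = e x" "j = e y" by blast
    hence "x ~= y" using ij by auto
    hence "B x Int B y = {}" using disjoint_family_onD[OF dis] xy by simp
    thus ?thesis using True xy ce by (auto simp: s_def B_def)
   qed (auto simp: s_def)
  qed
 next
  fix x assume "x : A"
  then obtain y where y: "y : G" "B x \<subseteq> ball y (3 * rho y)" using cov by blast
  thus "EX i. s i > 0 & ball x (rho x) \<subseteq> ball (c i) (3 * s i)"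
   using ce rho0 by (intro exI[of _ "e y"]) (auto simp: s_def B_def)
 qed
qed

text \<open>
If doubling fails at x on all small scales, the measure of the balls around x decays like a high power of
the radius, faster than the number of such balls needed for a covering grows. So the exceptional set is
covered by balls of arbitrarily small total measure.
\<close>

lemma small_doubling:
 "EX beta0::real. 1 <= beta0 & (ALL beta>=beta0. ALL R>0. AE x in M. ALL m. EX i>=m. V x (6 ^ p * (R / 6 ^ i)) <= beta * V x (R / 6 ^ i))"
proof -
 obtain N :: nat where N: "!!k x r. 0 < r ==>
   EX A. finite A & card A <= N ^ k & ball (x::'a) r \<subseteq> (UN y:A. ball y (r / 2 ^ k))"
  using cover_count by blast
 \<comment> \<open>Dividing a radius by 8^p multiplies the number of covering balls by at most N^(3p); the constant beats this by a factor of two.\<close>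
 define beta0 where "beta0 = 2 * real N ^ (3 * p) + 1"
 have beta01: "1 <= beta0" by (simp add: beta0_def)
 have main: "AE x in M. ALL m. EX i>=m. V x (6 ^ p * (R / 6 ^ i)) <= beta * V x (R / 6 ^ i)"
  if beta: "beta0 <= beta" and R: "0 < R" for beta R
 proof -
  have beta1: "1 <= beta" using beta01 beta by linarith
  fix o' :: 'a
  have null: "EX Z:null_sets M. {x : ball o' (real (Suc n)). ALL i>=m. ~ V x (6 ^ p * (R / 6 ^ i)) <= beta * V x (R / 6 ^ i)} \<subseteq> Z"
   (is "EX Z:null_sets M. ?Z \<subseteq> Z") for n m :: nat
  proof -
   let ?r = "real (Suc n)"
   define W where "W = V o' (?r + R)"
   have dec: "V x (R / 6 ^ (m + p * j)) * beta ^ j <= W" if x: "x : ?Z" for x j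
   proof (induction j)
    case 0
    have "R / 6 ^ m <= R" using R by (simp add: divide_le_eq mult_le_cancel_left1)
    hence "V x (R / 6 ^ m) <= W" unfolding W_def using x
     by (intro V_near) (simp add: dist_commute)
    thus ?case by simp
   next
    case (Suc j)
    let ?i = "m + p * Suc j"
    have "6 ^ p * (R / 6 ^ ?i) = R / 6 ^ (m + p * j)"
     by (simp add: power_add field_simps)
    hence "beta * V x (R / 6 ^ ?i) <= V x (R / 6 ^ (m + p * j))"
    proof -
     have "~ V x (6 ^ p * (R / 6 ^ ?i)) <= beta * V x (R / 6 ^ ?i)" using x by auto
     thus ?thesis using \<open>6 ^ p * (R / 6 ^ ?i) = R / 6 ^ (m + p * j)\<close> by simp
    qed
    hence "beta * V x (R / 6 ^ ?i) * beta ^ j <= V x (R / 6 ^ (m + p * j)) * beta ^ j"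
     using beta1 by (intro mult_right_mono) auto
    thus ?case using Suc by (simp add: mult_ac)
   qed
   obtain k0 :: nat where k0: "2 * ?r * 6 ^ m / R < 2 ^ k0"
    using real_arch_pow[of 2 "2 * ?r * 6 ^ m / R"] by auto
   define rad where "rad j = ?r / 2 ^ (k0 + 3 * p * j)" for j
   have rad: "2 * rad j <= R / 6 ^ (m + p * j)" for j
   proof -
    have "(6::real) ^ (p * j) <= 8 ^ (p * j)" by (intro power_mono) auto
    hence e: "(6::real) ^ (p * j) <= 2 ^ (3 * p * j)" by (simp add: power_mult mult.assoc)
    have "2 * ?r * 6 ^ m <= R * 2 ^ k0" using k0 R by (simp add: field_simps)
    hence "2 * ?r * 6 ^ m * 6 ^ (p * j) <= R * 2 ^ k0 * 2 ^ (3 * p * j)"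
     using e R by (intro mult_mono[of "2 * ?r * 6 ^ m" "R * 2 ^ k0"]) auto
    thus ?thesis unfolding rad_def by (simp add: field_simps power_add)
   qed
   have "EX A. finite A & card A <= N ^ (k0 + 3 * p * j) & ball o' ?r \<subseteq> (UN y:A. ball y (rad j))" for j
    using N[of ?r "k0 + 3 * p * j" o'] unfolding rad_def by auto
   hence "ALL j. EX A. finite A & card A <= N ^ (k0 + 3 * p * j) & ball o' ?r \<subseteq> (UN y:A. ball y (rad j))" by blast
   from choice[OF this]
   obtain A where A: "!!j. finite (A j)" "!!j. card (A j) <= N ^ (k0 + 3 * p * j)"
    "!!j. ball o' ?r \<subseteq> (UN y:A j. ball y (rad j))" by auto
   define A' where "A' j = {y : A j. ball y (rad j) Int ?Z ~= {}}" for j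
   define S where "S j = (UN y:A' j. ball y (rad j))" for j
   have ZS: "?Z \<subseteq> S j" for j
   proof
    fix x assume x: "x : ?Z"
    then obtain y where "y : A j" "x : ball y (rad j)" using A(3)[of j] by auto
    thus "x : S j" using x unfolding S_def A'_def by blast
   qed
   have Ss: "S j : sets M" for j unfolding S_def A'_def using A(1) by auto
   have bd: "emeasure M (S j) <= ennreal (real N ^ k0 * W * (1/2) ^ j)" for j
   proof -
    have one: "emeasure M (ball y (rad j)) <= ennreal (W / beta ^ j)" if y: "y : A' j" for y
    proof -
     obtain x where x: "x : ?Z" "x : ball y (rad j)" using y unfolding A'_def by blast
     have "V y (rad j) <= V x (R / 6 ^ (m + p * j))"
      using x(2) rad[of j] by (intro V_near) simp
     also have "... <= W / beta ^ j" using dec[OF x(1), of j] beta1 by (simp add: field_simps)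
     finally show ?thesis by (simp add: emeasure_ball ennreal_leI)
    qed
    have fA: "finite (A' j)" using A(1) by (auto simp: A'_def)
    have "emeasure M (S j) <= (SUM y:A' j. emeasure M (ball y (rad j)))"
     unfolding S_def using fA by (intro emeasure_subadditive_finite) auto
    also have "... <= (SUM y:A' j. ennreal (W / beta ^ j))" by (intro sum_mono one)
    also have "... = ennreal (real (card (A' j)) * (W / beta ^ j))"
     using beta1 by (simp add: ennreal_mult[symmetric] ennreal_of_nat_eq_real_of_nat W_def)
    also have "... <= ennreal (real N ^ k0 * W * (1/2) ^ j)"
    proof (rule ennreal_leI)
     have "card (A' j) <= card (A j)" using A(1) by (intro card_mono) (auto simp: A'_def)
     hence c: "card (A' j) <= N ^ (k0 + 3 * p * j)" using A(2)[of j] by linarith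
     have W0: "0 <= W / beta ^ j" using beta1 by (simp add: W_def)
     have "real (card (A' j)) <= real (N ^ (k0 + 3 * p * j))" using c by (rule of_nat_mono)
     hence "real (card (A' j)) * (W / beta ^ j) <= real N ^ (k0 + 3 * p * j) * (W / beta ^ j)"
      using W0 by (intro mult_right_mono) auto
     also have "... = real N ^ k0 * W * (real N ^ (3 * p) / beta) ^ j"
      by (simp add: power_add power_mult power_divide)
     also have "... <= real N ^ k0 * W * (1/2) ^ j"
     proof (intro mult_left_mono power_mono)
      show "real N ^ (3 * p) / beta <= 1 / 2" using beta beta1 by (simp add: beta0_def field_simps)
     qed (use beta1 in \<open>auto simp: W_def\<close>)
     finally show "real (card (A' j)) * (W / beta ^ j) <= real N ^ k0 * W * (1/2) ^ j" .
    qed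
    finally show ?thesis .
   qed
   define Z where "Z = (\<Inter>j. S j)"
   have Zs: "Z : sets M" unfolding Z_def using Ss by auto
   have "(%j. ennreal (real N ^ k0 * W * (1/2) ^ j)) \<longlonglongrightarrow> ennreal (real N ^ k0 * W * 0)"
    by (intro tendsto_ennrealI tendsto_mult tendsto_const LIMSEQ_power_zero) auto
   hence "emeasure M Z <= ennreal (real N ^ k0 * W * 0)"
   proof (rule LIMSEQ_le_const, intro exI allI impI)
    fix j
    have "emeasure M Z <= emeasure M (S j)" using Ss by (intro emeasure_mono) (auto simp: Z_def)
    thus "emeasure M Z <= ennreal (real N ^ k0 * W * (1/2) ^ j)" using bd[of j] by simp
   qed
   hence "Z : null_sets M" using Zs by (simp add: null_sets_def)
   moreover have "?Z \<subseteq> Z" using ZS unfolding Z_def by blast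
   ultimately show ?thesis by blast
  qed
  have "AE x in M. ALL n m. ~ (x : ball o' (real (Suc n)) & (ALL i>=m. ~ V x (6 ^ p * (R / 6 ^ i)) <= beta * V x (R / 6 ^ i)))"
   unfolding AE_all_countable
  proof (intro allI)
   fix n m
   obtain Z where "Z : null_sets M" "{x : ball o' (real (Suc n)). ALL i>=m. ~ V x (6 ^ p * (R / 6 ^ i)) <= beta * V x (R / 6 ^ i)} \<subseteq> Z"
    using null by blast
   thus "AE x in M. ~ (x : ball o' (real (Suc n)) & (ALL i>=m. ~ V x (6 ^ p * (R / 6 ^ i)) <= beta * V x (R / 6 ^ i)))"
    by (intro AE_I'[of Z]) auto
  qed
  thus ?thesis
  proof eventually_elim
   fix x assume a: "ALL n m. ~ (x : ball o' (real (Suc n)) & (ALL i>=m. ~ V x (6 ^ p * (R / 6 ^ i)) <= beta * V x (R / 6 ^ i)))"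
   obtain n :: nat where "dist o' x < real n" using reals_Archimedean2 by blast
   hence "x : ball o' (real (Suc n))" by simp
   thus "ALL m. EX i>=m. V x (6 ^ p * (R / 6 ^ i)) <= beta * V x (R / 6 ^ i)" using a by blast
  qed
 qed
 show ?thesis using beta01 main by blast
qed

text \<open>
The set where F is large and all the averages are small has measure zero: otherwise a closed subset of
positive measure is covered, inside a neighbourhood of nearly the same measure, by disjoint doubling
balls, on each of which the integral of F is small compared with what F > 2 \<tau> \<beta> forces.
\<close>

lemma differentiation:
 fixes F :: "'a => ennreal"
 assumes F[measurable]: "meas F" and R: "0 < R" and tau: "0 < tau" and beta: "1 <= beta"
  and dbl: "AE x in M. ALL m. EX i>=m. V x (6 ^ p * (R / 6 ^ i)) <= beta * V x (R / 6 ^ i)" and p: "Suc Q <= p"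
 shows "AE x in M. ennreal (2 * tau * beta) < F x -->
      (EX i. ennreal (tau * V x (6 ^ Q * (R / 6 ^ i))) < int_on (ball x (R / 6 ^ i)) F)"
proof -
 define nu where "nu = density M F"
 have nu: "emeasure nu A = int_on A F" if "A : sets M" for A
  unfolding nu_def using that by (intro emeasure_density) auto
 have snu: "sets nu = sets M" by (simp add: nu_def)
 obtain N where N: "N : null_sets M" "{x : space M. ~ (ALL m. EX i>=m. V x (6 ^ p * (R / 6 ^ i)) <= beta * V x (R / 6 ^ i))} \<subseteq> N"
  using dbl unfolding eventually_ae_filter by blast
 define Z where "Z = {x : space M. ennreal (2 * tau * beta) < F x &
   (ALL i. emeasure nu (ball x (R / 6 ^ i)) <= ennreal tau * emeasure M (ball x (6 ^ Q * (R / 6 ^ i))))}"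
 have [measurable]: "meas (%x. emeasure nu (ball x r))" "meas (%x. emeasure M (ball x r))" for r
  unfolding measurable_M_borel using snu sets_M by (auto intro!: emeasure_ball_measurable)
 have Zs: "Z : sets M" unfolding Z_def by measurable
 have null: "emeasure M ((Z - N) Int ball o' r) = 0" for o' r
 proof (rule ccontr)
  assume "emeasure M ((Z - N) Int ball o' r) ~= 0"
  hence "EX C. closed C & C \<subseteq> (Z - N) Int ball o' r & 0 < emeasure M C"
   using Zs N(1) by (intro inner_closed[of _ o' r]) (auto simp: zero_less_iff_neq_zero)
  then obtain C where C: "closed C" "C \<subseteq> (Z - N) Int ball o' r" "0 < emeasure M C" by blast
  have Cs: "C : sets M" using C by (simp add: sets_M)
  define E where "E m = (UN x:C. ball x (R / 6 ^ m))" for m :: nat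
  have Eo: "open (E m)" for m unfolding E_def by auto
  hence Es: "E m : sets M" for m by (simp add: sets_M)
  have key: "ennreal (2 * tau * beta) * emeasure M C <= ennreal (tau * beta) * emeasure M (E m)" for m
  proof -
   have "EX i>=Suc m. V x (6 ^ p * (R / 6 ^ i)) <= beta * V x (R / 6 ^ i)" if "x : C" for x
   proof -
    have "x ~: N" using that C(2) by blast
    hence "ALL m. EX i>=m. V x (6 ^ p * (R / 6 ^ i)) <= beta * V x (R / 6 ^ i)" using N(2) by auto
    thus ?thesis by blast
   qed
   then obtain l where l: "!!x. x : C ==> Suc m <= l x & V x (6 ^ p * (R / 6 ^ l x)) <= beta * V x (R / 6 ^ l x)"
    by metis
   from vitali_cover[OF R, of C l] obtain c s where
    cs: "!!i::nat. s i = 0 \<or> (c i : C & s i = R / 6 ^ l (c i))" and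
    dis: "disjoint_family (%i. ball (c i) (s i))" and
    cov: "!!x. x : C ==> EX i. s i > 0 & ball x (R / 6 ^ l x) \<subseteq> ball (c i) (3 * s i)" by blast
   have s0: "0 <= s i" for i using cs[of i] R by auto
   have one: "emeasure nu (ball (c i) (6 * s i)) <= ennreal (tau * beta) * emeasure M (ball (c i) (s i))" for i
   proof (cases "s i = 0")
    case False
    hence ci: "c i : C" and si: "s i = R / 6 ^ l (c i)" using cs by auto
    obtain k where k: "l (c i) = Suc k" using l[OF ci] by (cases "l (c i)") auto
    have e: "6 * s i = R / 6 ^ k" by (simp add: si k)
    have "c i : Z" using ci C(2) by blast
    hence "emeasure nu (ball (c i) (6 * s i)) <= ennreal tau * emeasure M (ball (c i) (6 ^ Q * (R / 6 ^ k)))"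
     unfolding e by (auto simp: Z_def)
    also have "... = ennreal (tau * V (c i) (6 ^ Suc Q * s i))"
     using tau unfolding e[symmetric] by (simp add: emeasure_ball ennreal_mult mult_ac)
    also have "... <= ennreal (tau * (beta * V (c i) (s i)))"
    proof (intro ennreal_leI mult_left_mono)
     have "(6::real) ^ Suc Q * s i <= 6 ^ p * s i" using p s0 by (intro mult_right_mono power_increasing) auto
     hence "V (c i) (6 ^ Suc Q * s i) <= V (c i) (6 ^ p * s i)" by (rule V_mono)
     thus "V (c i) (6 ^ Suc Q * s i) <= beta * V (c i) (s i)" using l[OF ci] by (simp add: si)
    qed (use tau in auto)
    also have "... = ennreal (tau * beta) * emeasure M (ball (c i) (s i))"
     using tau beta by (simp add: emeasure_ball ennreal_mult mult.assoc)
    finally show ?thesis .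
   qed auto
   have "ennreal (2 * tau * beta) * emeasure M C = int_on C (%y. ennreal (2 * tau * beta))"
    using Cs by (simp add: nn_integral_cmult)
   also have "... <= int_on C F"
    using C(2) by (intro nn_integral_mono) (auto simp: Z_def indicator_def less_imp_le split: if_splits)
   also have "... = emeasure nu C" using nu[OF Cs] by simp
   also have "... <= emeasure nu (UN i. ball (c i) (6 * s i))"
   proof (intro emeasure_mono subsetI)
    fix x assume x: "x : C"
    obtain i where i: "s i > 0" "ball x (R / 6 ^ l x) \<subseteq> ball (c i) (3 * s i)" using cov[OF x] by blast
    moreover have "x : ball x (R / 6 ^ l x)" using R by simp
    ultimately have "dist (c i) x < 3 * s i" by (auto simp: subset_iff)
    hence "x : ball (c i) (6 * s i)" using i(1) by simp
    thus "x : (UN i. ball (c i) (6 * s i))" by blast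
   qed (auto simp: snu sets_M)
   also have "... <= (\<Sum>i. emeasure nu (ball (c i) (6 * s i)))"
    by (intro emeasure_subadditive_countably) (auto simp: snu)
   also have "... <= (\<Sum>i. ennreal (tau * beta) * emeasure M (ball (c i) (s i)))"
    using one by (intro suminf_le) auto
   also have "... = ennreal (tau * beta) * emeasure M (UN i. ball (c i) (s i))"
    using dis by (subst suminf_emeasure[symmetric]) (auto simp: ennreal_suminf_cmult)
   also have "... <= ennreal (tau * beta) * emeasure M (E m)"
   proof (intro mult_left_mono emeasure_mono Es subsetI)
    fix x assume "x : (UN i. ball (c i) (s i))"
    then obtain i where i: "x : ball (c i) (s i)" by blast
    hence "s i ~= 0" by auto
    hence ci: "c i : C" and si: "s i = R / 6 ^ l (c i)" using cs by auto
    have "(6::real) ^ m <= 6 ^ l (c i)" using l[OF ci] by (intro power_increasing) auto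
    hence "s i <= R / 6 ^ m" using R unfolding si by (intro divide_left_mono) auto
    hence "x : ball (c i) (R / 6 ^ m)" using i by simp
    thus "x : E m" unfolding E_def using ci by blast
   qed auto
   finally show ?thesis .
  qed
  have ECap: "(\<Inter>m. E m) = C"
  proof (intro equalityI subsetI)
   fix x assume x: "x : (\<Inter>m. E m)"
   have "x : closure C" unfolding closure_approachable
   proof (intro allI impI)
    fix e :: real assume "0 < e"
    then obtain m where m: "R / e < 6 ^ m" using real_arch_pow[of 6 "R / e"] by auto
    obtain y where "y : C" "dist y x < R / 6 ^ m" using x by (auto simp: E_def)
    moreover have "R / 6 ^ m < e" using m \<open>0 < e\<close> by (simp add: field_simps)
    ultimately show "EX y:C. dist y x < e" by (meson less_trans)
   qed
   thus "x : C" using C(1) by simp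
  next
   fix x assume "x : C" thus "x : (\<Inter>m. E m)" using R by (auto simp: E_def intro!: bexI[of _ x])
  qed
  have dec: "decseq E"
  proof (intro decseq_SucI)
   fix m
   have "R / 6 ^ Suc m <= R / 6 ^ m" using R by (simp add: field_simps)
   hence "ball x (R / 6 ^ Suc m) \<subseteq> ball x (R / 6 ^ m)" for x by (rule subset_ball)
   thus "E (Suc m) \<subseteq> E m" unfolding E_def by blast
  qed
  have "E m \<subseteq> ball o' (r + R)" for m
  proof
   fix y assume "y : E m"
   then obtain x where x: "x : C" "dist x y < R / 6 ^ m" by (auto simp: E_def)
   have "R / 6 ^ m <= R" using R by (simp add: divide_le_eq mult_le_cancel_left1)
   moreover have "dist o' x < r" using x(1) C(2) by auto
   ultimately show "y : ball o' (r + R)" using x(2) dist_triangle[of o' y x] by simp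
  qed
  hence "emeasure M (E m) <= emeasure M (ball o' (r + R))" for m by (intro emeasure_mono) auto
  hence Ef: "emeasure M (E m) ~= \<infinity>" for m
   using emeasure_ball_finite[of o' "r + R"] by (metis infinity_ennreal_def leD)
  have "(%m. emeasure M (E m)) \<longlonglongrightarrow> emeasure M C"
   using Lim_emeasure_decseq[OF _ dec, of M] Es Ef ECap by auto
  hence "(%m. ennreal (tau * beta) * emeasure M (E m)) \<longlonglongrightarrow> ennreal (tau * beta) * emeasure M C"
   by (intro ennreal_tendsto_cmult) auto
  hence "ennreal (2 * tau * beta) * emeasure M C <= ennreal (tau * beta) * emeasure M C"
   by (rule LIMSEQ_le_const) (use key in auto)
  moreover have "emeasure M C = ennreal (measure M C)"
  proof -
   have "emeasure M C <= emeasure M (E 0)" using ECap Es by (intro emeasure_mono) auto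
   thus ?thesis using Ef[of 0] by (intro emeasure_eq_ennreal_measure) (auto simp: top_unique)
  qed
  moreover hence "0 < measure M C" using C(3) by (simp add: zero_less_measure_iff)
  ultimately have "2 * tau * beta * measure M C <= tau * beta * measure M C"
   using tau beta by (simp add: ennreal_mult[symmetric])
  thus False using \<open>0 < measure M C\<close> tau beta by (simp add: mult_le_cancel_right)
 qed
 fix o' :: 'a
 have "(UN n::nat. (Z - N) Int ball o' (real n)) : null_sets M"
  using null Zs N by (intro null_sets_UN) (auto simp: null_sets_def)
 moreover have "(UN n::nat. (Z - N) Int ball o' (real n)) = Z - N" using UN_balls[of o'] by blast
 ultimately have "(Z - N) Un N : null_sets M" using null_sets.Un[of "Z - N" M N] N(1) by simp
 thus ?thesis
 proof (rule AE_I', intro subsetI)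
  fix x assume x: "x : {x : space M. ~ (ennreal (2 * tau * beta) < F x -->
      (EX i. ennreal (tau * V x (6 ^ Q * (R / 6 ^ i))) < int_on (ball x (R / 6 ^ i)) F))}"
  hence "x : Z" using tau by (simp add: Z_def nu emeasure_ball ennreal_mult not_less)
  thus "x : (Z - N) Un N" by blast
 qed
qed

text \<open>
Stopping balls for the averages of F relative to dilated balls: the average is large on the ball itself,
small on all its dilates, and F is bounded off the balls dilated by 6. A radius 0 marks an unused index.
\<close>

definition CZ_balls :: "nat => real => 'a set => real => real => ('a => ennreal) => (nat => 'a) => (nat => real) => bool" where
 "CZ_balls Q R A tau L F c s \<longleftrightarrow> (ALL i. 0 <= s i & s i < R & (0 < s i --> c i : A)) &
  disjoint_family (%i. ball (c i) (s i)) &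
  (ALL i. 0 < s i --> ennreal (tau * V (c i) (6 ^ Q * s i)) < int_on (ball (c i) (s i)) F) &
  (ALL i j. 0 < s i --> 1 <= j --> int_on (ball (c i) (6 ^ j * s i)) F <= ennreal (tau * V (c i) (6 ^ (j + Q) * s i))) &
  (AE x in M. x : A --> x ~: (UN i. ball (c i) (6 * s i)) --> F x <= ennreal L)"

lemma CZ_ballsD:
 assumes "CZ_balls Q R A tau L F c s"
 shows "!!i. 0 <= s i" "!!i. s i < R" "!!i. 0 < s i ==> c i : A"
  "!!i. 0 < s i ==> ennreal (tau * V (c i) (6 ^ Q * s i)) < int_on (ball (c i) (s i)) F"
  "!!i j. 0 < s i ==> 1 <= j ==> int_on (ball (c i) (6 ^ j * s i)) F <= ennreal (tau * V (c i) (6 ^ (j + Q) * s i))"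
  "AE x in M. x : A --> x ~: (UN i. ball (c i) (6 * s i)) --> F x <= ennreal L"
 using assms unfolding CZ_balls_def by blast+

lemma CZ_balls_pos:
 assumes "CZ_balls Q R A tau L F c s" "0 < s i"
 shows "0 < V (c i) (s i)"
proof (rule ccontr)
 assume "~ 0 < V (c i) (s i)"
 hence "V (c i) (s i) = 0" using V_nonneg[of "c i" "s i"] by linarith
 hence "ball (c i) (s i) : null_sets M" by (auto simp: null_sets_def emeasure_ball)
 hence "int_on (ball (c i) (s i)) F = 0" by (rule nn_integral_null_set)
 thus False using CZ_ballsD(4)[OF assms] by simp
qed

lemma CZ_balls_sum:
 assumes "CZ_balls Q R A tau L F c s" and [measurable]: "meas F"
 shows "(\<Sum>i. \<integral>\<^sup>+y\<in>ball (c i) (s i). F y \<partial>M) <= ntot F"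
proof -
 have dis: "disjoint_family (%i. ball (c i) (s i))" using assms(1) unfolding CZ_balls_def by blast
 have "(\<Sum>i. \<integral>\<^sup>+y\<in>ball (c i) (s i). F y \<partial>M) = ntot (%y. (\<Sum>i. F y * indicator (ball (c i) (s i)) y))"
  by (intro nn_integral_suminf[symmetric]) auto
 also have "... <= ntot F"
 proof (intro nn_integral_mono)
  fix y
  have "(\<Sum>i. F y * indicator (ball (c i) (s i)) y) = F y * indicator (UN i. ball (c i) (s i)) y"
   using suminf_indicator[OF dis, of y] by (simp add: ennreal_suminf_cmult)
  also have "... <= F y" by (auto simp: indicator_def)
  finally show "(\<Sum>i. F y * indicator (ball (c i) (s i)) y) <= F y" .
 qed
 finally show ?thesis .
qed

text \<open>
Each point of A at which some average is large is given the largest such radius on the scale R / 6^i;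
maximality yields the upper bounds on the dilates, Vitali selects disjoint balls, and the differentiation
lemma controls F at the points without a large average.
\<close>

lemma CZ_covering:
 fixes F :: "'a => ennreal"
 assumes F[measurable]: "meas F" and R: "0 < R" and tau: "0 < tau" and beta: "1 <= beta"
  and dbl: "AE x in M. ALL m. EX i>=m. V x (6 ^ p * (R / 6 ^ i)) <= beta * V x (R / 6 ^ i)" and p: "Suc Q <= p"
  and large: "!!x r. x : A ==> R <= r ==> int_on (ball x r) F <= ennreal (tau * V x (6 ^ Q * r))"
 shows "EX c s. CZ_balls Q R A tau (2 * tau * beta) F c s"
proof -
 define bad where "bad x i \<longleftrightarrow> ennreal (tau * V x (6 ^ Q * (R / 6 ^ i))) < int_on (ball x (R / 6 ^ i)) F" for x and i :: nat
 define A' where "A' = {x : A. EX i. bad x i}"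
 define l where "l x = (LEAST i. bad x i)" for x
 have l: "bad x (l x)" if "x : A'" for x using that unfolding A'_def l_def by (auto intro: LeastI)
 have lmin: "~ bad x i" if "i < l x" for x i using that unfolding l_def by (rule not_less_Least)
 have l1: "1 <= l x" if x: "x : A'" for x
 proof (rule ccontr)
  assume "~ 1 <= l x"
  hence "bad x 0" using l[OF x] by (simp add: not_le)
  thus False using large[of x R] x by (auto simp: bad_def A'_def)
 qed
 from vitali_cover[OF R, of A' l] obtain c s where
  cs: "!!i::nat. s i = 0 \<or> (c i : A' & s i = R / 6 ^ l (c i))" and
  dis: "disjoint_family (%i. ball (c i) (s i))" and
  cov: "!!x. x : A' ==> EX i. s i > 0 & ball x (R / 6 ^ l x) \<subseteq> ball (c i) (3 * s i)" by blast
 have cs': "c i : A'" "s i = R / 6 ^ l (c i)" if "0 < s i" for i using cs[of i] that by auto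
 have 1: "0 <= s i & s i < R & (0 < s i --> c i : A)" for i
 proof (cases "s i = 0")
  case False
  hence *: "c i : A'" "s i = R / 6 ^ l (c i)" using cs by auto
  have "(1::real) < 6 ^ l (c i)" using l1[OF *(1)] by (intro one_less_power) auto
  hence "s i < R" using R unfolding *(2) by (simp add: divide_less_eq)
  thus ?thesis using * R by (auto simp: A'_def)
 qed (use R in auto)
 have 2: "int_on (ball (c i) (6 ^ j * s i)) F <= ennreal (tau * V (c i) (6 ^ (j + Q) * s i))" if "0 < s i" "1 <= j" for i j
 proof (cases "j <= l (c i)")
  case True
  hence e: "6 ^ j * s i = R / 6 ^ (l (c i) - j)" "6 ^ (j + Q) * s i = 6 ^ Q * (R / 6 ^ (l (c i) - j))"
   using cs'(2)[OF that(1)] by (simp_all add: power_diff power_add)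
  have "~ bad (c i) (l (c i) - j)" using True that(2) by (intro lmin) auto
  thus ?thesis unfolding e bad_def by (simp add: not_less)
 next
  case False
  hence "(6::real) ^ l (c i) <= 6 ^ j" by (intro power_increasing) auto
  hence "6 ^ l (c i) * s i <= 6 ^ j * s i" using that by (intro mult_right_mono) auto
  hence "R <= 6 ^ j * s i" using cs'(2)[OF that(1)] R by simp
  moreover have "c i : A" using cs'(1)[OF that(1)] by (simp add: A'_def)
  ultimately show ?thesis using large[of "c i" "6 ^ j * s i"] by (simp add: power_add mult_ac)
 qed
 have 3: "ennreal (tau * V (c i) (6 ^ Q * s i)) < int_on (ball (c i) (s i)) F" if "0 < s i" for i
  using l[OF cs'(1)[OF that]] cs'(2)[OF that] by (simp add: bad_def)
 have 4: "AE x in M. x : A --> x ~: (UN i. ball (c i) (6 * s i)) --> F x <= ennreal (2 * tau * beta)"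
  using differentiation[OF F R tau beta dbl p]
 proof eventually_elim
  fix x assume a: "ennreal (2 * tau * beta) < F x --> (EX i. ennreal (tau * V x (6 ^ Q * (R / 6 ^ i))) < int_on (ball x (R / 6 ^ i)) F)"
  show "x : A --> x ~: (UN i. ball (c i) (6 * s i)) --> F x <= ennreal (2 * tau * beta)"
  proof (intro impI, rule ccontr)
   assume x: "x : A" "x ~: (UN i. ball (c i) (6 * s i))" "~ F x <= ennreal (2 * tau * beta)"
   hence "x : A'" using a by (auto simp: A'_def bad_def not_le)
   then obtain i where i: "s i > 0" "ball x (R / 6 ^ l x) \<subseteq> ball (c i) (3 * s i)" using cov by blast
   moreover have "x : ball x (R / 6 ^ l x)" using R by simp
   ultimately have "dist (c i) x < 3 * s i" by (auto simp: subset_iff)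
   hence "x : ball (c i) (6 * s i)" using i(1) by simp
   thus False using x(2) by blast
  qed
 qed
 show ?thesis unfolding CZ_balls_def using 1 2 3 4 dis by (intro exI[of _ c] exI[of _ s] conjI allI impI) auto
qed

end

context nonhomogeneous_space
begin

section \<open>Bounded functions, the kernel and the operator\<close>

text \<open>
Bounded functions with bounded support are represented by honest pointwise bounds, so that no null sets
intervene in cutting and adding them.
\<close>

definition bfun :: "('a => complex) => bool" where
 "bfun f \<longleftrightarrow> meas f & (EX c. ALL x. cmod (f x) <= c) & (EX z r. ALL x. x ~: ball z r --> f x = 0)"

definition supb :: "('a => complex) => 'a => real => bool" where
 "supb f z r \<longleftrightarrow> (ALL x. x ~: ball z r --> f x = 0)"

definition L2 :: "('a => complex) set" where
 "L2 = {f : borel_measurable M. (sq f) < \<infinity>}"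

abbreviation nint :: "('a => complex) => real" where
 "nint f \<equiv> \<integral>x. cmod (f x) \<partial>M"

lemma bfun_meas [measurable_dest]: "bfun f ==> meas f" by (simp add: bfun_def)

lemma bfun_bound:
 assumes "bfun f"
 shows "EX c r z. 0 < c & 0 < r & (ALL x. cmod (f x) <= c * indicator (ball z r) x)"
proof -
 obtain c z r where *: "!!x. cmod (f x) <= c" "!!x. x ~: ball z r ==> f x = 0"
  using assms unfolding bfun_def by blast
 show ?thesis
 proof (rule exI[of _ "\<bar>c\<bar> + 1"], rule exI[of _ "\<bar>r\<bar> + 1"], rule exI[of _ z], intro conjI allI)
  fix x
  have "cmod (f x) <= \<bar>c\<bar> + 1" using *(1)[of x] by linarith
  moreover have "f x = 0" if "x ~: ball z (\<bar>r\<bar> + 1)" using that by (intro *(2)) auto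
  ultimately show "cmod (f x) <= (\<bar>c\<bar> + 1) * indicator (ball z (\<bar>r\<bar> + 1)) x"
   by (cases "x : ball z (\<bar>r\<bar> + 1)") auto
 qed auto
qed

lemma bfunI:
 assumes "meas f" "!!x. cmod (f x) <= c" "!!x. x ~: ball z r ==> f x = 0"
 shows "bfun f"
 using assms unfolding bfun_def by blast

lemma bfun_powr_integrable:
 assumes "bfun f" "0 <= q"
 shows "integrable M (%x. cmod (f x) powr q)"
proof -
 obtain c r z where *: "0 < c" "0 < r" "!!x. cmod (f x) <= c * indicator (ball z r) x"
  using bfun_bound[OF assms(1)] by blast
 have [measurable]: "meas f" using assms(1) by (rule bfun_meas)
 have "integrable M (%x. (c powr q) * indicator (ball z r) x :: real)"
  using emeasure_ball_finite[of z r] by (intro integrable_mult_right integrable_real_indicator) auto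
 thus ?thesis
 proof (rule Bochner_Integration.integrable_bound)
  show "AE x in M. norm (cmod (f x) powr q) <= norm (c powr q * indicator (ball z r) x :: real)"
  proof (intro AE_I2)
   fix x
   show "norm (cmod (f x) powr q) <= norm (c powr q * indicator (ball z r) x :: real)"
    using *(3)[of x] powr_mono2[of q "cmod (f x)" c] assms(2) by (cases "x : ball z r") auto
  qed
 qed auto
qed

lemma bfun_integrable: "bfun f ==> integrable M f"
 using bfun_powr_integrable[of f 1] bfun_meas[of f] by (simp add: integrable_norm_iff)

lemma bfun_norm_integrable: "bfun f ==> integrable M (%x. cmod (f x))"
 using bfun_integrable by auto

lemma bfun_L2: "bfun f ==> f : L2"
proof -
 assume f: "bfun f"
 have "integrable M (%x. (cmod (f x))\<^sup>2)"
  using bfun_powr_integrable[OF f, of 2] by simp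
 thus ?thesis using bfun_meas[OF f] unfolding L2_def
  by (auto simp: integrable_iff_bounded)
qed

lemma nn_nint: "integrable M f ==> mass f = ennreal (nint f)"
 by (intro nn_integral_eq_integral) auto

lemma bfun_add: "bfun f ==> bfun g ==> bfun (%x. f x + g x)"
proof -
 assume f: "bfun f" and g: "bfun g"
 obtain c r z where c: "0 < c" "0 < r" "!!x. cmod (f x) <= c * indicator (ball z r) x"
  using bfun_bound[OF f] by blast
 obtain c' r' z' where c': "0 < c'" "0 < r'" "!!x. cmod (g x) <= c' * indicator (ball z' r') x"
  using bfun_bound[OF g] by blast
 show ?thesis
 proof (rule bfunI[of _ "c + c'" z "r + r' + dist z z'"])
  fix x
  have "cmod (f x) <= c" using c(3)[of x] c(1) by (cases "x : ball z r") auto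
  moreover have "cmod (g x) <= c'" using c'(3)[of x] c'(1) by (cases "x : ball z' r'") auto
  ultimately    show "cmod (f x + g x) <= c + c'" by (meson add_mono norm_triangle_le)
  assume x: "x ~: ball z (r + r' + dist z z')"
  have "x ~: ball z r" using x c'(2) zero_le_dist[of z z'] by (auto simp del: zero_le_dist)
  moreover have "x ~: ball z' r'" using x c(2) dist_triangle[of z x z'] by auto
  ultimately show "f x + g x = 0" using c(3)[of x] c'(3)[of x] by auto
 qed (use bfun_meas[OF f] bfun_meas[OF g] in auto)
qed

lemma bfun_mult:
 assumes f: "bfun f" and g: "meas g" "!!x. cmod (g x) <= c"
 shows "bfun (%x. g x * f x)"
proof -
 obtain d r z where d: "0 < d" "0 < r" "!!x. cmod (f x) <= d * indicator (ball z r) x"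
  using bfun_bound[OF f] by blast
 show ?thesis
 proof (rule bfunI[of _ "c * d" z r])
  fix x
  have "0 <= c" using g(2)[of x] norm_ge_zero[of "g x"] by linarith
  moreover have "cmod (f x) <= d" using d(3)[of x] d(1) by (cases "x : ball z r") auto
  ultimately show "cmod (g x * f x) <= c * d" using g(2)[of x] by (simp add: norm_mult mult_mono)
  assume "x ~: ball z r" thus "g x * f x = 0" using d(3)[of x] by auto
 qed (use bfun_meas[OF f] g in auto)
qed

lemma bfun_cmult: "bfun f ==> bfun (%x. c * f x)"
 using bfun_mult[of f "%_. c" "cmod c"] by auto

lemma bfun_diff: "bfun f ==> bfun g ==> bfun (%x. f x - g x)"
 using bfun_add[of f "%x. -1 * g x"] bfun_cmult[of g "-1"] by simp

lemma bfun_zero: "bfun (%x. 0)"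
 by (rule bfunI[of _ 0]) auto

lemma bfun_sum: "(!!i. i : I ==> bfun (f i)) ==> bfun (%x. SUM i:I. f i x)"
proof (induction I rule: infinite_finite_induct)
 case (insert i I)
 thus ?case using bfun_add[of "f i" "%x. SUM i:I. f i x"] by simp
qed (auto simp: bfun_zero)

lemma bfun_indicator: "A : sets M ==> A \<subseteq> ball z r ==> bfun (indicator A)"
 by (rule bfunI[of _ 1 z r]) (auto simp: indicator_def)

lemma bfun_restrict: "bfun f ==> A : sets M ==> bfun (%x. indicator A x * f x)"
 by (rule bfun_mult[of f _ 1]) (auto simp: indicator_def)

lemma open_prod_sets:
 assumes "open (W :: ('a \<times> 'a) set)"
 shows "W : sets (M \<Otimes>\<^sub>M M)"
proof -
 obtain D :: "'a set" where D: "countable D" "!!x e. 0 < e ==> EX d:D. dist d x < e"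
  using separable by blast
 have dense: "EX d:D \<times> D. dist d p < e" if e: "0 < e" for p :: "'a \<times> 'a" and e
 proof -
  obtain d1 d2 where d: "d1 : D" "dist d1 (fst p) < e / 2" "d2 : D" "dist d2 (snd p) < e / 2"
   using D(2)[of "e / 2"] e by (meson half_gt_zero)
  have "dist (d1, d2) p <= dist d1 (fst p) + dist d2 (snd p)"
   unfolding dist_prod_def by (simp add: sqrt_sum_squares_le_sum)
  thus ?thesis using d by (intro bexI[of _ "(d1, d2)"]) auto
 qed
 have "EX A B. open A & open B & p : A \<times> B & A \<times> B \<subseteq> W" if "p : W" for p
  using assms that unfolding open_prod_def by blast
 then obtain A B where AB: "!!p. p : W ==> open (A p) & open (B p) & p : A p \<times> B p & A p \<times> B p \<subseteq> W"
  by metis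
 have cDD: "countable (D \<times> D)" using D by auto
 have op: "open (A p \<times> B p) & p : A p \<times> B p" if "p : W" for p
  using AB[OF that] open_Times[of "A p" "B p"] by simp
 from Lindelof_dense[of "D \<times> D" W "%p. A p \<times> B p", OF cDD dense op]
 obtain C where C: "C \<subseteq> W" "countable C" "W \<subseteq> (UN p:C. A p \<times> B p)" by blast
 have "W = (UN p:C. A p \<times> B p)" using C AB by blast
 moreover have "(UN p:C. A p \<times> B p) : sets (M \<Otimes>\<^sub>M M)"
  using C AB by (intro sets.countable_UN' pair_measureI) (auto simp: sets_M subset_iff)
 ultimately show ?thesis by simp
qed

lemma diagonal_open: "open {(x, y). x ~= (y::'a)}"
proof -
 have "open {p :: 'a \<times> 'a. fst p ~= snd p}"
  by (intro open_Collect_neq continuous_intros)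
 thus ?thesis by (simp add: case_prod_unfold)
qed

text \<open>
Local integrability speaks only about neighbourhoods of points off the diagonal; countably many of them
cover, because the space is separable.
\<close>

lemma kernel_measurable:
 assumes K: "locally_integrable_on (M \<Otimes>\<^sub>M M) {(x, y). x ~= y} (%(x, y). K x y)"
 shows "(%(x, y). if x = y then 0 else K x y) : borel_measurable (M \<Otimes>\<^sub>M M)"
proof -
 let ?S = "{(x, y). x ~= (y::'a)}"
 let ?g = "%(x, y). if x = y then 0 else K x y"
 obtain U where U: "!!p. p : ?S ==> open (U p) & p : U p & set_integrable (M \<Otimes>\<^sub>M M) (U p Int ?S) (%(x, y). K x y)"
  using K unfolding locally_integrable_on_def by metis
 obtain D :: "'a set" where D: "countable D" "!!x e. 0 < e ==> EX d:D. dist d x < e"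
  using separable by blast
 have dense: "EX d:D \<times> D. dist d p < e" if e: "0 < e" for p :: "'a \<times> 'a" and e
 proof -
  obtain d1 d2 where d: "d1 : D" "dist d1 (fst p) < e / 2" "d2 : D" "dist d2 (snd p) < e / 2"
   using D(2)[of "e / 2"] e by (meson half_gt_zero)
  have "dist (d1, d2) p <= dist d1 (fst p) + dist d2 (snd p)"
   unfolding dist_prod_def by (simp add: sqrt_sum_squares_le_sum)
  thus ?thesis using d by (intro bexI[of _ "(d1, d2)"]) auto
 qed
 have cDD: "countable (D \<times> D)" using D by auto
 have op: "open (U p) & p : U p" if "p : ?S" for p using U[OF that] by simp
 from Lindelof_dense[of "D \<times> D" ?S U, OF cDD dense op]
 obtain C where C: "C \<subseteq> ?S" "countable C" "?S \<subseteq> (UN p:C. U p)" by blast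
 have Ss: "?S : sets (M \<Otimes>\<^sub>M M)" by (rule open_prod_sets[OF diagonal_open])
 have sp: "space (M \<Otimes>\<^sub>M M) = UNIV" by (simp add: space_pair_measure)
 have Us: "U p Int ?S : sets (M \<Otimes>\<^sub>M M)" if "p : ?S" for p
  using open_prod_sets[of "U p"] U[OF that] Ss by (intro sets.Int) auto
 have cS: "- ?S : sets (M \<Otimes>\<^sub>M M)" using sets.compl_sets[OF Ss] by (simp add: sp Compl_eq_Diff_UNIV)
 show ?thesis
 proof (rule measurable_piecewise_restrict[of "insert (- ?S) ((%p. U p Int ?S) ` C)"])
  show "countable (insert (- ?S) ((%p. U p Int ?S) ` C))" using C by auto
  show "space (M \<Otimes>\<^sub>M M) \<subseteq> \<Union> (insert (- ?S) ((%p. U p Int ?S) ` C))" using C(3) by auto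
  fix Omega assume Omega: "Omega : insert (- ?S) ((%p. U p Int ?S) ` C)"
  show Omegas: "Omega Int space (M \<Otimes>\<^sub>M M) : sets (M \<Otimes>\<^sub>M M)" using Omega Us C(1) cS by (auto simp: sp)
  have "(%q. if q : Omega then ?g q else 0) : borel_measurable (M \<Otimes>\<^sub>M M)"
  proof (cases "Omega = - ?S")
   case True
   hence "(%q. if q : Omega then ?g q else 0) = (%q. 0)" by (auto simp: fun_eq_iff)
   thus ?thesis by simp
  next
   case False
   then obtain p where p: "p : C" "Omega = U p Int ?S" using Omega by blast
   have "(%q. if q : Omega then ?g q else 0) = (%q. indicator (U p Int ?S) q *\<^sub>R (case q of (x, y) => K x y))"
    by (auto simp: fun_eq_iff p indicator_def)
   moreover have "(%q. indicator (U p Int ?S) q *\<^sub>R (case q of (x, y) => K x y)) : borel_measurable (M \<Otimes>\<^sub>M M)"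
    using U[of p] p(1) C(1) unfolding set_integrable_def by (auto dest: borel_measurable_integrable)
   ultimately show ?thesis by simp
  qed
  thus "?g : borel_measurable (restrict_space (M \<Otimes>\<^sub>M M) Omega)"
   using Omegas by (subst measurable_restrict_space_iff[where c=0]) (auto simp: case_prod_unfold)
 qed
qed

lemma dis_add:
 assumes "meas F" "meas G"
  and "AE x in M. cmod (H x) <= cmod (F x) + cmod (G x)"
 shows "dis (s + t) H <= dis s F + dis t G"
proof -
 have "{x : space M. s < cmod (F x)} : sets M" "{x : space M. t < cmod (G x)} : sets M"
  using assms by measurable
 hence *: "{x. s < cmod (F x)} : sets M" "{x. t < cmod (G x)} : sets M" by auto
 have "dis (s + t) H <= emeasure M ({x. s < cmod (F x)} Un {x. t < cmod (G x)})"
  using assms(3) * by (intro emeasure_mono_AE) (auto elim!: eventually_mono)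
 also have "... <= dis s F + dis t G"
  using * by (rule emeasure_subadditive)
 finally show ?thesis .
qed

lemma dis_Markov:
 assumes [measurable]: "meas F" and t: "0 < t"
 shows "dis t F <= ennreal (1 / t) * mass F"
proof -
 have "dis t F = emeasure M {x : space M. t < cmod (F x)}" by simp
 also have "... <= emeasure M {x : space M. 1 <= ennreal (1 / t) * nn (F x)}"
 proof (intro emeasure_mono subsetI)
  show "{x : space M. 1 <= ennreal (1 / t) * nn (F x)} : sets M" by measurable
 qed (use t in \<open>auto simp: ennreal_mult[symmetric] field_simps\<close>)
 also have "... <= ennreal (1 / t) * mass F"
  using nn_integral_Markov_inequality[of "%x. nn (F x)" "space M" M "ennreal (1 / t)"] sets.top[of M] by simp
 finally show ?thesis .
qed

lemma dis_Markov2: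
 assumes [measurable]: "meas F" and t: "0 < t"
 shows "dis t F <= ennreal (1 / t\<^sup>2) * sq F"
proof -
 have "dis t F = dis (t\<^sup>2) (%x. (F x)\<^sup>2)"
  using t by (intro arg_cong[where f="emeasure M"]) (auto simp: norm_power power_strict_mono dest: power_less_imp_less_base)
 also have "... <= ennreal (1 / t\<^sup>2) * mass (%x. (F x)\<^sup>2)"
  using t by (intro dis_Markov) auto
 finally show ?thesis by (simp add: norm_power)
qed

end

locale cz_setting = nonhomogeneous_space M lam Clam
 for M :: "'a::metric_space measure" and lam :: "'a => real => real" and Clam :: real +
 fixes K :: "'a => 'a => complex" and T :: "('a => complex) => 'a => complex" and CK CH CT :: real
 assumes CK: "0 < CK" and CH: "0 < CH" and CT: "0 < CT"
  and K_meas: "(%(x, y). if x = y then 0 else K x y) : borel_measurable (M \<Otimes>\<^sub>M M)"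
  and K_size: "!!x y. x ~= y ==> cmod (K x y) <= CK * (1 / lam x (dist x y))"
  and K_horm: "!!R y y'. 0 < R ==> dist y y' < R ==>
    (\<Sum>j. of_nat (Suc j) *
      (int_on {x. 6 ^ Suc j * R < dist x y & dist x y <= 6 ^ (Suc j + 1) * R} (%x.               ennreal (cmod (K x y - K x y') + cmod (K y x - K y' x))))) <= ennreal CH"
  and T_meas: "!!f. f : L2 ==> meas (T f)"
  and T_L2: "!!f. f : L2 ==> sq (T f) <= ennreal CT * sq f"
  and T_add: "!!f g. f : L2 ==> g : L2 ==> AE x in M. T (%y. f y + g y) x = T f x + T g x"
  and T_cmult: "!!c f. f : L2 ==> AE x in M. T (%y. c * f y) x = c * T f x"
  and T_kernel: "!!f z r. bfun f ==> supb f z r ==>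
    AE x in M. x ~: cball z r --> T f x = tot (%y. K x y * f y)"
begin

lemma Kx_meas: "x ~: ball z r ==> supb f z r ==> meas f ==>
  (%y. K x y * f y) : borel_measurable M"
proof -
 assume a: "x ~: ball z r" "supb f z r" "meas f"
 have [measurable]: "meas f" by fact
 have "meas (%y. if x = y then 0 else K x y)"
  using measurable_Pair2[OF K_meas, of x] by simp
 hence "meas (%y. (if x = y then 0 else K x y) * f y)" by auto
 moreover have "(%y. (if x = y then 0 else K x y) * f y) = (%y. K x y * f y)"
  using a by (auto simp: fun_eq_iff supb_def)
 ultimately show ?thesis by simp
qed

definition CS :: real where "CS = CK * Clam\<^sup>2"

lemma CS_pos: "0 < CS" using CK Clam_pos by (simp add: CS_def)

lemma K_far:
 assumes x: "2 * r <= dist x c" and y: "y : ball c r" and r: "0 < r"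
 shows "cmod (K x y) <= CS / lam c (dist x c)"
proof -
 let ?d = "dist x c"
 have d: "?d / 2 <= dist x y" using x y dist_triangle[of x c y] by (simp add: dist_commute)
 have d0: "0 < ?d" using x r by linarith
 hence xy: "x ~= y" using d by auto
 have "lam c ?d <= Clam * lam x ?d" using d0 by (intro lam_compare) (auto simp: dist_commute)
 also have "... <= Clam * (Clam * lam x (?d / 2))"
  using d0 Clam_pos by (intro mult_left_mono lam_doubling) auto
 also have "... <= Clam * (Clam * lam x (dist x y))"
  using d0 d Clam_pos by (intro mult_left_mono lam_mono) auto
 finally have l: "lam c ?d <= Clam\<^sup>2 * lam x (dist x y)" by (simp add: power2_eq_square mult.assoc)
 have p: "0 < lam c ?d" "0 < lam x (dist x y)" using d0 xy by (auto intro: lam_pos)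
 have "1 / lam x (dist x y) <= Clam\<^sup>2 / lam c ?d" using l p by (simp add: field_simps)
 hence "CK * (1 / lam x (dist x y)) <= CK * (Clam\<^sup>2 / lam c ?d)" using CK by (intro mult_left_mono) auto
 thus ?thesis using K_size[OF xy] by (simp add: CS_def)
qed

lemma K_integrable:
 assumes u: "bfun u" "supb u c r" and x: "2 * r <= dist x c" and r: "0 < r"
 shows "integrable M (%y. K x y * u y)"
  and "cmod (tot (%y. K x y * u y)) <= CS / lam c (dist x c) * nint u"
proof -
 have xb: "x ~: ball c r" using x r by (simp add: dist_commute)
 have le: "cmod (K x y * u y) <= CS / lam c (dist x c) * cmod (u y)" for y
  using mult_right_mono[OF K_far[OF x _ r, of y], of "cmod (u y)"] u(2)[unfolded supb_def, rule_format, of y]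
  by (cases "y : ball c r") (auto simp: norm_mult)
 have i: "integrable M (%y. CS / lam c (dist x c) * cmod (u y))"
  using bfun_norm_integrable[OF u(1)] by simp
 have "0 < lam c (dist x c)" using x r by (intro lam_pos) linarith
 thus "integrable M (%y. K x y * u y)"
  using le CS_pos by (intro Bochner_Integration.integrable_bound[OF i] Kx_meas[OF xb] u bfun_meas AE_I2) auto
 have "cmod (tot (%y. K x y * u y)) <= tot (%y. cmod (K x y * u y))" by (rule integral_norm_bound)
 also have "... <= tot (%y. CS / lam c (dist x c) * cmod (u y))"
  using le by (intro integral_mono'[OF i]) (auto intro: order_trans[OF norm_ge_zero])
 finally show "cmod (tot (%y. K x y * u y)) <= CS / lam c (dist x c) * nint u" by simp
qed

text \<open>
Away from the support the kernel is comparable to 1/\<lambda> at the centre, by the doubling of \<lambda>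
and its near-independence of the point.
\<close>

lemma T_size:
 assumes u: "bfun u" "supb u c r" and r: "0 < r"
 shows "AE x in M. 2 * r <= dist x c --> cmod (T u x) <= CS / lam c (dist x c) * nint u"
proof -
 have "AE x in M. x ~: cball c r --> T u x = tot (%y. K x y * u y)"
  using u by (intro T_kernel) auto
 thus ?thesis
proof eventually_elim
 fix x assume *: "x ~: cball c r --> T u x = tot (%y. K x y * u y)"
 show "2 * r <= dist x c --> cmod (T u x) <= CS / lam c (dist x c) * nint u"
  using * K_integrable(2)[OF u _ r, of x] r by (auto simp: dist_commute)
qed
qed

end

context nonhomogeneous_space
begin

section \<open>Size and cancellation estimates for the operator\<close>

lemma L2_meas: "f : L2 ==> meas f" by (simp add: L2_def)

lemma norm_add_sq: "(cmod (a + b))\<^sup>2 <= 2 * (cmod a)\<^sup>2 + 2 * (cmod b)\<^sup>2"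
proof -
 have "(cmod (a + b))\<^sup>2 <= (cmod a + cmod b)\<^sup>2" by (intro power_mono norm_triangle_ineq) auto
 also have "... <= 2 * (cmod a)\<^sup>2 + 2 * (cmod b)\<^sup>2"
  using sum_squares_bound[of "cmod a" "cmod b"] by (simp add: power2_sum)
 finally show ?thesis .
qed

lemma L2_add:
 assumes f: "f : L2" and g: "g : L2"
 shows "(%x. f x + g x) : L2"
proof -
 have [measurable]: "meas f" "meas g" using f g by (auto dest: L2_meas)
 have "sq (%x. f x + g x) <= ntot (%x. 2 * ennreal ((cmod (f x))\<^sup>2) + 2 * ennreal ((cmod (g x))\<^sup>2))"
 proof (intro nn_integral_mono)
  fix x
  have "ennreal ((cmod (f x + g x))\<^sup>2) <= ennreal (2 * (cmod (f x))\<^sup>2 + 2 * (cmod (g x))\<^sup>2)"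
   by (intro ennreal_leI norm_add_sq)
  thus "ennreal ((cmod (f x + g x))\<^sup>2) <= 2 * ennreal ((cmod (f x))\<^sup>2) + 2 * ennreal ((cmod (g x))\<^sup>2)"
   by (simp add: ennreal_plus ennreal_mult)
 qed
 also have "... < \<infinity>" using f g by (simp add: nn_integral_add nn_integral_cmult L2_def ennreal_mult_less_top)
 finally show ?thesis by (simp add: L2_def)
qed

lemma L2_mult:
 assumes f: "f : L2" and g: "meas g" "!!x. cmod (g x) <= c"
 shows "(%x. g x * f x) : L2"
proof -
 have [measurable]: "meas f" "meas g" using f g by (auto dest: L2_meas)
 have "sq (%x. g x * f x) <= ntot (%x. ennreal (c\<^sup>2) * ennreal ((cmod (f x))\<^sup>2))"
  using g(2) by (intro nn_integral_mono) (auto simp: ennreal_mult[symmetric] norm_mult power_mult_distrib intro!: ennreal_leI mult_right_mono power_mono)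
 also have "... < \<infinity>" using f by (simp add: nn_integral_cmult L2_def ennreal_mult_less_top)
 finally show ?thesis by (simp add: L2_def)
qed

lemma L2_cmult: "f : L2 ==> (%x. c * f x) : L2"
 using L2_mult[of f "%_. c" "cmod c"] by simp

lemma L2_diff: "f : L2 ==> g : L2 ==> (%x. f x - g x) : L2"
 using L2_add[of f "%x. -1 * g x"] L2_cmult[of g "-1"] by simp

lemma L2_sum: "(!!i. i : I ==> f i : L2) ==> (%x. SUM i:I. f i x) : L2"
proof (induction I rule: infinite_finite_induct)
 case (insert i I)
 thus ?case using L2_add[of "f i" "%x. SUM i:I. f i x"] by simp
qed (auto simp: bfun_L2[OF bfun_zero])

definition ann :: "'a => real => nat => 'a set" where
 "ann e R j = {x. 6 ^ Suc j * R < dist x e & dist x e <= 6 ^ (Suc j + 1) * R}"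

lemma ann_sets [measurable]: "ann e R j : sets M"
proof -
 have "{x : space M. 6 ^ Suc j * R < dist x e & dist x e <= 6 ^ (Suc j + 1) * R} : sets M" by measurable
 thus ?thesis by (simp add: ann_def)
qed

lemma scale_index:
 fixes d r :: real
 assumes "0 < r" "r <= d"
 shows "EX k::nat. 6 ^ k * r <= d & d < 6 ^ Suc k * r"
proof -
 obtain n :: nat where "d / r < 6 ^ n" using real_arch_pow[of 6 "d / r"] by auto
 hence n: "d < 6 ^ n * r" using assms by (simp add: field_simps)
 define m where "m = (LEAST n. d < 6 ^ n * r)"
 have m: "d < 6 ^ m * r" unfolding m_def using n by (rule LeastI)
 have "m ~= 0" using m assms by (intro notI) simp
 then obtain k where k: "m = Suc k" by (cases m) auto
 hence "~ d < 6 ^ k * r" unfolding m_def by (intro not_less_Least) simp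
 thus ?thesis using m k by (auto simp: not_less)
qed

lemma scale_index':
 fixes d r :: real
 assumes "0 < r" "r < d"
 shows "EX k::nat. 6 ^ k * r < d & d <= 6 ^ Suc k * r"
proof -
 obtain n :: nat where "d / r < 6 ^ n" using real_arch_pow[of 6 "d / r"] by auto
 hence n: "d <= 6 ^ n * r" using assms by (simp add: field_simps)
 define m where "m = (LEAST n. d <= 6 ^ n * r)"
 have m: "d <= 6 ^ m * r" unfolding m_def using n by (rule LeastI)
 have "m ~= 0" using m assms by (intro notI) simp
 then obtain k where k: "m = Suc k" by (cases m) auto
 hence "~ d <= 6 ^ k * r" unfolding m_def by (intro not_less_Least) simp
 thus ?thesis using m k by (auto simp: not_le)
qed

end

context cz_setting
begin

lemma T_cong_AE:
 assumes f: "f : L2" and g: "g : L2" and eq: "AE x in M. f x = g x"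
 shows "AE x in M. T f x = T g x"
proof -
 let ?d = "%x. f x + (-1) * g x"
 have g': "(%x. (-1) * g x) : L2" using g by (rule L2_cmult)
 have d: "?d : L2" using f g' by (rule L2_add)
 have [measurable]: "meas (T ?d)" using d by (rule T_meas)
 have "sq (T ?d) <= ennreal CT * sq ?d"
  using d by (rule T_L2)
 also have "sq ?d = ntot (%x. 0)"
  using eq by (intro nn_integral_cong_AE) (auto elim!: eventually_mono)
 finally have "sq (T ?d) = 0" by simp
 moreover have "(%x. ennreal ((cmod (T ?d x))\<^sup>2)) : borel_measurable M" by measurable
 ultimately have "AE x in M. ennreal ((cmod (T ?d x))\<^sup>2) = 0" using nn_integral_0_iff_AE by blast
 hence "AE x in M. T ?d x = 0" by eventually_elim simp
 thus ?thesis using T_add[OF f g'] T_cmult[OF g, of "-1"] by eventually_elim simp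
qed

lemma T_diff:
 assumes f: "f : L2" and g: "g : L2"
 shows "AE x in M. T (%y. f y - g y) x = T f x - T g x"
proof -
 have g': "(%x. (-1) * g x) : L2" using g by (rule L2_cmult)
 have "(%y. f y - g y) = (%y. f y + (-1) * g y)" by auto
 thus ?thesis using T_add[OF f g'] T_cmult[OF g, of "-1"] by (auto elim: AE_mp)
qed

lemma T_sum:
 assumes "finite I" "!!i. i : I ==> f i : L2"
 shows "AE x in M. T (%y. SUM i:I. f i y) x = (SUM i:I. T (f i) x)"
 using assms
proof (induction I rule: finite_induct)
 case empty
 have z: "(%x. 0::complex) : L2" by (rule bfun_L2[OF bfun_zero])
 show ?case using T_cmult[OF z, of 0] by simp
next
 case (insert i I)
 have s: "(%y. SUM i:I. f i y) : L2" using insert by (intro L2_sum) auto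
 have "f i : L2" using insert by auto
 from T_add[OF this s] insert show ?case by (auto elim: AE_mp)
qed

text \<open>Chebyshev's inequality and the bound on L^2.\<close>

lemma T_weak_L2:
 assumes u: "u : L2" and t: "0 < t"
 shows "dis t (T u) <= ennreal (CT / t\<^sup>2) * sq u"
proof -
 have "dis t (T u) <= ennreal (1 / t\<^sup>2) * sq (T u)" by (rule dis_Markov2[OF T_meas[OF u] t])
 also have "... <= ennreal (1 / t\<^sup>2) * (ennreal CT * sq u)" by (intro mult_left_mono T_L2 u) auto
 finally show ?thesis using CT by (simp add: mult.assoc[symmetric] ennreal_mult[symmetric])
qed

lemma T_local:
 assumes g: "g : L2" and S: "S : sets M"
 shows "mass_on S (T g) <= emeasure M S + ennreal CT * sq g"
proof -
 have [measurable]: "meas (T g)" using g by (rule T_meas)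
 have "mass_on S (T g) <= ntot (%x. indicator S x + ennreal ((cmod (T g x))\<^sup>2))"
 proof (intro nn_integral_mono)
  fix x
  have "cmod (T g x) <= 1 + (cmod (T g x))\<^sup>2"
   using sum_squares_bound[of 1 "cmod (T g x)"] norm_ge_zero[of "T g x"] unfolding power2_eq_square by linarith
  hence "nn (T g x) <= 1 + ennreal ((cmod (T g x))\<^sup>2)"
   by (metis ennreal_1 ennreal_leI ennreal_plus zero_le_one zero_le_power2)
  thus "nn (T g x) * indicator S x <= indicator S x + ennreal ((cmod (T g x))\<^sup>2)"
   by (cases "x : S") auto
 qed
 also have "... = emeasure M S + sq (T g)"
  using S by (subst nn_integral_add) auto
 also have "... <= emeasure M S + ennreal CT * sq g"
  by (intro add_left_mono T_L2 g)
 finally show ?thesis .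
qed

text \<open>
The region between two concentric balls is split into annuli of ratio 6, and the size bound is used on
each; the resulting sums of densities are what the discrete coefficient controls.
\<close>

lemma T_mid:
 assumes u: "bfun u" "supb u c r" and r: "0 < r" and [measurable]: "meas w"
 shows "int_on (ball c (6 ^ Suc n * r) - ball c (6 * r)) (%x. w x * nn (T u x))
  <= ennreal (CS * nint u) * (SUM k:{1..n}. ennreal (1 / lam c (6 ^ k * r)) * int_on (ball c (6 ^ Suc k * r)) w)"
proof -
 have [measurable]: "meas (T u)" by (intro T_meas bfun_L2 u)
 let ?S = "ball c (6 ^ Suc n * r) - ball c (6 * r)"
 let ?C = "%k. ennreal (CS * nint u) * ennreal (1 / lam c (6 ^ k * r))"
 have nn: "0 <= nint u" by simp
 have "AE x in M. w x * nn (T u x) * indicator ?S x <= (SUM k:{1..n}. ?C k * (w x * indicator (ball c (6 ^ Suc k * r)) x))"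
  using T_size[OF u r]
 proof eventually_elim
  fix x assume *: "2 * r <= dist x c --> cmod (T u x) <= CS / lam c (dist x c) * nint u"
  show "w x * nn (T u x) * indicator ?S x <= (SUM k:{1..n}. ?C k * (w x * indicator (ball c (6 ^ Suc k * r)) x))"
  proof (cases "x : ?S")
   case True
   hence d: "6 * r <= dist x c" "dist x c < 6 ^ Suc n * r" by (auto simp: dist_commute)
   obtain k where k: "6 ^ k * r <= dist x c" "dist x c < 6 ^ Suc k * r"
    using scale_index[of r "dist x c"] d r by auto
   have "k ~= 0" using k d by (intro notI) auto
   moreover have "k <= n"
   proof (rule ccontr)
    assume "~ k <= n"
    hence "(6::real) ^ Suc n * r <= 6 ^ k * r" using r by (intro mult_right_mono power_increasing) auto
    thus False using k d by linarith
   qed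
   ultimately have kn: "k : {1..n}" by auto
   have l: "0 < lam c (6 ^ k * r)" "lam c (6 ^ k * r) <= lam c (dist x c)" using r k by (auto intro: lam_pos lam_mono)
   have "cmod (T u x) <= CS / lam c (dist x c) * nint u" using * d r by auto
   also have "... <= CS / lam c (6 ^ k * r) * nint u"
    using l CS_pos by (intro mult_right_mono divide_left_mono) auto
   finally have "nn (T u x) <= ennreal (CS * nint u * (1 / lam c (6 ^ k * r)))" by (intro ennreal_leI) simp
   hence "nn (T u x) <= ?C k" using CS_pos l by (subst ennreal_mult[symmetric]) auto
   hence "w x * nn (T u x) * indicator ?S x <= ?C k * (w x * indicator (ball c (6 ^ Suc k * r)) x)"
    using True k(2) by (simp add: dist_commute mult.commute mult_left_mono)
   also have "... <= (SUM k:{1..n}. ?C k * (w x * indicator (ball c (6 ^ Suc k * r)) x))"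
    using kn by (intro member_le_sum) auto
   finally show ?thesis .
  qed simp
 qed
 hence "int_on ?S (%x. w x * nn (T u x)) <= ntot (%x. (SUM k:{1..n}. ?C k * (w x * indicator (ball c (6 ^ Suc k * r)) x)))"
  by (rule nn_integral_mono_AE)
 also have "... = (SUM k:{1..n}. ?C k * int_on (ball c (6 ^ Suc k * r)) w)"
  by (subst nn_integral_sum) (auto simp: nn_integral_cmult)
 finally show ?thesis by (simp add: sum_distrib_left mult.assoc)
qed

text \<open>
As h has mean zero, Th(x) is the integral of (K(x,y) - K(x,e)) h(y). The part of the weight that grows
linearly in the index of the annulus is matched with the factor l in the Hoermander condition; the
remainder v, which is small only on average, is combined with the size condition.
\<close>

lemma T_far:
 assumes h: "bfun h" "supb h e R" and h0: "tot h = 0" and R: "0 < R"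
  and [measurable]: "meas w" "!!j. meas (v j)"
  and A: "0 <= A" and eta: "!!j. 0 <= eta j" "summable eta"
  and w: "!!j x. x : ann e R j ==> w x <= ennreal (A * real (Suc j)) + v j x"
  and v: "!!j. (int_on (ann e R j) (v j)) <= ennreal (eta j * lam e (6 ^ Suc j * R))"
 shows "int_on {x. 6 * R < dist x e} (%x. w x * nn (T h x)) <= ennreal ((A * CH + CS * (\<Sum>j. eta j)) * nint h)"
proof -
 have [measurable]: "meas (T h)" by (intro T_meas bfun_L2 h)
 have [measurable]: "meas h" by (intro bfun_meas h)
 define k0 where "k0 x y = (if x = y then 0 else K x y)" for x y
 have k0m[measurable]: "(%(x, y). k0 x y) : borel_measurable (M \<Otimes>\<^sub>M M)" using K_meas unfolding k0_def .
 have [measurable]: "meas (%x. k0 x e)" using measurable_Pair1[OF k0m, of e] by simp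
 define G where "G x = ntot (%y. nn (k0 x y - k0 x e) * nn (h y))" for x
 have [measurable]: "meas G" unfolding G_def by measurable
 have "AE x in M. x ~: cball e R --> T h x = tot (%y. K x y * h y)"
  by (intro T_kernel h)
 with T_size[OF h R] have TG: "AE x in M. 6 * R < dist x e -->
   nn (T h x) <= G x & cmod (T h x) <= CS / lam e (dist x e) * nint h"
 proof eventually_elim
  fix x assume *: "2 * R <= dist x e --> cmod (T h x) <= CS / lam e (dist x e) * nint h"
   "x ~: cball e R --> T h x = tot (%y. K x y * h y)"
  show "6 * R < dist x e --> nn (T h x) <= G x & cmod (T h x) <= CS / lam e (dist x e) * nint h"
  proof
   assume d: "6 * R < dist x e"
   have xe: "x ~= e" using d R by auto
   have d2: "2 * R <= dist x e" using d R by linarith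
   have i1: "integrable M (%y. K x y * h y)" using h d2 R by (rule K_integrable)
   have i2: "integrable M (%y. K x e * h y)" using bfun_integrable[OF h(1)] by simp
   have "T h x = tot (%y. K x y * h y)" using *(2) d R by (simp add: dist_commute)
   also have "... = tot (%y. K x y * h y - K x e * h y)"
    using i1 i2 h0 by simp
   finally have "nn (T h x) <= mass (%y. K x y * h y - K x e * h y)"
    using integral_norm_bound_ennreal[of M "%y. K x y * h y - K x e * h y"] i1 i2 by simp
   also have "... = G x"
    unfolding G_def
   proof (intro nn_integral_cong)
    fix y
    show "nn (K x y * h y - K x e * h y) = nn (k0 x y - k0 x e) * nn (h y)"
    proof (cases "y : ball e R")
     case True
     hence "x ~= y" using d R by (auto simp: dist_commute)
     thus ?thesis using xe by (simp add: k0_def ennreal_mult[symmetric] norm_mult[symmetric] left_diff_distrib)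
    next
     case False thus ?thesis using h(2) by (simp add: supb_def)
    qed
   qed
   finally show "nn (T h x) <= G x & cmod (T h x) <= CS / lam e (dist x e) * nint h"
    using * d2 by simp
  qed
 qed
 let ?c = "%j. ennreal (CS * nint h / lam e (6 ^ Suc j * R))"
 have AE1: "AE x in M. w x * nn (T h x) * indicator {x. 6 * R < dist x e} x
   <= (\<Sum>j. (ennreal A * (of_nat (Suc j) * (G x * indicator (ann e R j) x)) + ?c j * (v j x * indicator (ann e R j) x)))"
  using TG
 proof eventually_elim
  fix x assume *: "6 * R < dist x e --> nn (T h x) <= G x & cmod (T h x) <= CS / lam e (dist x e) * nint h"
  let ?F = "%j. ennreal A * (of_nat (Suc j) * (G x * indicator (ann e R j) x)) + ?c j * (v j x * indicator (ann e R j) x)"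
  show "w x * nn (T h x) * indicator {x. 6 * R < dist x e} x <= (\<Sum>j. ?F j)"
  proof (cases "6 * R < dist x e")
   case True
   obtain j where j: "6 ^ j * (6 * R) < dist x e" "dist x e <= 6 ^ Suc j * (6 * R)"
    using scale_index'[of "6 * R" "dist x e"] True R by auto
   hence xj: "x : ann e R j" by (simp add: ann_def mult_ac)
   have j': "6 ^ Suc j * R <= dist x e" using j(1) by simp
   have l: "0 < lam e (6 ^ Suc j * R)" "lam e (6 ^ Suc j * R) <= lam e (dist x e)"
    using R j' by (auto intro!: lam_pos lam_mono)
   have "cmod (T h x) <= CS / lam e (dist x e) * nint h" using * True by simp
   also have "... <= CS / lam e (6 ^ Suc j * R) * nint h"
    using l CS_pos by (intro mult_right_mono divide_left_mono) auto
   finally have t2: "nn (T h x) <= ?c j" by (intro ennreal_leI) simp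
   have t1: "nn (T h x) <= G x" using * True by simp
   have "w x * nn (T h x) <= (ennreal (A * real (Suc j)) + v j x) * nn (T h x)"
    by (intro mult_right_mono w xj) auto
   also have "... = ennreal (A * real (Suc j)) * nn (T h x) + v j x * nn (T h x)"
    by (rule distrib_right)
   also have "... <= ennreal (A * real (Suc j)) * G x + v j x * ?c j"
    using t1 t2 by (intro add_mono mult_left_mono) auto
   also have "... = ?F j" using xj A
    by (simp add: ennreal_mult ennreal_of_nat_eq_real_of_nat mult_ac del: of_nat_Suc)
   also have "... <= (\<Sum>j. ?F j)" using sum_le_suminf[of ?F "{j}"] by simp
   finally show ?thesis using True by simp
  qed simp
 qed
 have Gj: "ntot (%x. G x * indicator (ann e R j) x)
   = ntot (%y. nn (h y) * mass_on (ann e R j) (%x. k0 x y - k0 x e))" for j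
 proof -
  interpret P: pair_sigma_finite M M ..
  have "ntot (%x. G x * indicator (ann e R j) x)
   = ntot (%x. (\<integral>\<^sup>+y. nn (k0 x y - k0 x e) * nn (h y) * indicator (ann e R j) x \<partial>M))"
   unfolding G_def by (subst nn_integral_multc) auto
  also have "... = ntot (%y. (\<integral>\<^sup>+x. nn (k0 x y - k0 x e) * nn (h y) * indicator (ann e R j) x \<partial>M))"
   by (intro P.Fubini'[symmetric]) measurable
  also have "... = ntot (%y. nn (h y) * mass_on (ann e R j) (%x. k0 x y - k0 x e))"
   by (subst nn_integral_cmult[symmetric]) (auto simp: mult_ac)
  finally show ?thesis .
 qed
 have hor: "(\<Sum>j. of_nat (Suc j) * (nn (h y) * mass_on (ann e R j) (%x. k0 x y - k0 x e))) <= ennreal CH * nn (h y)" for y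
 proof (cases "y : ball e R")
  case True
  have le: "mass_on (ann e R j) (%x. k0 x y - k0 x e) <=
    (int_on {x. 6 ^ Suc j * R < dist x e & dist x e <= 6 ^ (Suc j + 1) * R} (%x. ennreal (cmod (K x e - K x y) + cmod (K e x - K y x))))" for j
   unfolding ann_def[symmetric]
  proof (intro nn_integral_mono)
   fix x
   show "nn (k0 x y - k0 x e) * indicator (ann e R j) x <= ennreal (cmod (K x e - K x y) + cmod (K e x - K y x)) * indicator (ann e R j) x"
   proof (cases "x : ann e R j")
    case xj: True
    have "1 * R <= 6 ^ Suc j * R" using R by (intro mult_right_mono one_le_power) auto
    hence "R <= 6 ^ Suc j * R" by simp
    hence "R < dist x e" using xj by (simp add: ann_def)
    hence "x ~= e" "x ~= y" using R True by (auto simp: dist_commute)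
    thus ?thesis using xj by (auto simp: k0_def norm_minus_commute intro!: ennreal_leI)
   qed simp
  qed
  have "(\<Sum>j. of_nat (Suc j) * (nn (h y) * mass_on (ann e R j) (%x. k0 x y - k0 x e)))
   <= (\<Sum>j. nn (h y) * (of_nat (Suc j) * int_on {x. 6 ^ Suc j * R < dist x e & dist x e <= 6 ^ (Suc j + 1) * R} (%x. ennreal (cmod (K x e - K x y) + cmod (K e x - K y x)))))"
  proof (intro suminf_le)
   fix j
   show "of_nat (Suc j) * (nn (h y) * mass_on (ann e R j) (%x. k0 x y - k0 x e))
    <= nn (h y) * (of_nat (Suc j) * int_on {x. 6 ^ Suc j * R < dist x e & dist x e <= 6 ^ (Suc j + 1) * R} (%x. ennreal (cmod (K x e - K x y) + cmod (K e x - K y x))))"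
    unfolding mult.left_commute[of "of_nat (Suc j)"] by (intro mult_left_mono le) auto
  qed auto
  also have "... <= nn (h y) * ennreal CH"
   unfolding ennreal_suminf_cmult using True R by (intro mult_left_mono K_horm) auto
  finally show ?thesis by (simp add: mult.commute)
 next
  case False thus ?thesis using h(2) by (simp add: supb_def)
 qed
 have "int_on {x. 6 * R < dist x e} (%x. w x * nn (T h x))
   <= ntot (%x. (\<Sum>j. (ennreal A * (of_nat (Suc j) * (G x * indicator (ann e R j) x)) + ?c j * (v j x * indicator (ann e R j) x))))"
  using AE1 by (rule nn_integral_mono_AE)
 also have "... = (\<Sum>j. ennreal A * (of_nat (Suc j) * ntot (%x. G x * indicator (ann e R j) x)) + ?c j * int_on (ann e R j) (v j))"
  by (subst nn_integral_suminf) (auto simp: nn_integral_add nn_integral_cmult)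
 also have "... = (\<Sum>j. ennreal A * (of_nat (Suc j) * ntot (%x. G x * indicator (ann e R j) x))) + (\<Sum>j. ?c j * int_on (ann e R j) (v j))"
  by (intro suminf_add[symmetric]) auto
 also have "(\<Sum>j. ?c j * int_on (ann e R j) (v j)) <= (\<Sum>j. ennreal (CS * nint h * eta j))"
 proof (intro suminf_le)
  fix j
  have l: "0 < lam e (6 ^ Suc j * R)" using R by (intro lam_pos) auto
  have "?c j * int_on (ann e R j) (v j) <= ?c j * ennreal (eta j * lam e (6 ^ Suc j * R))"
   by (intro mult_left_mono v) auto
  also have "... = ennreal (CS * nint h * eta j)"
  proof -
   have "0 <= CS * nint h / lam e (6 ^ Suc j * R)" using l CS_pos CK by (intro divide_nonneg_pos mult_nonneg_nonneg) auto
   moreover have "CS * nint h / lam e (6 ^ Suc j * R) * (eta j * lam e (6 ^ Suc j * R)) = CS * nint h * eta j"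
    using l by (simp del: power_Suc)
   moreover have "0 <= eta j * lam e (6 ^ Suc j * R)" using l eta(1)[of j] by (intro mult_nonneg_nonneg) auto
   ultimately show ?thesis by (metis ennreal_mult)
  qed
  finally show "?c j * int_on (ann e R j) (v j) <= ennreal (CS * nint h * eta j)" .
 qed auto
 also have "... = ennreal (CS * nint h * (\<Sum>j. eta j))"
  using eta CS_pos by (intro suminf_ennreal_eq sums_mult summable_sums) auto
 also have "(\<Sum>j. ennreal A * (of_nat (Suc j) * ntot (%x. G x * indicator (ann e R j) x)))
   = ennreal A * ntot (%y. (\<Sum>j. of_nat (Suc j) * (nn (h y) * mass_on (ann e R j) (%x. k0 x y - k0 x e))))"
  unfolding Gj by (subst nn_integral_suminf) (auto simp: nn_integral_cmult)
 also have "... <= ennreal A * ntot (%y. ennreal CH * nn (h y))"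
  using hor by (intro mult_left_mono nn_integral_mono) auto
 also have "... = ennreal (A * CH * nint h)"
  using A CH by (simp add: nn_integral_cmult nn_nint[OF bfun_integrable[OF h(1)]] ennreal_mult mult.assoc)
 also have "ennreal (A * CH * nint h) + ennreal (CS * nint h * (\<Sum>j. eta j)) = ennreal ((A * CH + CS * (\<Sum>j. eta j)) * nint h)"
  using A CH CS_pos eta by (subst ennreal_plus[symmetric]) (auto simp: algebra_simps suminf_nonneg)
 finally show ?thesis by (simp add: add_right_mono)
qed

end

context nonhomogeneous_space
begin

section \<open>Densities along dilates\<close>

text \<open>The ratio that is summed in the discrete coefficient.\<close>

definition dens :: "'a => real => real" where
 "dens c r = V c r / lam c r"

lemma dens_bounds: "0 < r ==> 0 <= dens c r" "0 < r ==> dens c r <= 1"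
 using lam_pos[of r c] V_le_lam[of r c] by (auto simp: dens_def)

lemma dens_upper:
 assumes "0 < r" "0 < s" "s <= 6 ^ n * r"
 shows "V c s / lam c r <= Clam ^ (3 * n) * dens c s"
proof -
 have p: "0 < lam c s" "0 < lam c r" using assms by (auto intro: lam_pos)
 have "lam c s <= Clam ^ (3 * n) * lam c r" using assms by (intro lam_scale) auto
 hence "V c s * lam c s <= V c s * (Clam ^ (3 * n) * lam c r)" by (intro mult_left_mono) auto
 thus ?thesis using p by (simp add: dens_def field_simps)
qed

text \<open>
A ball that is far from doubling has a density less than half of that of its dilate, since \<lambda> can
grow only by a fixed factor.
\<close>

lemma dens_half:
 assumes r: "0 < r" and beta: "2 * Clam ^ (3 * P) <= beta" and nd: "beta * V c r <= V c (6 ^ P * r)"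
 shows "2 * dens c r <= dens c (6 ^ P * r)"
proof -
 have p: "0 < lam c r" "0 < lam c (6 ^ P * r)" using r by (auto intro: lam_pos)
 have C: "0 < Clam ^ (3 * P)" using Clam_pos by simp
 have l: "lam c (6 ^ P * r) <= Clam ^ (3 * P) * lam c r" using r by (intro lam_scale) auto
 have "2 * Clam ^ (3 * P) * V c r <= V c (6 ^ P * r)"
  using mult_right_mono[OF beta, of "V c r"] nd by simp
 hence "2 * Clam ^ (3 * P) * V c r * lam c r <= V c (6 ^ P * r) * lam c r"
  using p by (intro mult_right_mono) auto
 moreover have "2 * V c r * lam c (6 ^ P * r) <= 2 * V c r * (Clam ^ (3 * P) * lam c r)"
  using l by (intro mult_left_mono) auto
 ultimately have "2 * V c r * lam c (6 ^ P * r) <= V c (6 ^ P * r) * lam c r" by (simp add: mult_ac)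
 thus ?thesis using p by (simp add: dens_def field_simps)
qed

text \<open>
Along non-doubling dilates the densities grow geometrically in steps of P and never exceed 1; so each of
the P residue classes contributes at most its last term twice, and the sum is bounded independently of
the length.
\<close>

lemma nondoubling_sum:
 assumes r: "0 < r" and beta: "2 * Clam ^ (3 * P) <= beta"
  and nd: "!!k. i <= k ==> k < j ==> beta * V c (6 ^ k * r) <= V c (6 ^ (k + P) * r)"
 shows "(SUM k:{i..<j}. dens c (6 ^ k * r)) <= P"
proof (cases "i <= j")
 case True
 let ?d = "%k. dens c (6 ^ k * r)"
 have d: "0 <= ?d k" "?d k <= 1" for k using dens_bounds[of "6 ^ k * r" c] r by auto
 have "2 * (SUM k:{i..<j}. ?d k) = (SUM k:{i..<j}. 2 * ?d k)" by (simp add: sum_distrib_left)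
 also have "... <= (SUM k:{i..<j}. ?d (k + P))"
 proof (intro sum_mono)
  fix k assume "k : {i..<j}"
  hence "2 * dens c (6 ^ k * r) <= dens c (6 ^ P * (6 ^ k * r))"
   using nd[of k] r by (intro dens_half[OF _ beta]) (auto simp: power_add mult_ac)
  thus "2 * ?d k <= ?d (k + P)" by (simp add: power_add mult_ac)
 qed
 also have "... = (SUM k:{i+P..<j+P}. ?d k)" by (subst sum.shift_bounds_nat_ivl) simp
 also have "... <= (SUM k:{i..<j+P}. ?d k)" using d by (intro sum_mono2) auto
 also have "... = (SUM k:{i..<j}. ?d k) + (SUM k:{j..<j+P}. ?d k)"
  using True by (subst sum.atLeastLessThan_concat) auto
 also have "(SUM k:{j..<j+P}. ?d k) <= (SUM k:{j..<j+P}. 1)" by (intro sum_mono d)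
 finally show ?thesis by simp
qed auto

text \<open>Non-doubling at every scale would make the measure of the dilates outgrow \<lambda>.\<close>

lemma first_doubling:
 assumes r: "0 < r" and beta: "2 * Clam ^ (3 * P) <= beta" and V: "0 < V c r" and P: "0 < P"
 shows "EX N>=i. V c (6 ^ (N + P) * r) <= beta * V c (6 ^ N * r) &
   (ALL k. i <= k --> k < N --> beta * V c (6 ^ k * r) <= V c (6 ^ (k + P) * r)) &
   (SUM k:{i..<N}. dens c (6 ^ k * r)) <= P"
proof -
 let ?D = "%N. i <= N & V c (6 ^ (N + P) * r) <= beta * V c (6 ^ N * r)"
 have "EX N. ?D N"
 proof (rule ccontr)
  assume "~ (EX N. ?D N)"
  hence nd: "beta * V c (6 ^ k * r) <= V c (6 ^ (k + P) * r)" if "i <= k" for k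
   using that by (meson linorder_le_cases)
  have grow: "2 ^ n * dens c (6 ^ i * r) <= dens c (6 ^ (i + P * n) * r)" for n
  proof (induction n)
   case (Suc n)
   have "2 * dens c (6 ^ (i + P * n) * r) <= dens c (6 ^ P * (6 ^ (i + P * n) * r))"
    using nd[of "i + P * n"] r by (intro dens_half[OF _ beta]) (auto simp: power_add mult_ac)
   thus ?case using Suc by (simp add: power_add mult_ac)
  qed simp
  have "V c (1 * r) <= V c (6 ^ i * r)" using r by (intro V_mono mult_right_mono one_le_power) auto
  hence "0 < dens c (6 ^ i * r)" using V r lam_pos[of "6 ^ i * r" c] by (simp add: dens_def)
  moreover obtain n :: nat where "1 / dens c (6 ^ i * r) < 2 ^ n" using real_arch_pow[of 2] by auto
  ultimately have "1 < 2 ^ n * dens c (6 ^ i * r)" by (simp add: field_simps)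
  thus False using grow[of n] dens_bounds(2)[of "6 ^ (i + P * n) * r" c] r by auto
 qed
 then obtain N0 where N0: "?D N0" by blast
 define N where "N = (LEAST N. ?D N)"
 have N: "?D N" unfolding N_def using N0 by (rule LeastI)
 have nd: "beta * V c (6 ^ k * r) <= V c (6 ^ (k + P) * r)" if "i <= k" "k < N" for k
  using not_less_Least[of k ?D] that unfolding N_def by auto
 show ?thesis using N nd nondoubling_sum[OF r beta, of i N c] by blast
qed

lemma integral_indicator_ball: "tot (%x. indicator (ball c R) x) = complex_of_real (V c R)"
proof -
 have "tot (%x. indicator (ball c R) x) = tot (%x. complex_of_real (indicator (ball c R) x))"
  by (intro Bochner_Integration.integral_cong) (auto simp: indicator_def)
 thus ?thesis by (simp add: V_def)
qed

lemma block_basic: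
 assumes u: "bfun u" "supb u e R'" and R: "R <= R'" and VR: "0 < V e R"
 defines "alpha \<equiv> (tot u) / V e R"
 defines "h \<equiv> %x. u x - alpha * indicator (ball e R) x"
 shows "bfun h" "supb h e R'" "tot h = 0" "nint h <= 2 * nint u" "cmod alpha * V e R <= nint u"
proof -
 let ?i = "indicator (ball e R) :: 'a => complex"
 have i: "bfun ?i" by (rule bfun_indicator[of _ e R]) auto
 have ai: "bfun (%x. alpha * ?i x)" using i by (rule bfun_cmult)
 show h: "bfun h" unfolding h_def using u(1) ai by (rule bfun_diff)
 show "supb h e R'" using u(2) R by (auto simp: supb_def h_def)
 show "tot h = 0" unfolding h_def
  using bfun_integrable[OF u(1)] bfun_integrable[OF ai] VR integral_indicator_ball[of e R] by (simp add: alpha_def)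
 show a: "cmod alpha * V e R <= nint u"
  using VR integral_norm_bound[of M u] by (simp add: alpha_def norm_divide)
 have "nint h <= tot (%x. cmod (u x) + cmod alpha * indicator (ball e R) x)"
 proof (intro integral_mono bfun_norm_integrable[OF h] Bochner_Integration.integrable_add bfun_norm_integrable[OF u(1)]
    integrable_mult_right integrable_real_indicator emeasure_ball_finite[of e R, folded infinity_ennreal_def])
  fix x
  show "cmod (h x) <= cmod (u x) + cmod alpha * indicator (ball e R) x"
   using norm_triangle_ineq4[of "u x" "alpha * ?i x"] by (cases "x : ball e R") (auto simp: norm_mult h_def)
 qed auto
 also have "... = nint u + cmod alpha * V e R"
  using bfun_norm_integrable[OF u(1)] emeasure_ball_finite[of e R] by (simp add: V_def)
 finally show "nint h <= 2 * nint u" using a by linarith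
qed

text \<open>
The constant \<beta> has two tasks: failure of doubling must double the density, and doubling balls must
occur at arbitrarily small scales around almost every point.
\<close>

definition dbl :: "nat => real => bool" where
 "dbl P beta \<longleftrightarrow> 1 <= beta & 2 * Clam ^ (3 * P) <= beta &
   (ALL R>0. AE x in M. ALL m. EX i>=m. V x (6 ^ P * (R / 6 ^ i)) <= beta * V x (R / 6 ^ i))"

lemma dbl_exists: "EX beta. dbl P beta"
proof -
 obtain beta0 where b: "1 <= beta0" "!!beta R. beta0 <= beta ==> 0 < R ==> AE x in M. ALL m. EX i>=m. V x (6 ^ P * (R / 6 ^ i)) <= beta * V x (R / 6 ^ i)"
  using small_doubling[of P] by blast
 show ?thesis unfolding dbl_def using b
  by (intro exI[of _ "max beta0 (2 * Clam ^ (3 * P))"]) auto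
qed

end

context cz_setting
begin

text \<open>
Between the stopping ball and its first doubling dilate the size condition suffices, the densities there
having a bounded sum; around the doubling dilate the L^2 bound is used on the bump, whose square integral
is controlled because the ball is doubling; beyond it the cancellation takes over.
\<close>

lemma T_block_off:
 assumes u: "bfun u" "supb u c (6 * s)" and s: "0 < s" and N: "1 <= N" and V0: "0 < V c (6 ^ N * s)"
  and dc: "V c (6 ^ (N + 5) * s) <= beta * V c (6 ^ N * s)" and sm: "(SUM k:{1..<N}. dens c (6 ^ k * s)) <= 5"
 defines "alpha \<equiv> (tot u) / V c (6 ^ N * s)"
 shows "mass_on (- ball c (36 * s)) (%x. T (%x. u x - alpha * indicator (ball c (6 ^ N * s)) x) x)
   <= ennreal ((8 * CS * Clam ^ 3 + beta + CT + 2 * CH) * nint u)"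
proof -
 define R where "R = 6 ^ N * s"
 have R: "0 < R" using s by (simp add: R_def)
 let ?i = "indicator (ball c R) :: 'a => complex"
 have i: "bfun ?i" by (rule bfun_indicator[of _ c R]) auto
 have ai: "bfun (%x. alpha * ?i x)" using i by (rule bfun_cmult)
 let ?h = "%x. u x - alpha * ?i x"
 have "6 * s <= R" using s N power_increasing[of 1 N "6::real"] by (simp add: R_def)
 hence uR: "supb u c R" using u(2) by (auto simp: supb_def)
 have VR: "0 < V c R" using V0 by (simp add: R_def)
 note bb = block_basic[OF u(1) uR order_refl VR, folded alpha_def[unfolded R_def[symmetric]]]
 note h = bb(1) and sh = bb(2) and h0 = bb(3) and nh = bb(4) and a = bb(5)
 have [measurable]: "meas u" "meas (T u)" "meas (T ?h)" "meas (T ?i)"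
  by (intro T_meas bfun_L2 bfun_meas u h i)+
 let ?S1 = "{x. 6 * R < dist x c}" and ?S2 = "ball c (6 ^ Suc N * (6 * s)) - ball c (6 * (6 * s))" and ?S3 = "ball c (36 * R)"
 have [measurable]: "?S1 : sets M"
 proof -
  have "{x : space M. 6 * R < dist x c} : sets M" by measurable
  thus ?thesis by simp
 qed
 have split: "AE x in M. nn (T ?h x) * indicator (- ball c (36 * s)) x <=
   nn (T ?h x) * indicator ?S1 x + nn (T u x) * indicator ?S2 x + ennreal (cmod alpha) * (nn (T ?i x) * indicator ?S3 x)"
  using T_diff[OF bfun_L2[OF u(1)] bfun_L2[OF ai]] T_cmult[OF bfun_L2[OF i], of alpha]
 proof eventually_elim
  fix x assume *: "T ?h x = T u x - T (%x. alpha * ?i x) x" "T (%x. alpha * ?i x) x = alpha * T ?i x"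
  show "nn (T ?h x) * indicator (- ball c (36 * s)) x <=
   nn (T ?h x) * indicator ?S1 x + nn (T u x) * indicator ?S2 x + ennreal (cmod alpha) * (nn (T ?i x) * indicator ?S3 x)"
  proof (cases "x : ball c (36 * s) \<or> x : ?S1")
   case True thus ?thesis by (auto simp: indicator_def add_increasing2)
  next
   case False
   hence d: "36 * s <= dist x c" "dist x c <= 6 * R" by (auto simp: dist_commute)
   hence "x : ?S2" "x : ?S3" using R by (auto simp: dist_commute R_def)
   moreover have "cmod (T ?h x) <= cmod (T u x) + cmod alpha * cmod (T ?i x)"
    unfolding * by (metis norm_mult norm_triangle_ineq4)
   hence "nn (T ?h x) <= nn (T u x) + ennreal (cmod alpha) * nn (T ?i x)"
    by (simp add: ennreal_mult[symmetric] ennreal_plus[symmetric] ennreal_leI del: ennreal_plus)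
   ultimately show ?thesis using False by (auto simp: indicator_def)
  qed
 qed
 have "mass_on (- ball c (36 * s)) (T ?h) <=
   (ntot (%x. nn (T ?h x) * indicator ?S1 x + nn (T u x) * indicator ?S2 x + ennreal (cmod alpha) * (nn (T ?i x) * indicator ?S3 x)))"
  using split by (rule nn_integral_mono_AE)
 also have "... = mass_on ?S1 (T ?h) + mass_on ?S2 (T u) + ennreal (cmod alpha) * mass_on ?S3 (T ?i)"
  by (simp add: nn_integral_add nn_integral_cmult)
 also have "... <= ennreal (CH * (2 * nint u)) + ennreal (8 * CS * Clam ^ 3 * nint u) + ennreal ((beta + CT) * nint u)"
 proof (intro add_mono)
  have "int_on ?S1 (%x. 1 * nn (T ?h x)) <= ennreal ((1 * CH + CS * (\<Sum>j::nat. 0)) * nint ?h)"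
   by (rule T_far[where v="%_ _. 0" and eta="%_. 0", OF h sh h0 R]) auto
  also have "... <= ennreal (CH * (2 * nint u))" using nh CH by (intro ennreal_leI) simp
  finally show "mass_on ?S1 (T ?h) <= ennreal (CH * (2 * nint u))" by simp
 next
  have "int_on ?S2 (%x. 1 * nn (T u x)) <= ennreal (CS * nint u) *
    (SUM k:{1..N}. ennreal (1 / lam c (6 ^ k * (6 * s))) * int_on (ball c (6 ^ Suc k * (6 * s))) (%x. 1))"
   using s by (intro T_mid u) auto
  also have "(SUM k:{1..N}. ennreal (1 / lam c (6 ^ k * (6 * s))) * int_on (ball c (6 ^ Suc k * (6 * s))) (%x. 1))
    <= (SUM k:{1..N}. ennreal (Clam ^ 3 * dens c (6 ^ (k + 2) * s)))"
  proof (intro sum_mono)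
   fix k
   have l: "0 < lam c (6 ^ k * (6 * s))" using s by (intro lam_pos) auto
   have "V c (6 ^ Suc k * (6 * s)) / lam c (6 ^ k * (6 * s)) <= Clam ^ (3 * 1) * dens c (6 ^ Suc k * (6 * s))"
    using s by (intro dens_upper) auto
   hence "ennreal (1 / lam c (6 ^ k * (6 * s)) * V c (6 ^ Suc k * (6 * s))) <= ennreal (Clam ^ 3 * dens c (6 ^ (k + 2) * s))"
    by (intro ennreal_leI) (simp add: mult_ac)
   thus "ennreal (1 / lam c (6 ^ k * (6 * s))) * int_on (ball c (6 ^ Suc k * (6 * s))) (%x. 1) <= ennreal (Clam ^ 3 * dens c (6 ^ (k + 2) * s))"
    using l by (simp add: emeasure_ball ennreal_mult[symmetric])
  qed
  also have "... = ennreal (Clam ^ 3 * (SUM k:{1..N}. dens c (6 ^ (k + 2) * s)))"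
   using Clam_pos dens_bounds s by (subst sum_ennreal) (auto simp: sum_distrib_left)
  also have "... <= ennreal (Clam ^ 3 * 8)"
  proof (intro ennreal_leI mult_left_mono)
   let ?d = "%k. dens c (6 ^ k * s)"
   have d: "0 <= ?d k" "?d k <= 1" for k using dens_bounds[of "6 ^ k * s" c] s by auto
   have "(SUM k:{1..N}. ?d (k + 2)) = (SUM k:{3..<N+3}. ?d k)"
    using sum.shift_bounds_nat_ivl[of ?d 1 2 "Suc N"] by (simp add: atLeastLessThanSuc_atLeastAtMost numeral_3_eq_3)
   also have "... <= (SUM k:{1..<N+3}. ?d k)" using d by (intro sum_mono2) auto
   also have "... = (SUM k:{1..<N}. ?d k) + (SUM k:{N..<N+3}. ?d k)"
    using N by (subst sum.atLeastLessThan_concat) auto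
   also have "(SUM k:{N..<N+3}. ?d k) <= (SUM k:{N..<N+3}. 1)" by (intro sum_mono d)
   finally show "(SUM k:{1..N}. ?d (k + 2)) <= 8" using sm by simp
  qed (use Clam_pos in auto)
  also have "ennreal (CS * nint u) * ennreal (Clam ^ 3 * 8) = ennreal (8 * CS * Clam ^ 3 * nint u)"
   using CS_pos Clam_pos by (subst ennreal_mult[symmetric]) (auto simp: mult_ac)
  finally show "mass_on ?S2 (T u) <= ennreal (8 * CS * Clam ^ 3 * nint u)"
   by (simp add: mult_left_mono)
 next
  have "mass_on ?S3 (T ?i) <= emeasure M ?S3 + ennreal CT * sq ?i"
   by (intro T_local bfun_L2 i) auto
  also have "sq ?i = ntot (%x. indicator (ball c R) x)"
   by (intro nn_integral_cong) (auto simp: indicator_def)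
  also have "emeasure M ?S3 + ennreal CT * ntot (%x. indicator (ball c R) x) = ennreal (V c (36 * R) + CT * V c R)"
   using CT by (simp add: emeasure_ball ennreal_mult)
  also have "... <= ennreal ((beta + CT) * V c R)"
  proof (intro ennreal_leI)
   have "V c (36 * R) <= V c (6 ^ (N + 5) * s)" using s by (intro V_mono) (simp add: R_def power_add)
   thus "V c (36 * R) + CT * V c R <= (beta + CT) * V c R" using dc by (simp add: R_def algebra_simps)
  qed
  finally have "ennreal (cmod alpha) * mass_on ?S3 (T ?i) <= ennreal (cmod alpha) * ennreal ((beta + CT) * V c R)"
   by (intro mult_left_mono) auto
  also have "... = ennreal ((beta + CT) * (cmod alpha * V c R))" by (subst ennreal_mult'[symmetric]) (auto simp: mult_ac)
  also have "... <= ennreal ((beta + CT) * nint u)"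
  proof -
   have "V c R <= V c (6 ^ (N + 5) * s)" using s by (intro V_mono) (simp add: R_def power_add)
   hence "0 < beta * V c R" using VR dc by (simp add: R_def)
   hence "0 < beta" using VR by (simp add: zero_less_mult_iff)
   thus ?thesis using a CT by (intro ennreal_leI mult_left_mono) auto
  qed
  finally show "ennreal (cmod alpha) * mass_on ?S3 (T ?i) <= ennreal ((beta + CT) * nint u)" .
 qed
 also have "... = ennreal ((8 * CS * Clam ^ 3 + beta + CT + 2 * CH) * nint u)"
 proof -
  have "V c R <= V c (6 ^ (N + 5) * s)" using s by (intro V_mono) (simp add: R_def power_add)
  hence "0 < beta * V c R" using VR dc by (simp add: R_def)
  hence "0 < beta" using VR by (simp add: zero_less_mult_iff)
  thus ?thesis using CS_pos CT CH Clam_pos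
   by (simp add: ennreal_plus[symmetric] algebra_simps del: ennreal_plus)
 qed
 finally show ?thesis by (simp add: R_def)
qed

end

context cz_setting
begin

section \<open>The weak type (1,1) inequality\<close>

text \<open>
Calderon--Zygmund decomposition: f is replaced on each stopping ball by a bump on the first doubling
dilate of that ball. The bumps may overlap a lot, yet their sum has a square integral of order t times
the mass of f: ordered by radius, the smaller bumps that meet a given one carry at most the mass of f on
a dilate of its ball, and there the stopping condition bounds the average. Only finitely many blocks are
subtracted, the rest being small in L^2, because T is linear for finite sums only. Four parts of level t
result.
\<close>

lemma weak11_aux:
 assumes f: "bfun f" and t: "0 < t" and beta: "dbl 5 beta"
  and R1: "nint f < t / (2 * beta) * V z R1"
 shows "dis (4 * t) (T f) <= ennreal ((2 * CT + 2 * beta + (8 * CS * Clam ^ 3 + beta + CT + 2 * CH)) / t * nint f)"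
proof -
 define tau where "tau = t / (2 * beta)"
 define C3 where "C3 = 8 * CS * Clam ^ 3 + beta + CT + 2 * CH"
 have beta1: "1 <= beta" and beta2: "2 * Clam ^ (3 * 5) <= beta" using beta by (auto simp: dbl_def)
 have tau: "0 < tau" using t beta1 by (simp add: tau_def)
 have taut: "2 * tau * beta = t" using beta1 by (simp add: tau_def)
 have C30: "0 < C3" using CS_pos CT CH Clam_pos beta1 unfolding C3_def by (intro add_pos_pos) auto
 have [measurable]: "meas f" using f by (rule bfun_meas)
 define F where "F x = nn (f x)" for x
 have Fm[measurable]: "meas F" unfolding F_def by measurable
 have intF: "ntot F = ennreal (nint f)" unfolding F_def by (rule nn_nint[OF bfun_integrable[OF f]])
 obtain C0 z0 R0 where f0: "0 < C0" "0 < R0" "!!x. cmod (f x) <= C0 * indicator (ball z0 R0) x"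
  using bfun_bound[OF f] by blast
 define R where "R = max R0 (max 1 R1 + dist z z0)"
 have Rp: "0 < R" "R0 <= R" using f0 by (auto simp: R_def)
 have large: "int_on (ball x r) F <= ennreal (tau * V x (6 ^ 2 * r))" if r: "R <= r" for x r
 proof (cases "ball x r Int ball z0 R0 = {}")
  case True
  have "int_on (ball x r) F = ntot (%y. 0)"
  proof (intro nn_integral_cong)
   fix y show "F y * indicator (ball x r) y = 0"
    using f0(3)[of y] True by (cases "y : ball x r"; cases "y : ball z0 R0") (auto simp: F_def)
  qed
  thus ?thesis by simp
 next
  case False
  then obtain y where "dist x y < r" "dist z0 y < R0" by auto
  hence "dist z0 x < 2 * r" using dist_triangle[of z0 x y] r Rp by (simp add: dist_commute)
  moreover have "R1 <= max 1 R1" "max 1 R1 + dist z z0 <= r" using r by (simp_all add: R_def)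
  hence "dist z z0 + R1 <= r" by linarith
  ultimately have "dist z x + R1 <= 6 ^ 2 * r" using dist_triangle[of z x z0] r Rp by simp
  hence V: "V z R1 <= V x (6 ^ 2 * r)" by (rule V_near)
  have "int_on (ball x r) F <= ntot F" by (intro nn_integral_mono) (auto simp: indicator_def)
  also have "... <= ennreal (tau * V x (6 ^ 2 * r))"
   unfolding intF using R1 mult_left_mono[OF V, of tau] tau by (intro ennreal_leI) (simp add: tau_def)
  finally show ?thesis .
 qed
 have dd: "AE x in M. ALL m. EX i>=m. V x (6 ^ 5 * (R / 6 ^ i)) <= beta * V x (R / 6 ^ i)"
  using beta Rp by (simp add: dbl_def)
 have "EX c s. CZ_balls 2 R UNIV tau (2 * tau * beta) F c s"
  using large by (intro CZ_covering[OF Fm Rp(1) tau beta1 dd]) simp_all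
 then obtain c s where cz: "CZ_balls 2 R UNIV tau (2 * tau * beta) F c s" by blast
 note s = CZ_ballsD(1)[OF cz] and av = CZ_ballsD(4)[OF cz] and up = CZ_ballsD(5)[OF cz] and Vpos = CZ_balls_pos[OF cz]
 have good: "AE x in M. x ~: (UN i. ball (c i) (6 * s i)) --> F x <= ennreal (2 * tau * beta)"
  using CZ_ballsD(6)[OF cz] by eventually_elim simp
 have "EX N>=1. 0 < s i --> V (c i) (6 ^ (N + 5) * s i) <= beta * V (c i) (6 ^ N * s i) & (SUM k:{1..<N}. dens (c i) (6 ^ k * s i)) <= 5" for i
 proof (cases "0 < s i")
  case True
  thus ?thesis using first_doubling[OF True beta2 Vpos[OF True], of 1] by auto
 qed auto
 then obtain N where N1: "!!i. 1 <= N i" and N2: "!!i. 0 < s i ==> V (c i) (6 ^ (N i + 5) * s i) <= beta * V (c i) (6 ^ N i * s i)"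
  and N3: "!!i. 0 < s i ==> (SUM k:{1..<N i}. dens (c i) (6 ^ k * s i)) <= 5" by metis
 define r where "r i = 6 ^ N i * s i" for i
 have r6: "6 * s i <= r i" for i
  using s[of i] power_increasing[OF N1[of i], of "6::real"] mult_right_mono[of 6 "6 ^ N i" "s i"] by (simp add: r_def)
 \<comment> \<open>Making the dilated stopping balls disjoint distributes the bad part of f among them.\<close>
 define W where "W i = ball (c i) (6 * s i) - (UN j<i. ball (c j) (6 * s j))" for i
 have Ws[measurable]: "W i : sets M" for i unfolding W_def by auto
 have Wsub: "W i \<subseteq> ball (c i) (6 * s i)" for i unfolding W_def by auto
 have Wdis: "disjoint_family W" unfolding disjoint_family_on_def
 proof (intro ballI impI)
  fix i j :: nat assume "i ~= j"
  then consider "i < j" | "j < i" by linarith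
  thus "W i Int W j = {}" by cases (auto simp: W_def)
 qed
 have WUN: "(UN i. W i) = (UN i. ball (c i) (6 * s i))"
 proof (intro equalityI subsetI)
  fix x assume "x : (UN i. ball (c i) (6 * s i))"
  hence ex: "EX i. x : ball (c i) (6 * s i)" by blast
  define i where "i = (LEAST i. x : ball (c i) (6 * s i))"
  have "x : ball (c i) (6 * s i)" unfolding i_def using ex by (rule LeastI_ex)
  moreover have "x ~: ball (c j) (6 * s j)" if "j < i" for j using that unfolding i_def by (rule not_less_Least)
  ultimately have "x : W i" by (auto simp: W_def)
  thus "x : (UN i. W i)" by blast
 qed (use Wsub in blast)
 define u where "u i x = indicator (W i) x * f x" for i x
 have ub: "bfun (u i)" for i unfolding u_def using f by (intro bfun_restrict) auto
 have us: "supb (u i) (c i) (6 * s i)" for i using Wsub[of i] by (auto simp: supb_def u_def indicator_def)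
 define m where "m i = nint (u i)" for i
 have m0: "0 <= m i" for i by (simp add: m_def)
 have mF: "ennreal (m i) = int_on (W i) F" for i
  unfolding m_def nn_nint[OF bfun_integrable[OF ub[of i]], symmetric]
  by (intro nn_integral_cong) (auto simp: u_def F_def indicator_def)
 have msum: "ennreal (SUM i:I. m i) <= int_on S F" if I: "finite I" "!!i. i : I ==> W i \<subseteq> S" for I S
 proof -
  have "ennreal (SUM i:I. m i) = (SUM i:I. \<integral>\<^sup>+x\<in>W i. F x \<partial>M)"
   using m0 by (simp add: sum_ennreal[symmetric] mF)
  also have "... = ntot (%x. (SUM i:I. F x * indicator (W i) x))" by (subst nn_integral_sum) auto
  also have "... <= int_on S F"
  proof (intro nn_integral_mono)
   fix x
   have "(SUM i:I. indicator (W i) x :: ennreal) = indicator (UN i:I. W i) x"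
    using Wdis I(1) by (intro indicator_UN_disjoint[symmetric]) (auto simp: disjoint_family_on_def)
   also have "... <= indicator S x" using I(2) by (auto simp: indicator_def)
   finally show "(SUM i:I. F x * indicator (W i) x) <= F x * indicator S x"
    by (simp add: sum_distrib_left[symmetric] mult_left_mono)
  qed
  finally show ?thesis .
 qed
 have mtot: "(SUM i:I. m i) <= nint f" if "finite I" for I
  using msum[OF that, of UNIV] by (simp add: intF)
 define alpha where "alpha i = tot (u i) / V (c i) (r i)" for i
 have aV: "cmod (alpha i) * V (c i) (r i) <= m i" for i
  using integral_norm_bound[of M "u i"] m0[of i] by (cases "V (c i) (r i) = 0") (auto simp: alpha_def norm_divide m_def)
 let ?ind = "%i. indicator (ball (c i) (r i)) :: 'a => complex"
 have ib: "bfun (?ind i)" for i by (rule bfun_indicator[of _ "c i" "r i"]) auto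
 define h where "h i x = u i x - alpha i * ?ind i x" for i x
 have hb: "bfun (h i)" for i unfolding h_def by (intro bfun_diff bfun_cmult ib ub)
 define Phi where "Phi n x = (SUM i<n. alpha i * ?ind i x)" for n x
 have Phib: "bfun (Phi n)" for n unfolding Phi_def by (intro bfun_sum bfun_cmult ib)
 define g where "g x = indicator (- (UN i. W i)) x * f x" for x
 have "(UN i. W i) : sets M" by auto
 hence cW: "- (UN i. W i) : sets M" using sets.compl_sets[of "UN i. W i" M] by (simp add: Compl_eq_Diff_UNIV)
 have gb: "bfun g" unfolding g_def by (rule bfun_restrict[OF f cW])
 \<comment> \<open>What the first n stopping balls leave over of the bad part.\<close>
 define rho where "rho n x = indicator (UN i:{n..}. W i) x * f x" for n x
 have rhob: "bfun (rho n)" for n unfolding rho_def using f by (intro bfun_restrict) auto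
 have decomp: "f x = (g x + Phi n x) + ((SUM i<n. h i x) + rho n x)" for n x
 proof -
  have "Phi n x + (SUM i<n. h i x) = (SUM i<n. u i x)" by (simp only: Phi_def h_def sum.distrib[symmetric]) (intro sum.cong, auto)
  also have "... = indicator (UN i<n. W i) x * f x"
  proof -
   have "(SUM i<n. indicator (W i) x :: complex) = indicator (UN i<n. W i) x"
    using Wdis by (intro indicator_UN_disjoint[symmetric]) (auto simp: disjoint_family_on_def)
   thus ?thesis by (simp add: u_def sum_distrib_right[symmetric])
  qed
  finally have e: "Phi n x + (SUM i<n. h i x) = indicator (UN i<n. W i) x * f x" .
  have "(indicator (- (UN i. W i)) x + indicator (UN i<n. W i) x + indicator (UN i:{n..}. W i) x :: complex) = 1"
  proof (cases "x : (UN i. W i)")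
   case True
   then obtain i where i: "x : W i" by blast
   have mem: "x : W j \<longleftrightarrow> j = i" for j using Wdis i by (auto simp: disjoint_family_on_def)
   have "x : (UN j<n. W j) \<longleftrightarrow> i < n" "x : (UN j:{n..}. W j) \<longleftrightarrow> n <= i" "x ~: - (UN j. W j)"
    by (auto simp: mem)
   thus ?thesis unfolding indicator_def of_bool_def by simp
  next
   case False
   thus ?thesis by auto
  qed
  hence "f x = (indicator (- (UN i. W i)) x + indicator (UN i<n. W i) x + indicator (UN i:{n..}. W i) x) * f x" by simp
  also have "... = g x + (Phi n x + (SUM i<n. h i x)) + rho n x" unfolding e by (simp add: g_def rho_def distrib_right)
  finally show ?thesis by simp
 qed
 \<comment> \<open>Off the stopping balls |f| is at most t, and the L^2 bound suffices.\<close>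
 have B1: "dis t (T g) <= ennreal (CT / t * nint f)"
 proof -
  have "sq g <= ntot (%x. ennreal t * F x)"
   using good
  proof (intro nn_integral_mono_AE, eventually_elim)
   fix x assume *: "x ~: (UN i. ball (c i) (6 * s i)) --> F x <= ennreal (2 * tau * beta)"
   show "ennreal ((cmod (g x))\<^sup>2) <= ennreal t * F x"
   proof (cases "x : (UN i. W i)")
    case True thus ?thesis by (simp add: g_def)
   next
    case False
    hence "cmod (f x) <= t" using * t unfolding WUN F_def taut by simp
    hence "cmod (f x) * cmod (f x) <= t * cmod (f x)" by (intro mult_right_mono) auto
    thus ?thesis using False t by (simp add: g_def F_def ennreal_mult[symmetric] power2_eq_square ennreal_leI)
   qed
  qed
  also have "... = ennreal (t * nint f)" using t by (simp add: nn_integral_cmult intF ennreal_mult)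
  finally have g2: "sq g <= ennreal (t * nint f)" .
  have "dis t (T g) <= ennreal (CT / t\<^sup>2) * ennreal (t * nint f)"
   by (rule order_trans[OF T_weak_L2[OF bfun_L2[OF gb] t] mult_left_mono[OF g2]]) simp
  also have "... = ennreal (CT / t * nint f)"
   using t CT by (simp add: ennreal_mult[symmetric] power2_eq_square)
  finally show ?thesis .
 qed
 \<comment> \<open>The bumps: the square of their sum is a double sum, bounded over pairs ordered by radius.\<close>
 have Phi2: "sq (Phi n) <= ennreal (t * nint f)" for n
 proof -
  let ?E = "%i j. ball (c i) (r i) Int ball (c j) (r j)"
  define a where "a i j = cmod (alpha i) * cmod (alpha j) * measure M (?E i j)" for i j
  have Ef: "emeasure M (?E i j) = ennreal (measure M (?E i j))" for i j
  proof (intro emeasure_eq_ennreal_measure)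
   have "emeasure M (?E i j) <= emeasure M (ball (c i) (r i))" by (intro emeasure_mono) auto
   thus "emeasure M (?E i j) ~= top" using emeasure_ball_finite[of "c i" "r i"] by (auto simp: top_unique)
  qed
  have a0: "0 <= a i j" for i j by (simp add: a_def)
  have asym: "a i j = a j i" for i j by (simp add: a_def mult_ac Int_commute)
  have "sq (Phi n) <= ntot (%x. (SUM i<n. SUM j<n. ennreal (cmod (alpha i) * cmod (alpha j)) * indicator (?E i j) x))"
  proof (intro nn_integral_mono)
   fix x
   have "cmod (Phi n x) <= (SUM i<n. cmod (alpha i) * indicator (ball (c i) (r i)) x)"
   proof -
    have "cmod (Phi n x) <= (SUM i<n. cmod (alpha i * ?ind i x))" unfolding Phi_def by (rule norm_sum)
    also have "... = (SUM i<n. cmod (alpha i) * indicator (ball (c i) (r i)) x)"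
    proof (intro sum.cong refl)
     fix i show "cmod (alpha i * ?ind i x) = cmod (alpha i) * indicator (ball (c i) (r i)) x"
      by (cases "x : ball (c i) (r i)") (auto simp: norm_mult)
    qed
    finally show ?thesis .
   qed
   hence "(cmod (Phi n x))\<^sup>2 <= (SUM i<n. cmod (alpha i) * indicator (ball (c i) (r i)) x)\<^sup>2"
    by (intro power_mono) auto
   also have "... = (SUM i<n. SUM j<n. cmod (alpha i) * cmod (alpha j) * indicator (?E i j) x)"
    unfolding power2_eq_square sum_product by (intro sum.cong refl) (auto simp: indicator_def)
   finally have "ennreal ((cmod (Phi n x))\<^sup>2) <= ennreal (SUM i<n. SUM j<n. cmod (alpha i) * cmod (alpha j) * indicator (?E i j) x)"
    by (rule ennreal_leI)
   also have "... = (SUM i<n. SUM j<n. ennreal (cmod (alpha i) * cmod (alpha j)) * indicator (?E i j) x)"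
    by (simp add: sum_ennreal[symmetric] sum_nonneg ennreal_mult ennreal_indicator del: sum_ennreal)
   finally show "ennreal ((cmod (Phi n x))\<^sup>2) <= (SUM i<n. SUM j<n. ennreal (cmod (alpha i) * cmod (alpha j)) * indicator (?E i j) x)" .
  qed
  also have "... = (SUM i<n. SUM j<n. ennreal (a i j))"
  proof -
   have "ntot (%x. (SUM i<n. SUM j<n. ennreal (cmod (alpha i) * cmod (alpha j)) * indicator (?E i j) x))
    = (SUM i<n. \<integral>\<^sup>+x. (SUM j<n. ennreal (cmod (alpha i) * cmod (alpha j)) * indicator (?E i j) x) \<partial>M)"
    by (intro nn_integral_sum borel_measurable_sum borel_measurable_times borel_measurable_indicator) auto
   also have "... = (SUM i<n. SUM j<n. \<integral>\<^sup>+x. ennreal (cmod (alpha i) * cmod (alpha j)) * indicator (?E i j) x \<partial>M)"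
    by (intro sum.cong refl nn_integral_sum borel_measurable_times borel_measurable_indicator) auto
   also have "... = (SUM i<n. SUM j<n. ennreal (a i j))"
    unfolding a_def by (intro sum.cong refl) (subst nn_integral_cmult_indicator, auto simp: Ef ennreal_mult)
   finally show ?thesis .
  qed
  also have "... = ennreal (SUM i<n. SUM j<n. a i j)" using a0 by (simp add: sum_nonneg)
  also have "... <= ennreal (t * nint f)"
  proof (intro ennreal_leI)
   have "(SUM i<n. SUM j<n. a i j) <= (SUM i<n. SUM j<n. (if r j <= r i then a i j else 0) + (if r i <= r j then a i j else 0))"
    using a0 by (intro sum_mono) auto
   also have "... = (SUM i<n. SUM j<n. (if r j <= r i then a i j else 0)) + (SUM i<n. SUM j<n. (if r i <= r j then a i j else 0))"
    by (simp add: sum.distrib)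
   also have "(SUM i<n. SUM j<n. (if r i <= r j then a i j else 0)) = (SUM j<n. SUM i<n. (if r i <= r j then a j i else 0))"
    using asym by (subst sum.swap) (auto intro!: sum.cong)
   finally have "(SUM i<n. SUM j<n. a i j) <= 2 * (SUM i<n. SUM j<n. (if r j <= r i then a i j else 0))" by simp
   also have "(SUM i<n. SUM j<n. (if r j <= r i then a i j else 0)) <= (SUM i<n. tau * beta * m i)"
   proof (intro sum_mono)
    fix i
    let ?J = "{j. j < n & r j <= r i & ?E i j ~= {}}"
    show "(SUM j<n. (if r j <= r i then a i j else 0)) <= tau * beta * m i"
    proof (cases "0 < s i")
     case False
     hence "r i = 0" using s[of i] by (simp add: r_def)
     hence z: "a i j = 0" for j by (simp add: a_def)
     have "0 <= tau * beta * m i" using tau beta1 m0[of i] by (intro mult_nonneg_nonneg) auto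
     moreover have "(SUM j<n. (if r j <= r i then a i j else 0)) = 0" by (intro sum.neutral) (auto simp: z)
     ultimately show ?thesis by linarith
    next
     case True
     have ri: "0 < r i" using True by (simp add: r_def)
     have "(SUM j<n. (if r j <= r i then a i j else 0)) = (SUM j:?J. a i j)"
      by (intro sum.mono_neutral_cong_right) (auto simp: a_def)
     also have "... <= (SUM j:?J. cmod (alpha i) * m j)"
     proof (intro sum_mono)
      fix j
      have "measure M (?E i j) <= V (c j) (r j)"
      proof -
      have "emeasure M (?E i j) <= emeasure M (ball (c j) (r j))" by (intro emeasure_mono) auto
      thus ?thesis unfolding Ef emeasure_ball by simp
      qed
      hence "cmod (alpha j) * measure M (?E i j) <= cmod (alpha j) * V (c j) (r j)" by (intro mult_left_mono) auto
      also have "... <= m j" by (rule aV)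
      finally show "a i j <= cmod (alpha i) * m j" unfolding a_def mult.assoc by (intro mult_left_mono) auto
     qed
     also have "... = cmod (alpha i) * (SUM j:?J. m j)" by (simp add: sum_distrib_left)
     also have "... <= cmod (alpha i) * (tau * (beta * V (c i) (r i)))"
     proof (intro mult_left_mono)
      have "ennreal (SUM j:?J. m j) <= int_on (ball (c i) (6 ^ Suc (N i) * s i)) F"
      proof (intro msum)
      fix j assume j: "j : ?J"
      then obtain y where y: "dist (c i) y < r i" "dist (c j) y < r j" by auto
      show "W j \<subseteq> ball (c i) (6 ^ Suc (N i) * s i)"
      proof
      fix x assume "x : W j"
      hence "dist (c j) x < r j" using Wsub[of j] r6[of j] by auto
      moreover have "dist (c i) x <= dist (c i) y + (dist (c j) y + dist (c j) x)"
      using dist_triangle[of "c i" x y] dist_triangle[of y x "c j"] by (simp add: dist_commute)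
      ultimately have "dist (c i) x < 6 * r i" using y j ri by simp
      thus "x : ball (c i) (6 ^ Suc (N i) * s i)" by (simp add: r_def)
      qed
      qed auto
      also have "... <= ennreal (tau * V (c i) (6 ^ (Suc (N i) + 2) * s i))" using True by (intro up) auto
      also have "... <= ennreal (tau * (beta * V (c i) (r i)))"
      proof (intro ennreal_leI mult_left_mono)
      have "V (c i) (6 ^ (Suc (N i) + 2) * s i) <= V (c i) (6 ^ (N i + 5) * s i)"
      using True by (intro V_mono mult_right_mono power_increasing) auto
      thus "V (c i) (6 ^ (Suc (N i) + 2) * s i) <= beta * V (c i) (r i)" using N2[OF True] by (simp add: r_def)
      qed (use tau in auto)
      finally show "(SUM j:?J. m j) <= tau * (beta * V (c i) (r i))"
      using tau beta1 by (subst (asm) ennreal_le_iff) auto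
     qed auto
     also have "... = tau * beta * (cmod (alpha i) * V (c i) (r i))" by simp
     also have "... <= tau * beta * m i" using aV[of i] tau beta1 by (intro mult_left_mono) auto
     finally show ?thesis .
    qed
   qed
   also have "2 * (SUM i<n. tau * beta * m i) = t * (SUM i<n. m i)" by (simp add: sum_distrib_left[symmetric] taut[symmetric])
   also have "... <= t * nint f" using mtot[of "{..<n}"] t by (intro mult_left_mono) auto
   finally show "(SUM i<n. SUM j<n. a i j) <= t * nint f" by simp
  qed
  finally show ?thesis .
 qed
 have B2: "dis t (%x. T (Phi n) x) <= ennreal (CT / t * nint f)" for n
 proof -
  have "dis t (%x. T (Phi n) x) <= ennreal (CT / t\<^sup>2) * ennreal (t * nint f)"
   by (rule order_trans[OF T_weak_L2[OF bfun_L2[OF Phib] t] mult_left_mono[OF Phi2]]) simp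
  also have "... = ennreal (CT / t * nint f)"
   using t CT by (simp add: ennreal_mult[symmetric] power2_eq_square)
  finally show ?thesis .
 qed
 \<comment> \<open>Off the stopping balls dilated by 36 the blocks are estimated in mean; the dilated balls have small total measure.\<close>
 define E where "E = (UN i. ball (c i) (36 * s i))"
 have Es[measurable]: "E : sets M" unfolding E_def by auto
 have mE: "emeasure M E <= ennreal (2 * beta / t * nint f)"
 proof -
  have "emeasure M E <= (\<Sum>i. emeasure M (ball (c i) (36 * s i)))"
   unfolding E_def by (intro emeasure_subadditive_countably) auto
  also have "... <= (\<Sum>i. ennreal (1 / tau) * int_on (ball (c i) (s i)) F)"
  proof (intro suminf_le)
   fix i
   show "emeasure M (ball (c i) (36 * s i)) <= ennreal (1 / tau) * int_on (ball (c i) (s i)) F"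
   proof (cases "0 < s i")
    case True
    have "emeasure M (ball (c i) (36 * s i)) = ennreal (1 / tau) * ennreal (tau * V (c i) (6 ^ 2 * s i))"
     using tau by (simp add: emeasure_ball ennreal_mult[symmetric])
    also have "... <= ennreal (1 / tau) * int_on (ball (c i) (s i)) F"
     using av[OF True] by (intro mult_left_mono) auto
    finally show ?thesis .
   next
    case False hence "s i = 0" using s[of i] by simp
    thus ?thesis by simp
   qed
  qed auto
  also have "... = ennreal (1 / tau) * (\<Sum>i. \<integral>\<^sup>+y. F y * indicator (ball (c i) (s i)) y \<partial>M)"
   by (rule ennreal_suminf_cmult)
  also have "... <= ennreal (1 / tau) * ntot F" by (rule mult_left_mono[OF CZ_balls_sum[OF cz Fm]]) simp
  also have "... = ennreal (2 * beta / t * nint f)"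
   using tau t beta1 unfolding intF by (subst ennreal_mult[symmetric]) (auto simp: tau_def)
  finally show ?thesis by (simp add: mult_left_mono)
 qed
 have hoff: "mass_on (- ball (c i) (36 * s i)) (%x. T (h i) x) <= ennreal (C3 * m i)" for i
 proof (cases "0 < s i")
  case True
  have VV: "0 < V (c i) (6 ^ N i * s i)"
  proof -
   have "V (c i) (s i) <= V (c i) (r i)" using r6[of i] True by (intro V_mono) simp
   thus ?thesis using Vpos[OF True] by (simp add: r_def)
  qed
  show ?thesis using T_block_off[OF ub us True N1 VV N2[OF True] N3[OF True]]
   by (simp add: h_def[abs_def] alpha_def r_def C3_def m_def)
 next
  case False
  hence si: "s i = 0" "r i = 0" using s[of i] by (auto simp: r_def)
  hence "W i = {}" using Wsub[of i] by simp
  hence "h i = (%x. 0)" using si by (auto simp: h_def u_def fun_eq_iff)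
  hence "AE x in M. T (h i) x = 0"
   using T_cmult[OF bfun_L2[OF bfun_zero], of 0] by simp
  hence "mass_on (- ball (c i) (36 * s i)) (%x. T (h i) x) = ntot (%x. 0)"
   by (intro nn_integral_cong_AE) (auto elim!: eventually_mono)
  thus ?thesis by simp
 qed
 have B3: "dis t (%x. T (%y. SUM i<n. h i y) x) <= ennreal (2 * beta / t * nint f) + ennreal (C3 / t * nint f)" for n
 proof -
  have [measurable]: "meas (T (h i))" for i by (intro T_meas bfun_L2 hb)
  have [measurable]: "meas (T (%y. SUM i<n. h i y))" by (intro T_meas bfun_L2 bfun_sum hb)
  let ?G = "%x. (SUM i<n. T (h i) x) * indicator (- E) x"
  have "dis t (%x. T (%y. SUM i<n. h i y) x) <= emeasure M (E Un {x. t < cmod (?G x)})"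
  proof (rule emeasure_mono_AE)
   have "AE x in M. T (%y. SUM i<n. h i y) x = (SUM i<n. T (h i) x)" by (intro T_sum bfun_L2 hb) auto
   thus "AE x in M. x : {x. t < cmod (T (%y. SUM i<n. h i y) x)} --> x : E Un {x. t < cmod (?G x)}"
   proof eventually_elim
    case (elim x)
    thus ?case by (cases "x : E") auto
   qed
   have "{x : space M. t < cmod (?G x)} : sets M" by measurable
   thus "E Un {x. t < cmod (?G x)} : sets M" using Es by auto
  qed
  also have "... <= emeasure M E + dis t ?G"
  proof (rule emeasure_subadditive[OF Es])
   have "{x : space M. t < cmod (?G x)} : sets M" by measurable
   thus "{x. t < cmod (?G x)} : sets M" by simp
  qed
  also have "dis t ?G <= ennreal (1 / t) * mass ?G"
   using t by (intro dis_Markov) auto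
  also have "mass ?G <= ntot (%x. (SUM i<n. nn (T (h i) x) * indicator (- ball (c i) (36 * s i)) x))"
  proof (intro nn_integral_mono)
   fix x
   show "nn (?G x) <= (SUM i<n. nn (T (h i) x) * indicator (- ball (c i) (36 * s i)) x)"
   proof (cases "x : E")
    case True thus ?thesis by simp
   next
    case False
    hence ne: "x ~: ball (c i) (36 * s i)" for i unfolding E_def by blast
    have "nn (SUM i<n. T (h i) x) <= ennreal (SUM i<n. cmod (T (h i) x))" by (intro ennreal_leI norm_sum)
    also have "... = (SUM i<n. nn (T (h i) x))" by simp
    finally show ?thesis using False ne by simp
   qed
  qed
  also have "... = (SUM i<n. \<integral>\<^sup>+x\<in>- ball (c i) (36 * s i). nn (T (h i) x) \<partial>M)"
   by (subst nn_integral_sum) auto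
  also have "... <= (SUM i<n. ennreal (C3 * m i))" by (intro sum_mono hoff)
  also have "... = ennreal (C3 * (SUM i<n. m i))" using C30 m0 by (simp add: sum_distrib_left)
  also have "... <= ennreal (C3 * nint f)" using mtot[of "{..<n}"] C30 by (intro ennreal_leI mult_left_mono) auto
  also have "ennreal (1 / t) * ennreal (C3 * nint f) = ennreal (C3 / t * nint f)"
   using t C30 by (simp add: ennreal_mult[symmetric])
  finally have "dis t (%x. T (%y. SUM i<n. h i y) x) <= emeasure M E + ennreal (C3 / t * nint f)"
   by (simp add: mult_left_mono add_left_mono)
  also have "... <= ennreal (2 * beta / t * nint f) + ennreal (C3 / t * nint f)" by (rule add_right_mono[OF mE])
  finally show ?thesis .
 qed
 \<comment> \<open>The remainder tends to zero in L^2.\<close>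
 let ?r2 = "%n. (sq (rho n))"
 have r2: "?r2 \<longlonglongrightarrow> 0"
 proof -
  define mu where "mu = density M (%x. ennreal ((cmod (f x))\<^sup>2))"
  have mu: "emeasure mu A = int_on A (%y. ennreal ((cmod (f y))\<^sup>2))" if "A : sets M" for A
   unfolding mu_def using that by (intro emeasure_density) auto
  have fin: "emeasure mu A ~= \<infinity>" if "A : sets M" for A
  proof -
   have "emeasure mu A <= sq f"
    unfolding mu[OF that] by (intro nn_integral_mono) (auto simp: indicator_def)
   also have "... < \<infinity>" using bfun_L2[OF f] by (simp add: L2_def)
   finally show ?thesis by simp
  qed
  have "(%n. emeasure mu (UN i:{n..}. W i)) \<longlonglongrightarrow> emeasure mu (\<Inter>n. UN i:{n..}. W i)"
  proof (intro Lim_emeasure_decseq)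
   show "decseq (%n. UN i:{n..}. W i)" by (intro decseq_SucI UN_mono) auto
   show "range (%n. UN i:{n..}. W i) \<subseteq> sets mu" unfolding mu_def using Ws by auto
   show "emeasure mu (UN i:{n..}. W i) ~= \<infinity>" for n by (intro fin) auto
  qed
  also have "(\<Inter>n. UN i:{n..}. W i) = {}"
  proof -
   have "x ~: (\<Inter>n. UN i:{n..}. W i)" for x
   proof
    assume x: "x : (\<Inter>n. UN i:{n..}. W i)"
    then obtain i where i: "x : W i" by blast
    from x have "x : (UN i:{Suc i..}. W i)" by blast
    then obtain j where "Suc i <= j" "x : W j" by auto
    moreover have "W i Int W j = {}" if "i ~= j" using disjoint_family_onD[OF Wdis] that by auto
    ultimately show False using i by auto
   qed
   thus ?thesis by blast
  qed
  also have "emeasure mu {} = 0" by simp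
  finally show ?thesis
  proof (rule tendsto_cong[THEN iffD1, rotated], intro always_eventually allI)
   fix n
   have "emeasure mu (UN i:{n..}. W i) = int_on ((UN i:{n..}. W i)) (%y. ennreal ((cmod (f y))\<^sup>2))" by (intro mu) auto
   also have "... = ?r2 n" by (intro nn_integral_cong) (auto simp: rho_def indicator_def)
   finally show "emeasure mu (UN i:{n..}. W i) = ?r2 n" .
  qed
 qed
 have B4: "dis t (%x. T (rho n) x) <= ennreal (CT / t\<^sup>2) * ?r2 n" for n
  by (rule T_weak_L2[OF bfun_L2[OF rhob] t])
 let ?X = "ennreal (CT / t * nint f) + ennreal (CT / t * nint f) + (ennreal (2 * beta / t * nint f) + ennreal (C3 / t * nint f))"
 have tot: "dis (4 * t) (T f) <= ?X + ennreal (CT / t\<^sup>2) * ?r2 n" for n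
 proof -
  let ?h = "%y. SUM i<n. h i y"
  have hs: "bfun ?h" by (intro bfun_sum hb)
  have l2: "g : L2" "Phi n : L2" "?h : L2" "rho n : L2" by (intro bfun_L2 gb Phib hs rhob)+
  have l12: "(%x. g x + Phi n x) : L2" "(%x. ?h x + rho n x) : L2" using l2 by (auto intro: L2_add)
  have "dis (2 * t + 2 * t) (T f) <= dis (2 * t) (%x. T (%x. g x + Phi n x) x) + dis (2 * t) (%x. T (%x. ?h x + rho n x) x)"
  proof (rule dis_add)
   have "f = (%x. (g x + Phi n x) + (?h x + rho n x))" using decomp[of _ n] by (intro ext)
   thus "AE x in M. cmod (T f x) <= cmod (T (%x. g x + Phi n x) x) + cmod (T (%x. ?h x + rho n x) x)"
    using T_add[OF l12] by (auto elim!: eventually_mono intro: norm_triangle_ineq)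
  qed (intro T_meas l12)+
  also have "dis (2 * t) (%x. T (%x. g x + Phi n x) x) <= dis t (T g) + dis t (%x. T (Phi n) x)"
   unfolding mult_2 using T_add[OF l2(1,2)]
   by (intro dis_add T_meas l2) (auto elim!: eventually_mono intro: norm_triangle_ineq)
  also have "dis (2 * t) (%x. T (%x. ?h x + rho n x) x) <= dis t (T ?h) + dis t (%x. T (rho n) x)"
   unfolding mult_2 using T_add[OF l2(3,4)]
   by (intro dis_add T_meas l2) (auto elim!: eventually_mono intro: norm_triangle_ineq)
  finally have "dis (4 * t) (T f) <= (dis t (T g) + dis t (%x. T (Phi n) x)) +
    (dis t (T ?h) + dis t (%x. T (rho n) x))"
   by (simp add: add_mono)
  also have "... <= (ennreal (CT / t * nint f) + ennreal (CT / t * nint f)) + ((ennreal (2 * beta / t * nint f) + ennreal (C3 / t * nint f)) + ennreal (CT / t\<^sup>2) * ?r2 n)"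
   by (intro add_mono B1 B2 B3 B4)
  finally show ?thesis by (simp add: add.assoc)
 qed
 have "(%n. ?X + ennreal (CT / t\<^sup>2) * ?r2 n) \<longlonglongrightarrow> ?X + ennreal (CT / t\<^sup>2) * 0"
  by (intro tendsto_add tendsto_const ennreal_tendsto_cmult r2) auto
 hence "dis (4 * t) (T f) <= ?X + ennreal (CT / t\<^sup>2) * 0"
  by (rule LIMSEQ_le_const) (use tot in auto)
 also have "... = ennreal ((2 * CT + 2 * beta + C3) / t * nint f)"
 proof -
  have "0 <= CT / t * nint f" "0 <= 2 * beta / t * nint f" "0 <= C3 / t * nint f" using t CT beta1 C30 by auto
  thus ?thesis by (simp add: ennreal_plus[symmetric] add_divide_distrib distrib_right del: ennreal_plus)
 qed
 finally show ?thesis by (simp add: C3_def)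
qed

text \<open>
If no ball is large enough for its average of f to be below the level, the whole space has measure at
most a multiple of the mass of f over t, and nothing is to be shown.
\<close>

lemma weak11: "EX W>0. ALL f t. bfun f --> 0 < t --> dis t (T f) <= ennreal (W / t * nint f)"
proof -
 obtain beta where beta: "dbl 5 beta" using dbl_exists by blast
 have beta1: "1 <= beta" using beta by (simp add: dbl_def)
 define D where "D = 2 * CT + 2 * beta + (8 * CS * Clam ^ 3 + beta + CT + 2 * CH)"
 have D: "2 * beta <= D" using CS_pos CT CH Clam_pos beta1 by (simp add: D_def)
 show ?thesis
 proof (intro exI[of _ "4 * D"] conjI allI impI)
  show "0 < 4 * D" using D beta1 by linarith
  fix f and t :: real assume f: "bfun f" and t: "0 < t"
  fix z :: 'a
  show "dis t (T f) <= ennreal (4 * D / t * nint f)"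
  proof (cases "EX R1. nint f < t / 4 / (2 * beta) * V z R1")
   case True
   then obtain R1 where R1: "nint f < t / 4 / (2 * beta) * V z R1" by blast
   have t4: "0 < t / 4" using t by simp
   show ?thesis using weak11_aux[OF f t4 beta R1] by (simp add: D_def)
  next
   case False
   have "V z R1 <= 4 * D / t * nint f" for R1
   proof -
    have "t / 4 / (2 * beta) * V z R1 <= nint f" using False by (simp add: not_less)
    hence "V z R1 <= 4 * (2 * beta) / t * nint f" using t beta1 by (simp add: field_simps)
    also have "... <= 4 * D / t * nint f" using D t by (intro mult_right_mono divide_right_mono) auto
    finally show ?thesis .
   qed
   hence le: "emeasure M (ball z (real n)) <= ennreal (4 * D / t * nint f)" for n :: nat
    by (simp add: emeasure_ball ennreal_leI)
   have "(SUP n. emeasure M (ball z (real n))) = emeasure M (UN n::nat. ball z (real n))"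
    by (intro SUP_emeasure_incseq) (auto simp: incseq_def subset_ball)
   hence "emeasure M UNIV <= ennreal (4 * D / t * nint f)"
    unfolding UN_balls using le by (metis (no_types, lifting) SUP_least)
   thus ?thesis using emeasure_mono[of "{x. t < cmod (T f x)}" UNIV M] sets.top[of M] by auto
  qed
 qed
qed

end

section \<open>Discrete coefficients and regular means\<close>

text \<open>
A descent along the indices with property P. From k one jumps to a later such index as soon as the
densities in between add up to more than 1; the gap condition keeps every jump bounded, and the number of
jumps is at most the sum of the densities. Hence something that grows by a bounded amount per jump grows
linearly in that sum, with no power \<gamma>.
\<close>

lemma chain_lemma:
 fixes delta :: "nat => real" and R :: "nat => real => bool"
 assumes delta: "!!k. 0 <= delta k" "!!k. delta k <= 1" and g: "0 <= g"
  and gap: "!!i j. i <= j ==> j <= n ==> (!!k. i <= k ==> k < j ==> ~ P k) ==> (SUM k:{i..<j}. delta k) <= g"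
  and base: "!!k. k <= n ==> P k ==> (SUM k:{k..n}. delta k) <= g + 4 ==> R k 1"
  and step: "!!k k' kappa. P k ==> P k' ==> k < k' ==> k' <= n ==> (SUM k:{k..k'}. delta k) <= g + 4 ==> R k' kappa ==> R k (kappa + 1)"
  and mono: "!!k kappa kappa'. R k kappa ==> kappa <= kappa' ==> R k kappa'"
 shows "k <= n ==> P k ==> R k (1 + (SUM k:{k..n}. delta k))"
proof (induction "n - k" arbitrary: k rule: less_induct)
 case less
 let ?S = "%i j. SUM k:{i..<j}. delta k"
 have S0: "0 <= ?S i j" for i j using delta by (intro sum_nonneg) auto
 have SS: "?S i (Suc j) = ?S i j + delta j" if "i <= j" for i j using that by simp
 have cat: "?S i j + ?S j l = ?S i l" if "i <= j" "j <= l" for i j l using that by (rule sum.atLeastLessThan_concat)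
 have cl: "(SUM k:{i..j}. delta k) = ?S i (Suc j)" for i j by (simp add: atLeastLessThanSuc_atLeastAtMost)
 show ?case
 proof (cases "(SUM k:{k..n}. delta k) <= g + 4")
  case True
  hence "R k 1" using less base by blast
  thus ?thesis by (rule mono) (use S0[of k "Suc n"] cl in simp)
 next
  case False
  hence big: "g + 4 < ?S k (Suc n)" unfolding cl by simp
  define j1 where "j1 = (LEAST j. 1 <= ?S k j)"
  have "1 <= ?S k (Suc n)" using big g by linarith
  hence j1: "1 <= ?S k j1" and j1n: "j1 <= Suc n" unfolding j1_def
   by (rule LeastI, rule Least_le)
  have kj1: "k < j1" using j1 by (rule_tac ccontr) simp
  have "~ 1 <= ?S k (j1 - 1)" unfolding j1_def[symmetric] using kj1 not_less_Least[of "j1 - 1" "%j. 1 <= ?S k j"]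
   unfolding j1_def by (metis (no_types, lifting) One_nat_def diff_less gr_implies_not0 j1_def less_Suc0 linorder_neqE_nat)
  moreover have "?S k j1 = ?S k (j1 - 1) + delta (j1 - 1)" using SS[of k "j1 - 1"] kj1 by simp
  ultimately have j1u: "?S k j1 <= 2" using delta(2)[of "j1 - 1"] by linarith
  define j2 where "j2 = (LEAST j. g < ?S j1 j)"
  have g1: "g < ?S j1 n"
  proof -
   have "j1 <= n"
   proof (rule ccontr)
    assume "~ j1 <= n"
    hence "j1 = Suc n" using j1n by simp
    thus False using j1u big g by simp
   qed
   thus ?thesis using cat[of k j1 "Suc n"] kj1 SS[of j1 n] delta(2)[of n] j1u big by simp
  qed
  hence j2: "g < ?S j1 j2" and j2n: "j2 <= n" unfolding j2_def by (rule LeastI, rule Least_le)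
  have j12: "j1 < j2" using j2 g by (rule_tac ccontr) simp
  have "~ g < ?S j1 (j2 - 1)"
  proof -
   have "j2 - 1 < j2" using j12 by simp
   thus ?thesis unfolding j2_def by (rule not_less_Least)
  qed
  moreover have "?S j1 j2 = ?S j1 (j2 - 1) + delta (j2 - 1)" using SS[of j1 "j2 - 1"] j12 by simp
  ultimately have j2u: "?S j1 j2 <= g + 1" using delta(2)[of "j2 - 1"] by linarith
  obtain k' where k': "j1 <= k'" "k' < j2" "P k'"
   using gap[of j1 j2] j12 j2n j2 by (meson less_imp_le not_le)
  have kk': "k < k'" "k' <= n" using kj1 k' j2n by auto
  have "?S k (Suc k') <= ?S k j2"
   using cat[of k "Suc k'" j2] kk' k' S0[of "Suc k'" j2] by simp
  also have "... <= g + 3" using cat[of k j1 j2] kj1 j12 j1u j2u by simp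
  finally have sm: "(SUM k:{k..k'}. delta k) <= g + 4" unfolding cl by simp
  have "R k' (1 + (SUM k:{k'..n}. delta k))" using less(1)[of k'] kk' k' by simp
  hence "R k (1 + (SUM k:{k'..n}. delta k) + 1)" using step[OF less(3) k'(3) kk' sm] by blast
  moreover have "1 <= ?S k k'" using cat[of k j1 k'] kj1 k' j1 S0[of j1 k'] by simp
  hence "1 + (SUM k:{k'..n}. delta k) + 1 <= 1 + (SUM k:{k..n}. delta k)"
   unfolding cl using cat[of k k' "Suc n"] kk' by simp
  ultimately show ?thesis by (rule mono)
 qed
qed

text \<open>For comparing sums over two geometric scales.\<close>

lemma sum_fibres_le:
 fixes g :: "'b => real"
 assumes "finite A" "finite B" and j: "!!k. k : A ==> j k : B" and g: "!!b. b : B ==> 0 <= g b"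
  and c: "!!b. b : B ==> card {k : A. j k = b} <= m"
 shows "(SUM k:A. g (j k)) <= real m * (SUM b:B. g b)"
proof -
 have "(SUM k:A. g (j k)) = (SUM b:B. SUM k:{k : A. j k = b}. g (j k))"
  using assms(1,2) j by (intro sum.group[symmetric]) auto
 also have "... = (SUM b:B. real (card {k : A. j k = b}) * g b)" by (intro sum.cong) auto
 also have "... <= (SUM b:B. real m * g b)" using c g by (intro sum_mono mult_right_mono) auto
 finally show ?thesis by (simp add: sum_distrib_left)
qed

lemma powi_ceiling:
 fixes a b :: real and k :: int
 assumes a: "1 < a" and b: "1 < b"
 defines "j \<equiv> \<lceil>k * log b a\<rceil>"
 shows "a powi k <= b powi j" "b powi (j - 1) < a powi k" "b powi j <= b * a powi k"
proof -
 have bp: "b powi i = b powr real_of_int i" for i using b by (simp add: powr_real_of_int')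
 have ak: "a powi k = b powr (k * log b a)"
  using a b by (simp add: powr_real_of_int' powr_powr[symmetric] mult.commute[of _ "log b a"])
 show "a powi k <= b powi j" unfolding bp ak using b by (simp add: j_def)
 show *: "b powi (j - 1) < a powi k" unfolding bp ak using b by (simp add: j_def) linarith
 have "b powi j = b * b powi (j - 1)" using b by (simp add: power_int_diff)
 thus "b powi j <= b * a powi k" using * b by simp
qed

lemma card_powi_fibre:
 fixes a b :: real
 assumes a: "1 < a" and b: "1 < b" and m: "b <= a ^ m" and A: "finite A"
 shows "card {k : A. \<lceil>real_of_int k * log b a\<rceil> = j} <= m"
proof (cases "{k : A. \<lceil>real_of_int k * log b a\<rceil> = j} = {}")
 case False
 let ?S = "{k : A. \<lceil>real_of_int k * log b a\<rceil> = j}"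
 define k0 where "k0 = Min ?S"
 have fS: "finite ?S" using A by simp
 have k0: "k0 : ?S" "!!k. k : ?S ==> k0 <= k" unfolding k0_def using Min_in[OF fS False] Min_le[OF fS] by auto
 have "?S \<subseteq> {k0..<k0 + int m}"
 proof
  fix k assume k: "k : ?S"
  have "a powi k <= b powi j" "b powi (j - 1) < a powi k0"
   using powi_ceiling[OF a b, of k] powi_ceiling[OF a b, of k0] k k0(1) by auto
  moreover have "b powi j = b * b powi (j - 1)" using b by (simp add: power_int_diff)
  ultimately have "a powi k < b * a powi k0" using b by (smt (verit) mult_less_cancel_left_pos)
  also have "... <= a ^ m * a powi k0" using m a by (intro mult_right_mono) auto
  also have "... = a powi (k0 + int m)" using a by (simp add: power_int_add)
  finally have "k < k0 + int m" using a by (metis linorder_not_le power_int_increasing less_imp_le)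
  thus "k : {k0..<k0 + int m}" using k0(2)[OF k] by simp
 qed
 hence "card ?S <= card {k0..<k0 + int m}" by (intro card_mono) auto
 thus ?thesis by simp
next
 case True
 show ?thesis unfolding True by simp
qed

lemma sum_Un_le:
 fixes g :: "'a => real"
 assumes "finite A" "finite B" "!!x. 0 <= g x"
 shows "sum g (A Un B) <= sum g A + sum g B"
 using sum.union_inter[OF assms(1,2), of g] sum_nonneg[of "A Int B" g] assms(3) by simp

context nonhomogeneous_space
begin

text \<open>
Replacing a radius on the scale a by the next larger one on the scale b changes a density by a bounded
factor, and boundedly many radii are sent to the same one.
\<close>

lemma base_change:
 assumes a: "1 < a" and b: "1 < b" and m: "b <= a ^ m" and q: "b <= 6 ^ q" and r: "0 < r"
  and A: "finite A" and B: "finite B" and AB: "!!k. k : A ==> \<lceil>real_of_int k * log b a\<rceil> : B"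
 shows "(SUM k:A. dens c (a powi k * r)) <= real m * Clam ^ (3 * q) * (SUM j:B. dens c (b powi j * r))"
proof -
 let ?j = "%k. \<lceil>real_of_int k * log b a\<rceil>"
 have "(SUM k:A. dens c (a powi k * r)) <= (SUM k:A. Clam ^ (3 * q) * dens c (b powi ?j k * r))"
 proof (intro sum_mono)
  fix k
  have p: "0 < a powi k" "0 < b powi ?j k" using a b by auto
  note c = powi_ceiling[OF a b, of k]
  have "dens c (a powi k * r) <= V c (b powi ?j k * r) / lam c (a powi k * r)"
   unfolding dens_def using c p r lam_pos[of "a powi k * r" c] by (intro divide_right_mono V_mono mult_right_mono) auto
  also have "... <= Clam ^ (3 * q) * dens c (b powi ?j k * r)"
  proof (rule dens_upper)
   have "b * a powi k <= 6 ^ q * a powi k" using q p by (intro mult_right_mono) auto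
   hence "b powi ?j k <= 6 ^ q * a powi k" using c(3) by linarith
   hence "b powi ?j k * r <= 6 ^ q * a powi k * r" using r by (intro mult_right_mono) auto
   thus "b powi ?j k * r <= 6 ^ q * (a powi k * r)" by (simp add: mult.assoc)
  qed (use p r in auto)
  finally show "dens c (a powi k * r) <= Clam ^ (3 * q) * dens c (b powi ?j k * r)" .
 qed
 also have "... = Clam ^ (3 * q) * (SUM k:A. dens c (b powi ?j k * r))" by (simp add: sum_distrib_left)
 also have "... <= Clam ^ (3 * q) * (real m * (SUM j:B. dens c (b powi j * r)))"
 proof (intro mult_left_mono sum_fibres_le A B AB)
  show "card {k : A. ?j k = j} <= m" for j by (rule card_powi_fibre[OF a b m A])
  show "0 <= dens c (b powi j * r)" for j using dens_bounds(1)[of "b powi j * r" c] b r by simp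
 qed (use Clam_pos in auto)
 finally show ?thesis by (simp add: mult_ac)
qed

lemma coeff_index_props:
 assumes rho: "1 < rho" and r: "0 < r" "0 < (R::real)"
 shows "R <= rho powi coeff_index rho (c, r) (e, R) * r"
  and "!!n. R <= rho powi n * r ==> coeff_index rho (c, r) (e, R) <= n"
proof -
 have ex: "EX n::int. R <= rho powi n * r"
 proof -
  obtain n :: nat where "R / r < rho ^ n" using real_arch_pow[OF rho] by blast
  hence "R <= rho powi int n * r" using r by (simp add: field_simps)
  thus ?thesis by blast
 qed
 have "EX m::nat. ALL n::int. R <= rho powi n * r --> - int m <= n"
 proof -
  obtain m :: nat where "r / R < rho ^ m" using real_arch_pow[OF rho] by blast
  hence m: "rho powi (- int m) * r < R" using r rho by (simp add: power_int_minus field_simps)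
  have "- int m <= n" if "R <= rho powi n * r" for n
  proof (rule ccontr)
   assume "~ - int m <= n"
   hence "rho powi n <= rho powi (- int m)" using rho by (intro power_int_increasing) auto
   hence "rho powi n * r <= rho powi (- int m) * r" using r by (intro mult_right_mono) auto
   thus False using that m by linarith
  qed
  thus ?thesis by blast
 qed
 then obtain m :: nat where m: "!!n::int. R <= rho powi n * r ==> - int m <= n" by blast
 let ?P = "%n::int. R <= rho powi n * r"
 define N where "N = (LEAST i::nat. ?P (int i - int m))"
 obtain n where n: "?P n" using ex by blast
 have e1: "?P (int (nat (n + int m)) - int m)" using n m[OF n] by simp
 have N: "?P (int N - int m)" unfolding N_def using e1 by (rule LeastI)
 have min: "int N - int m <= n" if "?P n" for n
 proof -
  have "?P (int (nat (n + int m)) - int m)" using that m[OF that] by simp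
  hence "N <= nat (n + int m)" unfolding N_def by (rule Least_le)
  thus ?thesis using m[OF that] by linarith
 qed
 have "coeff_index rho (c, r) (e, R) = int N - int m"
  unfolding coeff_index_def by (rule Least_equality) (use N min in auto)
 thus "R <= rho powi coeff_index rho (c, r) (e, R) * r"
  and "!!n. R <= rho powi n * r ==> coeff_index rho (c, r) (e, R) <= n" using N min by auto
qed

lemma discrete_coeff_dens:
 "discrete_coeff M lam rho (c, r) (e, R) = 1 + (\<Sum>k = - \<lfloor>log rho 2\<rfloor>..coeff_index rho (c, r) (e, R). dens c (rho powi k * r))"
 by (simp add: discrete_coeff_def ball_set_def dilate_def dens_def V_def)

text \<open>
The two coefficient comparisons reduce an arbitrary dilation factor \<rho> to powers of 6.
\<close>

lemma coeff_upper:
 assumes rho: "1 < rho"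
 shows "EX A>=1. ALL c r e R n. 0 < r --> 0 < R --> R <= 6 ^ n * r -->
   discrete_coeff M lam rho (c, r) (e, R) <= A * (1 + (SUM k:{1..n}. dens c (6 ^ k * r)))"
proof -
 obtain m :: nat where m: "6 < rho ^ m" using real_arch_pow[OF rho] by blast
 define L where "L = \<lfloor>log rho 2\<rfloor>"
 have L0: "0 <= L" using rho by (simp add: L_def)
 define A where "A = 3 + real_of_int L + real m * Clam ^ 3"
 have A1: "1 <= A" using L0 Clam_pos by (simp add: A_def)
 have main: "discrete_coeff M lam rho (c, r) (e, R) <= A * (1 + (SUM k:{1..n}. dens c (6 ^ k * r)))"
  if r: "0 < r" and R: "0 < R" and Rn: "R <= 6 ^ n * r" for c r e R n
 proof -
  define N where "N = coeff_index rho (c, r) (e, R)"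
  let ?d = "%k::int. dens c (rho powi k * r)"
  have d: "0 <= ?d k" "?d k <= 1" for k using dens_bounds[of "rho powi k * r" c] rho r by auto
  let ?A1 = "{- L..0}" and ?A2 = "{1..N - 1}"
  have "(\<Sum>k = - L..N. ?d k) <= (SUM k:?A1 Un (?A2 Un {N}). ?d k)"
   using d by (intro sum_mono2) auto
  also have "... <= (SUM k:?A1. ?d k) + (SUM k:?A2 Un {N}. ?d k)"
   using d by (intro sum_Un_le) auto
  also have "(SUM k:?A2 Un {N}. ?d k) <= (SUM k:?A2. ?d k) + (SUM k:{N}. ?d k)"
   using d by (intro sum_Un_le) auto
  also have "(SUM k:{N}. ?d k) <= 1" using d by simp
  also have "(SUM k:?A1. ?d k) <= (SUM k:?A1. 1)" by (intro sum_mono d)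
  also have "(SUM k:?A1. 1) = real_of_int L + 1" using L0 by simp
  also have "(SUM k:?A2. ?d k) <= real m * Clam ^ (3 * 1) * (SUM j:{1..int n}. dens c (6 powi j * r))"
  proof (rule base_change[OF rho])
   fix k assume k: "k : ?A2"
   have "0 < real_of_int k * log 6 rho" using k rho by (intro mult_pos_pos) auto
   moreover have "rho powi k * r < R"
   proof (rule ccontr)
    assume "~ rho powi k * r < R"
    hence "N <= k" unfolding N_def by (intro coeff_index_props(2)[OF rho r R]) simp
    thus False using k by simp
   qed
   hence "rho powi k * r < 6 ^ n * r" using Rn by linarith
   hence "rho powi k < 6 ^ n" using r by simp
   moreover have "(6::real) powi (\<lceil>real_of_int k * log 6 rho\<rceil> - 1) < rho powi k" using powi_ceiling(2)[OF rho, of 6 k] by simp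
   ultimately have "(6::real) powi (\<lceil>real_of_int k * log 6 rho\<rceil> - 1) < 6 powi (int n)" by simp
   hence "\<lceil>real_of_int k * log 6 rho\<rceil> - 1 < int n"
    by (metis linorder_not_le power_int_increasing numeral_le_iff one_le_numeral less_imp_le leD)
   thus "\<lceil>real_of_int k * log 6 rho\<rceil> : {1..int n}" using \<open>0 < real_of_int k * log 6 rho\<close> by simp
  qed (use m r in auto)
  also have "(SUM j:{1..int n}. dens c (6 powi j * r)) = (SUM k:{1..n}. dens c (6 ^ k * r))"
  proof -
   have "{1..int n} = int ` {1..n}" by (simp add: image_int_atLeastAtMost)
   thus ?thesis by (simp add: sum.reindex)
  qed
  finally have "discrete_coeff M lam rho (c, r) (e, R) <= 3 + real_of_int L + real m * Clam ^ 3 * (SUM k:{1..n}. dens c (6 ^ k * r))"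
   unfolding discrete_coeff_dens L_def[symmetric] N_def[symmetric] by simp
  also have "... <= A * (1 + (SUM k:{1..n}. dens c (6 ^ k * r)))"
  proof -
   have s0: "0 <= (SUM k:{1..n}. dens c (6 ^ k * r))" using dens_bounds(1) r by (intro sum_nonneg) auto
   have "real m * Clam ^ 3 * (SUM k:{1..n}. dens c (6 ^ k * r)) <= A * (SUM k:{1..n}. dens c (6 ^ k * r))"
    using s0 L0 by (intro mult_right_mono) (auto simp: A_def)
   moreover have "3 + real_of_int L <= A" using Clam_pos by (simp add: A_def)
   ultimately show ?thesis by (simp add: distrib_left)
  qed
  finally show ?thesis .
 qed
 show ?thesis using A1 main by blast
qed

lemma coeff_lower:
 assumes rho: "1 < rho"
 shows "EX A>=1. ALL c r e R n. 0 < r --> 0 < R --> 6 ^ n * r <= R -->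
   1 + (SUM k:{1..n}. dens c (6 ^ k * r)) <= A * discrete_coeff M lam rho (c, r) (e, R)"
proof -
 obtain q :: nat where q: "rho < 6 ^ q" using real_arch_pow[of 6 rho] by auto
 define A where "A = 1 + real q * Clam ^ (3 * q)"
 have A1: "1 <= A" using Clam_pos by (simp add: A_def)
 have main: "1 + (SUM k:{1..n}. dens c (6 ^ k * r)) <= A * discrete_coeff M lam rho (c, r) (e, R)"
  if r: "0 < r" and R: "0 < R" and Rn: "6 ^ n * r <= R" for c r e R n
 proof -
  define N where "N = coeff_index rho (c, r) (e, R)"
  have d: "0 <= dens c (rho powi k * r)" for k using dens_bounds[of "rho powi k * r" c] rho r by auto
  have "(SUM k:{1..n}. dens c (6 ^ k * r)) = (SUM j:{1..int n}. dens c (6 powi j * r))"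
  proof -
   have "{1..int n} = int ` {1..n}" by (simp add: image_int_atLeastAtMost)
   thus ?thesis by (simp add: sum.reindex)
  qed
  also have "... <= real q * Clam ^ (3 * q) * (SUM j:{1..N}. dens c (rho powi j * r))"
  proof (rule base_change[OF _ rho])
   fix k assume k: "k : {1..int n}"
   have "0 < real_of_int k * log rho 6" using k rho by (intro mult_pos_pos) auto
   moreover have "\<lceil>real_of_int k * log rho 6\<rceil> <= N"
   proof (rule ccontr)
    assume "~ \<lceil>real_of_int k * log rho 6\<rceil> <= N"
    hence "rho powi N <= rho powi (\<lceil>real_of_int k * log rho 6\<rceil> - 1)" using rho by (intro power_int_increasing) auto
    also have "... < 6 powi k" using powi_ceiling(2)[of 6 rho k] rho by simp
    also have "(6::real) powi k <= 6 powi (int n)" using k by (intro power_int_increasing) auto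
    finally have "rho powi N * r < 6 ^ n * r" using r by simp
    thus False using coeff_index_props(1)[OF rho r R, of c e] Rn unfolding N_def by linarith
   qed
   ultimately show "\<lceil>real_of_int k * log rho 6\<rceil> : {1..N}" by simp
  qed (use q r in auto)
  also have "(SUM j:{1..N}. dens c (rho powi j * r)) <= (\<Sum>j = - \<lfloor>log rho 2\<rfloor>..N. dens c (rho powi j * r))"
  proof -
   define L where "L = \<lfloor>log rho 2\<rfloor>"
   have "0 <= L" using rho by (simp add: L_def)
   thus ?thesis unfolding L_def[symmetric] using d by (intro sum_mono2) auto
  qed
  also have "... = discrete_coeff M lam rho (c, r) (e, R) - 1" unfolding discrete_coeff_dens N_def by simp
  finally have "(SUM k:{1..n}. dens c (6 ^ k * r)) <= real q * Clam ^ (3 * q) * (discrete_coeff M lam rho (c, r) (e, R) - 1)"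
   using Clam_pos by (simp add: mult_left_mono)
  moreover have "1 <= discrete_coeff M lam rho (c, r) (e, R)" unfolding discrete_coeff_dens using d by (simp add: sum_nonneg)
  moreover have "0 <= real q * Clam ^ (3 * q)" using Clam_pos by simp
  ultimately show ?thesis by (simp add: A_def algebra_simps)
 qed
 show ?thesis using A1 main by blast
qed

lemma coeff_ge_1: "1 < rho ==> 0 < r ==> 1 <= discrete_coeff M lam rho (c, r) (e, R)"
 unfolding discrete_coeff_dens using dens_bounds(1) by (simp add: sum_nonneg)

end

context nonhomogeneous_space
begin

text \<open>
The images of the means under \<phi> serve as means. This is applied to truncations of the symbol.
\<close>

lemma RBMO_bound_Lipschitz:
 assumes "RBMO_bound M lam gamma rho b C" and L: "!!z w. cmod (phi z - phi w) <= cmod (z - w)"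
 shows "RBMO_bound M lam gamma rho (%x. phi (b x)) C"
proof -
 have C: "0 < C" using assms by (simp add: RBMO_bound_def)
 obtain m where O: "!!B. is_ball B ==>
      (mass_on (ball_set B) (%x. b x - m B)) / emeasure M (ball_set (dilate rho B)) <= ennreal C"
  and K: "!!B S. is_ball B ==> is_ball S ==> subball B S ==> cmod (m B - m S) <= C * discrete_coeff M lam rho B S powr gamma"
  using assms(1) unfolding RBMO_bound_def by blast
 show ?thesis unfolding RBMO_bound_def
 proof (intro conjI exI[of _ "%B. phi (m B)"] allI impI C)
  fix B :: "'a ball_data" assume B: "is_ball B"
  have "mass_on (ball_set B) (%x. phi (b x) - phi (m B)) <= mass_on (ball_set B) (%x. b x - m B)"
   by (intro nn_integral_mono mult_right_mono ennreal_leI L) auto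
  thus "mass_on (ball_set B) (%x. phi (b x) - phi (m B)) / emeasure M (ball_set (dilate rho B)) <= ennreal C"
   using O[OF B] divide_right_mono_ennreal order_trans by blast
 next
  fix B S :: "'a ball_data" assume "is_ball B & is_ball S & subball B S"
  hence "cmod (m B - m S) <= C * discrete_coeff M lam rho B S powr gamma" using K by blast
  thus "cmod (phi (m B) - phi (m S)) <= C * discrete_coeff M lam rho B S powr gamma" using L order_trans by blast
 qed
qed

lemma RBMO_bound_scale:
 assumes [measurable]: "meas b" and "RBMO_bound M lam gamma rho b C"
 shows "RBMO_bound M lam gamma rho (%x. b x / of_real C) 1"
proof -
 have C: "0 < C" using assms by (simp add: RBMO_bound_def)
 obtain m where O: "!!B. is_ball B ==>
      (mass_on (ball_set B) (%x. b x - m B)) / emeasure M (ball_set (dilate rho B)) <= ennreal C"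
  and K: "!!B S. is_ball B ==> is_ball S ==> subball B S ==> cmod (m B - m S) <= C * discrete_coeff M lam rho B S powr gamma"
  using assms(2) unfolding RBMO_bound_def by blast
 show ?thesis unfolding RBMO_bound_def
 proof (intro conjI exI[of _ "%B. m B / of_real C"] allI impI)
  fix B :: "'a ball_data" assume B: "is_ball B"
  let ?I = "\<integral>\<^sup>+x\<in>ball_set B. nn (b x - m B) \<partial>M"
  let ?J = "\<integral>\<^sup>+x\<in>ball_set B. nn (b x / of_real C - m B / of_real C) \<partial>M"
  have "ennreal C * ?J <= ?I"
  proof -
   have "ennreal C * ?J <= ntot (%x. ennreal C * (nn (b x / of_real C - m B / of_real C) * indicator (ball_set B) x))"
    unfolding ball_set_def by (subst nn_integral_cmult) auto
   also have "... = ?I"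
   proof (intro nn_integral_cong)
    fix x
    have "cmod (b x / of_real C - m B / of_real C) = cmod (b x - m B) / C"
     using C by (simp add: diff_divide_distrib[symmetric] norm_divide)
    hence "ennreal C * nn (b x / of_real C - m B / of_real C) = nn (b x - m B)"
     using C by (simp add: ennreal_mult[symmetric])
    thus "ennreal C * (nn (b x / of_real C - m B / of_real C) * indicator (ball_set B) x) = nn (b x - m B) * indicator (ball_set B) x"
     by (simp add: mult.assoc[symmetric])
   qed
   finally show ?thesis .
  qed
  hence "ennreal C * ?J / emeasure M (ball_set (dilate rho B)) <= ennreal C"
   using O[OF B] divide_right_mono_ennreal order_trans by blast
  hence "ennreal C * (?J / emeasure M (ball_set (dilate rho B))) <= ennreal C * 1"
   by (simp add: ennreal_times_divide)
  thus "?J / emeasure M (ball_set (dilate rho B)) <= ennreal 1"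
   using C by (subst (asm) ennreal_mult_le_mult_iff) auto
 next
  fix B S :: "'a ball_data" assume "is_ball B & is_ball S & subball B S"
  hence "cmod (m B - m S) <= C * discrete_coeff M lam rho B S powr gamma" using K by blast
  thus "cmod (m B / of_real C - m S / of_real C) <= 1 * discrete_coeff M lam rho B S powr gamma"
   using C by (simp add: diff_divide_distrib[symmetric] norm_divide field_simps)
 qed simp
qed

text \<open>
The normal form in which RBMO is used: dilations are powers of 6, the exponent \<gamma> has disappeared,
and the comparison of means needs no inclusion of balls. The conditions on the means exclude balls of
measure zero, where the means carry no information.
\<close>

definition clean :: "nat => real => ('a => complex) => ('a \<times> real => complex) => bool" where
 "clean p A b m \<longleftrightarrow> meas b &
  (ALL c r. 0 < r --> mass_on (ball c r) (%x. b x - m (c, r)) <= ennreal (V c (6 ^ p * r))) &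
  (ALL c r n. 0 < r --> 0 < V c r --> cmod (m (c, r) - m (c, 6 ^ n * r)) <= A * (1 + (SUM k:{0..n}. dens c (6 ^ k * r)))) &
  (ALL c r e R. 0 < r --> 0 < R --> 0 < V c r --> 0 < V e R --> dist c e <= 36 * r --> R <= 36 * r --> r <= 36 * R -->
    cmod (m (c, r) - m (e, R)) <= A)"

text \<open>
Two constants that are both close to b on a ball of positive measure are close to each other.
\<close>

lemma const_diff_le:
 fixes a a' :: complex
 assumes [measurable]: "meas b" and v: "0 <= v" "0 <= v'"
  and 1: "mass_on (ball c r) (%x. b x - a) <= ennreal v" and 2: "mass_on (ball c r) (%x. b x - a') <= ennreal v'"
 shows "cmod (a - a') * V c r <= v + v'"
proof -
 have "ennreal (cmod (a - a') * V c r) = mass_on (ball c r) (%x. a - a')"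
  by (simp add: nn_integral_cmult emeasure_ball ennreal_mult)
 also have "... <= ntot (%x. nn (b x - a) * indicator (ball c r) x + nn (b x - a') * indicator (ball c r) x)"
 proof (intro nn_integral_mono)
  fix x
  have "cmod (a - a') <= cmod (b x - a) + cmod (b x - a')"
   using norm_triangle_ineq4[of "b x - a'" "b x - a"] by simp
  hence "nn (a - a') <= nn (b x - a) + nn (b x - a')"
   by (simp add: ennreal_plus[symmetric] ennreal_leI del: ennreal_plus)
  thus "nn (a - a') * indicator (ball c r) x <= nn (b x - a) * indicator (ball c r) x + nn (b x - a') * indicator (ball c r) x"
   by (cases "x : ball c r") auto
 qed
 also have "... <= ennreal v + ennreal v'" by (subst nn_integral_add) (auto intro: add_mono 1 2)
 finally show ?thesis using v by (simp add: ennreal_plus[symmetric] del: ennreal_plus)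
qed

text \<open>
Two means differ boundedly when the coefficient between their balls is bounded, since then so is its
power \<gamma>; comparable balls are of this kind. A long row of concentric balls is divided into
stretches over which the densities have a bounded sum, and the chain lemma, here with every index
admissible, adds up the differences.
\<close>

lemma RBMO_clean:
 assumes rho: "1 < rho" and gamma: "1 <= gamma"
 shows "EX p A. 0 < A & (ALL b:borel_measurable M. RBMO_bound M lam gamma rho b 1 --> (EX m. clean p A b m))"
proof -
 obtain p :: nat where p: "rho < 6 ^ p" using real_arch_pow[of 6 rho] by auto
 obtain A0 where A0: "1 <= A0" "!!c r e R n. 0 < r ==> 0 < R ==> R <= 6 ^ n * r ==>
   discrete_coeff M lam rho (c, r) (e, R) <= A0 * (1 + (SUM k:{1..n}. dens c (6 ^ k * r)))"
  using coeff_upper[OF rho] by blast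
 define Z where "Z s = 2 * (A0 * (1 + real p + s)) powr gamma + 2" for s
 have Zmono: "s <= s' ==> 0 <= s ==> Z s <= Z s'" for s s'
  unfolding Z_def using A0(1) gamma by (intro add_mono mult_left_mono powr_mono2 order_refl) auto
 have Z0: "2 <= Z s" for s unfolding Z_def by simp
 define A where "A = 2 * Z 7"
 have main: "EX m. clean p A b m" if bm: "meas b" and bd: "RBMO_bound M lam gamma rho b 1" for b
 proof -
  obtain m where O: "!!B. is_ball B ==>
      (mass_on (ball_set B) (%x. b x - m B)) / emeasure M (ball_set (dilate rho B)) <= ennreal 1"
   and K: "!!B S. is_ball B ==> is_ball S ==> subball B S ==> cmod (m B - m S) <= 1 * discrete_coeff M lam rho B S powr gamma"
   using bd unfolding RBMO_bound_def by blast
  have O': "mass_on (ball c r) (%x. b x - m (c, r)) <= ennreal (V c (rho * r))" if r: "0 < r" for c r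
  proof -
   let ?I = "\<integral>\<^sup>+x\<in>ball c r. nn (b x - m (c, r)) \<partial>M"
   have le: "?I / ennreal (V c (rho * r)) <= 1"
    using O[of "(c, r)"] r by (simp add: is_ball_def ball_set_def dilate_def emeasure_ball)
   have sub: "V c r <= V c (rho * r)" using r rho by (intro V_mono) simp
   show ?thesis
   proof (cases "V c (rho * r) = 0")
    case True
    hence "V c r = 0" using sub V_nonneg[of c r] by linarith
    hence "ball c r : null_sets M" by (auto simp: null_sets_def emeasure_ball)
    hence "?I = 0" by (rule nn_integral_null_set)
    thus ?thesis by simp
   next
    case False
    hence "0 < V c (rho * r)" using V_nonneg[of c "rho * r"] by linarith
    hence "?I = ?I / ennreal (V c (rho * r)) * ennreal (V c (rho * r))"
     by (simp add: ennreal_divide_times ennreal_mult_divide_eq)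
    also have "... <= 1 * ennreal (V c (rho * r))" by (intro mult_right_mono le) auto
    finally show ?thesis by simp
   qed
  qed
  have Kc: "cmod (m (x, s) - m (y, t)) <= X powr gamma"
   if "0 < s" "0 < t" "ball x s \<subseteq> ball y t" "ball x s ~= ball y t" "discrete_coeff M lam rho (x, s) (y, t) <= X" for x s y t X
  proof -
   have "cmod (m (x, s) - m (y, t)) <= discrete_coeff M lam rho (x, s) (y, t) powr gamma"
    using K[of "(x, s)" "(y, t)"] that by (simp add: is_ball_def subball_def ball_set_def)
   also have "... <= X powr gamma"
    using that(5) coeff_ge_1[OF rho that(1), of x y t] gamma by (intro powr_mono2) auto
   finally show ?thesis .
  qed
  have near: "cmod (m (c, r) - m (e, R)) <= Z (SUM k:{1..n}. dens c (6 ^ k * r))"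
   if r: "0 < r" "r <= R" "R <= 6 ^ n * r" and sub: "ball c r \<subseteq> ball e R" and V0: "0 < V c r" for c r e R n
  proof -
   let ?s = "SUM k:{1..n}. dens c (6 ^ k * r)"
   have R: "0 < R" using r by linarith
   have d: "0 <= dens y (6 ^ k * t)" "dens y (6 ^ k * t) <= 1" if "0 < t" for y k t
    using dens_bounds[of "6 ^ k * t" y] that by auto
   have s0: "0 <= ?s" using d(1) r by (intro sum_nonneg) auto
   define X where "X = A0 * (1 + real p + ?s)"
   have X1: "A0 * (1 + ?s) <= X" using A0(1) by (simp add: X_def)
   have X2: "A0 * (1 + (SUM k:{1..p}. dens y (6 ^ k * t))) <= X" if "0 < t" for y t
   proof -
    have "(SUM k:{1..p}. dens y (6 ^ k * t)) <= (SUM k:{1..p}. 1)" using d(2)[OF that] by (intro sum_mono) auto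
    thus ?thesis unfolding X_def using A0(1) s0 by (intro mult_left_mono) auto
   qed
   have X3: "A0 * (1 + (SUM k:{1..n+p}. dens c (6 ^ k * r))) <= X"
   proof -
    have "{1..n+p} = {1..n} Un {n+1..n+p}" by auto
    hence "(SUM k:{1..n+p}. dens c (6 ^ k * r)) = ?s + (SUM k:{n+1..n+p}. dens c (6 ^ k * r))"
     by (simp only:) (intro sum.union_disjoint, auto)
    also have "(SUM k:{n+1..n+p}. dens c (6 ^ k * r)) <= (SUM k:{n+1..n+p}. 1)" using d(2) r by (intro sum_mono) auto
    finally show ?thesis unfolding X_def using A0(1) by (intro mult_left_mono) auto
   qed
   have Rp: "rho * R <= 6 ^ p * R" "rho * r <= 6 ^ p * R" "rho * r <= 6 ^ p * r" "rho * R <= 6 ^ (n + p) * r"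
   proof -
    show 1: "rho * R <= 6 ^ p * R" "rho * r <= 6 ^ p * r" using p R r by (auto intro!: mult_right_mono)
    show "rho * r <= 6 ^ p * R" using 1 r rho mult_left_mono[of r R rho] by linarith
    have "6 ^ p * R <= 6 ^ p * (6 ^ n * r)" using r by (intro mult_left_mono) auto
    moreover have "6 ^ p * (6 ^ n * r) = 6 ^ (n + p) * r" by (simp add: power_add mult_ac)
    ultimately show "rho * R <= 6 ^ (n + p) * r" using 1(1) by linarith
   qed
   have X0: "0 <= X powr gamma" by simp
   have "cmod (m (c, r) - m (e, R)) <= 2 * X powr gamma + 2"
   proof (cases "ball c r = ball e R")
    case False
    have "cmod (m (c, r) - m (e, R)) <= X powr gamma"
     using order_trans[OF A0(2)[of r R n c e] X1] r R sub False by (intro Kc) auto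
    thus ?thesis using X0 by linarith
   next
    case eq: True
    show ?thesis
    proof (cases "ball e R = ball e (rho * R)")
     case False
     have ss: "ball e R \<subseteq> ball e (rho * R)" using R rho by (intro subset_ball) simp
     have "cmod (m (c, r) - m (e, rho * R)) <= X powr gamma"
      using order_trans[OF A0(2)[of r "rho * R" "n + p" c e] X3] r R rho Rp ss False eq by (intro Kc) auto
     moreover have "cmod (m (e, R) - m (e, rho * R)) <= X powr gamma"
      using order_trans[OF A0(2)[of R "rho * R" p e e] X2] r R rho Rp ss False by (intro Kc) auto
     ultimately show ?thesis using norm_triangle_ineq4[of "m (c, r) - m (e, rho * R)" "m (e, R) - m (e, rho * R)"] by simp
    next
     case eq2: True
     show ?thesis
     proof (cases "ball c r = ball c (rho * r)")
      case False
      have ss: "ball c r \<subseteq> ball c (rho * r)" using r rho by (intro subset_ball) simp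
      have "cmod (m (c, r) - m (c, rho * r)) <= X powr gamma"
      using order_trans[OF A0(2)[of r "rho * r" p c c] X2] r R rho Rp ss False by (intro Kc) auto
      moreover have "cmod (m (e, R) - m (c, rho * r)) <= X powr gamma"
      using order_trans[OF A0(2)[of R "rho * r" p e c] X2] r R rho Rp ss False eq by (intro Kc) auto
      ultimately show ?thesis using norm_triangle_ineq4[of "m (c, r) - m (c, rho * r)" "m (e, R) - m (c, rho * r)"] by simp
     next
      case eq3: True
      have v: "V c (rho * r) = V c r" "V e (rho * R) = V c r" using eq eq2 eq3 by (simp_all add: V_def)
      have "cmod (m (c, r) - m (e, R)) * V c r <= V c r + V c r"
      using O'[of r c] O'[of R e] r R unfolding v eq[symmetric] by (intro const_diff_le[OF bm]) auto
      hence "cmod (m (c, r) - m (e, R)) <= 2" using V0 by (simp add: mult_le_cancel_right flip: mult_2)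
      thus ?thesis using X0 by linarith
     qed
    qed
   qed
   thus ?thesis by (simp add: Z_def X_def)
  qed
  have d: "0 <= dens y (6 ^ k * t)" "dens y (6 ^ k * t) <= 1" if "0 < t" for y k t
   using dens_bounds[of "6 ^ k * t" y] that by auto
  have "clean p A b m"
   unfolding clean_def
  proof (intro conjI allI impI bm)
   fix c and r :: real assume r: "0 < r"
   have "rho * r <= 6 ^ p * r" using p r by (intro mult_right_mono) auto
   hence "ennreal (V c (rho * r)) <= ennreal (V c (6 ^ p * r))" by (intro ennreal_leI V_mono)
   thus "mass_on (ball c r) (%x. b x - m (c, r)) <= ennreal (V c (6 ^ p * r))"
    using O'[OF r, of c] by (rule order_trans[rotated])
  next
   fix c and r :: real and n assume r: "0 < r" and V0: "0 < V c r"
   let ?delta = "%k. dens c (6 ^ k * r)"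
   have two: "cmod (m (c, 6 ^ i * r) - m (c, 6 ^ j * r)) <= Z 7" if ij: "i <= j" and sm: "(SUM k:{i..j}. ?delta k) <= 4" for i j
   proof -
    have e: "6 ^ (j - i) * (6 ^ i * r) = 6 ^ j * r" using ij by (simp add: mult.assoc[symmetric] power_add[symmetric])
    have mono: "6 ^ i * r <= 6 ^ j * r" using ij r by (intro mult_right_mono power_increasing) auto
    have "V c (1 * r) <= V c (6 ^ i * r)" using r by (intro V_mono mult_right_mono one_le_power) auto
    hence "0 < V c (6 ^ i * r)" using V0 by simp
    hence "cmod (m (c, 6 ^ i * r) - m (c, 6 ^ j * r)) <= Z (SUM k:{1..j - i}. dens c (6 ^ k * (6 ^ i * r)))"
     using r mono e by (intro near subset_ball) auto
    also have "... <= Z 7"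
    proof (rule Zmono)
     have "(SUM k:{1..j - i}. dens c (6 ^ k * (6 ^ i * r))) = (SUM k:{1..j - i}. ?delta (k + i))"
      by (simp add: power_add mult_ac)
     also have "... = (SUM k:{1+i..j-i+i}. ?delta k)" by (rule sum.shift_bounds_cl_nat_ivl[symmetric])
     also have "... <= (SUM k:{i..j}. ?delta k)" using d r ij by (intro sum_mono2) auto
     finally show "(SUM k:{1..j - i}. dens c (6 ^ k * (6 ^ i * r))) <= 7" using sm by simp
     show "0 <= (SUM k:{1..j - i}. dens c (6 ^ k * (6 ^ i * r)))"
      using r by (intro sum_nonneg dens_bounds) auto
    qed
    finally show ?thesis .
   qed
   have "cmod (m (c, 6 ^ 0 * r) - m (c, 6 ^ n * r)) <= Z 7 * (1 + (SUM k:{0..n}. ?delta k))"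
   proof (rule chain_lemma[where P="%_. True" and g=0 and delta="?delta" and n=n and k=0 and
      R="%k kappa. cmod (m (c, 6 ^ k * r) - m (c, 6 ^ n * r)) <= Z 7 * kappa"])
    fix i j :: nat assume "i <= j" "!!k. i <= k ==> k < j ==> ~ True"
    hence "i = j" by (metis le_neq_implies_less order_refl)
    thus "(SUM k:{i..<j}. ?delta k) <= 0" by simp
   next
    fix k assume "k <= n" "(SUM k:{k..n}. ?delta k) <= 0 + 4"
    thus "cmod (m (c, 6 ^ k * r) - m (c, 6 ^ n * r)) <= Z 7 * 1" using two[of k n] by simp
   next
    fix k k' kappa assume *: "k < k'" "(SUM k:{k..k'}. ?delta k) <= 0 + 4" "cmod (m (c, 6 ^ k' * r) - m (c, 6 ^ n * r)) <= Z 7 * kappa"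
    hence "cmod (m (c, 6 ^ k * r) - m (c, 6 ^ k' * r)) <= Z 7" using two[of k k'] by simp
    thus "cmod (m (c, 6 ^ k * r) - m (c, 6 ^ n * r)) <= Z 7 * (kappa + 1)"
     using *(3) norm_triangle_ineq[of "m (c, 6 ^ k * r) - m (c, 6 ^ k' * r)" "m (c, 6 ^ k' * r) - m (c, 6 ^ n * r)"]
     by (simp add: distrib_left)
   next
    fix k kappa and kappa' :: real assume "cmod (m (c, 6 ^ k * r) - m (c, 6 ^ n * r)) <= Z 7 * kappa" "kappa <= kappa'"
    thus "cmod (m (c, 6 ^ k * r) - m (c, 6 ^ n * r)) <= Z 7 * kappa'"
     using Z0[of 7] mult_left_mono[of kappa kappa' "Z 7"] by linarith
   qed (use d r in auto)
   also have "... <= A * (1 + (SUM k:{0..n}. ?delta k))"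
   proof (rule mult_right_mono)
    show "Z 7 <= A" using Z0[of 7] by (simp add: A_def)
    show "0 <= 1 + (SUM k:{0..n}. ?delta k)" using d r by (intro add_nonneg_nonneg sum_nonneg) auto
   qed
   finally show "cmod (m (c, r) - m (c, 6 ^ n * r)) <= A * (1 + (SUM k:{0..n}. ?delta k))" by simp
  next
   fix c e and r R :: real
   assume r: "0 < r" "0 < R" "0 < V c r" "0 < V e R" "dist c e <= 36 * r" "R <= 36 * r" "r <= 36 * R"
   have bnd: "Z (SUM k:{1..n}. dens y (6 ^ k * t)) <= Z 7" if "n <= 7" "0 < t" for y t n
   proof (rule Zmono)
    have "(SUM k:{1..n}. dens y (6 ^ k * t)) <= (SUM k:{1..n}. 1)" using d(2) that by (intro sum_mono) auto
    thus "(SUM k:{1..n}. dens y (6 ^ k * t)) <= 7" using that by simp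
    show "0 <= (SUM k:{1..n}. dens y (6 ^ k * t))" using that by (intro sum_nonneg dens_bounds) auto
   qed
   have sub: "ball e R \<subseteq> ball c (6 ^ 3 * r)"
   proof
    fix y assume "y : ball e R"
    thus "y : ball c (6 ^ 3 * r)" using r dist_triangle[of c y e] by simp
   qed
   have "cmod (m (c, r) - m (c, 6 ^ 3 * r)) <= Z (SUM k:{1..3}. dens c (6 ^ k * r))"
    using r by (intro near subset_ball) auto
   moreover have "cmod (m (e, R) - m (c, 6 ^ 3 * r)) <= Z (SUM k:{1..5}. dens e (6 ^ k * R))"
    using r sub by (intro near) auto
   moreover note bnd[of 3 r c] bnd[of 5 R e] r
   ultimately show "cmod (m (c, r) - m (e, R)) <= A"
    using norm_triangle_ineq4[of "m (c, r) - m (c, 6 ^ 3 * r)" "m (e, R) - m (c, 6 ^ 3 * r)"] by (simp add: A_def)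
  qed
  thus ?thesis by blast
 qed
 have "0 < A" using Z0[of 7] by (simp add: A_def)
 thus ?thesis using main by blast
qed

end

section \<open>The John--Nirenberg inequality\<close>

lemma power_le_fact_exp: "0 <= x ==> x ^ n <= fact n * exp (x::real)"
proof -
 assume x: "0 <= x"
 have "(SUM k:{n}. x ^ k /\<^sub>R fact k) <= (\<Sum>k. x ^ k /\<^sub>R fact k)"
  using x by (intro sum_le_suminf summable_exp_generic) auto
 thus ?thesis by (simp add: exp_def field_simps)
qed

lemma summable_JN: "summable (%k::nat. ((real k + 1) * L) ^ n * (1/2) ^ k)"
proof -
 define a where "a = ln (3/2 :: real)"
 have a: "0 < a" "exp a = 3/2" by (auto simp: a_def)
 have le: "(real k + 1) ^ n <= (fact n / a ^ n * (3/2)) * (3/2) ^ k" for k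
 proof -
  have "(a * (real k + 1)) ^ n <= fact n * exp (a * (real k + 1))" using a by (intro power_le_fact_exp) auto
  also have "exp (a * (real k + 1)) = (3/2) ^ Suc k"
  proof -
   have "a * (real k + 1) = real (Suc k) * a" by simp
   thus ?thesis using exp_of_nat_mult[of "Suc k" a] a(2) by presburger
  qed
  finally have "a ^ n * (real k + 1) ^ n <= fact n * (3/2) ^ Suc k" by (simp add: power_mult_distrib)
  thus ?thesis using a by (simp add: field_simps)
 qed
 show ?thesis
 proof (rule summable_comparison_test')
  show "summable (%k. \<bar>L\<bar> ^ n * (fact n / a ^ n * (3/2)) * (3/4) ^ k :: real)"
   by (intro summable_mult summable_geometric) auto
  fix k :: nat
  have "norm (((real k + 1) * L) ^ n * (1/2) ^ k) = \<bar>L\<bar> ^ n * (real k + 1) ^ n * (1/2) ^ k"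
   by (simp add: abs_mult power_mult_distrib power_abs)
  also have "... <= \<bar>L\<bar> ^ n * ((fact n / a ^ n * (3/2)) * (3/2) ^ k) * (1/2) ^ k"
   using le[of k] by (intro mult_right_mono mult_left_mono) auto
  also have "... = \<bar>L\<bar> ^ n * (fact n / a ^ n * (3/2)) * ((3/2) ^ k * (1/2) ^ k)" by simp
  also have "(3/2) ^ k * (1/2) ^ k = (3/4 :: real) ^ k" by (simp add: power_mult_distrib[symmetric])
  finally show "norm (((real k + 1) * L) ^ n * (1/2) ^ k) <= \<bar>L\<bar> ^ n * (fact n / a ^ n * (3/2)) * (3/4) ^ k" .
 qed
qed

context nonhomogeneous_space
begin

lemma clean_meas: "clean p A b m ==> meas b" by (simp add: clean_def)

lemma clean_osc: "clean p A b m ==> 0 < r ==> mass_on (ball c r) (%x. b x - m (c, r)) <= ennreal (V c (6 ^ p * r))"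
 by (simp add: clean_def)

lemma clean_chain: "clean p A b m ==> 0 < r ==> 0 < V c r ==>
  cmod (m (c, r) - m (c, 6 ^ n * r)) <= A * (1 + (SUM k:{0..n}. dens c (6 ^ k * r)))"
 by (simp add: clean_def)

lemma clean_near: "clean p A b m ==> 0 < r ==> 0 < R ==> 0 < V c r ==> 0 < V e R ==> dist c e <= 36 * r ==> R <= 36 * r ==> r <= 36 * R ==>
    cmod (m (c, r) - m (e, R)) <= A"
 by (simp add: clean_def)

lemma clean_shift:
 assumes cl: "clean p A b m" and r: "0 < r"
 shows "mass_on (ball c r) (%x. b x - a) <= ennreal (V c (6 ^ p * r) + cmod (m (c, r) - a) * V c r)"
proof -
 have [measurable]: "meas b" using cl by (rule clean_meas)
 have "mass_on (ball c r) (%x. b x - a) <= ntot (%x. nn (b x - m (c, r)) * indicator (ball c r) x + nn (m (c, r) - a) * indicator (ball c r) x)"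
 proof (intro nn_integral_mono)
  fix x
  have "cmod (b x - a) <= cmod (b x - m (c, r)) + cmod (m (c, r) - a)"
   using norm_triangle_ineq[of "b x - m (c, r)" "m (c, r) - a"] by simp
  hence "nn (b x - a) <= nn (b x - m (c, r)) + nn (m (c, r) - a)"
   by (simp add: ennreal_plus[symmetric] ennreal_leI del: ennreal_plus)
  thus "nn (b x - a) * indicator (ball c r) x <= nn (b x - m (c, r)) * indicator (ball c r) x + nn (m (c, r) - a) * indicator (ball c r) x"
   by (cases "x : ball c r") auto
 qed
 also have "... <= ennreal (V c (6 ^ p * r)) + ennreal (cmod (m (c, r) - a) * V c r)"
  by (subst nn_integral_add) (auto intro!: add_mono clean_osc[OF cl r] simp: nn_integral_cmult emeasure_ball ennreal_mult)
 finally show ?thesis by simp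
qed

text \<open>
The stopping balls for |b - m| at a level that is twice the mean oscillation have a total measure, after
dilation, of at most half that of the given ball. Outside them b - m is bounded; inside, passing to the
mean of the stopping ball costs a constant, because the dilate of a stopping ball has a small average,
and the hypothesis for the level k applies.
\<close>

lemma JN_step:
 fixes beta A
 assumes beta: "dbl (p + 3) beta" and A: "0 < A"
 defines "C1 \<equiv> 1 + A"
 defines "tau \<equiv> 2 * C1"
 defines "C2 \<equiv> A * (real (p + 3) + 2) + (tau + 1) * beta + A"
 defines "Lambda \<equiv> 2 * tau * beta + C2"
 assumes cl: "clean p A b m" and r0: "0 < r0" and k: "0 <= k"
  and IH: "!!c r. 0 < r ==> emeasure M {x : ball c r. k * Lambda < cmod (b x - m (c, r))} <= ennreal (kappa * V c (6 ^ (p + 1) * r))"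
  and kappa: "0 <= kappa"
 shows "emeasure M {x : ball c0 r0. (k + 1) * Lambda < cmod (b x - m (c0, r0))} <= ennreal (kappa / 2 * V c0 (6 ^ (p + 1) * r0))"
proof (cases "V c0 r0 = 0")
 case True
 have "emeasure M {x : ball c0 r0. (k + 1) * Lambda < cmod (b x - m (c0, r0))} <= emeasure M (ball c0 r0)"
  by (intro emeasure_mono) auto
 thus ?thesis using True by (simp add: emeasure_ball)
next
 case False
 hence V0: "0 < V c0 r0" using V_nonneg[of c0 r0] by linarith
 have [measurable]: "meas b" using cl by (rule clean_meas)
 have beta1: "1 <= beta" and beta2: "2 * Clam ^ (3 * (p + 3)) <= beta" using beta by (auto simp: dbl_def)
 have C1: "1 <= C1" and tau: "0 < tau" using A by (auto simp: C1_def tau_def)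
 have Lambda: "2 * tau * beta <= Lambda" "C2 <= Lambda" "0 <= Lambda" using A tau beta1 by (auto simp: Lambda_def C2_def)
 let ?m0 = "m (c0, r0)"
 define F where "F x = nn (b x - ?m0) * indicator (ball c0 (6 * r0)) x" for x
 have Fm[measurable]: "meas F" unfolding F_def by measurable
 have intF: "ntot F <= ennreal (C1 * V c0 (6 ^ (p + 1) * r0))"
 proof -
  have V6: "V c0 r0 <= V c0 (6 * r0)" "V c0 (6 * r0) <= V c0 (6 ^ (p + 1) * r0)"
   using r0 by (auto intro!: V_mono)
  have "ntot F <= ennreal (V c0 (6 ^ p * (6 * r0)) + cmod (m (c0, 6 * r0) - ?m0) * V c0 (6 * r0))"
   unfolding F_def using r0 by (intro clean_shift[OF cl]) auto
  also have "... <= ennreal (C1 * V c0 (6 ^ (p + 1) * r0))"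
  proof (intro ennreal_leI)
   have "cmod (m (c0, 6 * r0) - ?m0) <= A" using r0 V0 V6 by (intro clean_near[OF cl]) auto
   hence "cmod (m (c0, 6 * r0) - ?m0) * V c0 (6 * r0) <= A * V c0 (6 ^ (p + 1) * r0)"
    using V6 A by (intro mult_mono) auto
   thus "V c0 (6 ^ p * (6 * r0)) + cmod (m (c0, 6 * r0) - ?m0) * V c0 (6 * r0) <= C1 * V c0 (6 ^ (p + 1) * r0)"
    by (simp add: C1_def algebra_simps)
  qed
  finally show ?thesis .
 qed
 have large: "int_on (ball x r) F <= ennreal (tau * V x (6 ^ (p + 2) * r))" if x: "x : ball c0 r0" and r: "r0 <= r" for x r
 proof -
  have "int_on (ball x r) F <= ntot F" by (intro nn_integral_mono) (auto simp: indicator_def)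
  also note intF
  also have "ennreal (C1 * V c0 (6 ^ (p + 1) * r0)) <= ennreal (tau * V x (6 ^ (p + 2) * r))"
  proof (intro ennreal_leI mult_mono)
   have "(1::real) <= 6 ^ (p + 1)" by (rule one_le_power) simp
   hence "1 * r <= 6 ^ (p + 1) * r" "6 ^ (p + 1) * r0 <= 6 ^ (p + 1) * r"
    using r r0 by (auto intro!: mult_right_mono mult_left_mono)
   hence "dist c0 x + 6 ^ (p + 1) * r0 <= 2 * (6 ^ (p + 1) * r)" using x r unfolding mem_ball by linarith
   also have "... <= 6 ^ (p + 2) * r" using r r0 by simp
   finally have "dist c0 x + 6 ^ (p + 1) * r0 <= 6 ^ (p + 2) * r" .
   thus "V c0 (6 ^ (p + 1) * r0) <= V x (6 ^ (p + 2) * r)" by (rule V_near)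
   show "C1 <= tau" using C1 by (simp add: tau_def)
  qed (use tau in auto)
  finally show ?thesis .
 qed
 have dd: "AE x in M. ALL m. EX i>=m. V x (6 ^ (p + 3) * (r0 / 6 ^ i)) <= beta * V x (r0 / 6 ^ i)"
  using beta r0 by (simp add: dbl_def)
 have "EX c s. CZ_balls (p + 2) r0 (ball c0 r0) tau (2 * tau * beta) F c s"
  by (intro CZ_covering[OF Fm r0 tau beta1 dd] large) simp_all
 then obtain c s where cz: "CZ_balls (p + 2) r0 (ball c0 r0) tau (2 * tau * beta) F c s" by blast
 note s = CZ_ballsD(1,2)[OF cz] and ci = CZ_ballsD(3)[OF cz] and av = CZ_ballsD(4)[OF cz] and up = CZ_ballsD(5)[OF cz] and good = CZ_ballsD(6)[OF cz]
 have comp: "cmod (m (c i, 6 * s i) - ?m0) <= C2" if si: "0 < s i" for i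
 proof -
  let ?D = "%j. 6 ^ j * s i"
  have Vs: "0 < V (c i) (s i)" by (rule CZ_balls_pos[OF cz si])
  have VD: "0 < V (c i) (?D j)" for j
  proof -
   have "V (c i) (1 * s i) <= V (c i) (?D j)" using si by (intro V_mono mult_right_mono one_le_power) auto
   thus ?thesis using Vs by simp
  qed
  have d: "0 <= dens (c i) (?D j)" "dens (c i) (?D j) <= 1" for j using dens_bounds[of "?D j" "c i"] si by auto
  have link: "cmod (m (c i, 6 * s i) - m (c i, ?D n)) <= A * (real (p + 3) + 2)"
   if n: "1 <= n" and sm: "(SUM k:{1..<n}. dens (c i) (?D k)) <= real (p + 3)" for n
  proof -
   have e: "6 ^ (n - 1) * (6 * s i) = ?D n" using n by (cases n) auto
   have "cmod (m (c i, 6 * s i) - m (c i, 6 ^ (n - 1) * (6 * s i))) <= A * (1 + (SUM k:{0..n - 1}. dens (c i) (6 ^ k * (6 * s i))))"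
    using si VD[of 1] by (intro clean_chain[OF cl]) auto
   also have "(SUM k:{0..n - 1}. dens (c i) (6 ^ k * (6 * s i))) = (SUM k:{0..<n}. dens (c i) (?D (k + 1)))"
    using n by (intro sum.cong) (auto simp: mult_ac)
   also have "... = (SUM k:{0+1..<n+1}. dens (c i) (?D k))" by (rule sum.shift_bounds_nat_ivl[symmetric])
   also have "... = (SUM k:{1..<n}. dens (c i) (?D k)) + dens (c i) (?D n)" using n by simp
   also have "A * (1 + ...) <= A * (real (p + 3) + 2)" using sm d(2)[of n] A by (intro mult_left_mono) auto
   finally show ?thesis unfolding e .
  qed
  obtain N where N: "1 <= N" "V (c i) (6 ^ (N + (p + 3)) * s i) <= beta * V (c i) (6 ^ N * s i)"
   "(SUM k:{1..<N}. dens (c i) (?D k)) <= real (p + 3)"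
   using first_doubling[OF si beta2 Vs, of 1] by auto
  obtain l where l: "6 ^ l * s i < r0" "r0 <= 6 ^ Suc l * s i" using scale_index'[OF si s(2)[of i]] by blast
  have dc: "dist (c i) c0 < r0" using ci[OF si] by (simp add: dist_commute)
  show ?thesis
  proof (cases "N <= l")
   case True
   have "6 ^ N * s i <= 6 ^ l * s i" using True si by (intro mult_right_mono power_increasing) auto
   hence DN: "?D N < r0" using l by linarith
   have sub: "ball (c i) (?D N) \<subseteq> ball c0 (6 * r0)"
   proof
    fix y assume "y : ball (c i) (?D N)"
    thus "y : ball c0 (6 * r0)" using DN dc r0 dist_triangle[of c0 y "c i"] by (simp add: dist_commute)
   qed
   have "mass_on (ball (c i) (?D N)) (%x. b x - ?m0) = int_on (ball (c i) (?D N)) F"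
    using sub by (intro nn_integral_cong) (auto simp: F_def indicator_def)
   also have "... <= ennreal (tau * V (c i) (6 ^ (N + (p + 2)) * s i))" using up[OF si N(1)] .
   also have "... <= ennreal (tau * (beta * V (c i) (?D N)))"
   proof (intro ennreal_leI mult_left_mono)
    have "V (c i) (6 ^ (N + (p + 2)) * s i) <= V (c i) (6 ^ (N + (p + 3)) * s i)"
     using si by (intro V_mono mult_right_mono power_increasing) auto
    thus "V (c i) (6 ^ (N + (p + 2)) * s i) <= beta * V (c i) (?D N)" using N(2) by linarith
   qed (use tau in auto)
   finally have i1: "mass_on (ball (c i) (?D N)) (%x. b x - ?m0) <= ennreal (tau * (beta * V (c i) (?D N)))" .
   have "mass_on (ball (c i) (?D N)) (%x. b x - m (c i, ?D N)) <= ennreal (V (c i) (6 ^ p * ?D N))"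
    using si by (intro clean_osc[OF cl]) auto
   also have "... <= ennreal (beta * V (c i) (?D N))"
   proof (intro ennreal_leI)
    have "V (c i) (6 ^ (p + N) * s i) <= V (c i) (6 ^ (N + (p + 3)) * s i)"
     using si by (intro V_mono mult_right_mono power_increasing) auto
    thus "V (c i) (6 ^ p * ?D N) <= beta * V (c i) (?D N)" using N(2) by (simp add: power_add mult.assoc)
   qed
   finally have i2: "mass_on (ball (c i) (?D N)) (%x. b x - m (c i, ?D N)) <= ennreal (beta * V (c i) (?D N))" .
   have "cmod (m (c i, ?D N) - ?m0) * V (c i) (?D N) <= beta * V (c i) (?D N) + tau * (beta * V (c i) (?D N))"
    using i1 i2 beta1 tau by (intro const_diff_le) auto
   also have "... = (tau + 1) * beta * V (c i) (?D N)" by (simp add: algebra_simps)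
   finally have "cmod (m (c i, ?D N) - ?m0) <= (tau + 1) * beta" using VD[of N] by simp
   thus ?thesis using link[OF N(1,3)] A norm_triangle_ineq[of "m (c i, 6 * s i) - m (c i, ?D N)" "m (c i, ?D N) - ?m0"]
    by (simp add: C2_def)
  next
   case False
   have "(SUM k:{1..<Suc l}. dens (c i) (?D k)) <= (SUM k:{1..<N}. dens (c i) (?D k))"
    using False d by (intro sum_mono2) auto
   hence "cmod (m (c i, 6 * s i) - m (c i, ?D (Suc l))) <= A * (real (p + 3) + 2)"
    using N(3) by (intro link) auto
   moreover have "cmod (m (c i, ?D (Suc l)) - ?m0) <= A"
   proof (intro clean_near[OF cl] VD V0 r0)
    have "6 ^ Suc l * s i = 6 * (6 ^ l * s i)" by simp
    thus "dist (c i) c0 <= 36 * (6 ^ Suc l * s i)" "r0 <= 36 * (6 ^ Suc l * s i)" "6 ^ Suc l * s i <= 36 * r0"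
     using l dc r0 by linarith+
    show "0 < 6 ^ Suc l * s i" using si by simp
   qed
   moreover have "0 <= (tau + 1) * beta" using tau beta1 by simp
   ultimately show ?thesis using norm_triangle_ineq[of "m (c i, 6 * s i) - m (c i, ?D (Suc l))" "m (c i, ?D (Suc l)) - ?m0"]
    by (simp add: C2_def)
  qed
 qed
 define E where "E i = (if 0 < s i then {x : ball (c i) (6 * s i). k * Lambda < cmod (b x - m (c i, 6 * s i))} else {})" for i
 have sets0: "{x : ball e R. t < cmod (b x - a)} : sets M" for e R t a
 proof -
  have "{x : space M. x : ball e R & t < cmod (b x - a)} : sets M" by measurable
  thus ?thesis by simp
 qed
 have Es[measurable]: "E i : sets M" for i unfolding E_def using sets0 by auto
 have "emeasure M {x : ball c0 r0. (k + 1) * Lambda < cmod (b x - ?m0)} <= emeasure M (UN i. E i)"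
 proof (rule emeasure_mono_AE)
  show "AE x in M. x : {x : ball c0 r0. (k + 1) * Lambda < cmod (b x - ?m0)} --> x : (UN i. E i)"
   using good
  proof eventually_elim
   fix x assume g: "x : ball c0 r0 --> x ~: (UN i. ball (c i) (6 * s i)) --> F x <= ennreal (2 * tau * beta)"
   show "x : {x : ball c0 r0. (k + 1) * Lambda < cmod (b x - ?m0)} --> x : (UN i. E i)"
   proof
    assume "x : {x : ball c0 r0. (k + 1) * Lambda < cmod (b x - ?m0)}"
    hence x: "x : ball c0 r0" "(k + 1) * Lambda < cmod (b x - ?m0)" by auto
    have "0 <= k * Lambda" using k Lambda by simp
    hence big: "2 * tau * beta < cmod (b x - ?m0)" using x(2) Lambda(1) by (simp add: distrib_right)
    have "x : (UN i. ball (c i) (6 * s i))"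
    proof (rule ccontr)
     assume "x ~: (UN i. ball (c i) (6 * s i))"
     hence "F x <= ennreal (2 * tau * beta)" using g x by blast
     moreover have "x : ball c0 (6 * r0)" using x(1) r0 by simp
     ultimately have "cmod (b x - ?m0) <= 2 * tau * beta" using tau beta1 by (simp add: F_def)
     thus False using big by linarith
    qed
    then obtain i where i: "x : ball (c i) (6 * s i)" by blast
    hence si: "0 < s i" using s(1)[of i] by (cases "s i = 0") auto
    have "cmod (b x - ?m0) <= cmod (b x - m (c i, 6 * s i)) + C2"
     using comp[OF si] norm_triangle_ineq[of "b x - m (c i, 6 * s i)" "m (c i, 6 * s i) - ?m0"] by simp
    hence "k * Lambda < cmod (b x - m (c i, 6 * s i))" using x(2) Lambda(2) by (simp add: distrib_right)
    hence "x : E i" using i si by (simp add: E_def)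
    thus "x : (UN i. E i)" by blast
   qed
  qed
 qed auto
 also have "... <= (\<Sum>i. emeasure M (E i))" by (intro emeasure_subadditive_countably) auto
 also have "... <= (\<Sum>i. ennreal (kappa / tau) * int_on (ball (c i) (s i)) F)"
 proof (intro suminf_le)
  fix i
  show "emeasure M (E i) <= ennreal (kappa / tau) * int_on (ball (c i) (s i)) F"
  proof (cases "0 < s i")
   case True
   hence "emeasure M (E i) <= ennreal (kappa * V (c i) (6 ^ (p + 1) * (6 * s i)))"
    using IH[of "6 * s i" "c i"] by (simp add: E_def)
   also have "... = ennreal (kappa / tau) * ennreal (tau * V (c i) (6 ^ (p + 2) * s i))"
    using tau kappa by (simp add: ennreal_mult[symmetric] mult_ac)
   also have "... <= ennreal (kappa / tau) * int_on (ball (c i) (s i)) F"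
    using av[OF True] by (intro mult_left_mono) auto
   finally show ?thesis .
  qed (auto simp: E_def)
 qed auto
 also have "... = ennreal (kappa / tau) * (\<Sum>i. \<integral>\<^sup>+y. F y * indicator (ball (c i) (s i)) y \<partial>M)"
  by (rule ennreal_suminf_cmult)
 also have "... <= ennreal (kappa / tau) * ntot F" by (rule mult_left_mono[OF CZ_balls_sum[OF cz Fm]]) simp
 also note intF
 also have "ennreal (kappa / tau) * ennreal (C1 * V c0 (6 ^ (p + 1) * r0)) = ennreal (kappa / 2 * V c0 (6 ^ (p + 1) * r0))"
  using kappa tau C1 by (subst ennreal_mult[symmetric]) (auto simp: tau_def)
 finally show ?thesis by (simp add: mult_left_mono)
qed

text \<open>The step is iterated, and the resulting exponential decay is summed against powers.\<close>

lemma John_Nirenberg: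
 assumes A: "0 < A" and n: "1 <= n"
 shows "EX C>0. ALL b m c r. clean p A b m --> 0 < r -->
   (int_on (ball c r) (%x. ennreal (cmod (b x - m (c, r)) ^ n))) <= ennreal (C * V c (6 ^ (p + 1) * r))"
proof -
 obtain beta where beta: "dbl (p + 3) beta" using dbl_exists by blast
 have beta1: "1 <= beta" using beta by (simp add: dbl_def)
 define tau where "tau = 2 * (1 + A)"
 define Lambda where "Lambda = 2 * tau * beta + (A * (real (p + 3) + 2) + (tau + 1) * beta + A)"
 have Lambda: "0 < Lambda" unfolding Lambda_def tau_def using A beta1 by (intro add_pos_pos mult_pos_pos) auto
 have tail: "emeasure M {x : ball c r. real k * Lambda < cmod (b x - m (c, r))} <= ennreal ((1/2) ^ k * V c (6 ^ (p + 1) * r))"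
  if cl: "clean p A b m" and r: "0 < r" for b m c r k
  using r
 proof (induction k arbitrary: c r)
  case 0
  have "emeasure M {x : ball c r. real 0 * Lambda < cmod (b x - m (c, r))} <= emeasure M (ball c r)"
   by (intro emeasure_mono) auto
  also have "... <= ennreal ((1/2) ^ 0 * V c (6 ^ (p + 1) * r))"
  proof -
   have "1 * r <= 6 ^ (p + 1) * r" using 0 by (intro mult_right_mono one_le_power) auto
   thus ?thesis by (simp add: emeasure_ball V_mono ennreal_leI del: power_Suc)
  qed
  finally show ?case .
 next
  case (Suc k)
  have "emeasure M {x : ball c r. (real k + 1) * Lambda < cmod (b x - m (c, r))} <= ennreal ((1/2) ^ k / 2 * V c (6 ^ (p + 1) * r))"
   unfolding Lambda_def tau_def using Suc(1) unfolding Lambda_def tau_def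
   by (intro JN_step[OF beta A cl Suc(2)]) auto
  thus ?case by (simp add: add.commute)
 qed
 define C where "C = (\<Sum>k. ((real k + 1) * Lambda) ^ n * (1/2) ^ k) + 1"
 have C0: "0 <= (\<Sum>k. ((real k + 1) * Lambda) ^ n * (1/2) ^ k)"
  using Lambda by (intro suminf_nonneg summable_JN) auto
 have main: "int_on (ball c r) (%x. ennreal (cmod (b x - m (c, r)) ^ n)) <= ennreal (C * V c (6 ^ (p + 1) * r))"
  if cl: "clean p A b m" and r: "0 < r" for b m c r
 proof -
  have [measurable]: "meas b" using cl by (rule clean_meas)
  define S where "S k = {x : ball c r. real k * Lambda < cmod (b x - m (c, r))}" for k :: nat
  have Ss[measurable]: "S k : sets M" for k
  proof -
   have "{x : space M. x : ball c r & real k * Lambda < cmod (b x - m (c, r))} : sets M" by measurable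
   thus ?thesis by (simp add: S_def)
  qed
  have "int_on (ball c r) (%x. ennreal (cmod (b x - m (c, r)) ^ n)) <= ntot (%x. (\<Sum>k. ennreal (((real k + 1) * Lambda) ^ n) * indicator (S k) x))"
  proof (intro nn_integral_mono)
   fix x
   let ?y = "cmod (b x - m (c, r))"
   show "ennreal (?y ^ n) * indicator (ball c r) x <= (\<Sum>k. ennreal (((real k + 1) * Lambda) ^ n) * indicator (S k) x)"
   proof (cases "x : ball c r & 0 < ?y")
    case True
    define k where "k = nat (\<lceil>?y / Lambda\<rceil> - 1)"
    have "0 < ?y / Lambda" using True Lambda by (intro divide_pos_pos) auto
    hence "real k = real_of_int \<lceil>?y / Lambda\<rceil> - 1" unfolding k_def by simp
    hence "real k < ?y / Lambda" "?y / Lambda <= real k + 1" by linarith+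
    hence k: "real k * Lambda < ?y" "?y <= (real k + 1) * Lambda" using Lambda by (simp_all add: field_simps)
    define f where "f k = ennreal (((real k + 1) * Lambda) ^ n) * indicator (S k) x" for k
    have "ennreal (?y ^ n) * indicator (ball c r) x <= f k"
     using True k by (auto simp: S_def f_def intro!: ennreal_leI power_mono)
    also have "... <= (\<Sum>k. f k)" using sum_le_suminf[of f "{k}"] by simp
    finally show ?thesis by (simp add: f_def)
   next
    case False
    hence z: "ennreal (?y ^ n) * indicator (ball c r) x = 0" using n by auto
    show ?thesis unfolding z by simp
   qed
  qed
  also have "... = (\<Sum>k. ennreal (((real k + 1) * Lambda) ^ n) * emeasure M (S k))"
   by (subst nn_integral_suminf) (auto simp: nn_integral_cmult)
  also have "... <= (\<Sum>k. ennreal (((real k + 1) * Lambda) ^ n) * ennreal ((1/2) ^ k * V c (6 ^ (p + 1) * r)))"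
   using tail[OF cl r] unfolding S_def by (intro suminf_le mult_left_mono) auto
  also have "... = (\<Sum>k. ennreal (((real k + 1) * Lambda) ^ n * (1/2) ^ k * V c (6 ^ (p + 1) * r)))"
   using Lambda by (simp add: ennreal_mult[symmetric] mult.assoc)
  also have "... = ennreal ((\<Sum>k. ((real k + 1) * Lambda) ^ n * (1/2) ^ k) * V c (6 ^ (p + 1) * r))"
   using Lambda by (intro suminf_ennreal_eq sums_mult2 summable_sums summable_JN) auto
  also have "... <= ennreal (C * V c (6 ^ (p + 1) * r))" by (intro ennreal_leI mult_right_mono) (auto simp: C_def)
  finally show ?thesis .
 qed
 have "0 < C" using C0 by (simp add: C_def)
 thus ?thesis using main by blast
qed

end

section \<open>Mean-zero blocks on linked balls\<close>

lemma Young_simple: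
 fixes x y :: real
 assumes "0 <= x" "0 <= y" "2 <= n"
 shows "x * y <= x ^ n + y powr (real n / (real n - 1))"
proof (cases "y <= x ^ (n - 1)")
 case True
 hence "x * y <= x * x ^ (n - 1)" using assms by (intro mult_left_mono) auto
 also have "... = x ^ n" using assms by (cases n) auto
 finally show ?thesis by (simp add: add_increasing2)
next
 case False
 hence y: "0 < y" using assms by (smt (verit) zero_le_power)
 show ?thesis
 proof (cases "x = 0")
  case True thus ?thesis by simp
 next
  case x0: False
  hence x: "0 < x" using assms by simp
  have n1: "real (n - 1) = real n - 1" using assms by simp
  have "x = (x ^ (n - 1)) powr (1 / (real n - 1))"
   using x assms by (simp add: powr_realpow[symmetric] powr_powr n1)
  also have "... <= y powr (1 / (real n - 1))" using False assms by (intro powr_mono2) auto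
  finally have "x * y <= y powr (1 / (real n - 1)) * y powr 1" using y by (intro mult_mono) auto
  also have "... = y powr (1 / (real n - 1) + 1)" by (simp add: powr_add)
  also have "1 / (real n - 1) + 1 = real n / (real n - 1)" using assms by (simp add: field_simps)
  finally show ?thesis using assms by (simp add: add_increasing)
 qed
qed

lemma add_power_le:
 fixes x y :: real
 assumes "0 <= x" "0 <= y"
 shows "(x + y) ^ n <= 2 ^ n * (x ^ n + y ^ n)"
proof -
 have "(x + y) ^ n <= (2 * max x y) ^ n" using assms by (intro power_mono) auto
 also have "... = 2 ^ n * (max x y) ^ n" by (simp add: power_mult_distrib)
 also have "(max x y) ^ n <= x ^ n + y ^ n" using assms by (auto simp: max_def)
 finally show ?thesis by simp
qed

lemma le_one_plus_powr: "0 <= y ==> a <= b ==> 0 <= a ==> y powr a <= 1 + y powr (b::real)"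
proof (cases "y <= 1")
 case True
 assume "0 <= y" "a <= b" "0 <= a"
 hence "y powr a <= 1 powr a" using True by (intro powr_mono2) auto
 thus ?thesis by (simp add: add_increasing2)
next
 case False
 assume "0 <= y" "a <= b" "0 <= a"
 hence "y powr a <= y powr b" using False by (intro powr_mono) auto
 thus ?thesis by simp
qed

context nonhomogeneous_space
begin

abbreviation npow :: "real => ('a => complex) => real" where
 "npow q f \<equiv> \<integral>x. cmod (f x) powr q \<partial>M"

lemma nn_npow: "bfun f ==> 0 <= q ==> ntot (%x. ennreal (cmod (f x) powr q)) = ennreal (npow q f)"
 using bfun_powr_integrable[of f q] by (intro nn_integral_eq_integral) auto

text \<open>Higher moments around a constant that is not the mean, by convexity of powers.\<close>

lemma clean_power_shift:
 assumes cl: "clean p A b m" and r: "0 < r"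
  and CJ: "int_on (ball c r) (%x. ennreal (cmod (b x - m (c, r)) ^ n)) <= ennreal (CJ * V c (6 ^ (p + 1) * r))" and CJ0: "0 <= CJ"
  and D: "cmod (m (c, r) - a) <= D"
 shows "int_on (ball c r) (%x. ennreal (cmod (b x - a) ^ n)) <= ennreal (2 ^ n * (CJ + D ^ n) * V c (6 ^ (p + 1) * r))"
proof -
 have [measurable]: "meas b" using cl by (rule clean_meas)
 have D0: "0 <= D" using D norm_ge_zero order_trans by blast
 have "int_on (ball c r) (%x. ennreal (cmod (b x - a) ^ n)) <=
   (ntot (%x. ennreal (2 ^ n) * (ennreal (cmod (b x - m (c, r)) ^ n) * indicator (ball c r) x + ennreal (D ^ n) * indicator (ball c r) x)))"
 proof (intro nn_integral_mono)
  fix x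
  have "cmod (b x - a) <= cmod (b x - m (c, r)) + D"
   using D norm_triangle_ineq[of "b x - m (c, r)" "m (c, r) - a"] by simp
  hence "cmod (b x - a) ^ n <= (cmod (b x - m (c, r)) + D) ^ n" by (intro power_mono) auto
  also have "... <= 2 ^ n * (cmod (b x - m (c, r)) ^ n + D ^ n)" using D0 by (intro add_power_le) auto
  finally have "ennreal (cmod (b x - a) ^ n) <= ennreal (2 ^ n * (cmod (b x - m (c, r)) ^ n + D ^ n))" by (rule ennreal_leI)
  also have "... = ennreal (2 ^ n) * (ennreal (cmod (b x - m (c, r)) ^ n) + ennreal (D ^ n))"
   using D0 by (simp add: ennreal_mult ennreal_plus)
  finally show "ennreal (cmod (b x - a) ^ n) * indicator (ball c r) x <= ennreal (2 ^ n) * (ennreal (cmod (b x - m (c, r)) ^ n) * indicator (ball c r) x + ennreal (D ^ n) * indicator (ball c r) x)"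
   by (cases "x : ball c r") auto
 qed
 also have "... = ennreal (2 ^ n) * (int_on (ball c r) (%x. ennreal (cmod (b x - m (c, r)) ^ n)) + ennreal (D ^ n) * emeasure M (ball c r))"
  by (subst nn_integral_cmult) (auto simp: nn_integral_add nn_integral_cmult)
 also have "... <= ennreal (2 ^ n) * (ennreal (CJ * V c (6 ^ (p + 1) * r)) + ennreal (D ^ n) * ennreal (V c (6 ^ (p + 1) * r)))"
 proof (intro mult_left_mono add_mono CJ)
  have "1 * r <= 6 ^ (p + 1) * r" using r by (intro mult_right_mono one_le_power) auto
  hence "V c r <= V c (6 ^ (p + 1) * r)" by (intro V_mono) simp
  thus "emeasure M (ball c r) <= ennreal (V c (6 ^ (p + 1) * r))" by (simp add: emeasure_ball ennreal_leI)
 qed auto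
 also have "... = ennreal (2 ^ n * (CJ + D ^ n) * V c (6 ^ (p + 1) * r))"
  using D0 CJ0 by (simp add: ennreal_mult[symmetric] ennreal_plus[symmetric] algebra_simps del: ennreal_plus)
 finally show ?thesis .
qed

lemma Young_integral:
 assumes [measurable]: "meas w" "meas f" "S : sets M" and n: "2 <= n"
 shows "int_on S (%x. nn (w x) * nn (f x)) <=
  (int_on S (%x. ennreal (cmod (w x) ^ n))) + int_on S (%x. ennreal (cmod (f x) powr (real n / (real n - 1))))"
proof -
 have "int_on S (%x. nn (w x) * nn (f x)) <=
  (ntot (%x. ennreal (cmod (w x) ^ n) * indicator S x + ennreal (cmod (f x) powr (real n / (real n - 1))) * indicator S x))"
 proof (intro nn_integral_mono)
  fix x
  have "ennreal (cmod (w x) * cmod (f x)) <= ennreal (cmod (w x) ^ n + cmod (f x) powr (real n / (real n - 1)))"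
   by (intro ennreal_leI Young_simple n) auto
  hence "nn (w x) * nn (f x) <= ennreal (cmod (w x) ^ n) + ennreal (cmod (f x) powr (real n / (real n - 1)))"
   by (simp add: ennreal_mult ennreal_plus)
  thus "nn (w x) * nn (f x) * indicator S x <= ennreal (cmod (w x) ^ n) * indicator S x + ennreal (cmod (f x) powr (real n / (real n - 1))) * indicator S x"
   by (cases "x : S") auto
 qed
 also have "... = int_on S (%x. ennreal (cmod (w x) ^ n)) + int_on S (%x. ennreal (cmod (f x) powr (real n / (real n - 1))))"
  by (intro nn_integral_add) measurable
 finally show ?thesis .
qed

end

context cz_setting
begin

text \<open>
Interpolation by hand: the part of u above the height t is estimated by the weak (1,1) inequality, the
part below it by the L^2 bound.
\<close>

lemma weak_q:
 assumes q: "1 <= q" "q <= 2"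
 shows "EX C>0. ALL u t. bfun u --> 0 < t --> dis (2 * t) (T u) <= ennreal (C * t powr (- q) * npow q u)"
proof -
 obtain W where W: "0 < W" "!!f t. bfun f ==> 0 < t ==> dis t (T f) <= ennreal (W / t * nint f)"
  using weak11 by blast
 have main: "dis (2 * t) (T u) <= ennreal ((W + CT) * t powr (- q) * npow q u)" if u: "bfun u" and t: "0 < t" for u t
 proof -
  have [measurable]: "meas u" using u by (rule bfun_meas)
  define S where "S = {x : space M. t < cmod (u x)}"
  have Ss: "S : sets M" unfolding S_def by measurable
  have Sc: "- S : sets M" using sets.compl_sets[OF Ss] by (simp add: Compl_eq_Diff_UNIV)
  define u1 where "u1 x = indicator S x * u x" for x
  define u2 where "u2 x = indicator (- S) x * u x" for x
  have b: "bfun u1" "bfun u2" unfolding u1_def u2_def using u Ss Sc by (auto intro: bfun_restrict)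
  have eq: "u = (%x. u1 x + u2 x)" by (auto simp: u1_def u2_def indicator_def fun_eq_iff)
  have nq: "0 <= npow q u" by simp
  have "dis (t + t) (T u) <= dis t (T u1) + dis t (T u2)"
  proof (rule dis_add)
   show "AE x in M. cmod (T u x) <= cmod (T u1 x) + cmod (T u2 x)"
    using T_add[OF bfun_L2[OF b(1)] bfun_L2[OF b(2)]] unfolding eq[symmetric]
    by eventually_elim (simp add: norm_triangle_ineq)
  qed (intro T_meas bfun_L2 b)+
  also have "dis t (T u1) <= ennreal (W * t powr (- q) * npow q u)"
  proof -
   have "nint u1 <= tot (%x. t powr (1 - q) * (cmod (u x) powr q))"
   proof (intro integral_mono bfun_norm_integrable b integrable_mult_right bfun_powr_integrable u)
    fix x
    show "cmod (u1 x) <= t powr (1 - q) * (cmod (u x) powr q)"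
    proof (cases "x : S")
     case True
     hence x: "t < cmod (u x)" by (simp add: S_def)
     have "cmod (u x) = cmod (u x) powr (1 - q) * cmod (u x) powr q" using x t by (simp add: powr_add[symmetric])
     also have "... <= t powr (1 - q) * cmod (u x) powr q" using x t q by (intro mult_right_mono powr_mono2') auto
     finally show ?thesis using True by (simp add: u1_def)
    qed (simp add: u1_def)
   qed (use q in auto)
   hence n1: "nint u1 <= t powr (1 - q) * npow q u" by simp
   have "dis t (T u1) <= ennreal (W / t * nint u1)" using W(2) b t by blast
   also have "... <= ennreal (W / t * (t powr (1 - q) * npow q u))" using W t n1 by (intro ennreal_leI mult_left_mono) auto
   also have "W / t * (t powr (1 - q) * npow q u) = W * t powr (- q) * npow q u"
    using t by (simp add: powr_diff powr_minus field_simps)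
   finally show ?thesis .
  qed
  also have "dis t (T u2) <= ennreal (CT * t powr (- q) * npow q u)"
  proof -
   have "sq u2 <= ntot (%x. ennreal (t powr (2 - q)) * ennreal (cmod (u x) powr q))"
   proof (intro nn_integral_mono)
    fix x
    show "ennreal ((cmod (u2 x))\<^sup>2) <= ennreal (t powr (2 - q)) * ennreal (cmod (u x) powr q)"
    proof (cases "x : S \<or> u x = 0")
     case False
     hence x: "cmod (u x) <= t" "0 < cmod (u x)" by (auto simp: S_def)
     have "(cmod (u x))\<^sup>2 = cmod (u x) powr (2 - q) * cmod (u x) powr q" using x by (simp add: powr_add[symmetric] powr_numeral)
     also have "... <= t powr (2 - q) * cmod (u x) powr q" using x t q by (intro mult_right_mono powr_mono2) auto
     finally show ?thesis using False by (simp add: u2_def ennreal_mult[symmetric] ennreal_leI)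
    qed (auto simp: u2_def)
   qed
   also have "... = ennreal (t powr (2 - q) * npow q u)" using q nq by (simp add: nn_integral_cmult nn_npow[OF u] ennreal_mult)
   finally have n2: "sq u2 <= ennreal (t powr (2 - q) * npow q u)" .
   have "dis t (T u2) <= ennreal (1 / t\<^sup>2) * sq (T u2)"
    by (intro dis_Markov2 T_meas bfun_L2 b t)
   also have "... <= ennreal (1 / t\<^sup>2) * (ennreal CT * ennreal (t powr (2 - q) * npow q u))"
    by (intro mult_left_mono order_trans[OF T_L2[OF bfun_L2[OF b(2)]]] n2) auto
   also have "... = ennreal (1 / t\<^sup>2 * (CT * (t powr (2 - q) * npow q u)))"
    using t CT nq by (simp add: ennreal_mult[symmetric])
   also have "1 / t\<^sup>2 * (CT * (t powr (2 - q) * npow q u)) = CT * t powr (- q) * npow q u"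
    using t by (simp add: powr_diff powr_minus field_simps powr_numeral)
   finally show ?thesis .
  qed
  finally have "dis (t + t) (T u) <= ennreal (W * t powr (- q) * npow q u) + ennreal (CT * t powr (- q) * npow q u)"
   by (simp add: add_mono)
  also have "... = ennreal ((W + CT) * t powr (- q) * npow q u)"
   using W CT nq by (simp add: ennreal_plus[symmetric] algebra_simps del: ennreal_plus)
  finally show ?thesis by (simp only: mult_2)
 qed
 show ?thesis using main W CT by (intro exI[of _ "W + CT"]) auto
qed

text \<open>
Kolmogorov's inequality: the weak bound is summed over the levels 2^j, and the values below 1 are counted
by the measure of S.
\<close>

lemma near_q:
 assumes r: "0 <= r" "r < q" and q: "1 <= q" "q <= 2"
 shows "EX C>=1. ALL u S. bfun u --> S : sets M -->
   (int_on S (%x. ennreal (cmod (T u x) powr r))) <= emeasure M S + ennreal (C * npow q u)"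
proof -
 obtain C0 where C0: "0 < C0" "!!u t. bfun u ==> 0 < t ==> dis (2 * t) (T u) <= ennreal (C0 * t powr (- q) * npow q u)"
  using weak_q[OF q] by blast
 define theta where "theta = 2 powr (r - q)"
 have theta: "0 < theta" "theta < 1" using r powr_less_mono[of "r - q" 0 2] by (auto simp: theta_def)
 define C where "C = C0 * 2 powr r * 2 powr q * (1 / (1 - theta)) + 1"
 have C1: "1 <= C" using C0 theta by (simp add: C_def)
 have main: "int_on S (%x. ennreal (cmod (T u x) powr r)) <= emeasure M S + ennreal (C * npow q u)"
  if u: "bfun u" and S[measurable]: "S : sets M" for u S
 proof -
  have [measurable]: "meas (T u)" by (intro T_meas bfun_L2 u)
  have nq: "0 <= npow q u" by simp
  define E where "E j = {x. 2 ^ j < cmod (T u x)}" for j :: nat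
  have Es[measurable]: "E j : sets M" for j
  proof -
   have "{x : space M. 2 ^ j < cmod (T u x)} : sets M" by measurable
   thus ?thesis by (simp add: E_def)
  qed
  have "int_on S (%x. ennreal (cmod (T u x) powr r)) <= ntot (%x. indicator S x + (\<Sum>j. ennreal ((2 ^ Suc j) powr r) * indicator (E j) x))"
  proof (intro nn_integral_mono)
   fix x
   let ?y = "cmod (T u x)"
   show "ennreal (?y powr r) * indicator S x <= indicator S x + (\<Sum>j. ennreal ((2 ^ Suc j) powr r) * indicator (E j) x)"
   proof (cases "1 < ?y")
    case False
    hence "?y powr r <= 1 powr r" using r by (intro powr_mono2) auto
    hence "ennreal (?y powr r) <= 1" by (simp add: ennreal_le_1)
    hence "ennreal (?y powr r) * indicator S x <= indicator S x" by (cases "x : S") auto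
    thus ?thesis by (simp add: add_increasing2)
   next
    case True
    obtain n :: nat where n: "?y < 2 ^ n" using real_arch_pow[of 2 ?y] by auto
    define l where "l = (LEAST n. ?y <= 2 ^ n)"
    have l: "?y <= 2 ^ l" unfolding l_def using less_imp_le[OF n] by (rule LeastI)
    have "l ~= 0" using l True by (intro notI) simp
    then obtain j where j: "l = Suc j" by (cases l) auto
    hence "~ ?y <= 2 ^ j" unfolding l_def by (intro not_less_Least) simp
    hence xE: "x : E j" by (simp add: E_def)
    define f where "f j = ennreal ((2 ^ Suc j) powr r) * indicator (E j) x" for j
    have "ennreal (?y powr r) * indicator S x <= ennreal (?y powr r)" by (auto simp: indicator_def)
    also have "... <= f j" using l j r xE by (auto simp: f_def intro!: ennreal_leI powr_mono2)
    also have "... <= (\<Sum>j. f j)" using sum_le_suminf[of f "{j}"] by simp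
    finally show ?thesis by (simp add: f_def add_increasing)
   qed
  qed
  also have "... = emeasure M S + (\<Sum>j. ennreal ((2 ^ Suc j) powr r) * emeasure M (E j))"
   by (subst nn_integral_add) (auto simp: nn_integral_suminf nn_integral_cmult)
  also have "(\<Sum>j. ennreal ((2 ^ Suc j) powr r) * emeasure M (E j)) <= (\<Sum>j. ennreal (C0 * 2 powr r * 2 powr q * npow q u * theta ^ j))"
  proof (intro suminf_le)
   fix j :: nat
   have "emeasure M (E j) <= ennreal (C0 * (2 ^ j / 2) powr (- q) * npow q u)"
    using C0(2)[OF u, of "2 ^ j / 2"] by (simp add: E_def)
   hence "ennreal ((2 ^ Suc j) powr r) * emeasure M (E j) <= ennreal ((2 ^ Suc j) powr r) * ennreal (C0 * (2 ^ j / 2) powr (- q) * npow q u)"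
    by (intro mult_left_mono) auto
   also have "... = ennreal ((2 ^ Suc j) powr r * (C0 * (2 ^ j / 2) powr (- q) * npow q u))"
    using C0 nq by (intro ennreal_mult[symmetric]) auto
   also have "(2 ^ Suc j) powr r * (C0 * (2 ^ j / 2) powr (- q) * npow q u) = C0 * 2 powr r * 2 powr q * npow q u * theta ^ j"
   proof -
    have 1: "(2 ^ Suc j :: real) powr r = 2 powr r * 2 powr (real j * r)"
     by (simp add: powr_realpow[symmetric] powr_powr powr_mult)
    have 2: "(2 ^ j / 2 :: real) powr (- q) = 2 powr q * 2 powr (- (real j * q))"
     by (simp add: powr_divide powr_realpow[symmetric] powr_powr powr_minus field_simps)
    have 3: "theta ^ j = 2 powr (real j * r) * 2 powr (- (real j * q))"
     by (simp add: theta_def powr_power powr_add[symmetric] algebra_simps)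
    show ?thesis unfolding 1 2 3 by (simp add: mult_ac)
   qed
   finally show "ennreal ((2 ^ Suc j) powr r) * emeasure M (E j) <= ennreal (C0 * 2 powr r * 2 powr q * npow q u * theta ^ j)" .
  qed auto
  also have "... = ennreal (C0 * 2 powr r * 2 powr q * npow q u * (1 / (1 - theta)))"
   using C0 nq theta by (intro suminf_ennreal_eq sums_mult geometric_sums) auto
  also have "... <= ennreal (C * npow q u)"
   using nq by (intro ennreal_leI) (simp add: C_def algebra_simps)
  finally show ?thesis by (simp add: add_left_mono)
 qed
 show ?thesis using C1 main by blast
qed

end

lemma le_plus_cube: "0 < l ==> 0 <= x ==> x <= l + x ^ 3 / (l::real)\<^sup>2"
proof (cases "x <= l")
 case True
 assume "0 < l" "0 <= x"
 thus ?thesis using True by (simp add: add_increasing2)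
next
 case False
 assume l: "0 < l" "0 <= x"
 hence "x * l\<^sup>2 <= x * x\<^sup>2" using False by (intro mult_left_mono power_mono) auto
 hence "x <= x ^ 3 / l\<^sup>2" using l by (simp add: field_simps power3_eq_cube power2_eq_square)
 thus ?thesis using l by simp
qed

context nonhomogeneous_space
begin

text \<open>
The doubling ball (e, R) lies at a bounded distance from (c, r), in the sense that the densities of the
dilates leading from one to the other have a bounded sum.
\<close>

definition link :: "real => 'a => real => 'a => real => nat => bool" where
 "link C0 c r e R N \<longleftrightarrow> 0 < r & 0 < R & 0 < V c r & 0 < V e R & dist c e <= R & r <= 6 * R & R <= 6 ^ N * r & 6 ^ N * r <= 36 * R &
   (SUM k:{0..N}. dens c (6 ^ k * r)) <= C0"

lemma V_scale_pos: "0 < r ==> 0 < V c r ==> 0 < V c (6 ^ k * r)"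
proof -
 assume r: "0 < r" "0 < V c r"
 have "V c (1 * r) <= V c (6 ^ k * r)" using r by (intro V_mono mult_right_mono one_le_power) auto
 thus ?thesis using r by simp
qed

lemma link_means:
 assumes cl: "clean p A b m" and A: "0 < A" and li: "link C0 c r e R N" and j: "j <= N + 4"
 shows "cmod (m (c, 6 ^ j * r) - m (e, R)) <= A * (8 + C0)"
proof -
 have r: "0 < r" "0 < R" "0 < V c r" "0 < V e R" "dist c e <= R" "r <= 6 * R" "R <= 6 ^ N * r" "6 ^ N * r <= 36 * R"
  and sm: "(SUM k:{0..N}. dens c (6 ^ k * r)) <= C0" using li by (auto simp: link_def)
 have d: "0 <= dens c (6 ^ k * r)" "dens c (6 ^ k * r) <= 1" for k using dens_bounds[of "6 ^ k * r" c] r by auto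
 have C00: "0 <= C0" using sm sum_nonneg[of "{0..N}" "%k. dens c (6 ^ k * r)"] d by simp
 have near: "cmod (m (c, 6 ^ N * r) - m (e, R)) <= A"
 proof (rule clean_near[OF cl])
  have "1 * (6 ^ N * r) <= 36 * (6 ^ N * r)" using r by (intro mult_right_mono) auto
  thus "dist c e <= 36 * (6 ^ N * r)" "R <= 36 * (6 ^ N * r)" using r by linarith+
 qed (use r V_scale_pos in auto)
 have shift: "(SUM k:{0..n}. dens c (6 ^ k * (6 ^ i * r))) = (SUM k:{i..n+i}. dens c (6 ^ k * r))" for i n
 proof -
  have "(SUM k:{0..n}. dens c (6 ^ k * (6 ^ i * r))) = (SUM k:{0..n}. dens c (6 ^ (k + i) * r))"
   by (simp add: power_add mult_ac)
  also have "... = (SUM k:{0+i..n+i}. dens c (6 ^ k * r))" by (rule sum.shift_bounds_cl_nat_ivl[symmetric])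
  finally show ?thesis by simp
 qed
 have chain: "cmod (m (c, 6 ^ i * r) - m (c, 6 ^ (n + i) * r)) <= A * (1 + (SUM k:{i..n+i}. dens c (6 ^ k * r)))" for i n
  using clean_chain[OF cl, of "6 ^ i * r" c n] r V_scale_pos[of r c i] shift[of i n] by (simp add: power_add mult.assoc)
 show ?thesis
 proof (cases "j <= N")
  case True
  have "(SUM k:{j..N}. dens c (6 ^ k * r)) <= C0"
   using sum_mono2[of "{0..N}" "{j..N}" "%k. dens c (6 ^ k * r)"] d sm by simp
  hence "A * (1 + (SUM k:{j..N}. dens c (6 ^ k * r))) <= A * (1 + C0)" using A by (intro mult_left_mono) auto
  hence "cmod (m (c, 6 ^ j * r) - m (c, 6 ^ N * r)) <= A * (1 + C0)" using chain[of j "N - j"] True by simp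
  hence "cmod (m (c, 6 ^ j * r) - m (e, R)) <= A * (1 + C0) + A"
   using near norm_triangle_ineq[of "m (c, 6 ^ j * r) - m (c, 6 ^ N * r)" "m (c, 6 ^ N * r) - m (e, R)"] by simp
  thus ?thesis using A by (simp add: distrib_left)
 next
  case False
  have "(SUM k:{N..j}. dens c (6 ^ k * r)) <= (SUM k:{N..j}. 1)" using d by (intro sum_mono) auto
  also have "... <= 5" using j False by simp
  finally have "A * (1 + (SUM k:{N..j}. dens c (6 ^ k * r))) <= A * (1 + 5)" using A by (intro mult_left_mono) auto
  hence "cmod (m (c, 6 ^ N * r) - m (c, 6 ^ j * r)) <= A * (1 + 5)" using chain[of N "j - N"] False by simp
  hence "cmod (m (c, 6 ^ j * r) - m (e, R)) <= A * 6 + A"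
   using near norm_triangle_ineq[of "m (c, 6 ^ j * r) - m (c, 6 ^ N * r)" "m (c, 6 ^ N * r) - m (e, R)"]
   by (simp add: norm_minus_commute)
  moreover have "0 <= A * C0" using A C00 by simp
  ultimately show ?thesis using A by (simp add: distrib_left)
 qed
qed

end

context cz_setting
begin

text \<open>
Transporting the integral of u over one link. The factors b - m and h, or Th, are separated by Young's
inequality: the first has all moments by John--Nirenberg, the second a moment of order slightly above 1.
For Th the space is divided into the neighbourhood of the small ball, the region between the two balls
(size condition), the neighbourhood of the large ball, and the rest (cancellation).
\<close>

lemma nice_block:
 assumes A: "0 < A" and n: "3 <= n" and q: "real n / (real n - 1) < q" "q <= 2" and beta: "1 <= beta" and C0: "0 <= C0"
 shows "EX C>0. ALL b m c r e R N u. clean p A b m --> link C0 c r e R N --> V e (6 ^ (p + 5) * R) <= beta * V e R -->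
  bfun u --> supb u c r --> npow q u <= 2 * V c (6 ^ (p + 2) * r) -->
  (ntot (%x. nn (b x - m (e, R)) * nn (u x - tot u / V e R * indicator (ball e R) x))) <= ennreal (C * V c (6 ^ (p + 2) * r)) &
  (ntot (%x. nn (b x - m (e, R)) * nn (T (%x. u x - tot u / V e R * indicator (ball e R) x) x))) <= ennreal (C * V c (6 ^ (p + 2) * r))"
proof -
 let ?n' = "real n / (real n - 1)"
 have n2: "2 <= n" using n by simp
 have n'1: "1 <= ?n'" using n by (simp add: field_simps)
 have q1: "1 <= q" using q n'1 by linarith
 obtain CJ where CJ: "0 < CJ" "!!b m c r. clean p A b m ==> 0 < r ==>
   (int_on (ball c r) (%x. ennreal (cmod (b x - m (c, r)) ^ n))) <= ennreal (CJ * V c (6 ^ (p + 1) * r))"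
  using John_Nirenberg[OF A, of n p] n by auto
 obtain C3 where C3: "0 < C3" "!!b m c r. clean p A b m ==> 0 < r ==>
   (int_on (ball c r) (%x. ennreal (cmod (b x - m (c, r)) ^ 3))) <= ennreal (C3 * V c (6 ^ (p + 1) * r))"
  using John_Nirenberg[OF A, of 3 p] by auto
 obtain CQ where CQ: "1 <= CQ" "!!u S. bfun u ==> S : sets M ==>
   (int_on S (%x. ennreal (cmod (T u x) powr ?n'))) <= emeasure M S + ennreal (CQ * npow q u)"
  using near_q[of ?n' q] n'1 q q1 by auto
 define D where "D = A * (8 + C0)"
 have D0: "0 <= D" using A C0 by (simp add: D_def)
 define eta where "eta j = C3 * Clam ^ (3 * (p + 3)) * (1 / (real (Suc j))\<^sup>2)" for j :: nat
 have eta0: "0 <= eta j" for j using C3 Clam_pos by (simp add: eta_def)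
 have etas: "summable eta"
 proof -
  have "summable (%j. inverse (real (Suc j) ^ 2))"
   using inverse_power_summable[of 2, where 'a=real] by (subst summable_Suc_iff) auto
  thus ?thesis unfolding eta_def by (intro summable_mult) (simp add: inverse_eq_divide)
 qed
 define H where "H = suminf eta"
 have H0: "0 <= H" unfolding H_def using eta0 etas by (intro suminf_nonneg) auto
 define K1 where "K1 = 2 ^ n * (CJ + D ^ n) + 3 + 3 * beta"
 define Kfar where "Kfar = ((1 + 7 * A) * CH + CS * H) * 6"
 define Knear where "Knear = 2 ^ n * (CJ + D ^ n) + (1 + 2 * CQ)"
 define Kmid where "Kmid = CS * 3 * ((1 + D) * Clam ^ (3 * (p + 1)) * (C0 + real p + 4))"
 define KE where "KE = 3 * (2 ^ n * (CJ + (6 * A) ^ n) * beta + beta + CQ)"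
 define C where "C = K1 + (Kfar + Knear + Kmid + KE)"
 have CJ0: "0 <= CJ" using CJ by simp
 have pos: "0 < K1" "0 <= Kfar" "0 <= Knear" "0 <= Kmid" "0 <= KE"
 proof -
  have t: "0 <= 2 ^ n * (CJ + D ^ n)" "0 <= 2 ^ n * (CJ + (6 * A) ^ n) * beta" using CJ D0 A beta by auto
  show "0 < K1" "0 <= Knear" "0 <= KE" using t beta CQ by (auto simp: K1_def Knear_def KE_def)
  show "0 <= Kfar" "0 <= Kmid" unfolding Kfar_def Kmid_def using A CH CS_pos H0 D0 C0 Clam_pos by auto
 qed
 have main: "ntot (%x. nn (b x - m (e, R)) * nn (u x - tot u / V e R * indicator (ball e R) x)) <= ennreal (C * V c (6 ^ (p + 2) * r)) &
  (ntot (%x. nn (b x - m (e, R)) * nn (T (%x. u x - tot u / V e R * indicator (ball e R) x) x))) <= ennreal (C * V c (6 ^ (p + 2) * r))"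
  if cl: "clean p A b m" and li: "link C0 c r e R N" and dE: "V e (6 ^ (p + 5) * R) <= beta * V e R"
   and u: "bfun u" "supb u c r" and uq: "npow q u <= 2 * V c (6 ^ (p + 2) * r)" for b m c r e R N u
 proof -
  have r: "0 < r" "0 < R" "0 < V c r" "0 < V e R" "dist c e <= R" "r <= 6 * R" "R <= 6 ^ N * r" "6 ^ N * r <= 36 * R"
   and sm: "(SUM k:{0..N}. dens c (6 ^ k * r)) <= C0" using li by (auto simp: link_def)
  have bm[measurable]: "meas b" using cl by (rule clean_meas)
  have um[measurable]: "meas u" "meas (T u)" by (intro T_meas bfun_L2 bfun_meas u)+
  define Lambda where "Lambda = V c (6 ^ (p + 2) * r)"
  define a where "a = m (e, R)"
  let ?w = "%x. nn (b x - a)"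
  define alpha where "alpha = tot u / V e R"
  define h where "h x = u x - alpha * indicator (ball e R) x" for x
  have Vmon: "V c (6 ^ i * r) <= V c (6 ^ j * r)" if "i <= j" for i j
   using that r by (intro V_mono mult_right_mono power_increasing) auto
  have VmonE: "V e (6 ^ i * R) <= V e (6 ^ j * R)" if "i <= j" for i j
   using that r by (intro V_mono mult_right_mono power_increasing) auto
  have Vr: "V c r <= Lambda" "V c (6 * r) <= Lambda" "V c (6 ^ (p + 1) * r) <= Lambda"
   using Vmon[of 0 "p + 2"] Vmon[of 1 "p + 2"] Vmon[of "p + 1" "p + 2"] by (auto simp: Lambda_def)
  have Lambda0: "0 < Lambda" using Vr r by linarith
  have uq': "npow q u <= 2 * Lambda" using uq by (simp add: Lambda_def)
  have nq0: "0 <= npow q u" by simp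
  have pw: "int_on (ball c r) (%x. ennreal (cmod (u x) powr s)) <= ennreal (3 * Lambda)" if s: "0 <= s" "s <= q" for s
  proof -
   have "int_on (ball c r) (%x. ennreal (cmod (u x) powr s)) <= ntot (%x. indicator (ball c r) x + ennreal (cmod (u x) powr q))"
   proof (intro nn_integral_mono)
    fix x
    have "ennreal (cmod (u x) powr s) <= ennreal (1 + cmod (u x) powr q)" using s by (intro ennreal_leI le_one_plus_powr) auto
    thus "ennreal (cmod (u x) powr s) * indicator (ball c r) x <= indicator (ball c r) x + ennreal (cmod (u x) powr q)"
     by (cases "x : ball c r") auto
   qed
   also have "... = ennreal (V c r) + ennreal (npow q u)"
    using nn_npow[OF u(1), of q] q1 by (subst nn_integral_add) (auto simp: emeasure_ball)
   also have "... = ennreal (V c r + npow q u)" by simp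
   also have "... <= ennreal (3 * Lambda)" using Vr uq' by (intro ennreal_leI) simp
   finally show ?thesis .
  qed
  have nu: "nint u <= 3 * Lambda"
  proof -
   have "ennreal (nint u) = mass u" by (rule nn_nint[OF bfun_integrable[OF u(1)], symmetric])
   also have "... = int_on (ball c r) (%x. ennreal (cmod (u x) powr 1))"
    using u(2) by (intro nn_integral_cong) (auto simp: supb_def indicator_def)
   also have "... <= ennreal (3 * Lambda)" using q1 by (intro pw) auto
   finally show ?thesis using Lambda0 by simp
  qed
  have su: "supb u e (36 * R)"
  proof -
   have "ball c r \<subseteq> ball e (36 * R)"
   proof
    fix y assume "y : ball c r"
    thus "y : ball e (36 * R)" using r dist_triangle[of e y c] by (simp add: dist_commute)
   qed
   thus ?thesis using u(2) unfolding supb_def by blast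
  qed
  have R36: "R <= 36 * R" using r by simp
  note bb = block_basic[OF u(1) su R36 r(4), folded alpha_def, folded h_def[abs_def]]
  have hm[measurable]: "meas h" "meas (T h)" by (intro T_meas bfun_L2 bfun_meas bb(1))+
  let ?i = "indicator (ball e R) :: 'a => complex"
  have i: "bfun ?i" by (rule bfun_indicator[of _ e R]) auto
  have Tim[measurable]: "meas (T ?i)" by (intro T_meas bfun_L2 i)
  have alphaV: "cmod alpha * V e R <= 3 * Lambda" using bb(5) nu by linarith
  \<comment> \<open>The block itself: Young's inequality, with the moments of b - m on each of the two balls.\<close>
  have osc0: "int_on (ball c r) (%x. ennreal (cmod (b x - a) ^ n)) <= ennreal (2 ^ n * (CJ + D ^ n) * V c (6 ^ (p + 1) * r))"
   unfolding a_def D_def using link_means[OF cl A li, of 0] by (intro clean_power_shift[OF cl r(1) CJ(2)[OF cl r(1)] CJ0]) auto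
  have part1: "ntot (%x. ?w x * nn (h x)) <= ennreal (K1 * Lambda)"
  proof -
   have "ntot (%x. ?w x * nn (h x)) <= ntot (%x. ?w x * nn (u x) * indicator (ball c r) x + ennreal (cmod alpha) * (?w x * indicator (ball e R) x))"
   proof (intro nn_integral_mono)
    fix x
    have "cmod (h x) <= cmod (u x) * indicator (ball c r) x + cmod alpha * indicator (ball e R) x"
    proof -
     have "cmod (h x) <= cmod (u x) + cmod (alpha * ?i x)" unfolding h_def by (rule norm_triangle_ineq4)
     moreover have "cmod (u x) = cmod (u x) * indicator (ball c r) x" using u(2) by (auto simp: supb_def indicator_def)
     moreover have "cmod (alpha * ?i x) = cmod alpha * indicator (ball e R) x" by (cases "x : ball e R") (auto simp: norm_mult)
     ultimately show ?thesis by linarith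
    qed
    hence "?w x * nn (h x) <= ?w x * ennreal (cmod (u x) * indicator (ball c r) x + cmod alpha * indicator (ball e R) x)"
     by (intro mult_left_mono ennreal_leI) auto
    also have "... = ?w x * nn (u x) * indicator (ball c r) x + ennreal (cmod alpha) * (?w x * indicator (ball e R) x)"
     by (cases "x : ball c r"; cases "x : ball e R") (auto simp: ennreal_plus distrib_left mult_ac)
    finally show "?w x * nn (h x) <= ?w x * nn (u x) * indicator (ball c r) x + ennreal (cmod alpha) * (?w x * indicator (ball e R) x)" .
   qed
   also have "... = int_on (ball c r) (%x. ?w x * nn (u x)) + ennreal (cmod alpha) * int_on (ball e R) ?w"
    by (subst nn_integral_add) (auto simp: nn_integral_cmult)
   also have "int_on (ball c r) (%x. ?w x * nn (u x)) <= int_on (ball c r) (%x. ennreal (cmod (b x - a) ^ n)) + int_on (ball c r) (%x. ennreal (cmod (u x) powr ?n'))"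
    by (intro Young_integral n2) auto
   also have "... <= ennreal (2 ^ n * (CJ + D ^ n) * V c (6 ^ (p + 1) * r)) + ennreal (3 * Lambda)"
    using n'1 q by (intro add_mono osc0 pw) auto
   also have "... <= ennreal (2 ^ n * (CJ + D ^ n) * Lambda) + ennreal (3 * Lambda)"
    using Vr CJ D0 by (intro add_right_mono ennreal_leI mult_left_mono) auto
   also have "ennreal (cmod alpha) * int_on (ball e R) ?w <= ennreal (cmod alpha) * ennreal (beta * V e R)"
   proof (intro mult_left_mono)
    have "int_on (ball e R) ?w <= ennreal (V e (6 ^ p * R))" unfolding a_def by (intro clean_osc[OF cl] r)
    also have "... <= ennreal (beta * V e R)" using VmonE[of p "p + 5"] dE by (intro ennreal_leI) simp
    finally show "int_on (ball e R) ?w <= ennreal (beta * V e R)" .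
   qed auto
   also have "... = ennreal (beta * (cmod alpha * V e R))" using beta by (simp add: ennreal_mult[symmetric] mult_ac)
   also have "... <= ennreal (beta * (3 * Lambda))" using alphaV beta by (intro ennreal_leI mult_left_mono) auto
   also have "ennreal (2 ^ n * (CJ + D ^ n) * Lambda) + ennreal (3 * Lambda) + ennreal (beta * (3 * Lambda)) = ennreal (K1 * Lambda)"
    using CJ D0 Lambda0 beta by (simp add: K1_def ennreal_plus[symmetric] algebra_simps del: ennreal_plus)
   finally show ?thesis by (simp add: add_mono)
  qed
  \<comment> \<open>Far away the means of b over the annuli drift linearly, which T_far admits in the weight.\<close>
  have far: "int_on {x. 6 * (36 * R) < dist x e} (%x. ?w x * nn (T h x)) <= ennreal (Kfar * Lambda)"
  proof -
   define v where "v j x = ennreal (cmod (b x - m (e, 6 ^ (j + 5) * R)) ^ 3 / (real (Suc j))\<^sup>2)" for j x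
   have vm: "meas (v j)" for j unfolding v_def by measurable
   have "int_on {x. 6 * (36 * R) < dist x e} (%x. ?w x * nn (T h x)) <= ennreal (((1 + 7 * A) * CH + CS * (\<Sum>j. eta j)) * nint h)"
   proof (rule T_far[OF bb(1,2,3), where v=v])
    fix j x
    have chain: "cmod (m (e, R) - m (e, 6 ^ (j + 5) * R)) <= 7 * A * real (Suc j)"
    proof -
     have "cmod (m (e, R) - m (e, 6 ^ (j + 5) * R)) <= A * (1 + (SUM k:{0..j + 5}. dens e (6 ^ k * R)))"
      using r by (intro clean_chain[OF cl]) auto
     also have "... <= A * (1 + (SUM k:{0..j + 5}. 1))"
      using A dens_bounds(2)[of _ e] r by (intro mult_left_mono add_left_mono sum_mono) auto
     also have "... <= A * (7 * real (Suc j))" using A by (intro mult_left_mono) auto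
     finally show ?thesis by (simp add: algebra_simps)
    qed
    let ?y = "cmod (b x - m (e, 6 ^ (j + 5) * R))"
    have "cmod (b x - a) <= ?y + 7 * A * real (Suc j)"
     using chain norm_triangle_ineq4[of "b x - m (e, 6 ^ (j + 5) * R)" "m (e, R) - m (e, 6 ^ (j + 5) * R)"] by (simp add: a_def)
    also have "... <= (1 + 7 * A) * real (Suc j) + ?y ^ 3 / (real (Suc j))\<^sup>2"
     using le_plus_cube[of "real (Suc j)" ?y] by (simp add: algebra_simps)
    finally have "?w x <= ennreal ((1 + 7 * A) * real (Suc j) + ?y ^ 3 / (real (Suc j))\<^sup>2)" by (rule ennreal_leI)
    thus "?w x <= ennreal ((1 + 7 * A) * real (Suc j)) + v j x"
     unfolding v_def using A by (subst (asm) ennreal_plus) auto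
   next
    fix j
    have sub: "ann e (36 * R) j \<subseteq> ball e (6 ^ (j + 5) * R)"
    proof
     fix x assume "x : ann e (36 * R) j"
     hence "dist x e <= 6 ^ (Suc j + 1) * (36 * R)" by (simp add: ann_def)
     also have "... < 6 ^ (j + 5) * R" using r by (simp add: power_add)
     finally show "x : ball e (6 ^ (j + 5) * R)" by (simp add: dist_commute)
    qed
    let ?s = "1 / (real (Suc j))\<^sup>2"
    have "int_on (ann e (36 * R) j) (v j) <= ntot (%x. ennreal ?s * (ennreal (cmod (b x - m (e, 6 ^ (j + 5) * R)) ^ 3) * indicator (ball e (6 ^ (j + 5) * R)) x))"
    proof (intro nn_integral_mono)
     fix x
     show "v j x * indicator (ann e (36 * R) j) x <= ennreal ?s * (ennreal (cmod (b x - m (e, 6 ^ (j + 5) * R)) ^ 3) * indicator (ball e (6 ^ (j + 5) * R)) x)"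
      using sub by (cases "x : ann e (36 * R) j") (auto simp: v_def ennreal_mult[symmetric] subset_iff)
    qed
    also have "... = ennreal ?s * int_on (ball e (6 ^ (j + 5) * R)) (%x. ennreal (cmod (b x - m (e, 6 ^ (j + 5) * R)) ^ 3))"
     by (intro nn_integral_cmult) measurable
    also have "... <= ennreal ?s * ennreal (C3 * V e (6 ^ (p + 1) * (6 ^ (j + 5) * R)))"
     using r by (intro mult_left_mono C3(2)[OF cl]) auto
    also have "... = ennreal (?s * (C3 * V e (6 ^ (p + 1) * (6 ^ (j + 5) * R))))"
     using C3 by (intro ennreal_mult[symmetric]) auto
    also have "... <= ennreal (eta j * lam e (6 ^ Suc j * (36 * R)))"
    proof (intro ennreal_leI)
     have "V e (6 ^ (p + 1) * (6 ^ (j + 5) * R)) <= lam e (6 ^ (p + 1) * (6 ^ (j + 5) * R))" using r by (intro V_le_lam) auto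
     also have "... <= Clam ^ (3 * (p + 3)) * lam e (6 ^ Suc j * (36 * R))" using r by (intro lam_scale) (auto simp: power_add)
     finally have "?s * (C3 * V e (6 ^ (p + 1) * (6 ^ (j + 5) * R))) <= ?s * (C3 * (Clam ^ (3 * (p + 3)) * lam e (6 ^ Suc j * (36 * R))))"
      using C3 by (intro mult_left_mono) auto
     thus "?s * (C3 * V e (6 ^ (p + 1) * (6 ^ (j + 5) * R))) <= eta j * lam e (6 ^ Suc j * (36 * R))"
      by (simp add: eta_def mult_ac)
    qed
    finally show "int_on (ann e (36 * R) j) (v j) <= ennreal (eta j * lam e (6 ^ Suc j * (36 * R)))" .
   qed (use r A eta0 etas vm in auto)
   also have "... <= ennreal (Kfar * Lambda)"
   proof (intro ennreal_leI)
    have "((1 + 7 * A) * CH + CS * H) * nint h <= ((1 + 7 * A) * CH + CS * H) * (6 * Lambda)"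
    proof (intro mult_left_mono)
     have "nint h <= 2 * nint u" using bb(4) by (simp add: h_def)
     thus "nint h <= 6 * Lambda" using nu by linarith
    qed (use A CH CS_pos H0 in auto)
    thus "((1 + 7 * A) * CH + CS * suminf eta) * nint h <= Kfar * Lambda"
     unfolding Kfar_def H_def[symmetric] by (simp only: mult.assoc)
   qed
   finally show ?thesis .
  qed
  \<comment> \<open>Near the small ball no cancellation is needed: the moments of b - m and of Tu suffice.\<close>
  have near: "int_on (ball c (6 * r)) (%x. ?w x * nn (T u x)) <= ennreal (Knear * Lambda)"
  proof -
   have r6: "0 < 6 * r" using r by simp
   have "int_on (ball c (6 * r)) (%x. ennreal (cmod (b x - a) ^ n)) <= ennreal (2 ^ n * (CJ + D ^ n) * V c (6 ^ (p + 1) * (6 * r)))"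
    unfolding a_def D_def using link_means[OF cl A li, of 1] by (intro clean_power_shift[OF cl r6 CJ(2)[OF cl r6] CJ0]) auto
   also have "6 ^ (p + 1) * (6 * r) = 6 ^ (p + 2) * r" by simp
   finally have o1: "int_on (ball c (6 * r)) (%x. ennreal (cmod (b x - a) ^ n)) <= ennreal (2 ^ n * (CJ + D ^ n) * Lambda)" by (simp add: Lambda_def)
   have "int_on (ball c (6 * r)) (%x. ?w x * nn (T u x)) <= int_on (ball c (6 * r)) (%x. ennreal (cmod (b x - a) ^ n)) + int_on (ball c (6 * r)) (%x. ennreal (cmod (T u x) powr ?n'))"
    by (intro Young_integral n2) auto
   also have "... <= ennreal (2 ^ n * (CJ + D ^ n) * Lambda) + (emeasure M (ball c (6 * r)) + ennreal (CQ * npow q u))"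
    by (intro add_mono o1 CQ(2) u) auto
   also have "... <= ennreal (2 ^ n * (CJ + D ^ n) * Lambda) + (ennreal Lambda + ennreal (CQ * (2 * Lambda)))"
    unfolding emeasure_ball using Vr CQ(1) uq' by (intro add_left_mono add_mono ennreal_leI mult_left_mono) auto
   also have "... = ennreal (Knear * Lambda)"
    using CJ D0 Lambda0 CQ by (simp add: Knear_def ennreal_plus[symmetric] algebra_simps del: ennreal_plus)
   finally show ?thesis .
  qed
  \<comment> \<open>Between the two balls: the size condition and the bounded sum of densities of the link.\<close>
  have mid: "int_on (ball c (6 ^ Suc (N + 3) * r) - ball c (6 * r)) (%x. ?w x * nn (T u x)) <= ennreal (Kmid * Lambda)"
  proof -
   have "int_on (ball c (6 ^ Suc (N + 3) * r) - ball c (6 * r)) (%x. ?w x * nn (T u x))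
     <= ennreal (CS * nint u) * (SUM k:{1..N + 3}. ennreal (1 / lam c (6 ^ k * r)) * int_on (ball c (6 ^ Suc k * r)) ?w)"
    using r by (intro T_mid u) auto
   also have "(SUM k:{1..N + 3}. ennreal (1 / lam c (6 ^ k * r)) * int_on (ball c (6 ^ Suc k * r)) ?w)
     <= (SUM k:{1..N + 3}. ennreal ((1 + D) * Clam ^ (3 * (p + 1)) * dens c (6 ^ (k + (p + 1)) * r)))"
   proof (intro sum_mono)
    fix k assume k: "k : {1..N + 3}"
    have l: "0 < lam c (6 ^ k * r)" using r by (intro lam_pos) auto
    have s0: "0 < 6 ^ Suc k * r" using r by simp
    have "int_on (ball c (6 ^ Suc k * r)) ?w <= ennreal (V c (6 ^ p * (6 ^ Suc k * r)) + cmod (m (c, 6 ^ Suc k * r) - a) * V c (6 ^ Suc k * r))"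
     by (rule clean_shift[OF cl s0])
    also have "... <= ennreal ((1 + D) * V c (6 ^ (k + (p + 1)) * r))"
    proof (intro ennreal_leI)
     have "cmod (m (c, 6 ^ Suc k * r) - a) <= D"
      unfolding a_def D_def using k by (intro link_means[OF cl A li]) auto
     moreover have "V c (6 ^ Suc k * r) <= V c (6 ^ (k + (p + 1)) * r)" by (rule Vmon) simp
     ultimately have "cmod (m (c, 6 ^ Suc k * r) - a) * V c (6 ^ Suc k * r) <= D * V c (6 ^ (k + (p + 1)) * r)"
      using D0 by (intro mult_mono) auto
     moreover have e: "6 ^ p * (6 ^ Suc k * r) = 6 ^ (k + (p + 1)) * r" by (simp add: power_add mult_ac)
     ultimately show "V c (6 ^ p * (6 ^ Suc k * r)) + cmod (m (c, 6 ^ Suc k * r) - a) * V c (6 ^ Suc k * r) <= (1 + D) * V c (6 ^ (k + (p + 1)) * r)"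
      unfolding e distrib_right by linarith
    qed
    finally have "ennreal (1 / lam c (6 ^ k * r)) * int_on (ball c (6 ^ Suc k * r)) ?w <= ennreal (1 / lam c (6 ^ k * r)) * ennreal ((1 + D) * V c (6 ^ (k + (p + 1)) * r))"
     by (intro mult_left_mono) auto
    also have "... = ennreal ((1 + D) * (V c (6 ^ (k + (p + 1)) * r) / lam c (6 ^ k * r)))"
     using l D0 by (subst ennreal_mult[symmetric]) auto
    also have "... <= ennreal ((1 + D) * (Clam ^ (3 * (p + 1)) * dens c (6 ^ (k + (p + 1)) * r)))"
    proof (intro ennreal_leI mult_left_mono dens_upper)
     show "6 ^ (k + (p + 1)) * r <= 6 ^ (p + 1) * (6 ^ k * r)" by (simp add: power_add)
    qed (use r D0 in auto)
    finally show "ennreal (1 / lam c (6 ^ k * r)) * int_on (ball c (6 ^ Suc k * r)) ?w <= ennreal ((1 + D) * Clam ^ (3 * (p + 1)) * dens c (6 ^ (k + (p + 1)) * r))"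
     by (simp add: mult.assoc)
   qed
   also have "... = ennreal ((1 + D) * Clam ^ (3 * (p + 1)) * (SUM k:{1..N + 3}. dens c (6 ^ (k + (p + 1)) * r)))"
    using Clam_pos dens_bounds(1) r D0 by (subst sum_ennreal) (auto simp: sum_distrib_left)
   also have "... <= ennreal ((1 + D) * Clam ^ (3 * (p + 1)) * (C0 + real p + 4))"
   proof (intro ennreal_leI mult_left_mono)
    let ?d = "%k. dens c (6 ^ k * r)"
    have d: "0 <= ?d k" "?d k <= 1" for k using dens_bounds[of "6 ^ k * r" c] r by auto
    have "(SUM k:{1..N + 3}. ?d (k + (p + 1))) = (SUM k:{1 + (p + 1)..N + 3 + (p + 1)}. ?d k)"
     by (rule sum.shift_bounds_cl_nat_ivl[symmetric])
    also have "... <= (SUM k:{0..N} Un {N + 1..N + 3 + (p + 1)}. ?d k)" using d by (intro sum_mono2) auto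
    also have "... <= (SUM k:{0..N}. ?d k) + (SUM k:{N + 1..N + 3 + (p + 1)}. ?d k)" using d by (intro sum_Un_le) auto
    also have "(SUM k:{N + 1..N + 3 + (p + 1)}. ?d k) <= (SUM k:{N + 1..N + 3 + (p + 1)}. 1)" using d by (intro sum_mono) auto
    finally show "(SUM k:{1..N + 3}. ?d (k + (p + 1))) <= C0 + real p + 4" using sm by simp
   qed (use D0 Clam_pos in auto)
   also have "ennreal (CS * nint u) * ennreal ((1 + D) * Clam ^ (3 * (p + 1)) * (C0 + real p + 4))
     = ennreal (CS * nint u * ((1 + D) * Clam ^ (3 * (p + 1)) * (C0 + real p + 4)))"
    using CS_pos Clam_pos D0 C0 by (intro ennreal_mult[symmetric]) auto
   also have "... <= ennreal (Kmid * Lambda)"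
   proof (intro ennreal_leI)
    have "CS * nint u * ((1 + D) * Clam ^ (3 * (p + 1)) * (C0 + real p + 4)) <= CS * (3 * Lambda) * ((1 + D) * Clam ^ (3 * (p + 1)) * (C0 + real p + 4))"
     using CS_pos Clam_pos D0 C0 nu by (intro mult_right_mono mult_left_mono) auto
    thus "CS * nint u * ((1 + D) * Clam ^ (3 * (p + 1)) * (C0 + real p + 4)) <= Kmid * Lambda" by (simp add: Kmid_def mult_ac)
   qed
   finally show ?thesis by (simp add: mult_left_mono)
  qed
  \<comment> \<open>The image of the bump near its own ball, where doubling controls the moments of b - m.\<close>
  have big: "ennreal (cmod alpha) * int_on (ball e (6 ^ 4 * R)) (%x. ?w x * nn (T ?i x)) <= ennreal (KE * Lambda)"
  proof -
   have R4: "0 < 6 ^ 4 * R" using r by simp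
   have ch: "cmod (m (e, 6 ^ 4 * R) - a) <= 6 * A"
   proof -
    have "cmod (m (e, R) - m (e, 6 ^ 4 * R)) <= A * (1 + (SUM k:{0..4}. dens e (6 ^ k * R)))"
     using r by (intro clean_chain[OF cl]) auto
    also have "... <= A * (1 + (SUM k:{0..4::nat}. 1))"
     using A dens_bounds(2)[of _ e] r by (intro mult_left_mono add_left_mono sum_mono) auto
    finally show ?thesis by (simp add: a_def norm_minus_commute)
   qed
   have "int_on (ball e (6 ^ 4 * R)) (%x. ennreal (cmod (b x - a) ^ n)) <= ennreal (2 ^ n * (CJ + (6 * A) ^ n) * V e (6 ^ (p + 1) * (6 ^ 4 * R)))"
    by (rule clean_power_shift[OF cl R4 CJ(2)[OF cl R4] CJ0 ch])
   also have "6 ^ (p + 1) * (6 ^ 4 * R) = 6 ^ (p + 5) * R" by (simp add: power_add)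
   also have "ennreal (2 ^ n * (CJ + (6 * A) ^ n) * V e (6 ^ (p + 5) * R)) <= ennreal (2 ^ n * (CJ + (6 * A) ^ n) * (beta * V e R))"
    using dE CJ A by (intro ennreal_leI mult_left_mono) auto
   finally have o1: "int_on (ball e (6 ^ 4 * R)) (%x. ennreal (cmod (b x - a) ^ n)) <= ennreal (2 ^ n * (CJ + (6 * A) ^ n) * (beta * V e R))" .
   have npi: "npow q ?i = V e R"
   proof -
    have "npow q ?i = tot (%x. indicator (ball e R) x)"
     by (intro Bochner_Integration.integral_cong) (auto simp: indicator_def)
    thus ?thesis by (simp add: V_def)
   qed
   have "int_on (ball e (6 ^ 4 * R)) (%x. ?w x * nn (T ?i x)) <= int_on (ball e (6 ^ 4 * R)) (%x. ennreal (cmod (b x - a) ^ n)) + int_on (ball e (6 ^ 4 * R)) (%x. ennreal (cmod (T ?i x) powr ?n'))"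
    by (intro Young_integral n2) auto
   also have "... <= ennreal (2 ^ n * (CJ + (6 * A) ^ n) * (beta * V e R)) + (emeasure M (ball e (6 ^ 4 * R)) + ennreal (CQ * npow q ?i))"
    by (intro add_mono o1 CQ(2) i) auto
   also have "... <= ennreal (2 ^ n * (CJ + (6 * A) ^ n) * (beta * V e R)) + (ennreal (beta * V e R) + ennreal (CQ * V e R))"
    unfolding emeasure_ball npi using VmonE[of 4 "p + 5"] dE by (intro add_left_mono add_mono ennreal_leI) auto
   also have "... = ennreal ((2 ^ n * (CJ + (6 * A) ^ n) * beta + beta + CQ) * V e R)"
    using CJ A beta CQ by (simp add: ennreal_plus[symmetric] algebra_simps del: ennreal_plus)
   finally have "ennreal (cmod alpha) * int_on (ball e (6 ^ 4 * R)) (%x. ?w x * nn (T ?i x)) <= ennreal (cmod alpha) * ennreal ((2 ^ n * (CJ + (6 * A) ^ n) * beta + beta + CQ) * V e R)"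
    by (intro mult_left_mono) auto
   also have "... = ennreal ((2 ^ n * (CJ + (6 * A) ^ n) * beta + beta + CQ) * (cmod alpha * V e R))"
    using CJ A beta CQ by (subst ennreal_mult[symmetric]) (auto simp: mult_ac)
   also have "... <= ennreal ((2 ^ n * (CJ + (6 * A) ^ n) * beta + beta + CQ) * (3 * Lambda))"
    using CJ A beta CQ alphaV by (intro ennreal_leI mult_left_mono) auto
   also have "... = ennreal (KE * Lambda)" by (simp add: KE_def mult_ac)
   finally show ?thesis .
  qed
  let ?S1 = "{x. 6 * (36 * R) < dist x e}" and ?S2 = "ball c (6 * r)" and ?S3 = "ball c (6 ^ Suc (N + 3) * r) - ball c (6 * r)" and ?S4 = "ball e (6 ^ 4 * R)"
  have S1s[measurable]: "?S1 : sets M"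
  proof -
   have "{x : space M. 6 * (36 * R) < dist x e} : sets M" by measurable
   thus ?thesis by simp
  qed
  have part2: "ntot (%x. ?w x * nn (T h x)) <= ennreal ((Kfar + Knear + Kmid + KE) * Lambda)"
  proof -
   have Th: "AE x in M. cmod (T h x) <= cmod (T u x) + cmod alpha * cmod (T ?i x)"
    using T_diff[OF bfun_L2[OF u(1)] bfun_L2[OF bfun_cmult[OF i, of alpha]]] T_cmult[OF bfun_L2[OF i], of alpha]
   proof eventually_elim
    fix x assume *: "T (%y. u y - alpha * ?i y) x = T u x - T (%x. alpha * ?i x) x" "T (%x. alpha * ?i x) x = alpha * T ?i x"
    have "T h x = T u x - alpha * T ?i x" using * by (simp add: h_def[abs_def])
    thus "cmod (T h x) <= cmod (T u x) + cmod alpha * cmod (T ?i x)" by (metis norm_mult norm_triangle_ineq4)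
   qed
   have "ntot (%x. ?w x * nn (T h x)) <=
    (ntot (%x. (?w x * nn (T h x) * indicator ?S1 x + ?w x * nn (T u x) * indicator ?S2 x) +
      (?w x * nn (T u x) * indicator ?S3 x + ennreal (cmod alpha) * (?w x * nn (T ?i x) * indicator ?S4 x))))"
    using Th
   proof (intro nn_integral_mono_AE, eventually_elim)
    fix x assume *: "cmod (T h x) <= cmod (T u x) + cmod alpha * cmod (T ?i x)"
    show "?w x * nn (T h x) <= (?w x * nn (T h x) * indicator ?S1 x + ?w x * nn (T u x) * indicator ?S2 x) +
      (?w x * nn (T u x) * indicator ?S3 x + ennreal (cmod alpha) * (?w x * nn (T ?i x) * indicator ?S4 x))"
    proof (cases "x : ?S1")
     case True
     hence "?w x * nn (T h x) = ?w x * nn (T h x) * indicator ?S1 x" by simp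
     thus ?thesis by (metis (no_types, lifting) add.assoc le_iff_add)
    next
     case False
     hence d: "dist x e <= 216 * R" by simp
     have x4: "x : ?S4" using d r by (simp add: dist_commute)
     have "dist c x <= 217 * R" using d r dist_triangle[of c x e] by (simp add: dist_commute)
     also have "... < 6 ^ 4 * R" using r by simp
     also have "... <= 6 ^ 4 * (6 ^ N * r)" using r by (intro mult_left_mono) auto
     also have "... = 6 ^ Suc (N + 3) * r" by (simp add: power_add)
     finally have x23: "x : ball c (6 ^ Suc (N + 3) * r)" by simp
     have "nn (T h x) <= ennreal (cmod (T u x) + cmod alpha * cmod (T ?i x))" using * by (rule ennreal_leI)
     also have "... = nn (T u x) + ennreal (cmod alpha) * nn (T ?i x)" by (simp add: ennreal_plus ennreal_mult)
     finally have "?w x * nn (T h x) <= ?w x * (nn (T u x) + ennreal (cmod alpha) * nn (T ?i x))"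
      by (intro mult_left_mono) auto
     also have "... = ?w x * nn (T u x) + ennreal (cmod alpha) * (?w x * nn (T ?i x))"
      by (simp add: distrib_left mult_ac)
     also have "?w x * nn (T u x) = ?w x * nn (T u x) * indicator ?S2 x + ?w x * nn (T u x) * indicator ?S3 x"
      using x23 by (cases "x : ?S2") auto
     also have "?w x * nn (T ?i x) = ?w x * nn (T ?i x) * indicator ?S4 x" using x4 by simp
     finally show ?thesis using False by (simp add: add.assoc del: mem_ball)
    qed
   qed
   also have "... = (int_on ?S1 (%x. ?w x * nn (T h x)) + int_on ?S2 (%x. ?w x * nn (T u x))) +
     (int_on ?S3 (%x. ?w x * nn (T u x)) + ennreal (cmod alpha) * int_on ?S4 (%x. ?w x * nn (T ?i x)))"
    by (simp add: nn_integral_add nn_integral_cmult)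
   also have "... <= (ennreal (Kfar * Lambda) + ennreal (Knear * Lambda)) + (ennreal (Kmid * Lambda) + ennreal (KE * Lambda))"
    by (intro add_mono far near mid big)
   also have "... = ennreal ((Kfar + Knear + Kmid + KE) * Lambda)"
    using pos Lambda0 by (simp add: ennreal_plus[symmetric] algebra_simps del: ennreal_plus)
   finally show ?thesis .
  qed
  have c1: "K1 * Lambda <= C * Lambda" "(Kfar + Knear + Kmid + KE) * Lambda <= C * Lambda"
   using pos Lambda0 unfolding C_def by (auto intro!: mult_right_mono)
  show ?thesis
   using order_trans[OF part1 ennreal_leI[OF c1(1)]] order_trans[OF part2 ennreal_leI[OF c1(2)]]
   by (simp add: h_def[abs_def] alpha_def a_def Lambda_def)
 qed
 have "0 < C" using pos by (simp add: C_def)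
 thus ?thesis using main by blast
qed

end

context nonhomogeneous_space
begin

section \<open>Good functions and atoms\<close>

text \<open>Off-centre version of the comparison, for the small balls into which an atom is cut.\<close>

lemma dens_compare:
 assumes s: "0 < s" and d: "dist y c <= s" and t: "2 * s <= t" "t <= 6 ^ n * s"
 shows "dens y s <= Clam ^ (1 + 3 * n) * dens c t"
proof -
 have l: "0 < lam y s" "0 < lam c s" using s by (auto intro: lam_pos)
 have "V y s <= V c t" using d t by (intro V_near) simp
 hence "dens y s <= V c t / lam y s" unfolding dens_def using l by (intro divide_right_mono) auto
 also have "... <= Clam * (V c t / lam c s)"
 proof -
  have "lam c s <= Clam * lam y s" using s d by (intro lam_compare) (auto simp: dist_commute)
  hence "V c t * lam c s <= V c t * (Clam * lam y s)" by (intro mult_left_mono) auto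
  thus ?thesis using l by (simp add: field_simps)
 qed
 also have "... <= Clam * (Clam ^ (3 * n) * dens c t)"
  using s t Clam_pos by (intro mult_left_mono dens_upper) auto
 finally show ?thesis by simp
qed

text \<open>John--Nirenberg with exponent 2.\<close>

lemma clean_L2:
 assumes A: "0 < A" and cl: "clean p A b m" and f: "bfun f"
 shows "(%x. b x * f x) : L2"
proof -
 have [measurable]: "meas b" "meas f" using clean_meas[OF cl] bfun_meas[OF f] by auto
 obtain c z r where cf: "0 < c" "0 < r" "!!x. cmod (f x) <= c * indicator (ball z r) x" using bfun_bound[OF f] by metis
 let ?m = "m (z, r)"
 obtain C where "ALL b m c r. clean p A b m --> 0 < r -->
   (int_on (ball c r) (%x. ennreal (cmod (b x - m (c, r)) ^ 2))) <= ennreal (C * V c (6 ^ (p + 1) * r))"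
  using John_Nirenberg[OF A, of 2 p] by auto
 hence C: "int_on (ball z r) (%x. ennreal (cmod (b x - ?m) ^ 2)) <= ennreal (C * V z (6 ^ (p + 1) * r))"
  using cl cf(2) by blast
 have "sq (%x. b x * f x) <=
  (ntot (%x. ennreal (c\<^sup>2 * 2) * (ennreal (cmod (b x - ?m) ^ 2) * indicator (ball z r) x) + ennreal (c\<^sup>2 * 2 * (cmod ?m)\<^sup>2) * indicator (ball z r) x))"
 proof (rule nn_integral_mono)
  fix x
  show "ennreal ((cmod (b x * f x))\<^sup>2) <= ennreal (c\<^sup>2 * 2) * (ennreal (cmod (b x - ?m) ^ 2) * indicator (ball z r) x) + ennreal (c\<^sup>2 * 2 * (cmod ?m)\<^sup>2) * indicator (ball z r) x"
  proof (cases "x : ball z r")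
   case True
   have "(cmod (b x))\<^sup>2 <= 2 * (cmod (b x - ?m))\<^sup>2 + 2 * (cmod ?m)\<^sup>2" using norm_add_sq[of "b x - ?m" ?m] by simp
   moreover have "(cmod (f x))\<^sup>2 <= c\<^sup>2" using cf(3)[of x] True by (intro power_mono) auto
   ultimately have "(cmod (b x))\<^sup>2 * (cmod (f x))\<^sup>2 <= (2 * (cmod (b x - ?m))\<^sup>2 + 2 * (cmod ?m)\<^sup>2) * c\<^sup>2"
    by (intro mult_mono) auto
   hence "ennreal ((cmod (b x * f x))\<^sup>2) <= ennreal (c\<^sup>2 * 2 * (cmod (b x - ?m))\<^sup>2 + c\<^sup>2 * 2 * (cmod ?m)\<^sup>2)"
    by (intro ennreal_leI) (simp add: norm_mult power_mult_distrib algebra_simps)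
   also have "... = ennreal (c\<^sup>2 * 2) * ennreal (cmod (b x - ?m) ^ 2) + ennreal (c\<^sup>2 * 2 * (cmod ?m)\<^sup>2)"
    by (simp add: ennreal_plus ennreal_mult)
   finally show ?thesis using True by simp
  next
   case False thus ?thesis using cf(3)[of x] by simp
  qed
 qed
 also have "... = ennreal (c\<^sup>2 * 2) * int_on (ball z r) (%x. ennreal (cmod (b x - ?m) ^ 2)) + ennreal (c\<^sup>2 * 2 * (cmod ?m)\<^sup>2) * emeasure M (ball z r)"
  by (simp add: nn_integral_add nn_integral_cmult)
 also have "... < \<infinity>"
 proof -
  have "int_on (ball z r) (%x. ennreal (cmod (b x - ?m) ^ 2)) < \<infinity>" using C by (rule le_less_trans) simp
  thus ?thesis using emeasure_ball_finite[of z r] by (simp add: ennreal_mult_less_top less_top)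
 qed
 finally show ?thesis by (simp add: L2_def)
qed

lemma mass_add:
 assumes [measurable]: "meas f" "meas g"
 shows "mass (%x. f x + g x) <= mass f + mass g"
proof -
 have "mass (%x. f x + g x) <= ntot (%x. nn (f x) + nn (g x))"
  by (intro nn_integral_mono) (simp add: ennreal_plus[symmetric] ennreal_leI norm_triangle_ineq del: ennreal_plus)
 thus ?thesis by (simp add: nn_integral_add)
qed

definition unit_bump :: "'a => real => 'a => complex" where
 "unit_bump c r x = indicator (ball c r) x / of_real (V c r)"

abbreviation center :: "('a => complex) => ('a => complex) => 'a => complex" where
 "center e u \<equiv> %x. u x - integral\<^sup>L M u * e x"

lemma unit_bump_bfun: "bfun (unit_bump c r)"
proof -
 have "bfun (%x. (1 / of_real (V c r)) * indicator (ball c r) x)"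
  by (intro bfun_cmult bfun_indicator[of _ c r]) auto
 thus ?thesis by (simp add: unit_bump_def[abs_def])
qed

end

context cz_setting
begin

lemma commutator_meas:
 "meas b ==> f : L2 ==> (%x. b x * f x) : L2 ==> meas (commutator b T f)"
proof -
 assume a: "meas b" "f : L2" "(%x. b x * f x) : L2"
 have [measurable]: "meas b" "meas (T f)" "meas (T (%x. b x * f x))"
  using a by (auto intro: T_meas)
 show ?thesis unfolding commutator_def by measurable
qed

lemma commutator_add:
 assumes "f : L2" "(%x. b x * f x) : L2" "g : L2" "(%x. b x * g x) : L2"
 shows "AE x in M. commutator b T (%x. f x + g x) x = commutator b T f x + commutator b T g x"
proof -
 have eq: "(%y. b y * (f y + g y)) = (%y. b y * f y + b y * g y)" by (simp add: fun_eq_iff distrib_left)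
 show ?thesis unfolding commutator_def eq using T_add[OF assms(1,3)] T_add[OF assms(2,4)]
  by eventually_elim (simp add: algebra_simps)
qed

lemma commutator_cmult:
 assumes "f : L2" "(%x. b x * f x) : L2"
 shows "AE x in M. commutator b T (%x. c * f x) x = c * commutator b T f x"
proof -
 have eq: "(%y. b y * (c * f y)) = (%y. c * (b y * f y))" by (simp add: fun_eq_iff mult_ac)
 show ?thesis unfolding commutator_def eq using T_cmult[OF assms(1), of c] T_cmult[OF assms(2), of c]
  by eventually_elim (simp add: algebra_simps)
qed

text \<open>
The representation refers to every clean symbol with the same parameters, so that the constant is uniform
in the symbol and survives truncation of it. The functions X and Y may depend on the symbol. Since Y
enters through T, it is required to be in L^2.
\<close>

definition good :: "nat => real => ('a => complex) => real => bool" where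
 "good p A g kappa \<longleftrightarrow> 0 < A & bfun g & 0 <= kappa & (ALL b m. clean p A b m -->
   (EX X Y. meas X & Y : L2 & (AE x in M. commutator b T g x = X x - T Y x) &
    mass X <= ennreal kappa & mass Y <= ennreal kappa))"

text \<open>Here X = (b - a) Tg and Y = (b - a) g.\<close>

lemma good_single:
 assumes A: "0 < A" and g: "bfun g" and kappa: "0 <= kappa"
  and *: "!!b m. clean p A b m ==> EX a. (ntot (%x. nn (b x - a) * nn (g x))) <= ennreal kappa &
    (ntot (%x. nn (b x - a) * nn (T g x))) <= ennreal kappa"
 shows "good p A g kappa"
 unfolding good_def
proof (intro conjI allI impI A g kappa)
 fix b m assume cl: "clean p A b m"
 have [measurable]: "meas b" "meas (T g)" using clean_meas[OF cl] T_meas[OF bfun_L2[OF g]] by auto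
 obtain a where a: "ntot (%x. nn (b x - a) * nn (g x)) <= ennreal kappa"
    "ntot (%x. nn (b x - a) * nn (T g x)) <= ennreal kappa" using *[OF cl] by blast
 have eq: "(%x. (b x - a) * g x) = (%x. b x * g x - a * g x)" by (simp add: fun_eq_iff left_diff_distrib)
 note L = clean_L2[OF A cl g] L2_cmult[OF bfun_L2[OF g], of a]
 have "AE x in M. commutator b T g x = (b x - a) * T g x - T (%x. (b x - a) * g x) x"
  unfolding eq using T_diff[OF L] T_cmult[OF bfun_L2[OF g], of a]
  by eventually_elim (simp add: commutator_def algebra_simps)
 moreover have "(%x. (b x - a) * g x) : L2" unfolding eq by (rule L2_diff[OF L])
 moreover have "meas (%x. (b x - a) * T g x)" by measurable
 ultimately show "EX X Y. meas X & Y : L2 & (AE x in M. commutator b T g x = X x - T Y x) &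
    mass X <= ennreal kappa & mass Y <= ennreal kappa"
  using a by (intro exI[of _ "%x. (b x - a) * T g x"] exI[of _ "%x. (b x - a) * g x"]) (auto simp: norm_mult ennreal_mult)
qed

lemma good_add:
 assumes g: "good p A g kappa" "good p A g' kappa'"
 shows "good p A (%x. g x + g' x) (kappa + kappa')"
 unfolding good_def
proof (intro conjI allI impI)
 have A: "0 < A" and gb: "bfun g" "bfun g'" and k: "0 <= kappa" "0 <= kappa'" using g by (auto simp: good_def)
 thus "0 < A" "bfun (%x. g x + g' x)" "0 <= kappa + kappa'" by (auto intro: bfun_add)
 fix b m assume cl: "clean p A b m"
 obtain X Y where X [measurable]: "meas X" and Y: "Y : L2" "AE x in M. commutator b T g x = X x - T Y x" "mass X <= ennreal kappa" "mass Y <= ennreal kappa"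
  using g(1) cl unfolding good_def by blast
 obtain X' Y' where X' [measurable]: "meas X'" and Y': "Y' : L2" "AE x in M. commutator b T g' x = X' x - T Y' x" "mass X' <= ennreal kappa'" "mass Y' <= ennreal kappa'"
  using g(2) cl unfolding good_def by blast
 have [measurable]: "meas Y" "meas Y'" using Y(1) Y'(1) by (auto dest: L2_meas)
 have "AE x in M. commutator b T (%x. g x + g' x) x = (X x + X' x) - T (%x. Y x + Y' x) x"
  using commutator_add[OF bfun_L2[OF gb(1)] clean_L2[OF A cl gb(1)] bfun_L2[OF gb(2)] clean_L2[OF A cl gb(2)]]
   T_add[OF Y(1) Y'(1)] Y(2) Y'(2) by eventually_elim simp
 moreover have "mass (%x. X x + X' x) <= ennreal (kappa + kappa')" "mass (%x. Y x + Y' x) <= ennreal (kappa + kappa')"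
  unfolding ennreal_plus[OF k] by (rule order_trans[OF mass_add add_mono]; use Y Y' in measurable)+
 ultimately show "EX X Y. meas X & Y : L2 & (AE x in M. commutator b T (%x. g x + g' x) x = X x - T Y x) &
    mass X <= ennreal (kappa + kappa') & mass Y <= ennreal (kappa + kappa')"
  using L2_add[OF Y(1) Y'(1)] by (intro exI[of _ "%x. X x + X' x"] exI[of _ "%x. Y x + Y' x"]) auto
qed

lemma good_cmult:
 assumes g: "good p A g kappa"
 shows "good p A (%x. c * g x) (cmod c * kappa)"
 unfolding good_def
proof (intro conjI allI impI)
 have A: "0 < A" and gb: "bfun g" and k: "0 <= kappa" using g by (auto simp: good_def)
 thus "0 < A" "bfun (%x. c * g x)" "0 <= cmod c * kappa" by (auto intro: bfun_cmult)
 fix b m assume cl: "clean p A b m"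
 obtain X Y where X [measurable]: "meas X" and Y: "Y : L2" "AE x in M. commutator b T g x = X x - T Y x" "mass X <= ennreal kappa" "mass Y <= ennreal kappa"
  using g cl unfolding good_def by blast
 have [measurable]: "meas Y" using Y(1) by (rule L2_meas)
 have "AE x in M. commutator b T (%x. c * g x) x = c * X x - T (%x. c * Y x) x"
  using commutator_cmult[OF bfun_L2[OF gb] clean_L2[OF A cl gb], of c] T_cmult[OF Y(1), of c] Y(2)
  by eventually_elim (simp add: right_diff_distrib)
 moreover have "mass (%x. c * X x) <= ennreal (cmod c * kappa)" "mass (%x. c * Y x) <= ennreal (cmod c * kappa)"
  using Y k by (auto simp: norm_mult ennreal_mult nn_integral_cmult intro: mult_left_mono)
 ultimately show "EX X Y. meas X & Y : L2 & (AE x in M. commutator b T (%x. c * g x) x = X x - T Y x) &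
    mass X <= ennreal (cmod c * kappa) & mass Y <= ennreal (cmod c * kappa)"
  using L2_cmult[OF Y(1), of c] by (intro exI[of _ "%x. c * X x"] exI[of _ "%x. c * Y x"]) auto
qed

lemma good_mono: "good p A g kappa ==> kappa <= kappa' ==> good p A g kappa'"
proof -
 assume g: "good p A g kappa" and k: "kappa <= kappa'"
 have e: "ennreal kappa <= ennreal kappa'" using k by (rule ennreal_leI)
 show ?thesis using g k unfolding good_def by (meson e order_trans)
qed

lemma T_null: "bfun u ==> AE x in M. u x = 0 ==> AE x in M. T u x = 0"
proof -
 assume u: "bfun u" "AE x in M. u x = 0"
 have "AE x in M. T u x = T (%x. 0) x" using u by (intro T_cong_AE bfun_L2 bfun_zero) auto
 moreover have "AE x in M. T (%x. 0) x = 0" using T_cmult[OF bfun_L2[OF bfun_zero], of 0] by simp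
 ultimately show ?thesis by eventually_elim simp
qed

lemma good_null:
 assumes A: "0 < A" and u: "bfun u" "AE x in M. u x = 0"
 shows "good p A u 0"
proof (rule good_single[OF A u(1)])
 fix b
 have "ntot (%x. nn (b x - 0) * nn (u x)) = ntot (%x. 0)"
  using u(2) by (intro nn_integral_cong_AE) (auto elim!: eventually_mono)
 moreover have "ntot (%x. nn (b x - 0) * nn (T u x)) = ntot (%x. 0)"
  using T_null[OF u] by (intro nn_integral_cong_AE) (auto elim!: eventually_mono)
 ultimately show "EX a. (ntot (%x. nn (b x - a) * nn (u x))) <= ennreal 0 &
    (ntot (%x. nn (b x - a) * nn (T u x))) <= ennreal 0" by (intro exI[of _ 0]) simp
qed auto

lemma good_sum:
 assumes A: "0 < A" and "finite I" "!!i. i : I ==> good p A (g i) (kappa i)"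
 shows "good p A (%x. SUM i:I. g i x) (SUM i:I. kappa i)"
 using assms(2,3)
proof (induction I rule: finite_induct)
 case empty
 show ?case using good_null[OF A bfun_zero] by simp
next
 case (insert i I)
 hence "good p A (%x. g i x + (SUM i:I. g i x)) (kappa i + (SUM i:I. kappa i))" by (intro good_add) auto
 thus ?case using insert by simp
qed

text \<open>
The only feature of an atom that the estimate needs: multiplied by the measure of a small dilated ball
and by the discrete coefficient, its restriction to the ball has a controlled moment.
\<close>

definition locally_small :: "nat => real => real => 'a \<times> real => 'a => real => ('a => complex) => bool" where
 "locally_small p q rho B c r a \<longleftrightarrow> (ALL W y s. W : sets M --> W \<subseteq> ball y s --> 0 < s --> 0 < V y s --> ball y (6 ^ (p + 2) * s) \<subseteq> ball c (rho * r) -->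
   npow q (%x. of_real (V y (6 ^ (p + 2) * s) * discrete_coeff M lam rho (c, r) B) * (indicator W x * a x)) <= 2 * V y (6 ^ (p + 2) * s))"

text \<open>
The atom is cut into boundedly many pieces on balls so small that their dilates stay inside \<rho>B'.
Each piece, normalised, goes through one block from its small ball to a first doubling ball and then
along doubling dilates of B' up to a ball concentric with B. The chain lemma counts the links by the
discrete coefficient, which is the factor by which the piece was normalised. The final radius Rt depends
on B alone, so that the bumps of the two atoms of a block can cancel.
\<close>

lemma atom_good:
 assumes A: "0 < A" and n: "3 <= n" and q: "real n / (real n - 1) < q" "q <= 2" and rho: "1 < rho"
 shows "EX C>0. ALL cB rB. 0 < rB --> 0 < V cB rB --> (EX Rt. 0 < V cB Rt &
  (ALL c r a. 0 < r --> r <= 2 * rB --> dist c cB < rB --> 0 < V c r --> bfun a --> supb a c r -->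
   locally_small p q rho (cB, rB) c r a -->
   good p A (center (unit_bump cB Rt) a) C))"
proof -
 define P where "P = p + 5"
 obtain beta where beta: "dbl P beta" using dbl_exists by blast
 have beta1: "1 <= beta" and beta2: "2 * Clam ^ (3 * P) <= beta" using beta by (auto simp: dbl_def)
 have P0: "0 < P" by (simp add: P_def)
 have q1: "1 <= q"
 proof -
  have "1 <= real n / (real n - 1)" using n by (simp add: field_simps)
  thus ?thesis using q by linarith
 qed
 \<comment> \<open>With this k1 the relevant dilates of a piece stay inside the ball of radius \<rho> r.\<close>
 obtain k1 :: nat where k1: "(6 ^ (p + 2) + 1) / (rho - 1) < 6 ^ k1" using real_arch_pow[of 6] by auto
 obtain N0 :: nat where N0: "!!k x r. 0 < r ==>
   EX A. finite A & card A <= N0 ^ k & ball (x::'a) r \<subseteq> (UN y:A. ball y (r / 2 ^ k))"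
  using cover_count by blast
 obtain A1 where A1: "1 <= A1" "!!c r e R n. 0 < r ==> 0 < R ==> 6 ^ n * r <= R ==>
   1 + (SUM k:{1..n}. dens c (6 ^ k * r)) <= A1 * discrete_coeff M lam rho (c, r) (e, R)"
  using coeff_lower[OF rho] by blast
 define C0 where "C0 = real P + 4 + (real k1 + 1 + Clam ^ 4 * (real P + 2))"
 have Cl0: "0 <= Clam ^ 4 * (real P + 2)" using Clam_pos by simp
 have C00: "0 <= C0" "real P + 4 <= C0" "real k1 + 1 + Clam ^ 4 * (real P + 2) <= C0" using Cl0 by (simp_all add: C0_def)
 obtain CN where CN: "0 < CN" "!!b m c r e R N u. clean p A b m ==> link C0 c r e R N ==> V e (6 ^ (p + 5) * R) <= beta * V e R ==>
  bfun u ==> supb u c r ==> npow q u <= 2 * V c (6 ^ (p + 2) * r) ==>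
  (ntot (%x. nn (b x - m (e, R)) * nn (u x - tot u / V e R * indicator (ball e R) x))) <= ennreal (CN * V c (6 ^ (p + 2) * r)) &
  (ntot (%x. nn (b x - m (e, R)) * nn (T (%x. u x - tot u / V e R * indicator (ball e R) x) x))) <= ennreal (CN * V c (6 ^ (p + 2) * r))"
  using nice_block[OF A n q beta1 C00(1)] by blast
 have nb: "good p A (center (unit_bump e R) u) (CN * V c (6 ^ (p + 2) * r))"
  if "link C0 c r e R N" "V e (6 ^ P * R) <= beta * V e R" "bfun u" "supb u c r" "npow q u <= 2 * V c (6 ^ (p + 2) * r)" for c r e R N u
 proof -
  have eq: "(center (unit_bump e R) u) = (%x. u x - tot u / V e R * indicator (ball e R) x)"
   by (simp add: unit_bump_def fun_eq_iff)
  have "bfun (center (unit_bump e R) u)"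
   by (intro bfun_diff bfun_cmult unit_bump_bfun that)
  thus ?thesis using CN(1) CN(2)[OF _ that[unfolded P_def]] unfolding eq by (intro good_single[OF A]) auto
 qed
 have bump_step: "good p A (%x. unit_bump c r x - unit_bump e R x) (CN * beta)"
  if li: "link C0 c r e R N" and d1: "V c (6 ^ P * r) <= beta * V c r" and d2: "V e (6 ^ P * R) <= beta * V e R" for c r e R N
 proof -
  have r: "0 < r" "0 < V c r" using li by (auto simp: link_def)
  let ?u = "indicator (ball c r) :: 'a => complex"
  have u: "bfun ?u" "supb ?u c r" by (auto simp: supb_def intro: bfun_indicator[of _ c r])
  have le: "V c r <= V c (6 ^ (p + 2) * r)" "V c (6 ^ (p + 2) * r) <= beta * V c r"
  proof -
   have "V c (1 * r) <= V c (6 ^ (p + 2) * r)" using r by (intro V_mono mult_right_mono one_le_power) auto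
   thus "V c r <= V c (6 ^ (p + 2) * r)" by simp
   have "V c (6 ^ (p + 2) * r) <= V c (6 ^ P * r)" using r unfolding P_def by (intro V_mono mult_right_mono power_increasing) auto
   thus "V c (6 ^ (p + 2) * r) <= beta * V c r" using d1 by linarith
  qed
  have "npow q ?u = tot (%x. indicator (ball c r) x)"
   by (intro Bochner_Integration.integral_cong) (auto simp: indicator_def)
  hence "npow q ?u = V c r" by (simp add: V_def)
  hence "good p A (%x. ?u x - tot ?u * unit_bump e R x) (CN * V c (6 ^ (p + 2) * r))"
   using le r by (intro nb[OF li d2 u]) simp
  hence "good p A (%x. (1 / of_real (V c r)) * (?u x - of_real (V c r) * unit_bump e R x)) (cmod (1 / of_real (V c r)) * (CN * V c (6 ^ (p + 2) * r)))"
   unfolding integral_indicator_ball by (rule good_cmult)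
  moreover have "(%x. (1 / of_real (V c r)) * (?u x - of_real (V c r) * unit_bump e R x)) = (%x. unit_bump c r x - unit_bump e R x)"
   using r by (simp add: fun_eq_iff unit_bump_def[of c] right_diff_distrib)
  moreover have "cmod (1 / of_real (V c r)) * (CN * V c (6 ^ (p + 2) * r)) <= CN * beta"
  proof -
   have "cmod (1 / of_real (V c r)) = 1 / V c r" using r by (simp add: norm_divide)
   moreover have "1 / V c r * (CN * V c (6 ^ (p + 2) * r)) <= 1 / V c r * (CN * (beta * V c r))"
    using le CN r by (intro mult_left_mono) auto
   ultimately show ?thesis using r by simp
  qed
  ultimately show ?thesis by (metis good_mono)
 qed
 define St where "St = Clam ^ 7 * (real P + 3)"
 have St0: "0 <= St" using Clam_pos by (simp add: St_def)
 define CP where "CP = CN + 3 * (CN * beta * (1 + 3 * A1 + St))"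
 have CP0: "0 < CP" unfolding CP_def using CN beta1 A1 St0 by (intro add_pos_nonneg) auto
 define C where "C = real (N0 ^ (3 * k1)) * CP + 1"
 have C1: "0 < C" using CP0 by (simp add: C_def add_nonneg_pos)
 have main: "EX Rt. 0 < V cB Rt &
  (ALL c r a. 0 < r --> r <= 2 * rB --> dist c cB < rB --> 0 < V c r --> bfun a --> supb a c r -->
   locally_small p q rho (cB, rB) c r a -->
   good p A (center (unit_bump cB Rt) a) C)"
  if rB: "0 < rB" and VB: "0 < V cB rB" for cB rB
 proof -
  obtain J where J: "1 <= J" "V cB (6 ^ (J + P) * rB) <= beta * V cB (6 ^ J * rB)" "(SUM k:{1..<J}. dens cB (6 ^ k * rB)) <= real P"
   using first_doubling[OF rB beta2 VB P0, of 1] by auto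
  define Rt where "Rt = 6 ^ J * rB"
  have Rt: "0 < Rt" "0 < V cB Rt" "V cB (6 ^ P * Rt) <= beta * V cB Rt" "6 * rB <= Rt"
  proof -
   show "0 < Rt" "0 < V cB Rt" using rB VB V_scale_pos by (auto simp: Rt_def)
   show "V cB (6 ^ P * Rt) <= beta * V cB Rt" using J(2) by (simp add: Rt_def power_add mult_ac)
   have "6 ^ 1 * rB <= 6 ^ J * rB" using rB J(1) by (intro mult_right_mono power_increasing) auto
   thus "6 * rB <= Rt" by (simp add: Rt_def)
  qed
  show ?thesis
  proof (intro exI[of _ Rt] conjI Rt(2) allI impI)
   fix c r a
   assume r: "0 < r" "r <= 2 * rB" and dc: "dist c cB < rB" and Vc: "0 < V c r" and a: "bfun a" "supb a c r"
    and S: "locally_small p q rho (cB, rB) c r a"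
   define K where "K = discrete_coeff M lam rho (c, r) (cB, rB)"
   have K1: "1 <= K" unfolding K_def by (rule coeff_ge_1[OF rho r(1)])
   let ?delta = "%k. dens c (6 ^ k * r)"
   have d: "0 <= dens y (6 ^ k * t)" "dens y (6 ^ k * t) <= 1" if "0 < t" for y k t
    using dens_bounds[of "6 ^ k * t" y] that by auto
   have "EX n0. rB <= 6 ^ n0 * r & 6 ^ n0 * r <= 6 * rB & (SUM k:{0..n0}. ?delta k) <= 1 + A1 * K"
   proof (cases "rB <= r")
    case True
    have "1 <= 1 + A1 * K" using A1 K1 by simp
    thus ?thesis using True r d(2)[of r c 0] rB by (intro exI[of _ 0]) auto
   next
    case False
    then obtain l where l: "6 ^ l * r < rB" "rB <= 6 ^ Suc l * r" using scale_index'[of r rB] r by auto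
    have "(SUM k:{0..Suc l}. ?delta k) = ?delta 0 + (SUM k:{1..l}. ?delta k) + ?delta (Suc l)"
     by (simp add: sum.atLeast_Suc_atMost)
    also have "... <= 1 + (1 + (SUM k:{1..l}. ?delta k))" using d(2)[OF r(1), of c 0] d(2)[OF r(1), of c "Suc l"] by simp
    also have "... <= 1 + A1 * K" using A1(2)[of r rB l c cB] l(1) r rB by (simp add: K_def)
    finally show ?thesis using l by (intro exI[of _ "Suc l"]) auto
   qed
   then obtain n0 where n0: "rB <= 6 ^ n0 * r" "6 ^ n0 * r <= 6 * rB" "(SUM k:{0..n0}. ?delta k) <= 1 + A1 * K" by blast
   define n' where "n' = n0 + J"
   have n'R: "Rt <= 6 ^ n' * r" "6 ^ n' * r <= 6 * Rt"
   proof -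
    have e: "6 ^ n' * r = 6 ^ J * (6 ^ n0 * r)" by (simp add: n'_def power_add)
    show "Rt <= 6 ^ n' * r" unfolding e Rt_def using n0 by (intro mult_left_mono) auto
    have "6 ^ J * (6 ^ n0 * r) <= 6 ^ J * (6 * rB)" using n0 by (intro mult_left_mono) auto
    thus "6 ^ n' * r <= 6 * Rt" unfolding e Rt_def by simp
   qed
   have n'1: "1 <= n'" using J(1) by (simp add: n'_def)
   have tail: "(SUM k:{n0 + 1..n'}. ?delta k) <= St"
   proof -
    have "(SUM k:{n0 + 1..n'}. ?delta k) = (SUM i:{1..J}. ?delta (i + n0))"
     using sum.shift_bounds_cl_nat_ivl[of ?delta 1 n0 J] by (simp add: n'_def add.commute)
    also have "... <= (SUM i:{1..J}. Clam ^ 7 * dens cB (6 ^ (i + 2) * rB))"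
    proof (intro sum_mono)
     fix i :: nat
     have e: "6 ^ (i + n0) * r = 6 ^ i * (6 ^ n0 * r)" by (simp add: power_add)
     have lo: "6 ^ i * rB <= 6 ^ (i + n0) * r" unfolding e using n0 by (intro mult_left_mono) auto
     have hi: "6 ^ (i + n0) * r <= 6 ^ i * (6 * rB)" unfolding e using n0 by (intro mult_left_mono) auto
     have "1 * rB <= 6 ^ i * rB" using rB by (intro mult_right_mono one_le_power) auto
     hence dcB: "dist c cB <= 6 ^ (i + n0) * r" using dc lo by linarith
     have "dens c (6 ^ (i + n0) * r) <= Clam ^ (1 + 3 * 2) * dens cB (6 ^ (i + 2) * rB)"
     proof (intro dens_compare)
      have t: "6 ^ (i + 2) * rB = 36 * (6 ^ i * rB)" by (simp add: power_add)
      have t0: "0 <= 6 ^ i * rB" using rB by simp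
      show "0 < 6 ^ (i + n0) * r" using r by simp
      show "dist c cB <= 6 ^ (i + n0) * r" by (rule dcB)
      show "2 * (6 ^ (i + n0) * r) <= 6 ^ (i + 2) * rB" unfolding t using hi t0 by linarith
      show "6 ^ (i + 2) * rB <= 6 ^ 2 * (6 ^ (i + n0) * r)" unfolding t using lo by simp
     qed
     thus "?delta (i + n0) <= Clam ^ 7 * dens cB (6 ^ (i + 2) * rB)" by simp
    qed
    also have "... = Clam ^ 7 * (SUM i:{1..J}. dens cB (6 ^ (i + 2) * rB))" by (simp add: sum_distrib_left)
    also have "(SUM i:{1..J}. dens cB (6 ^ (i + 2) * rB)) = (SUM k:{1 + 2..J + 2}. dens cB (6 ^ k * rB))"
     by (rule sum.shift_bounds_cl_nat_ivl[symmetric])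
    also have "Clam ^ 7 * ... <= St" unfolding St_def
    proof (intro mult_left_mono)
     have "(SUM k:{1 + 2..J + 2}. dens cB (6 ^ k * rB)) <= (SUM k:{1..<J} Un {J..J + 2}. dens cB (6 ^ k * rB))"
      using d rB by (intro sum_mono2) auto
     also have "... = (SUM k:{1..<J}. dens cB (6 ^ k * rB)) + (SUM k:{J..J + 2}. dens cB (6 ^ k * rB))"
      by (intro sum.union_disjoint) auto
     also have "(SUM k:{J..J + 2}. dens cB (6 ^ k * rB)) <= (SUM k:{J..J + 2}. 1)" using d rB by (intro sum_mono) auto
     finally show "(SUM k:{1 + 2..J + 2}. dens cB (6 ^ k * rB)) <= real P + 3" using J(3) by simp
    qed (use Clam_pos in auto)
    finally show ?thesis .
   qed
   have whole: "1 + (SUM k:{k..n'}. ?delta k) <= (1 + 3 * A1 + St) * K" for k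
   proof -
    have "(SUM k:{k..n'}. ?delta k) <= (SUM k:{0..n0} Un {n0 + 1..n'}. ?delta k)" using d r by (intro sum_mono2) auto
    also have "... <= (SUM k:{0..n0}. ?delta k) + (SUM k:{n0 + 1..n'}. ?delta k)" using d r by (intro sum_Un_le) auto
    also have "... <= 1 + A1 * K + St" using tail n0(3) by linarith
    finally have "1 + (SUM k:{k..n'}. ?delta k) <= 2 + A1 * K + St" by simp
    also have "... <= 2 * (A1 * K) + A1 * K + St * K + K"
    proof -
     have "1 * 1 <= A1 * K" using A1 K1 by (intro mult_mono) auto
     moreover have "St * 1 <= St * K" using St0 K1 by (intro mult_left_mono) auto
     ultimately show ?thesis using K1 by linarith
    qed
    also have "... = (1 + 3 * A1 + St) * K" by (simp add: algebra_simps)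
    finally show ?thesis .
   qed
   define D where "D k \<longleftrightarrow> V c (6 ^ P * (6 ^ k * r)) <= beta * V c (6 ^ k * r)" for k :: nat
   have VD: "0 < V c (6 ^ k * r)" for k by (rule V_scale_pos[OF r(1) Vc])
   have nonD: "(SUM k:{i..<j}. ?delta k) <= real P" if "!!k. i <= k ==> k < j ==> ~ D k" for i j
   proof (rule nondoubling_sum[OF r(1) beta2])
    fix k assume "i <= k" "k < j"
    hence "~ D k" using that by blast
    thus "beta * V c (6 ^ k * r) <= V c (6 ^ (k + P) * r)" by (simp add: D_def power_add mult_ac)
   qed
   have shift: "(SUM k:{0..l}. dens c (6 ^ k * (6 ^ i * r))) = (SUM k:{i..l+i}. ?delta k)" for i l
   proof -
    have "(SUM k:{0..l}. dens c (6 ^ k * (6 ^ i * r))) = (SUM k:{0..l}. ?delta (k + i))"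
     by (simp add: power_add mult_ac)
    also have "... = (SUM k:{0+i..l+i}. ?delta k)" by (rule sum.shift_bounds_cl_nat_ivl[symmetric])
    finally show ?thesis by simp
   qed
   \<comment> \<open>Bumps on doubling dilates of the ball of the atom differ from the final bump by good functions, with a constant given by the sum of the densities in between.\<close>
   have chain: "good p A (%x. unit_bump c (6 ^ k * r) x - unit_bump cB Rt x) (CN * beta * (1 + (SUM k:{k..n'}. ?delta k)))"
    if "k <= n'" "D k" for k
   proof (rule chain_lemma[where P=D and g="real P" and delta="?delta" and n=n' and k=k and
      R="%k kappa. good p A (%x. unit_bump c (6 ^ k * r) x - unit_bump cB Rt x) (CN * beta * kappa)"])
    fix i j :: nat assume "!!k. i <= k ==> k < j ==> ~ D k"
    thus "(SUM k:{i..<j}. ?delta k) <= real P" by (rule nonD)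
   next
    fix k assume k: "k <= n'" "D k" "(SUM k:{k..n'}. ?delta k) <= real P + 4"
    have "link C0 c (6 ^ k * r) cB Rt (n' - k)"
     unfolding link_def
    proof (intro conjI)
     have e: "6 ^ (n' - k) * (6 ^ k * r) = 6 ^ n' * r" using k(1) by (simp add: mult.assoc[symmetric] power_add[symmetric])
     show "Rt <= 6 ^ (n' - k) * (6 ^ k * r)" "6 ^ (n' - k) * (6 ^ k * r) <= 36 * Rt" unfolding e using n'R Rt by auto
     have "6 ^ k * r <= 6 ^ n' * r" using k(1) r by (intro mult_right_mono power_increasing) auto
     thus "6 ^ k * r <= 6 * Rt" using n'R by linarith
     show "dist c cB <= Rt" using dc Rt rB by linarith
     show "(SUM l:{0..n' - k}. dens c (6 ^ l * (6 ^ k * r))) <= C0" unfolding shift using k C00 by simp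
    qed (use r Rt VD in auto)
    hence "good p A (%x. unit_bump c (6 ^ k * r) x - unit_bump cB Rt x) (CN * beta)"
     using k(2) Rt(3) unfolding D_def by (rule bump_step)
    thus "good p A (%x. unit_bump c (6 ^ k * r) x - unit_bump cB Rt x) (CN * beta * 1)" by simp
   next
    fix k k' kappa assume k: "D k" "D k'" "k < k'" "k' <= n'" "(SUM k:{k..k'}. ?delta k) <= real P + 4"
     "good p A (%x. unit_bump c (6 ^ k' * r) x - unit_bump cB Rt x) (CN * beta * kappa)"
    have "link C0 c (6 ^ k * r) c (6 ^ k' * r) (k' - k)"
     unfolding link_def
    proof (intro conjI)
     have e: "6 ^ (k' - k) * (6 ^ k * r) = 6 ^ k' * r" using k(3) by (simp add: mult.assoc[symmetric] power_add[symmetric])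
     show "6 ^ k' * r <= 6 ^ (k' - k) * (6 ^ k * r)" "6 ^ (k' - k) * (6 ^ k * r) <= 36 * (6 ^ k' * r)" unfolding e using r by auto
     have "6 ^ k * r <= 6 ^ k' * r" using k(3) r by (intro mult_right_mono power_increasing) auto
     moreover have "0 <= 6 ^ k' * r" using r by simp
     ultimately show "6 ^ k * r <= 6 * (6 ^ k' * r)" by linarith
     show "(SUM l:{0..k' - k}. dens c (6 ^ l * (6 ^ k * r))) <= C0" unfolding shift using k C00 by simp
    qed (use r VD in auto)
    hence "good p A (%x. unit_bump c (6 ^ k * r) x - unit_bump c (6 ^ k' * r) x) (CN * beta)"
     using k(1,2) unfolding D_def by (rule bump_step)
    from good_add[OF this k(6)]
    show "good p A (%x. unit_bump c (6 ^ k * r) x - unit_bump cB Rt x) (CN * beta * (kappa + 1))"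
     by (simp add: algebra_simps)
   next
    fix k kappa and kappa' :: real assume "good p A (%x. unit_bump c (6 ^ k * r) x - unit_bump cB Rt x) (CN * beta * kappa)" "kappa <= kappa'"
    thus "good p A (%x. unit_bump c (6 ^ k * r) x - unit_bump cB Rt x) (CN * beta * kappa')"
     using CN beta1 by (elim good_mono) (auto intro!: mult_left_mono)
   qed (use d r that in auto)
   \<comment> \<open>One normalised piece: from its own ball to a doubling dilate of the ball of the atom, then along the chain.\<close>
   define s where "s = r / 6 ^ k1"
   have s: "0 < s" "s <= r" "6 ^ k1 * s = r" using r by (auto simp: s_def divide_le_eq mult_le_cancel_left1)
   have small: "6 ^ (p + 2) * s + (r + s) <= rho * r"
   proof -
    have "(6 ^ (p + 2) + 1) < (rho - 1) * 6 ^ k1" using k1 rho by (simp add: field_simps)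
    hence "(6 ^ (p + 2) + 1) * s <= (rho - 1) * 6 ^ k1 * s" using s by (intro mult_right_mono) auto
    also have "... = (rho - 1) * r" using s(3) by simp
    finally show ?thesis by (simp add: algebra_simps)
   qed
   have piece: "good p A (%x. indicator W x * a x - tot (%x. indicator W x * a x) * unit_bump cB Rt x) CP"
    if W: "W : sets M" "W \<subseteq> ball y s" and dy: "dist y c < r + s" for W y
   proof (cases "V y s = 0")
    case True
    let ?u = "%x. indicator W x * a x"
    have ub: "bfun ?u" using a W by (intro bfun_restrict) auto
    have "ball y s : null_sets M" using True by (auto simp: null_sets_def emeasure_ball)
    hence "AE x in M. x ~: ball y s" by (rule AE_not_in)
    hence u0: "AE x in M. ?u x = 0" by eventually_elim (use W in \<open>auto simp: indicator_def\<close>)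
    hence "tot ?u = 0" by (rule integral_eq_zero_AE)
    thus ?thesis using good_mono[OF good_null[OF A ub u0]] CP0 by simp
   next
    case False
    hence Vy: "0 < V y s" using V_nonneg[of y s] by linarith
    define mu where "mu = V y (6 ^ (p + 2) * s)"
    have mu: "0 < mu" unfolding mu_def using s(1) Vy by (rule V_scale_pos)
    define u where "u x = indicator W x * a x" for x
    have ub: "bfun u" unfolding u_def using a W by (intro bfun_restrict) auto
    define v where "v x = of_real (mu * K) * u x" for x
    have vb: "bfun v" unfolding v_def using ub by (rule bfun_cmult)
    have vs: "supb v y s" using W by (auto simp: supb_def v_def u_def indicator_def)
    have sub: "ball y (6 ^ (p + 2) * s) \<subseteq> ball c (rho * r)"
    proof
     fix x assume "x : ball y (6 ^ (p + 2) * s)"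
     hence "dist c x < (r + s) + 6 ^ (p + 2) * s" using dy dist_triangle[of c x y] by (simp add: dist_commute)
     thus "x : ball c (rho * r)" using small by simp
    qed
    have vq: "npow q v <= 2 * mu"
     using S W s Vy sub unfolding locally_small_def v_def u_def mu_def K_def by blast
    have uv: "u x = of_real (1 / (mu * K)) * v x" for x using mu K1 by (simp add: v_def)
    \<comment> \<open>Densities about y and about c are comparable for radii beyond the distance of the two points.\<close>
    have ysum: "(SUM j:{0..k1 + l}. dens y (6 ^ j * s)) <= C0" if l: "(SUM k:{1..<l}. ?delta k) <= real P" "1 <= l" for l
    proof -
     have "(SUM j:{0..k1 + l}. dens y (6 ^ j * s)) <= (SUM j:{0..k1} Un {1 + k1..l + k1}. dens y (6 ^ j * s))"
      using d s by (intro sum_mono2) auto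
     also have "... <= (SUM j:{0..k1}. dens y (6 ^ j * s)) + (SUM j:{1 + k1..l + k1}. dens y (6 ^ j * s))"
      using d s by (intro sum_Un_le) auto
     also have "(SUM j:{0..k1}. dens y (6 ^ j * s)) <= (SUM j:{0..k1}. 1)" using d s by (intro sum_mono) auto
     also have "(SUM j:{1 + k1..l + k1}. dens y (6 ^ j * s)) = (SUM i:{1..l}. dens y (6 ^ (i + k1) * s))"
      by (rule sum.shift_bounds_cl_nat_ivl)
     also have "... <= (SUM i:{1..l}. Clam ^ 4 * ?delta (i + 1))"
     proof (intro sum_mono)
      fix i assume i: "i : {1..l}"
      have e: "6 ^ (i + k1) * s = 6 ^ i * r" using s(3) by (simp add: power_add mult.assoc)
      have "6 ^ 1 * r <= 6 ^ i * r" using i r by (intro mult_right_mono power_increasing) auto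
      hence "dist y c <= 6 ^ i * r" using dy s(2) r(1) unfolding power_one_right by linarith
      hence "dens y (6 ^ i * r) <= Clam ^ (1 + 3 * 1) * dens c (6 ^ (i + 1) * r)"
      using r by (intro dens_compare) auto
      thus "dens y (6 ^ (i + k1) * s) <= Clam ^ 4 * ?delta (i + 1)" unfolding e by simp
     qed
     also have "... = Clam ^ 4 * (SUM i:{1..l}. ?delta (i + 1))" by (simp add: sum_distrib_left)
     also have "(SUM i:{1..l}. ?delta (i + 1)) = (SUM k:{1 + 1..l + 1}. ?delta k)" by (rule sum.shift_bounds_cl_nat_ivl[symmetric])
     also have "Clam ^ 4 * ... <= Clam ^ 4 * (real P + 2)"
     proof (intro mult_left_mono)
      have "(SUM k:{1 + 1..l + 1}. ?delta k) <= (SUM k:{1..<l} Un {l..l + 1}. ?delta k)" using d r by (intro sum_mono2) auto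
      also have "... = (SUM k:{1..<l}. ?delta k) + (SUM k:{l..l + 1}. ?delta k)" by (intro sum.union_disjoint) auto
      also have "(SUM k:{l..l + 1}. ?delta k) <= (SUM k:{l..l + 1}. 1)" using d r by (intro sum_mono) auto
      finally show "(SUM k:{1 + 1..l + 1}. ?delta k) <= real P + 2" using l by simp
     qed (use Clam_pos in auto)
     finally show ?thesis using C00(3) by simp
    qed
    have e: "6 ^ (k1 + l) * s = 6 ^ l * r" for l using s(3) by (simp add: power_add mult_ac)
    have scale: "good p A (center (unit_bump e R) u) (CN / K)"
     if "good p A (center (unit_bump e R) v) (CN * mu)" for e R
    proof -
     have "good p A (%x. of_real (1 / (mu * K)) * (v x - tot v * unit_bump e R x)) (cmod (of_real (1 / (mu * K))) * (CN * mu))"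
      using that by (rule good_cmult)
     moreover have iu: "tot u = of_real (1 / (mu * K)) * tot v" by (simp add: uv[abs_def])
     have "(%x. of_real (1 / (mu * K)) * center (unit_bump e R) v x) = center (unit_bump e R) u"
      unfolding iu by (rule ext) (simp only: uv right_diff_distrib mult.assoc)
     moreover have "cmod (of_real (1 / (mu * K))) * (CN * mu) = CN / K" unfolding norm_of_real using mu K1 by simp
     ultimately show ?thesis by simp
    qed
    have CNK: "CN / K <= CN" using CN K1 by (simp add: divide_le_eq mult_le_cancel_left1)
    have fin: "good p A (center (unit_bump cB Rt) u) CP"
    proof (cases "EX k. 1 <= k & k <= n' & D k")
     case True
     define k where "k = (LEAST k. 1 <= k & k <= n' & D k)"
     have k: "1 <= k" "k <= n'" "D k" using LeastI_ex[OF True] unfolding k_def by auto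
     have "~ D i" if "1 <= i" "i < k" for i
      using not_less_Least[of i "%k. 1 <= k & k <= n' & D k"] that k unfolding k_def by auto
     hence sm: "(SUM i:{1..<k}. ?delta i) <= real P" by (rule nonD)
     have "link C0 y s c (6 ^ k * r) (k1 + k)"
      unfolding link_def e
     proof (intro conjI)
      have "6 ^ 1 * r <= 6 ^ k * r" using k r by (intro mult_right_mono power_increasing) auto
      thus "dist y c <= 6 ^ k * r" "s <= 6 * (6 ^ k * r)" using dy s(2) r(1) unfolding power_one_right by linarith+
      show "(SUM j:{0..k1 + k}. dens y (6 ^ j * s)) <= C0" by (rule ysum[OF sm k(1)])
     qed (use r s Vy VD in auto)
     hence "good p A (center (unit_bump c (6 ^ k * r)) v) (CN * mu)"
      unfolding mu_def using k(3) vb vs vq unfolding D_def mu_def by (intro nb) auto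
     hence g1: "good p A (center (unit_bump c (6 ^ k * r)) u) (CN / K)" by (rule scale)
     have g2: "good p A (%x. (tot u) * (unit_bump c (6 ^ k * r) x - unit_bump cB Rt x)) (cmod (tot u) * (CN * beta * (1 + (SUM k:{k..n'}. ?delta k))))"
      by (intro good_cmult chain k)
     have nu: "cmod (tot u) <= 3 / K"
     proof -
      have "nint v <= tot (%x. indicator (ball y s) x + cmod (v x) powr q)"
      proof (intro integral_mono bfun_norm_integrable[OF vb] Bochner_Integration.integrable_add integrable_real_indicator
      emeasure_ball_finite[of y s, folded infinity_ennreal_def] bfun_powr_integrable[OF vb])
      fix x
      have "cmod (v x) powr 1 <= 1 + cmod (v x) powr q" using q1 by (intro le_one_plus_powr) auto
      thus "cmod (v x) <= indicator (ball y s) x + cmod (v x) powr q"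
      using vs by (cases "x : ball y s") (auto simp: supb_def)
      qed (use q1 in auto)
      also have "... = V y s + npow q v"
      proof -
      have "0 <= q" using q1 by simp
      thus ?thesis using bfun_powr_integrable[OF vb, of q] emeasure_ball_finite[of y s] by (simp add: V_def)
      qed
      also have "... <= 3 * mu"
      proof -
      have "V y (1 * s) <= V y (6 ^ (p + 2) * s)" using s by (intro V_mono mult_right_mono one_le_power) auto
      thus ?thesis using vq by (simp add: mu_def)
      qed
      finally have nv: "nint v <= 3 * mu" .
      have "cmod (tot u) <= nint u" by (rule integral_norm_bound)
      also have "nint u = 1 / (mu * K) * nint v" using mu K1 by (simp add: uv norm_mult norm_divide)
      also have "... <= 1 / (mu * K) * (3 * mu)" using nv mu K1 by (intro mult_left_mono) auto
      also have "... = 3 / K" using mu by simp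
      finally show ?thesis .
     qed
     have "cmod (tot u) * (CN * beta * (1 + (SUM k:{k..n'}. ?delta k))) <= 3 / K * (CN * beta * ((1 + 3 * A1 + St) * K))"
     proof (intro mult_mono nu order_refl whole)
      show "0 <= CN * beta * (1 + (SUM k:{k..n'}. ?delta k))"
      using CN beta1 d r by (intro mult_nonneg_nonneg add_nonneg_nonneg sum_nonneg) auto
      show "0 <= 1 + (SUM k:{k..n'}. ?delta k)" using d r by (intro add_nonneg_nonneg sum_nonneg) auto
     qed (use CN beta1 K1 in auto)
     also have "... = 3 * (CN * beta * (1 + 3 * A1 + St))" using K1 by simp
     finally have le: "CN / K + cmod (tot u) * (CN * beta * (1 + (SUM k:{k..n'}. ?delta k))) <= CP"
      using CNK by (simp add: CP_def)
     have "(%x. (u x - tot u * unit_bump c (6 ^ k * r) x) + tot u * (unit_bump c (6 ^ k * r) x - unit_bump cB Rt x)) = (center (unit_bump cB Rt) u)"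
      by (simp add: fun_eq_iff algebra_simps)
     thus ?thesis using good_mono[OF good_add[OF g1 g2] le] by simp
    next
     case False
     have "(SUM i:{1..<Suc n'}. ?delta i) <= real P" using False by (intro nonD) auto
     moreover have "(SUM i:{1..<n'}. ?delta i) <= (SUM i:{1..<Suc n'}. ?delta i)" using d r by (intro sum_mono2) auto
     ultimately have sm: "(SUM i:{1..<n'}. ?delta i) <= real P" by linarith
     have "link C0 y s cB Rt (k1 + n')"
      unfolding link_def e
     proof (intro conjI)
      have "dist y cB <= dist y c + dist c cB" by (rule dist_triangle)
      thus "dist y cB <= Rt" using dy dc s r Rt(4) by linarith
      show "(SUM j:{0..k1 + n'}. dens y (6 ^ j * s)) <= C0" by (rule ysum[OF sm n'1])
      show "s <= 6 * Rt" using s r Rt(4) rB by linarith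
      show "6 ^ n' * r <= 36 * Rt" using n'R Rt by linarith
     qed (use r s Vy Rt n'R in auto)
     hence "good p A (center (unit_bump cB Rt) v) (CN * mu)"
      unfolding mu_def using Rt(3) vb vs vq unfolding mu_def by (intro nb) auto
     hence g1: "good p A (center (unit_bump cB Rt) u) (CN / K)" by (rule scale)
     have "0 <= 3 * (CN * beta * (1 + 3 * A1 + St))" using CN beta1 A1 St0 by simp
     thus ?thesis using good_mono[OF g1] CNK by (simp add: CP_def)
    qed
    thus ?thesis unfolding u_def[abs_def] .
   qed
   \<comment> \<open>Boundedly many pieces, whose constants add up.\<close>
   obtain Y where Y: "finite Y" "card Y <= N0 ^ (3 * k1)" "ball c r \<subseteq> (UN y:Y. ball y (r / 2 ^ (3 * k1)))"
    using N0[OF r(1), of "3 * k1" c] by blast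
   define Y' where "Y' = {y : Y. ball y s Int ball c r ~= {}}"
   have Y': "finite Y'" "card Y' <= N0 ^ (3 * k1)"
   proof -
    show "finite Y'" using Y by (simp add: Y'_def)
    have "card Y' <= card Y" using Y by (intro card_mono) (auto simp: Y'_def)
    thus "card Y' <= N0 ^ (3 * k1)" using Y by linarith
   qed
   have cov: "ball c r \<subseteq> (UN y:Y'. ball y s)"
   proof
    fix x assume x: "x : ball c r"
    then obtain y where y: "y : Y" "x : ball y (r / 2 ^ (3 * k1))" using Y(3) by blast
    have "(6::real) ^ k1 <= 8 ^ k1" by (intro power_mono) auto
    hence "r / 2 ^ (3 * k1) <= s" unfolding s_def using r by (intro divide_left_mono) (auto simp: power_mult)
    hence "x : ball y s" using y(2) by simp
    thus "x : (UN y:Y'. ball y s)" using x y(1) unfolding Y'_def by blast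
   qed
   obtain idx :: "'a => nat" where idx: "inj_on idx Y'" using Y'(1) finite_imp_inj_to_nat_seg by blast
   define W where "W y = ball y s - (UN z:{z : Y'. idx z < idx y}. ball z s)" for y
   have Ws: "W y : sets M" "W y \<subseteq> ball y s" for y
   proof -
    have "(UN z:{z : Y'. idx z < idx y}. ball z s) : sets M" using Y'(1) by (intro sets.finite_UN) auto
    thus "W y : sets M" unfolding W_def by auto
    show "W y \<subseteq> ball y s" unfolding W_def by blast
   qed
   have ind: "(SUM y:Y'. indicator (W y) x :: complex) = 1" if x: "x : ball c r" for x
   proof -
    have ex: "EX y. y : Y' & x : ball y s" using cov x by blast
    then obtain y where y: "y : Y'" "x : ball y s" and ymin: "!!z. z : Y' ==> x : ball z s ==> idx y <= idx z"
     using ex_has_least_nat[of "%y. y : Y' & x : ball y s" _ idx] by blast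
    have iff: "x : W z \<longleftrightarrow> z = y" if z: "z : Y'" for z
    proof
     assume xz: "x : W z"
     hence "x : ball z s" "~ idx y < idx z" using y unfolding W_def by auto
     hence "idx z = idx y" using ymin[OF z] by linarith
     thus "z = y" using idx z y(1) by (simp add: inj_on_def)
    next
     assume "z = y"
     thus "x : W z" using y ymin unfolding W_def by (auto simp: not_less dest: leD simp del: mem_ball)
    qed
    have "(SUM z:Y'. indicator (W z) x :: complex) = (SUM z:Y'. if z = y then 1 else 0)"
     using iff by (intro sum.cong) (auto simp: indicator_def)
    also have "... = 1" using Y'(1) y(1) by simp
    finally show ?thesis .
   qed
   have asum: "a x = (SUM y:Y'. indicator (W y) x * a x)" for x
   proof (cases "x : ball c r")
    case True
    have "(SUM y:Y'. indicator (W y) x * a x) = (SUM y:Y'. indicator (W y) x) * a x" by (rule sum_distrib_right[symmetric])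
    thus ?thesis unfolding ind[OF True] by simp
   next
    case False hence "a x = 0" using a(2) by (simp add: supb_def)
    thus ?thesis by simp
   qed
   have bw: "bfun (%x. indicator (W y) x * a x)" for y using a Ws by (intro bfun_restrict) auto
   have g: "good p A (%x. SUM y:Y'. (indicator (W y) x * a x - tot (%x. indicator (W y) x * a x) * unit_bump cB Rt x)) (SUM y:Y'. CP)"
   proof (intro good_sum A Y' piece Ws)
    fix y assume "y : Y'"
    then obtain x where "dist y x < s" "dist c x < r" by (auto simp: Y'_def)
    thus "dist y c < r + s" using dist_triangle[of y c x] by (simp add: dist_commute)
   qed (rule Ws)
   have ia: "tot a = (SUM y:Y'. \<integral>x. indicator (W y) x * a x \<partial>M)"
   proof -
    have "tot a = tot (%x. (SUM y:Y'. indicator (W y) x * a x))"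
     by (intro Bochner_Integration.integral_cong asum refl)
    also have "... = (SUM y:Y'. \<integral>x. indicator (W y) x * a x \<partial>M)"
     by (intro Bochner_Integration.integral_sum bfun_integrable bw)
    finally show ?thesis .
   qed
   have "(%x. SUM y:Y'. (indicator (W y) x * a x - tot (%x. indicator (W y) x * a x) * unit_bump cB Rt x)) = (center (unit_bump cB Rt) a)"
   proof
    fix x
    have "(SUM y:Y'. (indicator (W y) x * a x - tot (%x. indicator (W y) x * a x) * unit_bump cB Rt x))
     = (SUM y:Y'. indicator (W y) x * a x) - (SUM y:Y'. \<integral>x. indicator (W y) x * a x \<partial>M) * unit_bump cB Rt x"
     by (simp only: sum_subtractf sum_distrib_right)
    thus "(SUM y:Y'. (indicator (W y) x * a x - tot (%x. indicator (W y) x * a x) * unit_bump cB Rt x)) = a x - tot a * unit_bump cB Rt x"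
     using asum[of x] ia by presburger
   qed
   hence "good p A (center (unit_bump cB Rt) a) (SUM y:Y'. CP)" using g by simp
   moreover have "(SUM y:Y'. CP) <= C"
   proof -
    have "real (card Y') * CP <= real (N0 ^ (3 * k1)) * CP" using Y' CP0 by (intro mult_right_mono of_nat_mono) auto
    thus ?thesis by (simp add: C_def)
   qed
   ultimately show "good p A (center (unit_bump cB Rt) a) C" by (rule good_mono)
  qed
 qed
 show ?thesis using C1 main by blast
qed

end

section \<open>Atomic blocks and decompositions\<close>

text \<open>
If r > 2 rB, the smaller ball contains the larger one; then the two sets are equal, and so are the radii.
\<close>

lemma subball_geometry:
 fixes c cB :: "'a::metric_space"
 assumes r: "0 < r" "0 < rB" and sub: "subball (c, r) (cB, rB)"
 shows "r <= 2 * rB" "dist c cB < rB"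
proof -
 have inc: "ball c r \<subseteq> ball cB rB" and eq: "ball c r = ball cB rB ==> r = rB"
  using sub by (auto simp: subball_def ball_set_def)
 have "c : ball c r" using r by simp
 hence "c : ball cB rB" using inc by blast
 thus d: "dist c cB < rB" by (simp add: dist_commute)
 show "r <= 2 * rB"
 proof (rule ccontr)
  assume n: "~ r <= 2 * rB"
  have "ball cB rB \<subseteq> ball c r"
  proof
   fix x assume "x : ball cB rB"
   hence "dist c x < rB + rB" using d dist_triangle[of c x cB] by simp
   thus "x : ball c r" using n by simp
  qed
  hence "r = rB" using inc eq by blast
  thus False using n r by simp
 qed
qed

context nonhomogeneous_space
begin

lemma ess_supp_AE: "AE x in M. x ~: ess_supp M f --> f x = 0"
 using AE_locally[of "- ess_supp M f" "%x. f x = 0"] by (simp add: ess_supp_def)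

lemma ess_supp_ball_AE: "ess_supp M f \<subseteq> ball c r ==> AE x in M. x ~: ball c r --> f x = 0"
 using ess_supp_AE[of f] by (auto elim!: eventually_mono)

text \<open>
A ball that is null cannot carry anything, which disposes of atoms on balls of measure zero.
\<close>

lemma null_ball_AE:
 assumes "V c r = 0" "AE x in M. x ~: ball c r --> f x = (0::complex)"
 shows "AE x in M. f x = 0"
proof -
 have "ball c r : null_sets M" using assms(1) by (auto simp: null_sets_def emeasure_ball)
 hence "AE x in M. x ~: ball c r" by (rule AE_not_in)
 with assms(2) show ?thesis by eventually_elim auto
qed

text \<open>
An atom in L^infinity is treated as an atom in L^2. As the coefficient is at least 1, the exponent
\<gamma> may be lowered to 1.
\<close>

lemma atom_moment:
 assumes at: "is_atom M lam q gamma rho B (c, r) a" and q: "1 < q" and gamma: "1 <= gamma" and rho: "1 < rho"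
 defines "Q \<equiv> if q = \<infinity> then 2 else real_of_ereal q"
 shows "integrable M (%x. cmod (a x) powr Q)"
  and "0 < V c (rho * r) ==> npow Q a <= V c (rho * r) powr (1 - Q) * discrete_coeff M lam rho (c, r) B powr (- Q)"
proof -
 define m where "m = V c (rho * r)"
 define K where "K = discrete_coeff M lam rho (c, r) B"
 have r: "0 < r" using at by (simp add: is_atom_def is_ball_def)
 have K1: "1 <= K" using coeff_ge_1[OF rho r, of c "fst B" "snd B"] by (simp add: K_def)
 have aq: "a : Lp M q" and "ess_supp M a \<subseteq> ball c r" using at by (auto simp: is_atom_def ball_set_def)
 hence off: "AE x in M. x ~: ball c r --> a x = 0" by (intro ess_supp_ball_AE)
 have am [measurable]: "meas a" using aq by (simp add: Lp_def)
 have size: "Lp_norm M q a <= m powr (real_of_ereal (1 / q) - 1) * K powr (- gamma)"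
  using at by (simp add: is_atom_def ball_set_def dilate_def V_def m_def K_def)
 have "integrable M (%x. cmod (a x) powr Q) & (0 < m --> npow Q a <= m powr (1 - Q) * K powr (- Q))"
 proof (cases "q = \<infinity>")
  case True
  hence Q: "Q = 2" by (simp add: Q_def)
  define D where "D = m powr (- 1) * K powr (- gamma)"
  obtain c0 where c0: "AE x in M. cmod (a x) <= c0" using aq True by (auto simp: Lp_def)
  let ?E = "esssup M (%x. ereal (cmod (a x)))"
  have "?E <= ereal c0" using c0 by (intro esssup_I) auto
  hence Ef: "?E ~= \<infinity>" by auto
  have "AE x in M. ereal (cmod (a x)) <= ?E" by (rule esssup_AE)
  moreover have "real_of_ereal ?E <= D" using size True by (simp add: Lp_norm_def D_def)
  ultimately have bd: "AE x in M. cmod (a x) <= D"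
  proof (elim eventually_mono)
   fix x assume x: "ereal (cmod (a x)) <= ?E"
   show "cmod (a x) <= D" using x Ef \<open>real_of_ereal ?E <= D\<close> by (cases ?E) auto
  qed
  have D0: "0 <= D" by (simp add: D_def)
  have le: "AE x in M. cmod (a x) powr Q <= D\<^sup>2 * indicator (ball c r) x"
   using bd off
  proof eventually_elim
   case (elim x)
   hence "(cmod (a x))\<^sup>2 <= D\<^sup>2" by (intro power_mono) auto
   thus ?case using elim by (cases "x : ball c r") (auto simp: Q)
  qed
  have ib: "integrable M (%x. D\<^sup>2 * indicator (ball c r) x :: real)"
   using emeasure_ball_finite[of c r] by (intro integrable_mult_right integrable_real_indicator) auto
  have int: "integrable M (%x. cmod (a x) powr Q)"
  proof (rule Bochner_Integration.integrable_bound[OF ib])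
   show "AE x in M. norm (cmod (a x) powr Q) <= norm (D\<^sup>2 * indicator (ball c r) x)"
    using le by eventually_elim simp
  qed simp
  have "npow Q a <= m powr (1 - Q) * K powr (- Q)" if m: "0 < m"
  proof -
   have "npow Q a <= tot (%x. D\<^sup>2 * indicator (ball c r) x)" by (rule integral_mono_AE[OF int ib le])
   also have "... = D\<^sup>2 * V c r" by (simp add: V_def)
   also have "... <= D\<^sup>2 * m"
   proof -
    have "V c (1 * r) <= V c (rho * r)" using r rho by (intro V_mono mult_right_mono) auto
    thus ?thesis by (intro mult_left_mono) (auto simp: m_def)
   qed
   also have "D\<^sup>2 * m = m powr (1 - Q) * K powr (- gamma * 2)"
   proof -
    have "(m powr (- 1))\<^sup>2 * m = m powr (1 - Q)" using m by (simp add: Q powr_minus power2_eq_square field_simps)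
    moreover have "(K powr (- gamma))\<^sup>2 = K powr (- gamma * 2)" using K1 by (simp add: power2_eq_square powr_add[symmetric] mult.commute)
    ultimately show ?thesis unfolding D_def power_mult_distrib by (metis mult.commute mult.assoc)
   qed
   also have "... <= m powr (1 - Q) * K powr (- Q)"
    using gamma K1 by (intro mult_left_mono powr_mono) (auto simp: Q)
   finally show ?thesis .
  qed
  thus ?thesis using int by blast
 next
  case False
  then obtain Q' where Q': "q = ereal Q'" "1 < Q'" using q by (cases q) auto
  hence Q: "Q = Q'" by (simp add: Q_def)
  have Q1: "1 < Q" using Q Q' by simp
  have int: "integrable M (%x. cmod (a x) powr Q)" using aq by (simp add: Lp_def Q' Q)
  have "npow Q a <= m powr (1 - Q) * K powr (- Q)" if m: "0 < m"
  proof -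
   have I0: "0 <= npow Q a" by simp
   have rq: "real_of_ereal (1 / q) = 1 / Q" using Q1 by (simp add: Q' Q one_ereal_def)
   have "npow Q a powr (1 / Q) <= m powr (1 / Q - 1) * K powr (- gamma)"
    using size rq by (simp add: Lp_norm_def Q' Q[symmetric])
   hence "(npow Q a powr (1 / Q)) powr Q <= (m powr (1 / Q - 1) * K powr (- gamma)) powr Q"
    using Q1 by (intro powr_mono2) auto
   moreover have "(npow Q a powr (1 / Q)) powr Q = npow Q a" using Q1 I0 by (simp add: powr_powr)
   moreover have "(m powr (1 / Q - 1) * K powr (- gamma)) powr Q = m powr (1 - Q) * K powr (- gamma * Q)"
    using Q1 by (simp add: powr_mult powr_powr left_diff_distrib)
   moreover have "m powr (1 - Q) * K powr (- gamma * Q) <= m powr (1 - Q) * K powr (- Q)"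
    using gamma K1 Q1 by (intro mult_left_mono powr_mono) auto
   ultimately show ?thesis by linarith
  qed
  thus ?thesis using int by blast
 qed
 thus "integrable M (%x. cmod (a x) powr Q)"
  "0 < V c (rho * r) ==> npow Q a <= V c (rho * r) powr (1 - Q) * discrete_coeff M lam rho (c, r) B powr (- Q)"
  by (auto simp: m_def K_def)
qed

text \<open>
Passing from the exponent Q to q by y^q \<le> 1 + y^Q avoids Hoelder's inequality and is where the factor
2 comes from.
\<close>

lemma moment_local_size:
 assumes a: "bfun a" and q: "1 <= q" "q <= Q" and m: "0 < V c R" and K: "1 <= K"
  and mom: "npow Q a <= V c R powr (1 - Q) * K powr (- Q)"
  and W: "W : sets M" "W \<subseteq> ball y s" and s: "0 < s" "0 < V y s" and L: "1 <= L" and sub: "ball y (L * s) \<subseteq> ball c R"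
 shows "npow q (%x. of_real (V y (L * s) * K) * (indicator W x * a x)) <= 2 * V y (L * s)"
proof -
 define mu where "mu = V y (L * s)"
 have le: "V y s <= mu" "mu <= V c R"
 proof -
  have "V y (1 * s) <= V y (L * s)" using s L by (intro V_mono mult_right_mono) auto
  thus "V y s <= mu" by (simp add: mu_def)
  show "mu <= V c R" unfolding mu_def using sub by (rule V_subset)
 qed
 have mu: "0 < mu" using le s by linarith
 define v where "v x = of_real (mu * K) * (indicator W x * a x)" for x
 have vb: "bfun v" unfolding v_def using a W by (intro bfun_cmult bfun_restrict) auto
 have iv: "integrable M (%x. cmod (v x) powr q)" "integrable M (%x. cmod (v x) powr Q)"
  using bfun_powr_integrable[OF vb] q by auto
 have ib: "integrable M (%x. indicator (ball y s) x :: real)"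
  using emeasure_ball_finite[of y s] by (intro integrable_real_indicator) auto
 have ia: "integrable M (%x. cmod (a x) powr Q)" using bfun_powr_integrable[OF a] q by auto
 have "npow q v <= tot (%x. indicator (ball y s) x + cmod (v x) powr Q)"
 proof (intro integral_mono iv Bochner_Integration.integrable_add ib)
  fix x
  show "cmod (v x) powr q <= indicator (ball y s) x + cmod (v x) powr Q"
  proof (cases "x : W")
   case True
   hence "x : ball y s" using W by blast
   moreover have "cmod (v x) powr q <= 1 + cmod (v x) powr Q" using q by (intro le_one_plus_powr) auto
   ultimately show ?thesis by simp
  next
   case False thus ?thesis using q by (simp add: v_def)
  qed
 qed
 also have "... = V y s + npow Q v" using ib iv by (simp add: V_def)
 also have "npow Q v <= tot (%x. (mu * K) powr Q * cmod (a x) powr Q)"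
 proof (intro integral_mono iv integrable_mult_right ia)
  fix x
  have "cmod (v x) <= (mu * K) * cmod (a x)"
   using mu K unfolding v_def norm_mult norm_of_real by (cases "x : W") auto
  hence "cmod (v x) powr Q <= ((mu * K) * cmod (a x)) powr Q" using q by (intro powr_mono2) auto
  thus "cmod (v x) powr Q <= (mu * K) powr Q * cmod (a x) powr Q" using mu K by (simp add: powr_mult)
 qed
 also have "... = (mu * K) powr Q * npow Q a" by simp
 also have "... <= (mu * K) powr Q * (mu powr (1 - Q) * K powr (- Q))"
 proof (intro mult_left_mono order_trans[OF mom] mult_right_mono)
  show "V c R powr (1 - Q) <= mu powr (1 - Q)" using le mu q by (intro powr_mono2') auto
 qed auto
 also have "... = (mu powr Q * mu powr (1 - Q)) * (K powr Q * K powr (- Q))" using mu K by (simp add: powr_mult mult_ac)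
 also have "... = mu" using mu K by (simp add: powr_add[symmetric])
 finally have "npow q v <= V y s + mu" by simp
 thus ?thesis using le by (simp add: v_def mu_def)
qed

lemma truncation_tends:
 assumes f: "integrable M (%x. cmod (a x) powr Q)" and [measurable]: "meas a"
 shows "(%k. \<integral>x. (if cmod (a x) <= real k then 0 else cmod (a x) powr Q) \<partial>M) \<longlonglongrightarrow> 0"
proof -
 have "(%k. \<integral>x. (if cmod (a x) <= real k then 0 else cmod (a x) powr Q) \<partial>M) \<longlonglongrightarrow> (tot (%x. 0))"
 proof (rule integral_dominated_convergence[where w="%x. cmod (a x) powr Q"])
  show "AE x in M. (%k. if cmod (a x) <= real k then 0 else cmod (a x) powr Q) \<longlonglongrightarrow> 0"
  proof (rule AE_I2)
   fix x
   obtain k0 :: nat where k0: "cmod (a x) <= real k0" using real_arch_simple by blast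
   have "eventually (%k. (if cmod (a x) <= real k then 0 else cmod (a x) powr Q) = 0) sequentially"
    using eventually_ge_at_top[of k0] by eventually_elim (use k0 in auto)
   thus "(%k. if cmod (a x) <= real k then 0 else cmod (a x) powr Q) \<longlonglongrightarrow> 0" by (rule tendsto_eventually)
  qed
 qed (use f in auto)
 thus ?thesis by simp
qed

lemma nint_unit_bump: "0 < V c r ==> nint (unit_bump c r) = 1"
proof -
 assume V: "0 < V c r"
 have "nint (unit_bump c r) = tot (%x. indicator (ball c r) x / V c r)"
  by (intro Bochner_Integration.integral_cong) (auto simp: unit_bump_def norm_divide indicator_def)
 also have "... = 1" using V by (simp add: V_def)
 finally show ?thesis .
qed

definition trunc :: "'a => real => ('a => complex) => nat => 'a => complex" where
 "trunc c r a k x = indicator (ball c r) x * (if cmod (a x) <= real k then a x else 0)"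

lemma trunc_bfun: "meas a ==> bfun (trunc c r a k)"
proof -
 assume [measurable]: "meas a"
 have "bfun (%x. (if cmod (a x) <= real k then a x else 0) * indicator (ball c r) x)"
  by (rule bfun_mult[of _ _ "real k"]) (auto intro: bfun_indicator[of _ c r])
 thus ?thesis by (simp add: trunc_def[abs_def] mult.commute)
qed

lemma trunc_supb: "supb (trunc c r a k) c r"
 by (simp add: supb_def trunc_def)

lemma trunc_le: "cmod (trunc c r a k x) <= cmod (a x)"
 by (simp add: trunc_def indicator_def)

lemma trunc_diff_le:
 assumes "k0 <= k" "k0 <= k'"
 shows "cmod (trunc c r a k' x - trunc c r a k x) <= (if cmod (a x) <= real k0 then 0 else cmod (a x))"
proof -
 have "real k0 <= real k" "real k0 <= real k'" using assms by auto
 thus ?thesis by (auto simp: trunc_def indicator_def)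
qed

end

context cz_setting
begin

text \<open>
The function a need not be bounded, so it cannot be good itself; it is a limit of bounded functions whose
deviations from multiples of the bump e are uniformly good and Cauchy.
\<close>

definition approximable :: "nat => real => ('a => complex) => real => ('a => complex) => bool" where
 "approximable p A e C a \<longleftrightarrow> integrable M a & (EX w. (ALL k::nat. bfun (w k) & good p A (center e (w k)) C) &
   (ALL delta>0. EX k0. ALL k>=k0. nint (%x. a x - w k x) <= delta & (ALL k'>=k0. good p A (center e (%x. w k' x - w k x)) delta)))"

lemma approximable_lin:
 assumes "approximable p A e C a1" "approximable p A e C a2"
 shows "approximable p A e (C * (cmod c1 + cmod c2)) (%x. c1 * a1 x + c2 * a2 x)"
proof -
 let ?N = "%a w delta. EX k0. ALL k>=k0. nint (%x. a x - w k x) <= delta & (ALL k'>=k0. good p A (center e (%x. w k' x - w k x)) delta)"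
 obtain w1 where a1: "integrable M a1" and w1: "!!k::nat. bfun (w1 k)" "!!k. good p A (center e (w1 k)) C" "!!delta. 0 < delta ==> ?N a1 w1 delta"
  using assms(1) unfolding approximable_def by blast
 obtain w2 where a2: "integrable M a2" and w2: "!!k::nat. bfun (w2 k)" "!!k. good p A (center e (w2 k)) C" "!!delta. 0 < delta ==> ?N a2 w2 delta"
  using assms(2) unfolding approximable_def by blast
 note iw = bfun_integrable[OF w1(1)] bfun_integrable[OF w2(1)]
 have ctr: "center e (%x. c1 * u x + c2 * v x) = (%x. c1 * center e u x + c2 * center e v x)" if "integrable M u" "integrable M v" for u v
  using that by (simp add: fun_eq_iff algebra_simps)
 let ?s = "cmod c1 + cmod c2"
 define w where "w k x = c1 * w1 k x + c2 * w2 k x" for k x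
 have "?N (%x. c1 * a1 x + c2 * a2 x) w delta" if delta: "0 < delta" for delta
 proof -
  define eta where "eta = delta / (?s + 1)"
  have s1: "0 < ?s + 1" by (simp add: add_nonneg_pos)
  hence eta: "0 < eta" "(?s + 1) * eta = delta" using delta by (auto simp: eta_def)
  hence se: "cmod c1 * eta + cmod c2 * eta <= delta" by (simp add: algebra_simps)
  obtain k1 where k1: "!!k. k1 <= k ==> nint (%x. a1 x - w1 k x) <= eta" "!!k k'. k1 <= k ==> k1 <= k' ==> good p A (center e (%x. w1 k' x - w1 k x)) eta"
   using w1(3)[OF eta(1)] by blast
  obtain k2 where k2: "!!k. k2 <= k ==> nint (%x. a2 x - w2 k x) <= eta" "!!k k'. k2 <= k ==> k2 <= k' ==> good p A (center e (%x. w2 k' x - w2 k x)) eta"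
   using w2(3)[OF eta(1)] by blast
  show ?thesis
  proof (intro exI[of _ "max k1 k2"] allI impI conjI)
   fix k assume k: "max k1 k2 <= k"
   have "nint (%x. c1 * a1 x + c2 * a2 x - w k x) <= tot (%x. cmod c1 * cmod (a1 x - w1 k x) + cmod c2 * cmod (a2 x - w2 k x))"
   proof (rule integral_mono)
    show "cmod (c1 * a1 x + c2 * a2 x - w k x) <= cmod c1 * cmod (a1 x - w1 k x) + cmod c2 * cmod (a2 x - w2 k x)" for x
     using norm_triangle_ineq[of "c1 * (a1 x - w1 k x)" "c2 * (a2 x - w2 k x)"] by (simp add: w_def norm_mult[symmetric] algebra_simps)
   qed (use a1 a2 iw in \<open>auto simp: w_def\<close>)
   also have "... = cmod c1 * nint (%x. a1 x - w1 k x) + cmod c2 * nint (%x. a2 x - w2 k x)" using a1 a2 iw by simp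
   also have "... <= cmod c1 * eta + cmod c2 * eta" using k k1(1) k2(1) by (intro add_mono mult_left_mono) auto
   finally show "nint (%x. c1 * a1 x + c2 * a2 x - w k x) <= delta" using se by linarith
   fix k' assume k': "max k1 k2 <= k'"
   have "good p A (%x. c1 * center e (%x. w1 k' x - w1 k x) x + c2 * center e (%x. w2 k' x - w2 k x) x) (cmod c1 * eta + cmod c2 * eta)"
    using k k' by (intro good_add good_cmult k1(2) k2(2)) auto
   also have "(%x. c1 * center e (%x. w1 k' x - w1 k x) x + c2 * center e (%x. w2 k' x - w2 k x) x) = center e (%x. c1 * (w1 k' x - w1 k x) + c2 * (w2 k' x - w2 k x))"
    by (rule ctr[symmetric]) (use iw in auto)
   also have "(%x. c1 * (w1 k' x - w1 k x) + c2 * (w2 k' x - w2 k x)) = (%x. w k' x - w k x)" by (simp add: w_def fun_eq_iff algebra_simps)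
   finally show "good p A (center e (%x. w k' x - w k x)) delta" using se by (rule good_mono)
  qed
 qed
 moreover have "good p A (center e (w k)) (C * ?s)" for k
  using good_add[OF good_cmult[OF w1(2), of c1] good_cmult[OF w2(2), of c2], of k k]
  unfolding w_def[abs_def] ctr[OF iw] by (simp add: algebra_simps)
 moreover have "bfun (w k)" for k unfolding w_def by (intro bfun_add bfun_cmult w1 w2)
 ultimately show ?thesis unfolding approximable_def using a1 a2 by (intro conjI exI[of _ w]) auto
qed

text \<open>
The integrals of the approximations converge to that of the limit, which is zero; so subtracting their
bumps in advance does not change the limit, and afterwards no bump is needed.
\<close>

lemma approximable_center:
 assumes e: "bfun e" "nint e = 1" and a: "approximable p A e C a" "tot a = 0"
 shows "approximable p A (%x. 0) C a"
proof -
 let ?N = "%w e delta. EX k0. ALL k>=k0. nint (%x. a x - w k x) <= delta & (ALL k'>=k0. good p A (center e (%x. w k' x - w k x)) delta)"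
 obtain w where ai: "integrable M a" and w: "!!k::nat. bfun (w k)" "!!k. good p A (center e (w k)) C" "!!delta. 0 < delta ==> ?N w e delta"
  using a(1) unfolding approximable_def by blast
 note iw = bfun_integrable[OF w(1)] and ie = bfun_integrable[OF e(1)]
 have "?N (%k. center e (w k)) (%x. 0) delta" if delta: "0 < delta" for delta
 proof -
  have "0 < delta / 2" using delta by simp
  then obtain k0 where k0: "!!k. k0 <= k ==> nint (%x. a x - w k x) <= delta / 2"
   "!!k k'. k0 <= k ==> k0 <= k' ==> good p A (center e (%x. w k' x - w k x)) (delta / 2)" using w(3) by blast
  show ?thesis
  proof (intro exI[of _ k0] allI impI conjI)
   fix k assume k: "k0 <= k"
   have "tot (%x. a x - w k x) = - tot (w k)" using ai iw a(2) by simp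
   hence "cmod (tot (w k)) <= nint (%x. a x - w k x)" using integral_norm_bound[of M "%x. a x - w k x"] by simp
   moreover have "nint (%x. a x - center e (w k) x) <= tot (%x. cmod (a x - w k x) + cmod (\<integral>x. w k x \<partial>M) * cmod (e x))"
   proof (rule integral_mono)
    show "cmod (a x - center e (w k) x) <= cmod (a x - w k x) + cmod (tot (w k)) * cmod (e x)" for x
     using norm_triangle_ineq[of "a x - w k x" "tot (w k) * e x"] by (simp add: norm_mult[symmetric] algebra_simps)
   qed (use ai iw ie in auto)
   moreover have "... = nint (%x. a x - w k x) + cmod (tot (w k))" using ai iw ie e(2) by simp
   ultimately show "nint (%x. a x - center e (w k) x) <= delta" using k0(1)[OF k] by linarith
   fix k' assume k': "k0 <= k'"
   have "center e (%x. w k' x - w k x) = (%x. center e (w k') x - center e (w k) x)" using iw by (simp add: fun_eq_iff algebra_simps)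
   moreover have "good p A (center e (%x. w k' x - w k x)) delta" using delta by (intro good_mono[OF k0(2)[OF k k']]) simp
   ultimately show "good p A (center (%x. 0) (%x. center e (w k') x - center e (w k) x)) delta" by simp
  qed
 qed
 moreover have "good p A (center (%x. 0) (center e (w k))) C" for k using w(2) by simp
 moreover have "bfun (center e (w k))" for k by (intro bfun_diff bfun_cmult w e)
 ultimately show ?thesis unfolding approximable_def using ai by (intro conjI exI[of _ "%k. center e (w k)"]) blast+
qed

lemma approximable_null:
 assumes A: "0 < A" and C: "0 <= C" and a: "meas a" "AE x in M. a x = 0"
 shows "approximable p A e C a"
 unfolding approximable_def
proof (intro conjI exI[of _ "%k x. 0"] allI impI)
 show "integrable M a" using integrable_cong_AE[of a M "%x. 0"] a by simp
 have z: "good p A (center e (%x. 0)) kappa" if "0 <= kappa" for kappa using good_mono[OF good_null[OF A bfun_zero] that] by simp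
 show "good p A (center e (%x. 0)) C" by (rule z[OF C])
 have "nint (%x. a x - 0) = 0" using a(2) by (intro integral_eq_zero_AE) (auto elim!: eventually_mono)
 thus "EX k0::nat. ALL k>=k0. nint (%x. a x - 0) <= delta & (ALL k'>=k0. good p A (center e (%x. 0 - 0)) delta)" if "0 < delta" for delta :: real
  using z[of delta] that by (intro exI[of _ 0]) auto
qed (rule bfun_zero)

text \<open>Truncations of the atom by height.\<close>

lemma atom_approx:
 assumes A: "0 < A" and q: "1 < q" and gamma: "1 <= gamma" and rho: "1 < rho"
 shows "EX C>0. ALL cB rB. 0 < rB --> 0 < V cB rB --> (EX Rt. 0 < V cB Rt &
  (ALL a B'. is_atom M lam q gamma rho (cB, rB) B' a --> approximable p A (unit_bump cB Rt) C a))"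
proof -
 define Q where "Q = (if q = \<infinity> then 2 else real_of_ereal q)"
 have Q1: "1 < Q" using q by (cases q) (auto simp: Q_def)
 define q0 where "q0 = min Q 2"
 have q0: "1 < q0" "q0 <= 2" "q0 <= Q" using Q1 by (auto simp: q0_def)
 obtain n0 :: nat where n0: "q0 / (q0 - 1) < real n0" using reals_Archimedean2 by blast
 define n where "n = max n0 3"
 have n: "3 <= n" "real n / (real n - 1) < q0"
 proof -
  show n3: "3 <= n" by (simp add: n_def)
  have "q0 / (q0 - 1) < real n" using n0 by (simp add: n_def)
  hence "real n < q0 * (real n - 1)" using q0 by (simp add: field_simps)
  thus "real n / (real n - 1) < q0" using n3 by (simp add: divide_less_eq)
 qed
 obtain C where CC: "0 < C & (ALL cB rB. 0 < rB --> 0 < V cB rB --> (EX Rt. 0 < V cB Rt &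
  (ALL c r a. 0 < r --> r <= 2 * rB --> dist c cB < rB --> 0 < V c r --> bfun a --> supb a c r -->
   locally_small p q0 rho (cB, rB) c r a -->
   good p A (center (unit_bump cB Rt) a) C)))"
  using atom_good[OF A n q0(2) rho, of p] by (rule exE)
 hence C: "0 < C" by (rule conjunct1)
 note ag = CC[THEN conjunct2, THEN spec, THEN spec, THEN mp, THEN mp]
 show ?thesis
 proof (rule exI[of _ C], intro conjI C allI impI)
  fix cB rB assume rB: "0 < rB" "0 < V cB rB"
  obtain Rt where Rt: "0 < V cB Rt" and ag': "!!c r a. 0 < r ==> r <= 2 * rB ==> dist c cB < rB ==> 0 < V c r ==> bfun a ==> supb a c r ==>
   locally_small p q0 rho (cB, rB) c r a ==>
   good p A (center (unit_bump cB Rt) a) C"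
   using ag[OF rB] by blast
  let ?g = "center (unit_bump cB Rt)"
  have "approximable p A (unit_bump cB Rt) C a" if "is_atom M lam q gamma rho (cB, rB) B' a" for a B'
  proof -
   obtain c r where "B' = (c, r)" by (cases B')
   hence at: "is_atom M lam q gamma rho (cB, rB) (c, r) a" using \<open>is_atom M lam q gamma rho (cB, rB) B' a\<close> by simp
   have r: "0 < r" using at by (simp add: is_atom_def is_ball_def)
   have geo: "r <= 2 * rB" "dist c cB < rB"
    using subball_geometry[OF r rB(1)] at by (auto simp: is_atom_def)
   have "ess_supp M a \<subseteq> ball c r" and [measurable]: "meas a"
    using at by (auto simp: is_atom_def ball_set_def Lp_def)
   hence off: "AE x in M. x ~: ball c r --> a x = 0" by (intro ess_supp_ball_AE)
   have iQ: "integrable M (%x. cmod (a x) powr Q)" using atom_moment(1)[OF at q gamma rho] by (simp add: Q_def)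
   have ib: "integrable M (%x. indicator (ball c r) x :: real)"
    using emeasure_ball_finite[of c r] by (intro integrable_real_indicator) auto
   have ia: "integrable M a"
   proof (rule Bochner_Integration.integrable_bound[OF Bochner_Integration.integrable_add[OF ib iQ]])
    show "AE x in M. norm (a x) <= norm (indicator (ball c r) x + cmod (a x) powr Q)"
     using off
    proof eventually_elim
     case (elim x)
     have "cmod (a x) powr 1 <= 1 + cmod (a x) powr Q" using Q1 by (intro le_one_plus_powr) auto
     thus ?case using elim by (cases "x : ball c r") auto
    qed
   qed simp
   define w where "w = trunc c r a"
   have wb: "bfun (w k)" for k unfolding w_def by (rule trunc_bfun) simp
   have conv1: "(%k. nint (%x. a x - w k x)) \<longlonglongrightarrow> 0"
   proof -
    have "nint (%x. a x - w k x) = tot (%x. (if cmod (a x) <= real k then 0 else cmod (a x) powr 1))" for k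
     using off by (intro integral_cong_AE) (auto elim!: eventually_mono simp: w_def trunc_def indicator_def split: if_splits)
    thus ?thesis using truncation_tends[of a 1] ia by simp
   qed
   have ex: "EX k0. ALL k>=k0. nint (%x. a x - w k x) <= delta" if "0 < delta" for delta
    using order_tendstoD(2)[OF conv1 that] unfolding eventually_sequentially by (meson less_imp_le)
   show ?thesis
   proof (cases "V c r = 0")
    case True
    have "AE x in M. a x = 0" using True off by (rule null_ball_AE)
    thus ?thesis using C by (intro approximable_null A) auto
   next
    case False
    hence Vc: "0 < V c r" using V_nonneg[of c r] by linarith
    have "V c (1 * r) <= V c (rho * r)" using r rho by (intro V_mono mult_right_mono) auto
    hence Vm: "0 < V c (rho * r)" using Vc by simp
    define K where "K = discrete_coeff M lam rho (c, r) (cB, rB)"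
    have K1: "1 <= K" unfolding K_def by (rule coeff_ge_1[OF rho r])
    define D where "D = V c (rho * r) powr (1 - Q) * K powr (- Q)"
    have D0: "0 < D" using Vm K1 by (simp add: D_def)
    have mom: "npow Q a <= D" using atom_moment(2)[OF at q gamma rho] Vm by (simp add: Q_def D_def K_def)
    have gd: "good p A (?g u) C" if u: "bfun u" "supb u c r" "npow Q u <= D" for u
    proof (rule ag'[OF r geo Vc u(1,2)], unfold locally_small_def, intro allI impI)
     fix W y s assume "W : sets M" "W \<subseteq> ball y s" "0 < s" "0 < V y s" "ball y (6 ^ (p + 2) * s) \<subseteq> ball c (rho * r)"
     moreover have "(1::real) <= 6 ^ (p + 2)" by (intro one_le_power) auto
     ultimately show "npow q0 (%x. of_real (V y (6 ^ (p + 2) * s) * discrete_coeff M lam rho (c, r) (cB, rB)) * (indicator W x * u x)) <= 2 * V y (6 ^ (p + 2) * s)"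
      using moment_local_size[OF u(1) less_imp_le[OF q0(1)] q0(3) Vm K1 u(3)[unfolded D_def], of W y s "6 ^ (p + 2)"] unfolding K_def by blast
    qed
    have g1: "good p A (?g (w k)) C" for k
    proof (rule gd[OF wb])
     show "supb (w k) c r" unfolding w_def by (rule trunc_supb)
     have "npow Q (w k) <= npow Q a"
      using Q1 by (intro integral_mono bfun_powr_integrable wb iQ powr_mono2) (auto simp: w_def trunc_le)
     thus "npow Q (w k) <= D" using mom by linarith
    qed
    have g2: "EX k0. ALL k>=k0. ALL k'>=k0. good p A (?g (%x. w k' x - w k x)) delta" if delta: "0 < delta" for delta
    proof -
     define eta where "eta = delta / C"
     have eta: "0 < eta" using delta C by (simp add: eta_def)
     let ?t = "%k x. if cmod (a x) <= real k then 0 else cmod (a x) powr Q"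
     have "0 < D * eta powr Q" using D0 eta by simp
     from order_tendstoD(2)[OF truncation_tends[OF iQ] this]
     obtain k0 where k0: "tot (?t k0) < D * eta powr Q" unfolding eventually_sequentially by auto
     have it: "integrable M (?t k0)" by (rule Bochner_Integration.integrable_bound[OF iQ]) auto
     show ?thesis
     proof (intro exI[of _ k0] allI impI)
      fix k k' assume k: "k0 <= k" "k0 <= k'"
      \<comment> \<open>Divided by \<eta>, a late difference of truncations is still locally small; hence the difference itself is good with constant C \<eta> = \<delta>.\<close>
      define u where "u x = of_real (1 / eta) * (w k' x - w k x)" for x
      have ub: "bfun u" unfolding u_def by (intro bfun_cmult bfun_diff wb)
      have us: "supb u c r" using trunc_supb[of c r a] by (simp add: supb_def u_def w_def)
      have "npow Q u <= tot (%x. (1 / eta) powr Q * ?t k0 x)"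
      proof (intro integral_mono bfun_powr_integrable ub integrable_mult_right it)
      fix x
      have "cmod (u x) = 1 / eta * cmod (w k' x - w k x)" unfolding u_def norm_mult norm_of_real using eta by simp
      also have "... <= 1 / eta * (if cmod (a x) <= real k0 then 0 else cmod (a x))"
      unfolding w_def using eta by (intro mult_left_mono trunc_diff_le k) auto
      finally have "cmod (u x) powr Q <= (1 / eta * (if cmod (a x) <= real k0 then 0 else cmod (a x))) powr Q"
      using Q1 by (intro powr_mono2) auto
      also have "... = (1 / eta) powr Q * ?t k0 x" using eta Q1 by (simp add: powr_mult powr_divide)
      finally show "cmod (u x) powr Q <= (1 / eta) powr Q * ?t k0 x" .
      qed (use Q1 in auto)
      also have "... = (1 / eta) powr Q * tot (?t k0)" by simp
      also have "... <= (1 / eta) powr Q * (D * eta powr Q)" using k0 by (intro mult_left_mono) auto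
      also have "... = D" using eta by (simp add: powr_divide)
      finally have "npow Q u <= D" .
      hence "good p A (%x. of_real eta * (?g u x)) (cmod (of_real eta) * C)"
      using gd[OF ub us] by (intro good_cmult)
      moreover have "cmod (of_real eta) * C = delta" unfolding norm_of_real using eta delta C by (simp add: eta_def)
      moreover have iu: "tot u = of_real (1 / eta) * tot (%x. w k' x - w k x)" by (simp add: u_def[abs_def])
      have "(%x. of_real eta * (?g u x)) = ?g (%x. w k' x - w k x)"
      unfolding iu using eta by (simp add: u_def fun_eq_iff field_simps)
      ultimately show "good p A (?g (%x. w k' x - w k x)) delta" by simp
     qed
    qed
    show ?thesis unfolding approximable_def
    proof (intro conjI ia exI[of _ w] allI impI wb g1)
     fix delta :: real assume delta: "0 < delta"
     obtain k1 where k1: "ALL k>=k1. nint (%x. a x - w k x) <= delta" using ex[OF delta] by blast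
     obtain k2 where k2: "ALL k>=k2. ALL k'>=k2. good p A (?g (%x. w k' x - w k x)) delta" using g2[OF delta] by blast
     show "EX k0. ALL k>=k0. nint (%x. a x - w k x) <= delta & (ALL k'>=k0. good p A (?g (%x. w k' x - w k x)) delta)"
      using k1 k2 by (intro exI[of _ "max k1 k2"]) auto
    qed
   qed
  qed
  thus "EX Rt. 0 < V cB Rt & (ALL a B'. is_atom M lam q gamma rho (cB, rB) B' a --> approximable p A (unit_bump cB Rt) C a)"
   using Rt by blast
 qed
qed

text \<open>
Both atoms are compared with the same bump, and the total coefficient of the bump is the integral of the
block, which vanishes.
\<close>

lemma block_approx:
 assumes A: "0 < A" and q: "1 < q" and gamma: "1 <= gamma" and rho: "1 < rho"
 shows "EX C>0. ALL h s. atomic_block M lam q gamma rho h s --> 0 <= s & approximable p A (%x. 0) (C * s) h"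
proof -
 obtain C where C: "0 < C" and ap: "!!cB rB. 0 < rB ==> 0 < V cB rB ==> (EX Rt. 0 < V cB Rt &
  (ALL a B'. is_atom M lam q gamma rho (cB, rB) B' a --> approximable p A (unit_bump cB Rt) C a))"
  using atom_approx[OF A q gamma rho, of p] by blast
 have "0 <= s & approximable p A (%x. 0) (C * s) h" if bl: "atomic_block M lam q gamma rho h s" for h s
 proof -
  obtain B B1 B2 a1 a2 c1 c2 where ih: "integrable M h" and h0: "tot h = 0" and B: "is_ball B" "ess_supp M h \<subseteq> ball_set B"
   and at: "is_atom M lam q gamma rho B B1 a1" "is_atom M lam q gamma rho B B2 a2"
   and ha: "AE x in M. h x = c1 * a1 x + c2 * a2 x" and s: "s = cmod c1 + cmod c2"
   using bl unfolding atomic_block_def by blast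
  have s0: "0 <= s" using s by simp
  obtain cB rB where cB: "B = (cB, rB)" by (cases B) auto
  have rB: "0 < rB" using B cB by (simp add: is_ball_def)
  have "approximable p A (%x. 0) (C * s) h"
  proof (cases "V cB rB = 0")
   case True
   have "AE x in M. x ~: ball cB rB --> h x = 0" using B cB by (intro ess_supp_ball_AE) (simp add: ball_set_def)
   with True have "AE x in M. h x = 0" by (rule null_ball_AE)
   thus ?thesis using ih C s0 by (intro approximable_null A) auto
  next
   case False
   hence "0 < V cB rB" using V_nonneg[of cB rB] by linarith
   then obtain Rt where Rt: "0 < V cB Rt" and ap': "!!a B'. is_atom M lam q gamma rho B B' a ==> approximable p A (unit_bump cB Rt) C a"
    using ap[OF rB] cB by blast
   let ?g = "%x. c1 * a1 x + c2 * a2 x"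
   have ag: "approximable p A (unit_bump cB Rt) (C * s) ?g" unfolding s by (intro approximable_lin ap'[OF at(1)] ap'[OF at(2)])
   hence ig: "integrable M ?g" by (simp add: approximable_def)
   have "tot ?g = tot h"
    using ha by (intro integral_cong_AE borel_measurable_integrable ig ih) (auto elim!: eventually_mono)
   hence "approximable p A (%x. 0) (C * s) ?g"
    by (intro approximable_center[OF unit_bump_bfun nint_unit_bump[OF Rt] ag]) (simp only: h0)
   then obtain w where w: "!!k::nat. bfun (w k) & good p A (center (%x. 0) (w k)) (C * s)"
    "!!delta. delta > 0 ==> EX k0. ALL k>=k0. nint (%x. ?g x - w k x) <= delta & (ALL k'>=k0. good p A (center (%x. 0) (%x. w k' x - w k x)) delta)"
    unfolding approximable_def by blast
   have "nint (%x. ?g x - w k x) = nint (%x. h x - w k x)" for k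
   proof (rule integral_cong_AE)
    have [measurable]: "meas ?g" "meas h" "meas (w k)"
     using ig ih w(1)[of k] by (auto intro: bfun_meas borel_measurable_integrable)
    show "meas (%x. cmod (?g x - w k x))" "meas (%x. cmod (h x - w k x))" by measurable
    show "AE x in M. cmod (?g x - w k x) = cmod (h x - w k x)" using ha by eventually_elim simp
   qed
   thus ?thesis using ih w unfolding approximable_def by (intro conjI exI[of _ w]) auto
  qed
  with s0 show ?thesis ..
 qed
 thus ?thesis using C by blast
qed

text \<open>
A diagonal choice: the partial sum of length n uses approximations of its blocks whose errors have a sum
tending to zero. The tails are good with a constant given by the tail of the summable sizes.
\<close>

lemma decomposition_approx:
 assumes A: "0 < A" and q: "1 < q" and gamma: "1 <= gamma" and rho: "1 < rho"
 shows "EX C>0. ALL f h s. integrable M f --> atomic_decomposition M lam q gamma rho f h s --> 0 <= suminf s &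
  (EX G. (ALL n::nat. good p A (G n) (C * suminf s)) & (%n. nint (%x. f x - G n x)) \<longlonglongrightarrow> 0 &
   (ALL delta>0. EX N. ALL n>=N. ALL m>=N. good p A (%x. G m x - G n x) delta))"
proof -
 obtain C where C: "0 < C" and ba: "!!h s. atomic_block M lam q gamma rho h s ==> 0 <= s & approximable p A (%x. 0) (C * s) h"
  using block_approx[OF A q gamma rho, of p] by blast
 show ?thesis
 proof (intro exI[of _ C] conjI C allI impI)
  fix f h s assume f: "integrable M f" and de: "atomic_decomposition M lam q gamma rho f h s"
  have bl: "!!i. atomic_block M lam q gamma rho (h i) (s i)" and sm: "summable s"
   and lim: "(%n. \<integral>x. cmod (f x - (SUM i<n. h i x)) \<partial>M) \<longlonglongrightarrow> 0" using de by (auto simp: atomic_decomposition_def)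
  have s0: "!!i. 0 <= s i" and ih: "!!i. integrable M (h i)" using ba[OF bl] by (auto simp: approximable_def)
  show S0: "0 <= suminf s" using sm s0 by (rule suminf_nonneg)
  have "EX w. (ALL k::nat. good p A (w k) (C * s i)) & (ALL delta>0. EX k0. ALL k>=k0. nint (%x. h i x - w k x) <= delta &
    (ALL k'>=k0. good p A (%x. w k' x - w k x) delta))" for i using ba[OF bl, of i] by (simp add: approximable_def) blast
  hence "EX w. ALL i. (ALL k::nat. good p A (w i k) (C * s i)) & (ALL delta>0. EX k0. ALL k>=k0. nint (%x. h i x - w i k x) <= delta &
    (ALL k'>=k0. good p A (%x. w i k' x - w i k x) delta))" by (intro choice allI)
  then obtain w where w: "!!i (k::nat). good p A (w i k) (C * s i)"
   "!!i delta. 0 < delta ==> EX k0. ALL k>=k0. nint (%x. h i x - w i k x) <= delta & (ALL k'>=k0. good p A (%x. w i k' x - w i k x) delta)"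
   by blast
  \<comment> \<open>Summable in i with a sum that vanishes as n grows.\<close>
  define eta :: "nat => nat => real" where "eta i n = (1 / 2) ^ n * (1 / 2) ^ Suc i" for i n :: nat
  have eta0: "0 < eta i n" for i n by (simp add: eta_def)
  have etas: "(SUM i<N. eta i n) <= (1 / 2) ^ n" for N n
  proof -
   have "(SUM i<N. (1 / 2) ^ Suc i) <= (1::real)" using sum_gp_strict[of "1/2 :: real" N]
    by (simp add: sum_divide_distrib[symmetric])
   hence "(1 / 2) ^ n * (SUM i<N. (1 / 2) ^ Suc i) <= (1 / 2) ^ n * (1::real)" by (intro mult_left_mono) auto
   thus ?thesis by (simp add: eta_def sum_distrib_left)
  qed
  define k0 where "k0 i n = (SOME k0. ALL k>=k0. nint (%x. h i x - w i k x) <= eta i n & (ALL k'>=k0. good p A (%x. w i k' x - w i k x) (eta i n)))" for i n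
  have k0: "ALL k>=k0 i n. nint (%x. h i x - w i k x) <= eta i n & (ALL k'>=k0 i n. good p A (%x. w i k' x - w i k x) (eta i n))" for i n
   unfolding k0_def using someI_ex[OF w(2)[OF eta0[of i n]]] by blast
  define kappa where "kappa i n = (SUM e<=n. k0 i e)" for i n
  have kappa: "k0 i e <= kappa i n" if "e <= n" for i e n unfolding kappa_def using that by (intro member_le_sum) auto
  define G where "G n x = (SUM i<n. w i (kappa i n) x)" for n x
  have gG: "good p A (G n) (C * suminf s)" for n
  proof -
   have "good p A (G n) (SUM i<n. C * s i)" unfolding G_def[abs_def] by (intro good_sum A w) auto
   moreover have "(SUM i<n. C * s i) <= C * suminf s"
    using C sum_le_suminf[OF sm, of "{..<n}"] s0 by (auto simp: sum_distrib_left[symmetric])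
   ultimately show ?thesis by (rule good_mono)
  qed
  have iw: "integrable M (w i k)" for i k using w(1)[of i k] by (auto simp: good_def intro: bfun_integrable)
  have up: "nint (%x. f x - G n x) <= nint (%x. f x - (SUM i<n. h i x)) + (1 / 2) ^ n" for n
  proof -
   have "nint (%x. f x - G n x) <= tot (%x. cmod (f x - (SUM i<n. h i x)) + (SUM i<n. cmod (h i x - w i (kappa i n) x)))"
   proof (rule integral_mono)
    show "integrable M (%x. cmod (f x - G n x))" unfolding G_def using f iw by auto
    show "integrable M (%x. cmod (f x - (SUM i<n. h i x)) + (SUM i<n. cmod (h i x - w i (kappa i n) x)))" using f ih iw by auto
    fix x
    have "f x - G n x = (f x - (SUM i<n. h i x)) + (SUM i<n. h i x - w i (kappa i n) x)" by (simp add: G_def sum_subtractf)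
    hence "cmod (f x - G n x) <= cmod (f x - (SUM i<n. h i x)) + cmod (SUM i<n. h i x - w i (kappa i n) x)"
     by (metis norm_triangle_ineq)
    also have "cmod (SUM i<n. h i x - w i (kappa i n) x) <= (SUM i<n. cmod (h i x - w i (kappa i n) x))" by (rule norm_sum)
    finally show "cmod (f x - G n x) <= cmod (f x - (SUM i<n. h i x)) + (SUM i<n. cmod (h i x - w i (kappa i n) x))" by simp
   qed
   also have "... = nint (%x. f x - (SUM i<n. h i x)) + (SUM i<n. nint (%x. h i x - w i (kappa i n) x))"
    using f ih iw by simp
   also have "(SUM i<n. nint (%x. h i x - w i (kappa i n) x)) <= (SUM i<n. eta i n)"
    using k0 kappa by (intro sum_mono) auto
   also have "... <= (1 / 2) ^ n" by (rule etas)
   finally show ?thesis by simp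
  qed
  have conv: "(%n. nint (%x. f x - G n x)) \<longlonglongrightarrow> 0"
  proof (rule tendsto_sandwich[where f="%_. 0" and h="%n. nint (%x. f x - (SUM i<n. h i x)) + (1 / 2) ^ n"])
   have "(%n. nint (%x. f x - (SUM i<n. h i x)) + (1 / 2) ^ n) \<longlonglongrightarrow> 0 + 0"
    by (intro tendsto_add lim LIMSEQ_power_zero) auto
   thus "(%n. nint (%x. f x - (SUM i<n. h i x)) + (1 / 2) ^ n) \<longlonglongrightarrow> 0" by simp
  qed (use up in auto)
  have gd: "good p A (%x. G m x - G n x) ((1 / 2) ^ n + C * (SUM i:{n..<m}. s i))" if nm: "n <= m" for n m
  proof -
   have "good p A (%x. (SUM i<n. w i (kappa i m) x - w i (kappa i n) x) + (SUM i:{n..<m}. w i (kappa i m) x)) ((SUM i<n. eta i n) + (SUM i:{n..<m}. C * s i))"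
   proof (intro good_add good_sum A w)
    fix i show "good p A (%x. w i (kappa i m) x - w i (kappa i n) x) (eta i n)"
     using k0[of i n] kappa[of n n i] kappa[of n m i] nm by blast
   qed auto
   moreover have "(SUM i<n. eta i n) + (SUM i:{n..<m}. C * s i) <= (1 / 2) ^ n + C * (SUM i:{n..<m}. s i)"
    using etas[of n n] by (simp add: sum_distrib_left)
   moreover have "(%x. (SUM i<n. w i (kappa i m) x - w i (kappa i n) x) + (SUM i:{n..<m}. w i (kappa i m) x)) = (%x. G m x - G n x)"
   proof
    fix x
    have "{..<m} = {..<n} Un {n..<m}" using nm by auto
    hence "G m x = (SUM i<n. w i (kappa i m) x) + (SUM i:{n..<m}. w i (kappa i m) x)"
     unfolding G_def by (simp add: sum.union_disjoint[symmetric] ivl_disj_int)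
    thus "(SUM i<n. w i (kappa i m) x - w i (kappa i n) x) + (SUM i:{n..<m}. w i (kappa i m) x) = G m x - G n x"
     by (simp add: G_def sum_subtractf)
   qed
   ultimately show ?thesis using good_mono by simp
  qed
  show "EX G. (ALL n::nat. good p A (G n) (C * suminf s)) & (%n. nint (%x. f x - G n x)) \<longlonglongrightarrow> 0 &
   (ALL delta>0. EX N. ALL n>=N. ALL m>=N. good p A (%x. G m x - G n x) delta)"
  proof (intro exI[of _ G] conjI allI impI gG conv)
   fix delta :: real assume delta: "0 < delta"
   have "(%n. (1 / 2) ^ n :: real) \<longlonglongrightarrow> 0" by (intro LIMSEQ_power_zero) auto
   from order_tendstoD(2)[OF this, of "delta / 2"] delta
   obtain N1 where N1: "!!n. N1 <= n ==> (1 / 2) ^ n < delta / 2" unfolding eventually_sequentially by auto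
   have "0 < delta / (2 * C)" using delta C by simp
   then obtain N2 where N2: "!!m n. N2 <= m ==> norm (sum s {m..<n}) < delta / (2 * C)"
    using sm unfolding summable_Cauchy by meson
   have le: "good p A (%x. G m x - G n x) delta" if "N1 <= n" "N2 <= n" "n <= m" for n m
   proof (rule good_mono[OF gd[OF that(3)]])
    have "sum s {n..<m} <= delta / (2 * C)" using N2[OF that(2), of m] by simp
    hence "C * sum s {n..<m} <= delta / 2" using C by (simp add: field_simps)
    thus "(1 / 2) ^ n + C * sum s {n..<m} <= delta" using N1[OF that(1)] by linarith
   qed
   show "EX N. ALL n>=N. ALL m>=N. good p A (%x. G m x - G n x) delta"
   proof (intro exI[of _ "max N1 N2"] allI impI)
    fix n m assume nm: "max N1 N2 <= n" "max N1 N2 <= m"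
    show "good p A (%x. G m x - G n x) delta"
    proof (cases "n <= m")
     case True thus ?thesis using nm by (intro le) auto
    next
     case False
     hence "good p A (%x. -1 * (G n x - G m x)) (cmod (-1) * delta)" using nm by (intro good_cmult le) auto
     thus ?thesis by simp
    qed
   qed
  qed
 qed
qed

end

context nonhomogeneous_space
begin

section \<open>The commutator as a limit in measure\<close>

definition conv_measure :: "(nat => 'a => complex) => ('a => complex) => bool" where
 "conv_measure F G \<longleftrightarrow> (ALL t>0. ALL eps>0. EX N. ALL n>=N. dis t (%x. F n x - G x) <= ennreal eps)"

lemma conv_measureD: "conv_measure F G ==> 0 < t ==> 0 < eps ==> EX N. ALL n>=N. dis t (%x. F n x - G x) <= ennreal eps"
 by (simp add: conv_measure_def)

lemma dis_sets: "meas F ==> {x. t < cmod (F x)} : sets M"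
proof -
 assume [measurable]: "meas F"
 have "{x : space M. t < cmod (F x)} : sets M" by measurable
 thus ?thesis by simp
qed

lemma dis_mono:
 assumes "meas F" "AE x in M. cmod (H x) <= cmod (F x)"
 shows "dis t H <= dis t F"
 using assms by (intro emeasure_mono_AE dis_sets) (auto elim!: eventually_mono)

text \<open>
A subsequence with summable exceptional sets converges almost everywhere, by Borel--Cantelli.
\<close>

lemma Cauchy_in_measure:
 assumes m [measurable]: "!!n. meas (F n)"
  and C: "!!t eps. 0 < t ==> 0 < eps ==> EX N. ALL m>=N. ALL n>=N. dis t (%x. F m x - F n x) <= ennreal eps"
 shows "EX G:borel_measurable M. conv_measure F G"
proof -
 define r0 where "r0 k = (SOME N. ALL m>=N. ALL n>=N. dis ((1 / 2) ^ k) (%x. F m x - F n x) <= ennreal ((1 / 2) ^ k))" for k :: nat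
 have r0: "ALL m>=r0 k. ALL n>=r0 k. dis ((1 / 2) ^ k) (%x. F m x - F n x) <= ennreal ((1 / 2) ^ k)" for k
  unfolding r0_def by (rule someI_ex, rule C) auto
 define r where "r k = (SUM e<=k. Suc (r0 e))" for k
 have r: "r0 k <= r k" "r k <= r (Suc k)" for k
 proof -
  have "Suc (r0 k) <= r k" unfolding r_def by (intro member_le_sum) auto
  thus "r0 k <= r k" by simp
  show "r k <= r (Suc k)" by (simp add: r_def)
 qed
 have rk: "k <= r k" for k by (induction k) (auto simp: r_def)
 define E where "E k = {x. (1 / 2) ^ k < cmod (F (r (Suc k)) x - F (r k) x)}" for k
 have Es [measurable]: "E k : sets M" for k unfolding E_def by (intro dis_sets) measurable
 have Em: "emeasure M (E k) <= ennreal ((1 / 2) ^ k)" for k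
  unfolding E_def using r0[of k] r[of k] by auto
 have Ef: "emeasure M (E k) < \<infinity>" for k using Em[of k] by (rule le_less_trans) simp
 have "summable (%k. measure M (E k))"
 proof (rule summable_comparison_test'[where g="%k. (1 / 2) ^ k"])
  show "summable (%k. (1 / 2 :: real) ^ k)" by (rule summable_geometric) simp
  show "norm (measure M (E k)) <= (1 / 2) ^ k" if "0 <= k" for k
   using Em[of k] Ef[of k] by (simp add: emeasure_eq_ennreal_measure)
 qed
 hence "AE x in M. eventually (%k. x : space M - E k) sequentially"
  using Ef by (intro borel_cantelli_AE1) auto
 hence conv: "AE x in M. convergent (%k. F (r k) x)"
 proof eventually_elim
  case (elim x)
  have "summable (%k. F (r (Suc k)) x - F (r k) x)"
  proof (rule summable_comparison_test_ev[where g="%k. (1 / 2) ^ k"])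
   show "eventually (%k. norm (F (r (Suc k)) x - F (r k) x) <= (1 / 2) ^ k) sequentially"
    using elim by eventually_elim (simp add: E_def)
   show "summable (%k. (1 / 2 :: real) ^ k)" by (rule summable_geometric) simp
  qed
  hence "convergent (%n. SUM k<n. F (r (Suc k)) x - F (r k) x)" by (simp add: summable_iff_convergent)
  hence "convergent (%n. F (r n) x - F (r 0) x)"
   by (simp only: sum_lessThan_telescope[of "%k. F (r k) x"])
  hence "convergent (%n. (F (r n) x - F (r 0) x) + F (r 0) x)" by (intro convergent_add convergent_const)
  thus ?case by simp
 qed
 define G where "G x = lim (%k. F (r k) x)" for x
 have [measurable]: "meas G" unfolding G_def by measurable
 have lim: "AE x in M. (%k. F (r k) x) \<longlonglongrightarrow> G x"
  using conv by eventually_elim (simp add: G_def convergent_LIMSEQ_iff)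
 have "conv_measure F G"
  unfolding conv_measure_def
 proof (intro allI impI)
  fix t eps :: real assume te: "0 < t" "0 < eps"
  obtain N where N: "!!m n. N <= m ==> N <= n ==> dis t (%x. F m x - F n x) <= ennreal eps" using C[OF te] by blast
  show "EX N. ALL n>=N. dis t (%x. F n x - G x) <= ennreal eps"
  proof (intro exI[of _ N] allI impI)
   fix n assume n: "N <= n"
   define B where "B j = {x. ALL i>=j. t < cmod (F n x - F (r i) x)}" for j
   have Bs: "B j : sets M" for j
   proof -
    have "{x : space M. ALL i. j <= i --> t < cmod (F n x - F (r i) x)} : sets M" by measurable
    thus ?thesis by (simp add: B_def)
   qed
   have inc: "incseq B" by (auto simp: incseq_def B_def)
   have "AE x in M. x : {x. t < cmod (F n x - G x)} --> x : (UN j. B j)"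
    using lim
   proof eventually_elim
    case (elim x)
    show ?case
    proof
     assume x: "x : {x. t < cmod (F n x - G x)}"
     have "(%k. cmod (F n x - F (r k) x)) \<longlonglongrightarrow> cmod (F n x - G x)" by (intro tendsto_intros elim)
     hence "eventually (%k. t < cmod (F n x - F (r k) x)) sequentially" using x by (intro order_tendstoD(1)) auto
     thus "x : (UN j. B j)" unfolding eventually_sequentially B_def by blast
    qed
   qed
   hence "dis t (%x. F n x - G x) <= emeasure M (UN j. B j)" using Bs by (intro emeasure_mono_AE) auto
   also have "... = (SUP j. emeasure M (B j))" using Bs inc by (intro SUP_emeasure_incseq[symmetric]) auto
   also have "... <= ennreal eps"
   proof (rule SUP_least)
    fix j
    have "emeasure M (B j) <= dis t (%x. F n x - F (r (max j N)) x)"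
     by (intro emeasure_mono dis_sets) (auto simp: B_def)
    also have "... <= ennreal eps" using n rk[of "max j N"] by (intro N) auto
    finally show "emeasure M (B j) <= ennreal eps" .
   qed
   finally show "dis t (%x. F n x - G x) <= ennreal eps" .
  qed
 qed
 thus ?thesis by (rule bexI[of _ G]) measurable
qed

lemma ennreal_eps_zero:
 assumes "!!eps. 0 < eps ==> x <= ennreal (k * eps)" "0 <= k"
 shows "x = 0"
proof -
 have "x <= 0"
 proof (rule ennreal_le_epsilon)
  fix e :: real assume e: "0 < e"
  have "x <= ennreal (k * (e / (k + 1)))" using e assms(2) by (intro assms(1)) auto
  also have "... <= ennreal e" using e assms(2) by (intro ennreal_leI) (simp add: field_simps)
  finally show "x <= 0 + ennreal e" by simp
 qed
 thus ?thesis by simp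
qed

text \<open>Dominated convergence.\<close>

lemma L2_dominated:
 assumes w: "w : L2" and [measurable]: "!!k. meas (v k)"
  and le: "!!k x. cmod (v k x) <= cmod (w x)" and z: "!!x. eventually (%k. v k x = 0) sequentially"
 shows "(%k. \<integral>\<^sup>+x. ennreal ((cmod (v k x))\<^sup>2) \<partial>M) \<longlonglongrightarrow> 0"
proof -
 have [measurable]: "meas w" using w by (rule L2_meas)
 have "(%k. \<integral>\<^sup>+x. ennreal ((cmod (v k x))\<^sup>2) \<partial>M) \<longlonglongrightarrow> (ntot (%x. 0))"
 proof (rule nn_integral_dominated_convergence[where w="%x. ennreal ((cmod (w x))\<^sup>2)"])
  show "sq w < \<infinity>" using w by (simp add: L2_def)
  show "AE x in M. (%k. ennreal ((cmod (v k x))\<^sup>2)) \<longlonglongrightarrow> 0"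
  proof (rule AE_I2)
   fix x
   have "eventually (%k. ennreal ((cmod (v k x))\<^sup>2) = 0) sequentially" using z[of x] by eventually_elim simp
   thus "(%k. ennreal ((cmod (v k x))\<^sup>2)) \<longlonglongrightarrow> 0" by (rule tendsto_eventually)
  qed
  show "AE x in M. ennreal ((cmod (v k x))\<^sup>2) <= ennreal ((cmod (w x))\<^sup>2)" for k
   using le by (intro AE_I2 ennreal_leI power_mono) auto
 qed auto
 thus ?thesis by simp
qed

text \<open>
Truncation of the symbol as the nearest-point projection to a disc, which is 1-Lipschitz and therefore
respects RBMO.
\<close>

definition retract :: "nat => complex => complex" where
 "retract k z = closest_point (cball 0 (real k)) z"

lemma retract_Lipschitz: "cmod (retract k z - retract k w) <= cmod (z - w)"
 unfolding retract_def using closest_point_lipschitz[of "cball (0::complex) (real k)" z w] by (simp add: dist_norm)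

lemma retract_bound: "cmod (retract k z) <= real k"
 unfolding retract_def using closest_point_in_set[of "cball (0::complex) (real k)" z] by simp

lemma retract_self: "cmod z <= real k ==> retract k z = z"
 unfolding retract_def by (intro closest_point_self) simp

lemma retract_diff: "cmod (retract k z - z) <= cmod z"
 unfolding retract_def using closest_point_le[of "cball (0::complex) (real k)" 0 z] by (simp add: dist_norm norm_minus_commute)

lemma retract_meas: "meas b ==> meas (%x. retract k (b x))"
proof -
 assume [measurable]: "meas b"
 have "retract k : borel_measurable borel"
  unfolding retract_def[abs_def] by (intro borel_measurable_continuous_onI continuous_on_closest_point) auto
 thus ?thesis by measurable
qed

end

context cz_setting
begin

text \<open>Bounded functions are dense for both norms simultaneously.\<close>

lemma weak11_L2: "EX W>0. ALL u t. u : L2 --> integrable M u --> 0 < t --> dis t (T u) <= ennreal (W / t * nint u)"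
proof -
 obtain W where W: "0 < W" "!!f t. bfun f ==> 0 < t ==> dis t (T f) <= ennreal (W / t * nint f)"
  using weak11 by blast
 show ?thesis
 proof (intro exI[of _ "2 * W"] conjI allI impI)
  show "0 < 2 * W" using W by simp
  fix u t assume u: "u : L2" "integrable M u" and t: "(0::real) < t"
  have um [measurable]: "meas u" using u(1) by (rule L2_meas)
  define c :: 'a where "c = undefined"
  define v where "v n = trunc c (real n) u n" for n
  have vb: "bfun (v n)" for n unfolding v_def by (intro trunc_bfun um)
  have lim: "(%n. \<integral>\<^sup>+x. ennreal ((cmod (u x - v n x))\<^sup>2) \<partial>M) \<longlonglongrightarrow> 0"
  proof (rule L2_dominated[OF u(1)])
   show "meas (%x. u x - v k x)" for k using bfun_meas[OF vb] by measurable
   show "cmod (u x - v k x) <= cmod (u x)" for k x by (simp add: v_def trunc_def indicator_def)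
   fix x
   obtain n0 :: nat where n0: "dist c x + cmod (u x) < real n0" using reals_Archimedean2 by blast
   show "eventually (%k. u x - v k x = 0) sequentially"
    using eventually_ge_at_top[of n0]
   proof eventually_elim
    case (elim k)
    hence "dist c x + cmod (u x) < real k" using n0 by linarith
    hence "dist c x < real k" "cmod (u x) <= real k" using zero_le_dist[of c x] norm_ge_zero[of "u x"] by linarith+
    thus ?case by (simp add: v_def trunc_def)
   qed
  qed
  have bd: "dis t (T u) <= ennreal (2 * W / t * nint u) + ennreal (CT / (t / 2)\<^sup>2) * sq (%x. u x - v n x)" for n
  proof -
   have vL: "v n : L2" "(%x. u x - v n x) : L2" using bfun_L2[OF vb] L2_diff[OF u(1) bfun_L2[OF vb]] by auto
   have "dis (t / 2 + t / 2) (T u) <= dis (t / 2) (%x. T (v n) x) + dis (t / 2) (%x. T (%x. u x - v n x) x)"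
   proof (intro dis_add T_meas vL)
    show "AE x in M. cmod (T u x) <= cmod (T (v n) x) + cmod (T (%x. u x - v n x) x)"
     using T_diff[OF u(1) vL(1)]
    proof eventually_elim
     case (elim x)
     hence "T u x = T (v n) x + T (%x. u x - v n x) x" by simp
     thus ?case by (metis norm_triangle_ineq)
    qed
   qed
   also have "dis (t / 2) (%x. T (v n) x) <= ennreal (W / (t / 2) * nint (v n))" using t by (intro W vb) auto
   also have "... <= ennreal (2 * W / t * nint u)"
   proof (intro ennreal_leI)
    have "nint (v n) <= nint u" using integrable_norm[OF u(2)] bfun_norm_integrable[OF vb] by (intro integral_mono) (auto simp: v_def trunc_le)
    hence "2 * W / t * nint (v n) <= 2 * W / t * nint u" using W t by (intro mult_left_mono) auto
    thus "W / (t / 2) * nint (v n) <= 2 * W / t * nint u" by (simp add: field_simps)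
   qed
   also have "dis (t / 2) (%x. T (%x. u x - v n x) x) <= ennreal (CT / (t / 2)\<^sup>2) * sq (%x. u x - v n x)"
    using t by (intro T_weak_L2 vL) auto
   finally show ?thesis by (simp add: add_left_mono)
  qed
  have "(%n. ennreal (2 * W / t * nint u) + ennreal (CT / (t / 2)\<^sup>2) * sq (%x. u x - v n x))
    \<longlonglongrightarrow> ennreal (2 * W / t * nint u) + ennreal (CT / (t / 2)\<^sup>2) * 0"
   by (intro tendsto_add tendsto_const ennreal_tendsto_cmult lim) auto
  from LIMSEQ_le_const[OF this] bd
  show "dis t (T u) <= ennreal (2 * W / t * nint u)" by simp
 qed
qed

lemma commutator_diff:
 assumes "f : L2" "(%x. b x * f x) : L2" "g : L2" "(%x. b x * g x) : L2"
 shows "AE x in M. commutator b T (%x. f x - g x) x = commutator b T f x - commutator b T g x"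
proof -
 have eq: "(%y. b y * (f y - g y)) = (%y. b y * f y - b y * g y)" by (simp add: fun_eq_iff right_diff_distrib)
 show ?thesis unfolding commutator_def eq using T_diff[OF assms(1,3)] T_diff[OF assms(2,4)]
 proof eventually_elim
  case (elim x)
  show ?case unfolding elim by (simp add: algebra_simps)
 qed
qed

text \<open>The weak (1,1) inequality is applied to Y and Markov's inequality to X.\<close>

lemma commutator_good:
 assumes A: "0 < A"
 shows "EX C>0. ALL b m g kappa t. clean p A b m --> good p A g kappa --> 0 < t -->
   dis t (commutator b T g) <= ennreal (C * kappa / t)"
proof -
 obtain W where W: "0 < W" "!!u t. u : L2 ==> integrable M u ==> 0 < t ==> dis t (T u) <= ennreal (W / t * nint u)"
  using weak11_L2 by blast
 show ?thesis
 proof (intro exI[of _ "2 + 2 * W"] conjI allI impI)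
  show "0 < 2 + 2 * W" using W by simp
  fix b m g kappa t assume cl: "clean p A b m" and g: "good p A g kappa" and t: "(0::real) < t"
  have [measurable]: "meas b" using cl by (rule clean_meas)
  have kappa: "0 <= kappa" using g by (simp add: good_def)
  obtain X Y where X: "meas X" "mass X <= ennreal kappa" and sp: "Y : L2" "AE x in M. commutator b T g x = X x - T Y x" and Y: "mass Y <= ennreal kappa"
   using g cl unfolding good_def by blast
  have iY: "integrable M Y"
   using L2_meas[OF sp(1)] Y by (intro integrableI_bounded) (auto intro: le_less_trans)
  have nY: "nint Y <= kappa" using Y kappa unfolding nn_nint[OF iY] by simp
  have "dis (t / 2 + t / 2) (commutator b T g) <= dis (t / 2) X + dis (t / 2) (T Y)"
  proof (intro dis_add X T_meas sp)
   show "AE x in M. cmod (commutator b T g x) <= cmod (X x) + cmod (T Y x)"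
    using sp(2) by eventually_elim (simp add: norm_triangle_ineq4)
  qed
  also have "dis (t / 2) X <= ennreal (1 / (t / 2)) * mass X"
   using t by (intro dis_Markov X) auto
  also have "... <= ennreal (1 / (t / 2)) * ennreal kappa" by (intro mult_left_mono X) auto
  also have "dis (t / 2) (T Y) <= ennreal (W / (t / 2) * nint Y)" using t by (intro W sp iY) auto
  also have "... <= ennreal (W / (t / 2) * kappa)" using nY W t by (intro ennreal_leI mult_left_mono) auto
  also have "ennreal (1 / (t / 2)) * ennreal kappa + ennreal (W / (t / 2) * kappa) = ennreal ((2 + 2 * W) * kappa / t)"
   using t kappa W by (simp add: ennreal_mult[symmetric] ennreal_plus[symmetric] field_simps del: ennreal_plus)
  finally show "dis t (commutator b T g) <= ennreal ((2 + 2 * W) * kappa / t)" by (simp add: add_mono)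
 qed
qed

text \<open>
The case of a bounded symbol needs no cancellation, but the constant depends on the bound L.
\<close>

lemma commutator_bounded_weak:
 "EX W>0. ALL b L v t. meas b --> 0 < L --> (ALL x. cmod (b x) <= L) --> v : L2 --> integrable M v --> 0 < t -->
   dis t (commutator b T v) <= ennreal (W * L / t * nint v)"
proof -
 obtain W where W: "0 < W" "!!u t. u : L2 ==> integrable M u ==> 0 < t ==> dis t (T u) <= ennreal (W / t * nint u)"
  using weak11_L2 by blast
 show ?thesis
 proof (intro exI[of _ "4 * W"] conjI allI impI)
  show "0 < 4 * W" using W by simp
  fix b L v t assume b: "meas b" and L: "0 < L" "ALL x. cmod (b x) <= L" and v: "v : L2" "integrable M v" and t: "(0::real) < t"
  have bv: "(%x. b x * v x) : L2" using b L by (intro L2_mult[OF v(1)]) auto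
  have le: "cmod (b x * v x) <= L * cmod (v x)" for x unfolding norm_mult using L by (intro mult_right_mono) auto
  have iL: "integrable M (%x. L * cmod (v x))" using v by auto
  have ibv: "integrable M (%x. b x * v x)"
   using L2_meas[OF bv] le L by (intro Bochner_Integration.integrable_bound[OF iL]) (auto intro: order_trans)
  have nb: "nint (%x. b x * v x) <= L * nint v"
  proof -
   have "nint (%x. b x * v x) <= tot (%x. L * cmod (v x))" using ibv iL le by (intro integral_mono) auto
   thus ?thesis by simp
  qed
  have [measurable]: "meas b" "meas (T v)" using b v by (auto intro: T_meas)
  have "dis (t / 2 + t / 2) (commutator b T v) <= dis (t / 2) (%x. b x * T v x) + dis (t / 2) (%x. T (%x. b x * v x) x)"
  proof (intro dis_add T_meas bv)
   show "AE x in M. cmod (commutator b T v x) <= cmod (b x * T v x) + cmod (T (%x. b x * v x) x)"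
    by (intro AE_I2) (simp only: commutator_def, rule norm_triangle_ineq4)
  qed measurable
  also have "dis (t / 2) (%x. b x * T v x) <= dis (t / 2 / L) (T v)"
  proof (intro emeasure_mono dis_sets T_meas v)
   show "{x. t / 2 < cmod (b x * T v x)} \<subseteq> {x. t / 2 / L < cmod (T v x)}"
   proof safe
    fix x assume x: "t / 2 < cmod (b x * T v x)"
    have "cmod (b x * T v x) <= L * cmod (T v x)" unfolding norm_mult using L by (intro mult_right_mono) auto
    hence "t / 2 < L * cmod (T v x)" using x by linarith
    thus "t / 2 / L < cmod (T v x)" using L by (simp add: divide_less_eq mult_ac)
   qed
  qed
  also have "... <= ennreal (W / (t / 2 / L) * nint v)" using t L by (intro W v) auto
  also have "dis (t / 2) (%x. T (%x. b x * v x) x) <= ennreal (W / (t / 2) * nint (%x. b x * v x))" using t by (intro W bv ibv) auto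
  also have "... <= ennreal (W / (t / 2) * (L * nint v))" using nb W t by (intro ennreal_leI mult_left_mono) auto
  also have "ennreal (W / (t / 2 / L) * nint v) + ennreal (W / (t / 2) * (L * nint v)) = ennreal (4 * W * L / t * nint v)"
   using t L W by (subst ennreal_plus[symmetric]) (auto simp: field_simps intro!: divide_nonneg_nonneg mult_nonneg_nonneg)
  finally show "dis t (commutator b T v) <= ennreal (4 * W * L / t * nint v)" by (simp add: add_mono)
 qed
qed

end

locale commutator_setting = cz_setting M lam Clam K T CK CH CT
 for M :: "'a::metric_space measure" and lam :: "'a => real => real" and Clam :: real
  and K :: "'a => 'a => complex" and T :: "('a => complex) => 'a => complex" and CK CH CT :: real +
 fixes gamma' rho' A :: real and p :: nat and b :: "'a => complex"
 assumes A: "0 < A"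
  and clean_ex: "!!b'. meas b' ==> RBMO_bound M lam gamma' rho' b' 1 ==> EX m. clean p A b' m"
  and b_meas: "meas b" and b_RBMO: "EX B. RBMO_bound M lam gamma' rho' b B"
begin

lemma RBMO_L2:
 assumes b': "meas b'" "RBMO_bound M lam gamma' rho' b' B" and f: "bfun f"
 shows "(%x. b' x * f x) : L2"
proof -
 have B: "0 < B" using b' by (simp add: RBMO_bound_def)
 have [measurable]: "meas b'" by (rule b')
 have "meas (%x. b' x / of_real B)" by measurable
 then obtain m where m: "clean p A (%x. b' x / of_real B) m" using clean_ex RBMO_bound_scale[OF b'] by blast
 have "(%x. of_real B * (b' x / of_real B * f x)) : L2" by (rule L2_cmult[OF clean_L2[OF A m f]])
 thus ?thesis using B by simp
qed

lemma b_L2: "bfun f ==> (%x. b x * f x) : L2"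
 using b_RBMO RBMO_L2[OF b_meas] by blast

lemma commutator_bfun_meas: "bfun f ==> meas (commutator b T f)"
 by (rule commutator_meas[OF b_meas bfun_L2 b_L2])

lemma commutator_weak_good:
 "EX C>0. ALL b' B g kappa t. meas b' --> RBMO_bound M lam gamma' rho' b' B --> good p A g kappa --> 0 < t -->
   dis t (commutator b' T g) <= ennreal (C * B * kappa / t)"
proof -
 obtain C where C: "0 < C" "!!b m g kappa t. clean p A b m ==> good p A g kappa ==> 0 < t ==>
   dis t (commutator b T g) <= ennreal (C * kappa / t)"
  using commutator_good[OF A, of p] by blast
 show ?thesis
 proof (intro exI[of _ C] conjI C(1) allI impI)
  fix b' B g kappa t assume b': "meas b'" "RBMO_bound M lam gamma' rho' b' B" and g: "good p A g kappa" and t: "(0::real) < t"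
  have B: "0 < B" using b' by (simp add: RBMO_bound_def)
  have [measurable]: "meas b'" by (rule b')
  let ?b = "%x. b' x / of_real B"
  have bm: "meas ?b" by measurable
  then obtain m where m: "clean p A ?b m" using clean_ex RBMO_bound_scale[OF b'] by blast
  have gb: "bfun g" using g by (simp add: good_def)
  have L: "(%x. b' x * g x) : L2" by (rule RBMO_L2[OF b' gb])
  have eq: "(%y. b' y / of_real B * g y) = (%y. (1 / of_real B) * (b' y * g y))" by (simp add: fun_eq_iff)
  have "AE x in M. commutator ?b T g x = commutator b' T g x / of_real B"
   unfolding commutator_def eq using T_cmult[OF L, of "1 / of_real B"]
   by eventually_elim (simp add: diff_divide_distrib)
  hence "dis t (commutator b' T g) <= dis (t / B) (commutator ?b T g)"
  proof (intro emeasure_mono_AE dis_sets commutator_meas[OF bm bfun_L2[OF gb] clean_L2[OF A m gb]])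
   assume "AE x in M. commutator ?b T g x = commutator b' T g x / of_real B"
   thus "AE x in M. x : {x. t < cmod (commutator b' T g x)} --> x : {x. t / B < cmod (commutator ?b T g x)}"
    by eventually_elim (use B in \<open>simp add: norm_divide divide_strict_right_mono\<close>)
  qed
  also have "... <= ennreal (C * kappa / (t / B))" using t B by (intro C(2)[OF m g]) auto
  finally show "dis t (commutator b' T g) <= ennreal (C * B * kappa / t)" by (simp add: mult_ac)
 qed
qed

text \<open>
Convergence in measure is only local, because b may exceed every truncation level on a set of infinite
measure.
\<close>

lemma commutator_truncated_symbol:
 assumes v: "v : L2" "(%x. b x * v x) : L2" and t: "0 < t" and eps: "0 < eps"
 shows "EX k0. ALL k>=k0. emeasure M (ball z r Int {x. t < cmod (commutator (%x. retract k (b x)) T v x - commutator b T v x)}) <= ennreal eps"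
proof -
 have [measurable]: "meas b" by (rule b_meas)
 have rm [measurable]: "meas (%x. retract k (b x))" for k by (rule retract_meas) measurable
 have vm [measurable]: "meas v" using v by (auto intro: L2_meas)
 define w where "w k x = (retract k (b x) - b x) * v x" for k x
 have wm [measurable]: "meas (w k)" for k unfolding w_def by measurable
 have kv: "(%x. retract k (b x) * v x) : L2" for k using retract_bound by (intro L2_mult[OF v(1) rm])
 have weq: "w k = (%x. retract k (b x) * v x - b x * v x)" for k by (simp add: w_def fun_eq_iff left_diff_distrib)
 have wL: "w k : L2" for k unfolding weq by (intro L2_diff kv v)
 have lim1: "(%k. \<integral>\<^sup>+x. ennreal ((cmod (w k x))\<^sup>2) \<partial>M) \<longlonglongrightarrow> 0"
 proof (rule L2_dominated[OF v(2) wm])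
  show "cmod (w k x) <= cmod (b x * v x)" for k x
   unfolding w_def norm_mult by (intro mult_right_mono retract_diff) auto
  fix x
  obtain k0 :: nat where k0: "cmod (b x) <= real k0" using real_arch_simple by blast
  show "eventually (%k. w k x = 0) sequentially"
   using eventually_ge_at_top[of k0] by eventually_elim (use k0 in \<open>simp add: w_def retract_self\<close>)
 qed
 define S where "S k = ball z r Int {x. real k < cmod (b x)}" for k :: nat
 have Ss: "S k : sets M" for k unfolding S_def by (intro sets.Int dis_sets) measurable
 have "(%k. emeasure M (S k)) \<longlonglongrightarrow> emeasure M (\<Inter>k. S k)"
 proof (rule Lim_emeasure_decseq)
  show "decseq S" by (auto simp: decseq_def S_def)
  fix k
  have "emeasure M (S k) <= emeasure M (ball z r)" by (intro emeasure_mono) (auto simp: S_def)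
  thus "emeasure M (S k) ~= \<infinity>" using emeasure_ball_finite[of z r] by (auto simp: top_unique)
 qed (use Ss in auto)
 moreover have "(\<Inter>k. S k) = {}"
 proof -
  have "EX k. x ~: S k" for x
   using real_arch_simple[of "cmod (b x)"] by (auto simp: S_def not_less)
  thus ?thesis by blast
 qed
 ultimately have lim2: "(%k. emeasure M (S k)) \<longlonglongrightarrow> 0" by simp
 have "(%k. emeasure M (S k) + ennreal (CT / t\<^sup>2) * sq (w k)) \<longlonglongrightarrow> 0 + ennreal (CT / t\<^sup>2) * 0"
  by (intro tendsto_add lim2 ennreal_tendsto_cmult lim1) auto
 hence "(%k. emeasure M (S k) + ennreal (CT / t\<^sup>2) * sq (w k)) \<longlonglongrightarrow> 0" by simp
 from order_tendstoD(2)[OF this, of "ennreal eps"] eps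
 obtain k0 where k0: "!!k. k0 <= k ==> emeasure M (S k) + ennreal (CT / t\<^sup>2) * sq (w k) < ennreal eps"
  unfolding eventually_sequentially by auto
 show ?thesis
 proof (intro exI[of _ k0] allI impI)
  fix k assume k: "k0 <= k"
  let ?E = "{x. t < cmod (T (w k) x)}"
  have Es: "?E : sets M" by (intro dis_sets T_meas wL)
  have "AE x in M. x : ball z r Int {x. t < cmod (commutator (%x. retract k (b x)) T v x - commutator b T v x)} --> x : S k Un ?E"
   using T_diff[OF kv v(2), of k]
  proof eventually_elim
   case (elim x)
   have eq: "commutator (%x. retract k (b x)) T v x - commutator b T v x = (retract k (b x) - b x) * T v x - T (w k) x"
    unfolding commutator_def weq elim by (simp add: algebra_simps)
   show ?case
   proof
    assume x: "x : ball z r Int {x. t < cmod (commutator (%x. retract k (b x)) T v x - commutator b T v x)}"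
    show "x : S k Un ?E"
    proof (cases "cmod (b x) <= real k")
     case True
     hence "retract k (b x) = b x" by (rule retract_self)
     moreover have "t < cmod ((retract k (b x) - b x) * T v x - T (w k) x)" using x unfolding eq[symmetric] by simp
     ultimately have "x : ?E" by simp
     thus ?thesis by blast
    next
     case False
     hence "x : S k" using x by (simp add: S_def)
     thus ?thesis by blast
    qed
   qed
  qed
  hence "emeasure M (ball z r Int {x. t < cmod (commutator (%x. retract k (b x)) T v x - commutator b T v x)}) <= emeasure M (S k Un ?E)"
   using Ss Es by (intro emeasure_mono_AE sets.Un)
  also have "... <= emeasure M (S k) + emeasure M ?E" using Ss Es by (intro emeasure_subadditive)
  also have "... <= emeasure M (S k) + ennreal (CT / t\<^sup>2) * sq (w k)"
   by (intro add_left_mono T_weak_L2 wL t)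
  also have "... <= ennreal eps" using k0[OF k] by (rule less_imp_le)
  finally show "emeasure M (ball z r Int {x. t < cmod (commutator (%x. retract k (b x)) T v x - commutator b T v x)}) <= ennreal eps" .
 qed
qed

definition good_Cauchy :: "(nat => 'a => complex) => bool" where
 "good_Cauchy G \<longleftrightarrow> (ALL n. bfun (G n)) & (ALL delta>0. EX N. ALL n>=N. ALL m>=N. good p A (%x. G m x - G n x) delta)"

text \<open>
The difference between F and the commutator at u is split into five terms. The two terms in which the
symbol is truncated vanish with the level k; the term for G N - G n is small uniformly in k, since
truncation keeps the RBMO bound; the term for u - G n is controlled for fixed k by the weak inequality
for bounded symbols. This is the reason why the limit does not depend on the approximating sequence.
\<close>

lemma commutator_closed:
 assumes u: "u : L2" "integrable M u" "(%x. b x * u x) : L2" and G: "good_Cauchy G"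
  and lim: "(%n. nint (%x. u x - G n x)) \<longlonglongrightarrow> 0"
  and F: "meas F" "conv_measure (%n. commutator b T (G n)) F"
 shows "AE x in M. F x = commutator b T u x"
proof -
 obtain B where B: "RBMO_bound M lam gamma' rho' b B" using b_RBMO by blast
 have B0: "0 < B" using B by (simp add: RBMO_bound_def)
 obtain C where C: "0 < C" "!!b' B g kappa t. meas b' ==> RBMO_bound M lam gamma' rho' b' B ==> good p A g kappa ==> 0 < t ==>
   dis t (commutator b' T g) <= ennreal (C * B * kappa / t)"
  using commutator_weak_good by blast
 obtain W where W: "0 < W" "!!b L v t. meas b ==> 0 < L ==> (ALL x. cmod (b x) <= L) ==> v : L2 ==> integrable M v ==> 0 < t ==>
   dis t (commutator b T v) <= ennreal (W * L / t * nint v)"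
  using commutator_bounded_weak by blast
 have Gb: "bfun (G n)" for n using G by (simp add: good_Cauchy_def)
 have GL: "G n : L2" "(%x. b x * G n x) : L2" for n using bfun_L2[OF Gb] b_L2[OF Gb] by auto
 let ?U = "%f. commutator b T f"
 have Um: "meas (?U u)" "meas (?U (G n))" for n
  by (auto intro!: commutator_meas b_meas u GL)
 have null: "emeasure M (ball z r Int {x. 5 * t < cmod (F x - ?U u x)}) = 0" if t: "0 < t" for z r t
 proof (rule ennreal_eps_zero[of _ 5])
  fix eps :: real assume eps: "0 < eps"
  let ?E = "%H. ball z r Int {x. t < cmod (H x :: complex)}"
  obtain N1 where N1: "!!n. N1 <= n ==> dis t (%x. ?U (G n) x - F x) <= ennreal eps"
   using conv_measureD[OF F(2) t eps] by blast
  \<comment> \<open>Order of choices: first the index N, then the truncation level k, then n, because the inequality for bounded symbols degenerates as k grows.\<close>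
  define delta where "delta = eps * t / (C * B)"
  have delta: "0 < delta" "C * B * delta / t = eps" using eps t C B0 by (auto simp: delta_def)
  obtain N2 where N2: "!!n m. N2 <= n ==> N2 <= m ==> good p A (%x. G m x - G n x) delta"
   using G delta(1) unfolding good_Cauchy_def by blast
  define N where "N = max N1 N2"
  obtain k1 where k1: "!!k. k1 <= k ==> emeasure M (ball z r Int {x. t < cmod (commutator (%x. retract k (b x)) T (G N) x - ?U (G N) x)}) <= ennreal eps"
   using commutator_truncated_symbol[OF GL t eps] by blast
  obtain k2 where k2: "!!k. k2 <= k ==> emeasure M (ball z r Int {x. t < cmod (commutator (%x. retract k (b x)) T u x - ?U u x)}) <= ennreal eps"
   using commutator_truncated_symbol[OF u(1,3) t eps] by blast
  define k where "k = max k1 k2"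
  define bk where "bk x = retract k (b x)" for x
  let ?Uk = "%f. commutator bk T f"
  have bkm: "meas bk" unfolding bk_def by (rule retract_meas[OF b_meas])
  have bkB: "RBMO_bound M lam gamma' rho' bk B" unfolding bk_def by (rule RBMO_bound_Lipschitz[OF B retract_Lipschitz])
  have "cmod (bk x) <= real k + 1" for x using retract_bound[of k "b x"] by (simp add: bk_def)
  hence bkL: "0 < real k + 1" "ALL x. cmod (bk x) <= real k + 1" by auto
  have bkf: "(%x. bk x * f x) : L2" if "f : L2" for f using L2_mult[OF that bkm] bkL(2) by blast
  have "0 < eps * t / (W * (real k + 1))" using eps t W bkL by simp
  from order_tendstoD(2)[OF lim this]
  obtain N3 where N3: "!!n. N3 <= n ==> nint (%x. u x - G n x) < eps * t / (W * (real k + 1))"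
   unfolding eventually_sequentially by blast
  define n where "n = max N N3"
  have iGn: "integrable M (%x. u x - G n x)" using u bfun_integrable[OF Gb] by auto
  have LGn: "(%x. u x - G n x) : L2" by (intro L2_diff u GL)
  have LNn: "(%x. G N x - G n x) : L2" by (intro L2_diff GL)
  define H1 where "H1 x = ?U (G N) x - F x" for x
  define H2 where "H2 x = ?Uk (G N) x - ?U (G N) x" for x
  define H3 where "H3 = ?Uk (%x. G N x - G n x)"
  define H4 where "H4 = ?Uk (%x. u x - G n x)"
  define H5 where "H5 x = ?Uk u x - ?U u x" for x
  have Ukm: "meas (?Uk f)" if "f : L2" for f by (intro commutator_meas bkm bkf that)
  have Hm: "meas H1" "meas H2" "meas H3" "meas H4" "meas H5"
   unfolding H1_def[abs_def] H2_def[abs_def] H3_def H4_def H5_def[abs_def]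
   by (intro borel_measurable_diff Um Ukm F GL u LGn LNn)+
  have Es: "?E H : sets M" if "meas H" for H using that by (intro sets.Int dis_sets) auto
  have loc: "emeasure M (?E H) <= dis t H" if "meas H" for H
   using that by (intro emeasure_mono dis_sets) auto
  have e1: "emeasure M (?E H1) <= ennreal eps"
   using order_trans[OF loc[OF Hm(1)]] N1[of N] by (simp add: H1_def N_def)
  have e2: "emeasure M (?E H2) <= ennreal eps" using k1[of k] by (simp add: H2_def k_def bk_def[abs_def])
  have e5: "emeasure M (?E H5) <= ennreal eps" using k2[of k] by (simp add: H5_def k_def bk_def[abs_def])
  have "good p A (%x. G N x - G n x) delta" by (rule N2) (auto simp: N_def n_def)
  hence "dis t H3 <= ennreal (C * B * delta / t)" unfolding H3_def using t by (intro C(2) bkm bkB)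
  hence e3: "emeasure M (?E H3) <= ennreal eps" using order_trans[OF loc[OF Hm(3)]] delta(2) by simp
  have "dis t H4 <= ennreal (W * (real k + 1) / t * nint (%x. u x - G n x))"
   unfolding H4_def using t by (intro W(2) bkm bkL LGn iGn)
  also have "... <= ennreal eps"
  proof (intro ennreal_leI)
   have "W * (real k + 1) / t * nint (%x. u x - G n x) <= W * (real k + 1) / t * (eps * t / (W * (real k + 1)))"
    using N3[of n] W t bkL by (intro mult_left_mono) (auto simp: n_def)
   also have "... = eps" using W t bkL(1) by simp
   finally show "W * (real k + 1) / t * nint (%x. u x - G n x) <= eps" .
  qed
  finally have e4: "emeasure M (?E H4) <= ennreal eps" using order_trans[OF loc[OF Hm(4)]] by blast
  have "AE x in M. x : ball z r Int {x. 5 * t < cmod (F x - ?U u x)} --> x : ?E H1 Un (?E H2 Un (?E H3 Un (?E H4 Un ?E H5)))"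
   using commutator_diff[OF GL(1)[of N] bkf[OF GL(1)] GL(1)[of n] bkf[OF GL(1)]] commutator_diff[OF u(1) bkf[OF u(1)] GL(1)[of n] bkf[OF GL(1)]]
  proof eventually_elim
   case (elim x)
   show ?case
   proof (rule impI, rule ccontr)
    assume x: "x : ball z r Int {x. 5 * t < cmod (F x - ?U u x)}" and n: "x ~: ?E H1 Un (?E H2 Un (?E H3 Un (?E H4 Un ?E H5)))"
    hence le: "cmod (H1 x) <= t" "cmod (H2 x) <= t" "cmod (H3 x) <= t" "cmod (H4 x) <= t" "cmod (H5 x) <= t"
     by (auto simp: not_less)
    have "F x - ?U u x = - H1 x - H2 x + H3 x - H4 x + H5 x"
     unfolding H1_def H2_def H3_def H4_def H5_def elim by simp
    hence "cmod (F x - ?U u x) <= cmod (H1 x) + cmod (H2 x) + cmod (H3 x) + cmod (H4 x) + cmod (H5 x)"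
     using norm_triangle_ineq[of "- H1 x - H2 x + H3 x - H4 x" "H5 x"] norm_triangle_ineq4[of "- H1 x - H2 x + H3 x" "H4 x"]
      norm_triangle_ineq[of "- H1 x - H2 x" "H3 x"] norm_triangle_ineq4[of "- H1 x" "H2 x"] by simp
    thus False using x le by simp
   qed
  qed
  hence "emeasure M (ball z r Int {x. 5 * t < cmod (F x - ?U u x)}) <= emeasure M (?E H1 Un (?E H2 Un (?E H3 Un (?E H4 Un ?E H5))))"
   by (rule emeasure_mono_AE) (intro sets.Un Es Hm)
  also have "... <= emeasure M (?E H1) + (emeasure M (?E H2) + (emeasure M (?E H3) + (emeasure M (?E H4) + emeasure M (?E H5))))"
   by (intro order_trans[OF emeasure_subadditive] add_mono order_refl sets.Un Es Hm)
  also have "... <= ennreal eps + (ennreal eps + (ennreal eps + (ennreal eps + ennreal eps)))"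
   by (intro add_mono e1 e2 e3 e4 e5)
  also have "... = ennreal (5 * eps)" using eps by (simp add: ennreal_plus[symmetric] del: ennreal_plus)
  finally show "emeasure M (ball z r Int {x. 5 * t < cmod (F x - ?U u x)}) <= ennreal (5 * eps)" .
 qed simp
 define z :: 'a where "z = undefined"
 have "AE x in M. ~ (x : ball z (real R) & 5 * (1 / real (Suc j)) < cmod (F x - ?U u x))" for R j
 proof -
  let ?S = "ball z (real R) Int {x. 5 * (1 / real (Suc j)) < cmod (F x - ?U u x)}"
  have "?S : sets M" using F(1) Um by (intro sets.Int dis_sets borel_measurable_diff) auto
  hence "?S : null_sets M" using null[of "1 / real (Suc j)" z "real R"] by (auto simp: null_sets_def)
  hence "AE x in M. x ~: ?S" by (rule AE_not_in)
  thus ?thesis by eventually_elim simp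
 qed
 hence "AE x in M. ALL R j. ~ (x : ball z (real R) & 5 * (1 / real (Suc j)) < cmod (F x - ?U u x))"
  unfolding AE_all_countable by blast
 thus ?thesis
 proof eventually_elim
  case (elim x)
  obtain R :: nat where R: "dist z x < real R" using reals_Archimedean2 by blast
  show ?case
  proof (rule ccontr)
   assume "F x ~= ?U u x"
   hence "0 < cmod (F x - ?U u x) / 5" by simp
   then obtain j where "inverse (real (Suc j)) < cmod (F x - ?U u x) / 5" using reals_Archimedean by blast
   hence "5 * (1 / real (Suc j)) < cmod (F x - ?U u x)" by (simp add: inverse_eq_divide)
   thus False using elim R by auto
  qed
 qed
qed

text \<open>
A possible value of T_b f. It is a relation: uniqueness up to null sets is a consequence of closedness.
\<close>

definition commutator_value :: "('a => complex) => ('a => complex) => bool" where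
 "commutator_value f F \<longleftrightarrow> integrable M f & meas F &
   (EX G. good_Cauchy G & (%n. nint (%x. f x - G n x)) \<longlonglongrightarrow> 0 & conv_measure (%n. commutator b T (G n)) F)"

lemma commutator_value_L2:
 "commutator_value u F ==> u : L2 ==> (%x. b x * u x) : L2 ==> AE x in M. F x = commutator b T u x"
 unfolding commutator_value_def using commutator_closed by blast

lemma commutator_value_lin:
 assumes "commutator_value f F" "commutator_value f' F'"
 shows "commutator_value (%x. f x + c * f' x) (%x. F x + c * F' x)"
proof -
 have f: "integrable M f" "integrable M f'" and F [measurable]: "meas F" "meas F'"
  using assms by (auto simp: commutator_value_def)
 obtain G where G: "good_Cauchy G" "(%n. nint (%x. f x - G n x)) \<longlonglongrightarrow> 0" "conv_measure (%n. commutator b T (G n)) F"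
  using assms by (auto simp: commutator_value_def)
 obtain G' where G': "good_Cauchy G'" "(%n. nint (%x. f' x - G' n x)) \<longlonglongrightarrow> 0" "conv_measure (%n. commutator b T (G' n)) F'"
  using assms by (auto simp: commutator_value_def)
 let ?G = "%n x. G n x + c * G' n x" and ?U = "%f. commutator b T f" and ?c = "cmod c + 1"
 have Gb: "bfun (G n)" "bfun (G' n)" for n using G(1) G'(1) by (auto simp: good_Cauchy_def)
 note iG = bfun_integrable[OF Gb(1)] bfun_integrable[OF Gb(2)]
 note L = bfun_L2[OF Gb(1)] b_L2[OF Gb(1)] bfun_L2[OF Gb(2)] b_L2[OF Gb(2)]
 have c: "0 < ?c" by (simp add: add_nonneg_pos)
 have "good_Cauchy ?G"
  unfolding good_Cauchy_def
 proof (intro conjI allI impI bfun_add bfun_cmult Gb)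
  fix delta :: real assume delta: "0 < delta"
  hence d: "0 < delta / 2" "0 < delta / 2 / ?c" using c by auto
  obtain N where N: "!!n m. N <= n ==> N <= m ==> good p A (%x. G m x - G n x) (delta / 2)"
   using G(1) d(1) unfolding good_Cauchy_def by blast
  obtain N' where N': "!!n m. N' <= n ==> N' <= m ==> good p A (%x. G' m x - G' n x) (delta / 2 / ?c)"
   using G'(1) d(2) unfolding good_Cauchy_def by blast
  show "EX N. ALL n>=N. ALL m>=N. good p A (%x. ?G m x - ?G n x) delta"
  proof (intro exI[of _ "max N N'"] allI impI)
   fix n m assume "max N N' <= n" "max N N' <= m"
   hence "good p A (%x. (G m x - G n x) + c * (G' m x - G' n x)) (delta / 2 + cmod c * (delta / 2 / ?c))"
    by (intro good_add good_cmult N N') auto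
   moreover have "delta / 2 + cmod c * (delta / 2 / ?c) <= delta" using delta c by (simp add: field_simps)
   moreover have "(%x. (G m x - G n x) + c * (G' m x - G' n x)) = (%x. ?G m x - ?G n x)" by (simp add: fun_eq_iff algebra_simps)
   ultimately show "good p A (%x. ?G m x - ?G n x) delta" using good_mono by simp
  qed
 qed
 moreover have "(%n. nint (%x. f x + c * f' x - ?G n x)) \<longlonglongrightarrow> 0"
 proof (rule tendsto_sandwich[where f="%_. 0" and h="%n. nint (%x. f x - G n x) + cmod c * nint (%x. f' x - G' n x)"])
  show "(%n. nint (%x. f x - G n x) + cmod c * nint (%x. f' x - G' n x)) \<longlonglongrightarrow> 0"
   using tendsto_add[OF G(2) tendsto_mult_left[OF G'(2), of "cmod c"]] by simp
  have "nint (%x. f x + c * f' x - ?G n x) <= tot (%x. cmod (f x - G n x) + cmod c * cmod (f' x - G' n x))" for n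
  proof (rule integral_mono)
   show "cmod (f x + c * f' x - ?G n x) <= cmod (f x - G n x) + cmod c * cmod (f' x - G' n x)" for x
    using norm_triangle_ineq[of "f x - G n x" "c * (f' x - G' n x)"] by (simp add: norm_mult[symmetric] algebra_simps)
  qed (use f iG in auto)
  thus "eventually (%n. nint (%x. f x + c * f' x - ?G n x) <= nint (%x. f x - G n x) + cmod c * nint (%x. f' x - G' n x)) sequentially"
   using f iG by simp
 qed auto
 moreover have "conv_measure (%n. ?U (?G n)) (%x. F x + c * F' x)"
  unfolding conv_measure_def
 proof (intro allI impI)
  fix t eps :: real assume "0 < t" "0 < eps"
  hence te: "0 < t / 2" "0 < t / 2 / ?c" "0 < eps / 2" using c by auto
  obtain N where N: "!!n. N <= n ==> dis (t / 2) (%x. ?U (G n) x - F x) <= ennreal (eps / 2)"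
   using conv_measureD[OF G(3) te(1,3)] by blast
  obtain N' where N': "!!n. N' <= n ==> dis (t / 2 / ?c) (%x. ?U (G' n) x - F' x) <= ennreal (eps / 2)"
   using conv_measureD[OF G'(3) te(2,3)] by blast
  show "EX N. ALL n>=N. dis t (%x. ?U (?G n) x - (F x + c * F' x)) <= ennreal eps"
  proof (intro exI[of _ "max N N'"] allI impI)
   fix n assume n: "max N N' <= n"
   note [measurable] = commutator_bfun_meas[OF Gb(1)[of n]] commutator_bfun_meas[OF Gb(2)[of n]]
   have "dis (t / 2 + t / 2) (%x. ?U (?G n) x - (F x + c * F' x)) <=
    dis (t / 2) (%x. ?U (G n) x - F x) + dis (t / 2) (%x. c * (?U (G' n) x - F' x))"
   proof (rule dis_add)
    have "(%x. b x * (c * G' n x)) : L2" by (intro b_L2 bfun_cmult Gb)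
    from commutator_add[OF L(1)[of n] L(2) L2_cmult[OF L(3)] this] commutator_cmult[OF L(3)[of n] L(4), of c]
    show "AE x in M. cmod (?U (?G n) x - (F x + c * F' x)) <= cmod (?U (G n) x - F x) + cmod (c * (?U (G' n) x - F' x))"
    proof eventually_elim
     case (elim x)
     show ?case unfolding elim
      using norm_triangle_ineq[of "?U (G n) x - F x" "c * (?U (G' n) x - F' x)"] by (simp add: algebra_simps)
    qed
   qed measurable
   also have "dis (t / 2) (%x. c * (?U (G' n) x - F' x)) <= dis (t / 2 / ?c) (%x. ?U (G' n) x - F' x)"
   proof (intro emeasure_mono dis_sets subsetI)
    fix x assume "x : {x. t / 2 < cmod (c * (?U (G' n) x - F' x))}"
    moreover have "cmod (c * (?U (G' n) x - F' x)) <= ?c * cmod (?U (G' n) x - F' x)"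
     unfolding norm_mult by (intro mult_right_mono) auto
    ultimately have "t / 2 < ?c * cmod (?U (G' n) x - F' x)" unfolding mem_Collect_eq by linarith
    thus "x : {x. t / 2 / ?c < cmod (?U (G' n) x - F' x)}" using c by (simp only: mem_Collect_eq pos_divide_less_eq mult.commute)
   qed measurable
   also have "dis (t / 2) (%x. ?U (G n) x - F x) + dis (t / 2 / ?c) (%x. ?U (G' n) x - F' x) <= ennreal (eps / 2) + ennreal (eps / 2)"
    using n by (intro add_mono N N') auto
   also have "... = ennreal eps" using te by (simp add: ennreal_plus[symmetric] del: ennreal_plus)
   finally show "dis t (%x. ?U (?G n) x - (F x + c * F' x)) <= ennreal eps" by (simp add: add_left_mono)
  qed
 qed
 ultimately show ?thesis using f unfolding commutator_value_def
  by (intro conjI exI[of _ ?G] Bochner_Integration.integrable_add integrable_mult_right) (auto intro: borel_measurable_add borel_measurable_times)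
qed

lemma commutator_value_cmult: "commutator_value f F ==> commutator_value (%x. c * f x) (%x. c * F x)"
 using commutator_value_lin[of f F f F "c - 1"] by (simp add: algebra_simps)

lemma commutator_value_add:
 "commutator_value f F ==> commutator_value f' F' ==> commutator_value (%x. f x + f' x) (%x. F x + F' x)"
 using commutator_value_lin[of f F f' F' 1] by simp

text \<open>
By linearity the difference of two values is a value at zero, where closedness forces it to vanish.
\<close>

lemma commutator_value_unique:
 assumes "commutator_value f F" "commutator_value f F'"
 shows "AE x in M. F x = F' x"
proof -
 have v: "commutator_value (%x. 0) (%x. F x - F' x)"
  using commutator_value_lin[OF assms, of "-1"] by simp
 have z: "(%x. 0) : L2" using bfun_L2[OF bfun_zero] .
 have "AE x in M. F x - F' x = commutator b T (%x. 0) x" using z by (intro commutator_value_L2[OF v]) auto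
 moreover have "AE x in M. T (%x. 0) x = 0" by (rule T_null[OF bfun_zero]) simp
 ultimately show ?thesis by eventually_elim (simp add: commutator_def)
qed

text \<open>
The function F is chosen before the bound B, so that one value satisfies the estimate for all admissible
bounds.
\<close>

lemma commutator_value_exists:
 assumes q: "1 < q" and gamma: "1 <= gamma" and rho: "1 < rho"
 shows "EX C>0. ALL f h s. integrable M f --> atomic_decomposition M lam q gamma rho f h s --> 0 <= suminf s &
  (EX F. commutator_value f F & (ALL B t. RBMO_bound M lam gamma' rho' b B --> 0 < t -->
    dis t F <= ennreal (C * B * suminf s / t)))"
proof -
 obtain C where C: "0 < C" "!!b' B g kappa t. meas b' ==> RBMO_bound M lam gamma' rho' b' B ==> good p A g kappa ==> 0 < t ==>
   dis t (commutator b' T g) <= ennreal (C * B * kappa / t)"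
  using commutator_weak_good by blast
 obtain D where D: "0 < D" "!!f h s. integrable M f ==> atomic_decomposition M lam q gamma rho f h s ==> 0 <= suminf s &
  (EX G. (ALL n::nat. good p A (G n) (D * suminf s)) & (%n. nint (%x. f x - G n x)) \<longlonglongrightarrow> 0 &
   (ALL delta>0. EX N. ALL n>=N. ALL m>=N. good p A (%x. G m x - G n x) delta))"
  using decomposition_approx[OF A q gamma rho, of p] by blast
 show ?thesis
 proof (rule exI[of _ "2 * C * D"], intro conjI allI impI)
  show "0 < 2 * C * D" using C D by simp
  fix f h s assume f: "integrable M f" and de: "atomic_decomposition M lam q gamma rho f h s"
  show S: "0 <= suminf s" using D(2)[OF f de] by blast
  obtain G where G: "!!n::nat. good p A (G n) (D * suminf s)" "(%n. nint (%x. f x - G n x)) \<longlonglongrightarrow> 0"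
   "!!delta. delta > 0 ==> EX N. ALL n>=N. ALL m>=N. good p A (%x. G m x - G n x) delta"
   using D(2)[OF f de] by blast
  have Gb: "bfun (G n)" for n using G(1)[of n] by (simp add: good_def)
  have GC: "good_Cauchy G" using Gb G(3) by (simp add: good_Cauchy_def)
  have Um: "meas (commutator b T (G n))" for n by (rule commutator_bfun_meas[OF Gb])
  obtain B0 where B0: "RBMO_bound M lam gamma' rho' b B0" using b_RBMO by blast
  have B00: "0 < B0" using B0 by (simp add: RBMO_bound_def)
  have "EX F:borel_measurable M. conv_measure (%n. commutator b T (G n)) F"
  proof (rule Cauchy_in_measure[OF Um])
   fix t eps :: real assume t: "0 < t" and eps: "0 < eps"
   define delta where "delta = eps * t / (C * B0)"
   have delta: "0 < delta" "C * B0 * delta / t = eps" using eps t C B00 by (auto simp: delta_def)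
   obtain N where N: "!!n m. N <= n ==> N <= m ==> good p A (%x. G m x - G n x) delta" using G(3)[OF delta(1)] by blast
   show "EX N. ALL m>=N. ALL n>=N. dis t (%x. commutator b T (G m) x - commutator b T (G n) x) <= ennreal eps"
   proof (intro exI[of _ N] allI impI)
    fix m n assume mn: "N <= m" "N <= n"
    have "dis t (%x. commutator b T (G m) x - commutator b T (G n) x) <= dis t (%x. commutator b T (%x. G m x - G n x) x)"
    proof (intro dis_mono commutator_bfun_meas bfun_diff Gb)
     show "AE x in M. cmod (commutator b T (G m) x - commutator b T (G n) x) <= cmod (commutator b T (%x. G m x - G n x) x)"
      using commutator_diff[OF bfun_L2[OF Gb] b_L2[OF Gb] bfun_L2[OF Gb] b_L2[OF Gb], of m n] by eventually_elim simp
    qed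
    also have "... <= ennreal (C * B0 * delta / t)" by (rule C(2)[OF b_meas B0 N[OF mn(2,1)] t])
    finally show "dis t (%x. commutator b T (G m) x - commutator b T (G n) x) <= ennreal eps" using delta by simp
   qed
  qed
  then obtain F where F: "meas F" "conv_measure (%n. commutator b T (G n)) F" by blast
  have val: "commutator_value f F" unfolding commutator_value_def using f F GC G(2) by blast
  have "dis t F <= ennreal (2 * C * D * B * suminf s / t)"
   if B: "RBMO_bound M lam gamma' rho' b B" and t: "0 < t" for B t
  proof (rule ennreal_le_epsilon)
   fix eps :: real assume eps: "0 < eps"
   have t2: "0 < t / 2" using t by simp
   obtain n where n: "dis (t / 2) (%x. commutator b T (G n) x - F x) <= ennreal eps"
    using conv_measureD[OF F(2) t2 eps] by blast
   have "dis (t / 2 + t / 2) F <= dis (t / 2) (%x. commutator b T (G n) x) + dis (t / 2) (%x. commutator b T (G n) x - F x)"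
   proof (intro dis_add Um borel_measurable_diff F)
    show "AE x in M. cmod (F x) <= cmod (commutator b T (G n) x) + cmod (commutator b T (G n) x - F x)"
     by (intro AE_I2) (metis norm_minus_commute norm_triangle_sub)
   qed
   also have "... <= ennreal (C * B * (D * suminf s) / (t / 2)) + ennreal eps"
    by (intro add_mono n C(2)[OF b_meas B G(1) t2])
   finally show "dis t F <= ennreal (2 * C * D * B * suminf s / t) + ennreal eps" by (simp add: mult_ac)
  qed
  thus "EX F. commutator_value f F & (ALL B t. RBMO_bound M lam gamma' rho' b B --> 0 < t -->
    dis t F <= ennreal (2 * C * D * B * suminf s / t))" using val by blast
 qed
qed

end

context nonhomogeneous_space
begin

section \<open>The estimate in terms of the norms\<close>

lemma locally_integrable_measurable:
 assumes f: "locally_integrable_on M UNIV f"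
 shows "meas f"
proof -
 obtain U where U: "!!x. open (U x) & x : U x & set_integrable M (U x) f"
  using f unfolding locally_integrable_on_def by (simp, metis)
 obtain C where C: "countable C" "UNIV \<subseteq> (UN x:C. U x)" using Lindelof_space[of UNIV U] U by auto
 show ?thesis
 proof (rule measurable_piecewise_restrict[of "U ` C"])
  show "countable (U ` C)" using C by simp
  show "space M \<subseteq> \<Union> (U ` C)" using C by auto
  fix Omega assume "Omega : U ` C"
  then obtain x where x: "Omega = U x" by blast
  show Omegas: "Omega Int space M : sets M" using U[of x] by (simp add: x open_in_sets)
  have "meas (%y. indicator Omega y *\<^sub>R f y)"
   using U[of x] unfolding set_integrable_def x by (auto dest: borel_measurable_integrable)
  moreover have "(%y. if y : Omega then f y else 0) = (%y. indicator Omega y *\<^sub>R f y)" by (auto simp: fun_eq_iff)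
  ultimately show "f : borel_measurable (restrict_space M Omega)"
   using Omegas by (subst measurable_restrict_space_iff[where c=0]) auto
 qed
qed

lemma L2_iff_Lp: "f : L2 \<longleftrightarrow> f : Lp M 2"
proof -
 have "meas f ==> sq f < \<infinity> \<longleftrightarrow> integrable M (%x. (cmod (f x))\<^sup>2)"
  by (subst integrable_iff_bounded) auto
 thus ?thesis by (auto simp: L2_def Lp_def)
qed

lemma Lp_norm_2:
 assumes "f : L2"
 shows "sq f = ennreal ((Lp_norm M 2 f)\<^sup>2)" "0 <= Lp_norm M 2 f"
proof -
 have i: "integrable M (%x. (cmod (f x))\<^sup>2)" using assms unfolding L2_iff_Lp by (simp add: Lp_def)
 have "real_of_ereal (1 / ereal x) = 1 / x" if "0 < x" for x using that by (simp add: one_ereal_def)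
 hence h: "real_of_ereal (1 / ereal 2) = 1 / 2" by simp
 have n: "Lp_norm M 2 f = sqrt (tot (%x. (cmod (f x))\<^sup>2))" by (simp add: Lp_norm_def h powr_half_sqrt)
 show "sq f = ennreal ((Lp_norm M 2 f)\<^sup>2)"
  unfolding n using i by (subst nn_integral_eq_integral) auto
 show "0 <= Lp_norm M 2 f" unfolding n by simp
qed

lemma bfun_ess_supp:
 assumes f: "bfun f" "supb f z r"
 shows "ess_supp M f \<subseteq> cball z r" "f : Linf_b M"
proof -
 show s: "ess_supp M f \<subseteq> cball z r"
 proof (rule ccontr)
  assume "~ ess_supp M f \<subseteq> cball z r"
  then obtain x where x: "x : ess_supp M f" "x : - cball z r" by blast
  have "open (- cball z r)" by (intro open_Compl closed_cball)
  then obtain e where e: "0 < e" "ball x e \<subseteq> - cball z r" using x(2) unfolding open_contains_ball by blast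
  have "AE y in M. y : ball x e --> f y = 0"
  proof (intro AE_I2 impI)
   fix y assume "y : ball x e"
   hence "y ~: ball z r" using e(2) ball_subset_cball by blast
   thus "f y = 0" using f(2) by (simp add: supb_def)
  qed
  thus False using x(1) e(1) unfolding ess_supp_def by blast
 qed
 obtain c where "ALL x. cmod (f x) <= c" using f(1) unfolding bfun_def by blast
 hence "f : Lp M \<infinity>" using bfun_meas[OF f(1)] by (auto simp: Lp_def)
 thus "f : Linf_b M" using bounded_subset[OF bounded_cball s] by (simp add: Linf_b_def)
qed

text \<open>
The constants hidden in the existential hypotheses on kernel and operator are made explicit.
\<close>

lemma CZ_setting:
 assumes K: "locally_integrable_on (M \<Otimes>\<^sub>M M) {(x, y). x ~= y} (%(x, y). K x y)"
  and size: "size_condition lam K" and horm: "hormander_condition M K"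
  and T: "CZ_operator M K T" and T2: "bounded_on_L2 M T"
 shows "EX CK CH CT. cz_setting M lam Clam K T CK CH CT"
proof -
 obtain CK where CK: "0 < CK" "!!x y. x ~= y ==> cmod (K x y) <= CK * (1 / lam x (dist x y))"
  using size unfolding size_condition_def by blast
 obtain CH where CH: "0 < CH" "!!R y y'. 0 < R ==> dist y y' < R ==>
    (\<Sum>j. let l = Suc j in of_nat l *
      (int_on {x. 6 ^ l * R < dist x y & dist x y <= 6 ^ (l + 1) * R} (%x.               ennreal (cmod (K x y - K x y') + cmod (K y x - K y' x))))) <= ennreal CH"
  using horm unfolding hormander_condition_def by blast
 obtain C where C: "0 < C" "!!f. f : L2 ==> T f : L2 & Lp_norm M 2 (T f) <= C * Lp_norm M 2 f"
  using T2 unfolding bounded_on_L2_def L2_iff_Lp by blast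
 have lin: "!!f g. f : L2 ==> g : L2 ==> AE x in M. T (%y. f y + g y) x = T f x + T g x"
  "!!c f. f : L2 ==> AE x in M. T (%y. c * f y) x = c * T f x"
  using T unfolding CZ_operator_def linear_ae_def L2_iff_Lp by blast+
 have "cz_setting M lam Clam K T CK CH (C\<^sup>2)"
 proof unfold_locales
  show "0 < CK" "0 < CH" "0 < C\<^sup>2" using CK CH C by auto
  show "(%(x, y). if x = y then 0 else K x y) : borel_measurable (M \<Otimes>\<^sub>M M)" by (rule kernel_measurable[OF K])
  show "cmod (K x y) <= CK * (1 / lam x (dist x y))" if "x ~= y" for x y using CK(2)[OF that] .
  show "(\<Sum>j. of_nat (Suc j) * int_on {x. 6 ^ Suc j * R < dist x y & dist x y <= 6 ^ (Suc j + 1) * R} (%x.               ennreal (cmod (K x y - K x y') + cmod (K y x - K y' x)))) <= ennreal CH"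
   if "0 < R" "dist y y' < R" for R y y' using CH(2)[OF that] unfolding Let_def .
  show "meas (T f)" if "f : L2" for f using C(2)[OF that] L2_meas by blast
  show "sq (T f) <= ennreal (C\<^sup>2) * sq f" if f: "f : L2" for f
  proof -
   have Tf: "T f : L2" "Lp_norm M 2 (T f) <= C * Lp_norm M 2 f" using C(2)[OF f] by auto
   have "(Lp_norm M 2 (T f))\<^sup>2 <= (C * Lp_norm M 2 f)\<^sup>2" using Tf Lp_norm_2(2) by (intro power_mono) auto
   hence "ennreal ((Lp_norm M 2 (T f))\<^sup>2) <= ennreal (C\<^sup>2 * (Lp_norm M 2 f)\<^sup>2)"
    by (intro ennreal_leI) (simp add: power_mult_distrib)
   thus ?thesis unfolding Lp_norm_2(1)[OF f] Lp_norm_2(1)[OF Tf(1)] by (simp add: ennreal_mult)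
  qed
  show "AE x in M. T (%y. f y + g y) x = T f x + T g x" if "f : L2" "g : L2" for f g by (rule lin(1)[OF that])
  show "AE x in M. T (%y. c * f y) x = c * T f x" if "f : L2" for c f by (rule lin(2)[OF that])
  show "AE x in M. x ~: cball z r --> T f x = tot (%y. K x y * f y)" if f: "bfun f" "supb f z r" for f z r
  proof -
   have "AE x in M. x ~: ess_supp M f --> T f x = tot (%y. K x y * f y)"
    using T bfun_ess_supp(2)[OF f] unfolding CZ_operator_def by blast
   thus ?thesis using bfun_ess_supp(1)[OF f] by (auto elim!: eventually_mono)
  qed
 qed
 thus ?thesis by blast
qed

end

text \<open>The infima that define the two norms are taken one after the other.\<close>

lemma le_mult_Inf:
 fixes k y :: real
 assumes X: "X ~= {}" and k: "0 <= k" and le: "!!a. a : X ==> y <= k * a"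
 shows "y <= k * Inf X"
proof (cases "k = 0")
 case True
 thus ?thesis using X le by auto
next
 case False
 hence k0: "0 < k" using k by simp
 have "y / k <= Inf X"
 proof (rule cInf_greatest[OF X])
  fix a assume "a : X"
  thus "y / k <= a" using le[of a] k0 by (simp add: divide_le_eq mult.commute)
 qed
 thus ?thesis using k0 by (simp add: divide_le_eq mult.commute)
qed

theorem theorem3p1:
  fixes M :: "'a::metric_space measure"
    and lam :: "'a \<Rightarrow> real \<Rightarrow> real" and Clam :: real
    and b :: "'a \<Rightarrow> complex" and K :: "'a \<Rightarrow> 'a \<Rightarrow> complex"
    and T :: "('a \<Rightarrow> complex) \<Rightarrow> 'a \<Rightarrow> complex"
    and \<rho> \<gamma> \<rho>' \<gamma>' :: real and q :: ereal
  assumes "nonhomogeneous_space M lam Clam"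
    and "1 < \<rho>" and "1 \<le> \<gamma>" and "1 < q"
    and "1 < \<rho>'" and "1 \<le> \<gamma>'"
    and "b \<in> RBMO M lam \<gamma>' \<rho>'"
    and "locally_integrable_on (M \<Otimes>\<^sub>M M) {(x, y). x \<noteq> y} (\<lambda>(x, y). K x y)"
    and "size_condition lam K"
    and "hormander_condition M K"
    and "CZ_operator M K T"
    and "bounded_on_L2 M T"
  shows "\<exists>Tb. commutator_on M (H1 M lam q \<gamma> \<rho>) b T Tb \<and>
           (\<exists>C>0. \<forall>t>0. \<forall>f\<in>H1 M lam q \<gamma> \<rho>.
              emeasure M {x \<in> space M. t < cmod (Tb f x)}
                \<le> ennreal (C * RBMO_norm M lam \<gamma>' \<rho>' b * (1 / t) * H1_norm M lam q \<gamma> \<rho> f))"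
proof -
 interpret nonhomogeneous_space M lam Clam by fact
 obtain CK CH CT where "cz_setting M lam Clam K T CK CH CT"
  using CZ_setting[OF assms(8-12)] by blast
 then interpret cz_setting M lam Clam K T CK CH CT .
 obtain p A where A: "0 < A" "\<forall>b'\<in>borel_measurable M. RBMO_bound M lam \<gamma>' \<rho>' b' 1 --> (EX m. clean p A b' m)"
  using RBMO_clean[OF assms(5,6)] by blast
 have b: "b \<in> borel_measurable M" "EX B. RBMO_bound M lam \<gamma>' \<rho>' b B"
  using assms(7) locally_integrable_measurable by (auto simp: RBMO_def)
 interpret commutator_setting M lam Clam K T CK CH CT \<gamma>' \<rho>' A p b
  by unfold_locales (use A b in blast)+
 obtain C where C: "0 < C" "!!f h s. integrable M f ==> atomic_decomposition M lam q \<gamma> \<rho> f h s ==> 0 <= suminf s &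
  (EX F. commutator_value f F & (ALL B t. RBMO_bound M lam \<gamma>' \<rho>' b B --> 0 < t -->
    emeasure M {x. t < cmod (F x)} <= ennreal (C * B * suminf s / t)))"
  using commutator_value_exists[OF assms(4,3,2)] by blast
 let ?H = "H1 M lam q \<gamma> \<rho>"
 define Tb where "Tb f = (SOME F. commutator_value f F)" for f
 have val: "commutator_value f (Tb f)" if "commutator_value f F" for f F
  unfolding Tb_def by (rule someI[where P="commutator_value f", OF that])
 have Hval: "commutator_value f (Tb f)" if f: "f \<in> ?H" for f
 proof -
  obtain h s where "integrable M f" "atomic_decomposition M lam q \<gamma> \<rho> f h s" using f unfolding H1_def by blast
  then obtain F where "commutator_value f F" using C(2) by blast
  thus ?thesis by (rule val)
 qed
 have "commutator_on M ?H b T Tb"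
  unfolding commutator_on_def linear_ae_def
 proof (intro conjI ballI allI impI)
  fix f assume f: "f \<in> ?H"
  show "Tb f \<in> borel_measurable M" using Hval[OF f] by (simp add: commutator_value_def)
  show "AE x in M. Tb (%y. f y + g y) x = Tb f x + Tb g x" if g: "g \<in> ?H" for g
  proof -
   have "commutator_value (%x. f x + g x) (%x. Tb f x + Tb g x)" by (rule commutator_value_add[OF Hval[OF f] Hval[OF g]])
   from commutator_value_unique[OF val[OF this] this] show ?thesis .
  qed
  show "AE x in M. Tb (%y. c * f y) x = c * Tb f x" for c
  proof -
   have "commutator_value (%x. c * f x) (%x. c * Tb f x)" by (rule commutator_value_cmult[OF Hval[OF f]])
   from commutator_value_unique[OF val[OF this] this] show ?thesis .
  qed
  assume "f \<in> Lp M 2 & (%x. b x * f x) \<in> Lp M 2"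
  thus "AE x in M. Tb f x = commutator b T f x"
   using commutator_value_L2[OF Hval[OF f]] by (simp add: L2_iff_Lp)
 qed
 moreover have "emeasure M {x \<in> space M. t < cmod (Tb f x)}
   <= ennreal (C * RBMO_norm M lam \<gamma>' \<rho>' b * (1 / t) * H1_norm M lam q \<gamma> \<rho> f)" if t: "0 < t" and f: "f \<in> ?H" for t f
 proof -
  let ?E = "emeasure M {x. t < cmod (Tb f x)}"
  let ?X = "{B. RBMO_bound M lam \<gamma>' \<rho>' b B}" and ?Y = "{(\<Sum>i. s i) | h s. atomic_decomposition M lam q \<gamma> \<rho> f h s}"
  have fi: "integrable M f" and Yne: "?Y ~= {}" using f by (auto simp: H1_def)
  have bd: "?E <= ennreal (C * B * S / t)" "0 <= S" if B: "B \<in> ?X" and S: "S \<in> ?Y" for B S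
  proof -
   obtain h s where s: "S = suminf s" "atomic_decomposition M lam q \<gamma> \<rho> f h s" using S by blast
   show "0 <= S" using C(2)[OF fi s(2)] by (simp add: s)
   obtain F where F: "commutator_value f F" "emeasure M {x. t < cmod (F x)} <= ennreal (C * B * suminf s / t)"
    using C(2)[OF fi s(2)] B t by blast
   have "?E <= emeasure M {x. t < cmod (F x)}"
   proof (rule dis_mono)
    show "F \<in> borel_measurable M" using F by (simp add: commutator_value_def)
    show "AE x in M. cmod (Tb f x) <= cmod (F x)"
     using commutator_value_unique[OF Hval[OF f] F(1)] by eventually_elim simp
   qed
   thus "?E <= ennreal (C * B * S / t)" using F(2) by (simp add: s)
  qed
  obtain B0 where B0: "B0 \<in> ?X" using b(2) by blast
  obtain S0 where S0: "S0 \<in> ?Y" using Yne by blast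
  have "?E < \<infinity>" using bd(1)[OF B0 S0] by (rule le_less_trans) simp
  then obtain y where y: "?E = ennreal y" "0 <= y" by (cases ?E) auto
  have pos: "0 <= C * B * S / t" if "B \<in> ?X" "S \<in> ?Y" for B S
   using that bd(2)[OF that] C(1) t by (auto simp: RBMO_bound_def)
  have le: "y <= C * B * S / t" if "B \<in> ?X" "S \<in> ?Y" for B S
   using bd(1)[OF that] pos[OF that] unfolding y(1) by simp
  have 1: "y <= (C * S / t) * Inf ?X" if "S \<in> ?Y" for S
  proof (rule le_mult_Inf)
   show "?X ~= {}" using B0 by blast
   show "0 <= C * S / t" using bd(2)[OF B0 that] C(1) t by simp
   show "y <= C * S / t * a" if "a \<in> ?X" for a using le[OF that \<open>S \<in> ?Y\<close>] by (simp add: mult_ac)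
  qed
  have "y <= (C * Inf ?X / t) * Inf ?Y"
  proof (rule le_mult_Inf[OF Yne])
   have "0 <= Inf ?X"
   proof (rule cInf_greatest)
    show "?X ~= {}" using B0 by blast
    show "0 <= B" if "B \<in> ?X" for B using that unfolding RBMO_bound_def by simp
   qed
   thus "0 <= C * Inf ?X / t" using C(1) t by simp
   show "y <= C * Inf ?X / t * a" if "a \<in> ?Y" for a using 1[OF that] by (simp add: mult_ac)
  qed
  hence "ennreal y <= ennreal (C * RBMO_norm M lam \<gamma>' \<rho>' b * (1 / t) * H1_norm M lam q \<gamma> \<rho> f)"
   by (intro ennreal_leI) (simp add: RBMO_norm_def H1_norm_def)
  thus ?thesis using y(1) by simp
 qed
 ultimately show ?thesis using C(1) by blast
qed

end
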